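(* There exist constants $\delta_0>0$ and $C>0$ such that if $\varepsilon<\delta_0$ and $$(\phi(0),\partial_t\phi(0))\in S\times L^2(\mathbb{R})\quad\text{with}\quad E_{tot}(\phi(0),\partial_t\phi(0))=2E_{pot}(H_{0,1})+\varepsilon,$$ then there exist functions $x_1,x_2\in C^2(\mathbb{R})$ such that, for all $t\in\mathbb{R}$, the unique global-in-time solution $\phi(t,x)$ of $$\partial_{tt}\phi-\partial_{xx}\phi+2\phi-8\phi^3+6\phi^5=0,\qquad (t,x)\in\mathbb{R}\times\mathbb{R},$$ with initial data $(\phi(0),\partial_t\phi(0))$ is given by $$\phi(t,x)=H_{0,1}(x+x_1(t))+H_{-1,0}(x+x_2(t))+g(t,x),$$ where $$e^{-\sqrt{2}(x_2(t)-x_1(t))}+\|g(t)\|_{H^1(\mathbb{R})}\le C\,\|\partial_{tt}\phi(t)\|_{L^2_x(\mathbb{R})}\qquad\text{for all } t\in\mathbb{R}.$$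
   Context: All functions are real-valued. The kinks are $$H_{0,1}(x)=\frac{e^{\sqrt{2}x}}{(1+e^{2\sqrt{2}x})^{1/2}},\qquad H_{-1,0}(x)=-\frac{e^{-\sqrt{2}x}}{(1+e^{-2\sqrt{2}x})^{1/2}} .$$ The set $S$ is $$S:=\{u\in L^\infty(\mathbb{R}) : u-H_{0,1}-H_{-1,0}\in H^1(\mathbb{R})\}.$$ The potential and total energies are $$E_{pot}(\phi)=\frac12\int_{\mathbb{R}}(\partial_x\phi)^2\,dx+\int_{\mathbb{R}}\phi^2(1-\phi^2)^2\,dx,$$ $$E_{tot}(\phi,\partial_t\phi)=\frac12\int_{\mathbb{R}}\big[(\partial_x\phi)^2+(\partial_t\phi)^2\big]\,dx+\int_{\mathbb{R}}\phi^2(1-\phi^2)^2\,dx .$$ The global-in-time solution is the energy-space solution, i.e. the solution (in the sense of distributions) with $(\phi(t)-H_{0,1}-H_{-1,0},\partial_t\phi(t))\in C(\mathbb{R};H^1(\mathbb{R})\times L^2(\mathbb{R}))$. The quantity $\|\partial_{tt}\phi(t)\|_{L^2_x}$ is the $L^2$ norm in $x$ of $\partial_{tt}\phi(t)=\partial_{xx}\phi(t)-2\phi(t)+8\phi(t)^3-6\phi(t)^5$, understood as $+\infty$ if this distribution is not in $L^2(\mathbb{R})$. *)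

theory Defs
  imports "HOL-Analysis.Analysis"
begin

text \<open>Elements of Lebesgue and Sobolev spaces are represented by functions; all notions below
  depend on these functions only up to equality almost everywhere.\<close>

section \<open>Continuously differentiable functions and test functions\<close>

definition dir_deriv :: "'a::euclidean_space \<Rightarrow> ('a \<Rightarrow> real) \<Rightarrow> 'a \<Rightarrow> real" where
  "dir_deriv b f x = frechet_derivative f (at x) b"

primrec C_diff :: "nat \<Rightarrow> ('a::euclidean_space \<Rightarrow> real) \<Rightarrow> bool" where
  "C_diff 0 f \<longleftrightarrow> continuous_on UNIV f"
| "C_diff (Suc k) f \<longleftrightarrow> f differentiable_on UNIV \<and> (\<forall>b\<in>Basis. C_diff k (dir_deriv b f))"

definition test_fun :: "('a::euclidean_space \<Rightarrow> real) \<Rightarrow> bool" where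
  "test_fun \<eta> \<longleftrightarrow> (\<forall>k. C_diff k \<eta>) \<and> compact (closure {x. \<eta> x \<noteq> 0})"

section \<open>Function spaces on the real line\<close>

definition Linf :: "(real \<Rightarrow> real) set" where
  "Linf = {u \<in> borel_measurable lebesgue. \<exists>M. AE x in lebesgue. \<bar>u x\<bar> \<le> M}"

definition L2 :: "(real \<Rightarrow> real) set" where
  "L2 = {u \<in> borel_measurable lebesgue. integrable lebesgue (\<lambda>x. (u x)\<^sup>2)}"

definition L2_norm :: "(real \<Rightarrow> real) \<Rightarrow> real" where
  "L2_norm u = sqrt (LINT x|lebesgue. (u x)\<^sup>2)"

definition loc_integrable :: "(real \<Rightarrow> real) \<Rightarrow> bool" where
  "loc_integrable u \<longleftrightarrow> (\<forall>a b. set_integrable lebesgue {a..b} u)"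

definition has_weak_deriv :: "(real \<Rightarrow> real) \<Rightarrow> (real \<Rightarrow> real) \<Rightarrow> bool" where
  "has_weak_deriv u v \<longleftrightarrow> loc_integrable u \<and> loc_integrable v \<and>
     (\<forall>\<eta>. test_fun \<eta> \<longrightarrow>
        (LINT x|lebesgue. u x * deriv \<eta> x) = - (LINT x|lebesgue. v x * \<eta> x))"

text \<open>Weak derivatives are unique almost everywhere, so the choice below is immaterial.\<close>

definition weak_deriv :: "(real \<Rightarrow> real) \<Rightarrow> real \<Rightarrow> real" where
  "weak_deriv u = (SOME v. has_weak_deriv u v)"

definition H1 :: "(real \<Rightarrow> real) set" where
  "H1 = {u \<in> L2. \<exists>v\<in>L2. has_weak_deriv u v}"

definition H1_norm :: "(real \<Rightarrow> real) \<Rightarrow> real" where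
  "H1_norm u = sqrt ((L2_norm u)\<^sup>2 + (L2_norm (weak_deriv u))\<^sup>2)"

text \<open>A distribution is given by its values on test functions; its $L^2$ norm is infinite
  if it is not represented by a square integrable function.\<close>

definition represents :: "(real \<Rightarrow> real) \<Rightarrow> ((real \<Rightarrow> real) \<Rightarrow> real) \<Rightarrow> bool" where
  "represents f T \<longleftrightarrow> (\<forall>\<eta>. test_fun \<eta> \<longrightarrow> T \<eta> = (LINT x|lebesgue. f x * \<eta> x))"

definition distr_L2_norm :: "((real \<Rightarrow> real) \<Rightarrow> real) \<Rightarrow> ennreal" where
  "distr_L2_norm T =
     (if \<exists>f\<in>L2. represents f T
      then ennreal (L2_norm (SOME f. f \<in> L2 \<and> represents f T)) else \<infinity>)"

section \<open>Kinks, energies and the energy space\<close>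

definition kink01 :: "real \<Rightarrow> real" where
  "kink01 x = exp (sqrt 2 * x) / sqrt (1 + exp (2 * sqrt 2 * x))"

definition kink10 :: "real \<Rightarrow> real" where
  "kink10 x = - (exp (- sqrt 2 * x) / sqrt (1 + exp (- 2 * sqrt 2 * x)))"

definition kink_space :: "(real \<Rightarrow> real) set" where
  "kink_space = {u \<in> Linf. (\<lambda>x. u x - kink01 x - kink10 x) \<in> H1}"

definition E_pot :: "(real \<Rightarrow> real) \<Rightarrow> real" where
  "E_pot \<phi> = 1/2 * (LINT x|lebesgue. (weak_deriv \<phi> x)\<^sup>2)
     + (LINT x|lebesgue. (\<phi> x)\<^sup>2 * (1 - (\<phi> x)\<^sup>2)\<^sup>2)"

definition E_tot :: "(real \<Rightarrow> real) \<Rightarrow> (real \<Rightarrow> real) \<Rightarrow> real" where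
  "E_tot \<phi> \<psi> = 1/2 * (LINT x|lebesgue. (weak_deriv \<phi> x)\<^sup>2 + (\<psi> x)\<^sup>2)
     + (LINT x|lebesgue. (\<phi> x)\<^sup>2 * (1 - (\<phi> x)\<^sup>2)\<^sup>2)"

section \<open>Energy-space solutions\<close>

text \<open>Here \<open>\<phi> t x\<close> is the solution and \<open>\<psi> t x\<close> its time derivative. Test functions on
  space-time take \<open>(t, x)\<close>. Integrals over space-time are iterated, because
  \<open>\<phi> t\<close> and \<open>\<psi> t\<close> are only determined up to null sets for each \<open>t\<close>, so joint measurability
  of the representatives is not available; the inner integrals are continuous in \<open>t\<close>.\<close>

definition energy_class :: "(real \<Rightarrow> real \<Rightarrow> real) \<Rightarrow> (real \<Rightarrow> real \<Rightarrow> real) \<Rightarrow> bool" where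
  "energy_class \<phi> \<psi> \<longleftrightarrow>
     (\<forall>t. (\<lambda>x. \<phi> t x - kink01 x - kink10 x) \<in> H1 \<and> \<psi> t \<in> L2) \<and>
     (\<forall>t. ((\<lambda>s. H1_norm (\<lambda>x. \<phi> s x - \<phi> t x)) \<longlongrightarrow> 0) (at t)) \<and>
     (\<forall>t. ((\<lambda>s. L2_norm (\<lambda>x. \<psi> s x - \<psi> t x)) \<longlongrightarrow> 0) (at t))"

definition distr_time_deriv :: "(real \<Rightarrow> real \<Rightarrow> real) \<Rightarrow> (real \<Rightarrow> real \<Rightarrow> real) \<Rightarrow> bool" where
  "distr_time_deriv \<phi> \<psi> \<longleftrightarrow>
     (\<forall>\<eta>::real \<times> real \<Rightarrow> real. test_fun \<eta> \<longrightarrow>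
        (LINT t|lebesgue. LINT x|lebesgue. \<phi> t x * dir_deriv (1, 0) \<eta> (t, x)) =
        - (LINT t|lebesgue. LINT x|lebesgue. \<psi> t x * \<eta> (t, x)))"

definition distr_solution :: "(real \<Rightarrow> real \<Rightarrow> real) \<Rightarrow> bool" where
  "distr_solution \<phi> \<longleftrightarrow>
     (\<forall>\<eta>::real \<times> real \<Rightarrow> real. test_fun \<eta> \<longrightarrow>
        (LINT t|lebesgue. LINT x|lebesgue.
           \<phi> t x * (dir_deriv (1, 0) (dir_deriv (1, 0) \<eta>) (t, x)
                    - dir_deriv (0, 1) (dir_deriv (0, 1) \<eta>) (t, x))
           + (2 * \<phi> t x - 8 * (\<phi> t x) ^ 3 + 6 * (\<phi> t x) ^ 5) * \<eta> (t, x)) = 0)"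

definition global_solution ::
  "(real \<Rightarrow> real) \<Rightarrow> (real \<Rightarrow> real) \<Rightarrow> (real \<Rightarrow> real \<Rightarrow> real) \<Rightarrow> (real \<Rightarrow> real \<Rightarrow> real) \<Rightarrow> bool" where
  "global_solution \<phi>\<^sub>0 \<phi>\<^sub>1 \<phi> \<psi> \<longleftrightarrow>
     energy_class \<phi> \<psi> \<and> distr_time_deriv \<phi> \<psi> \<and> distr_solution \<phi> \<and>
     (AE x in lebesgue. \<phi> 0 x = \<phi>\<^sub>0 x) \<and> (AE x in lebesgue. \<psi> 0 x = \<phi>\<^sub>1 x)"

definition unique_global_solution ::
  "(real \<Rightarrow> real) \<Rightarrow> (real \<Rightarrow> real) \<Rightarrow> (real \<Rightarrow> real \<Rightarrow> real) \<Rightarrow> (real \<Rightarrow> real \<Rightarrow> real) \<Rightarrow> bool" where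
  "unique_global_solution \<phi>\<^sub>0 \<phi>\<^sub>1 \<phi> \<psi> \<longleftrightarrow>
     global_solution \<phi>\<^sub>0 \<phi>\<^sub>1 \<phi> \<psi> \<and>
     (\<forall>\<phi>' \<psi>'. global_solution \<phi>\<^sub>0 \<phi>\<^sub>1 \<phi>' \<psi>' \<longrightarrow>
        (\<forall>t. AE x in lebesgue. \<phi>' t x = \<phi> t x \<and> \<psi>' t x = \<psi> t x))"

text \<open>The distribution $\partial_{xx}\phi - 2\phi + 8\phi^3 - 6\phi^5$ on the real line at a fixed
  time, which equals $\partial_{tt}\phi$ for a solution.\<close>

definition dtt_distr :: "(real \<Rightarrow> real) \<Rightarrow> (real \<Rightarrow> real) \<Rightarrow> real" where
  "dtt_distr u \<eta> = (LINT x|lebesgue. u x * deriv (deriv \<eta>) x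
     + (- 2 * u x + 8 * (u x) ^ 3 - 6 * (u x) ^ 5) * \<eta> x)"

end

theory Submission
 imports Defs
begin

text \<open>Energy close to \<open>2 * E_pot H01\<close> leaves little room in the Bogomolny inequality, so on either side of
 its minimum point a profile nearly solves \<open>u' = \<plusminus>sqrt 2 * u * (1 - u^2)\<close> and, by weighted Hardy
 estimates, is close to two distant kinks. For the stationary estimate pair \<open>f = u'' - dpot u\<close> with
 the distance to the kinks, where the linearised energy is coercive, and integrate \<open>(v^2 / 2 - W u)' = f v\<close>
 from infinity to the midpoint, where the left side measures the interaction of the kinks. An open condition at
 each time, solved by a constant pair of shifts locally, has a smooth solution after gluing by convex combinations.
 The flow comes from a fixed point of Duhamel's formula for a truncated nonlinearity, and the truncation is
 invisible by conservation of energy. Uniqueness of distributional solutions follows by pairing with test functions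
 that move along characteristics.\<close>

text \<open>The final estimate is static: it is proved at each fixed time for one profile, and the
  flow only supplies existence, uniqueness and the conserved energy bound. It is linear in the norm
  of \<open>f\<close> because the interaction \<open>exp (- sqrt 2 * (a - b))\<close> is comparable
  to the square of the slope of the two kinks at their midpoint, and the first integral bounds the
  square of the slope by the first power of that norm. The shifts are not fixed by orthogonality
  conditions: coercivity only asks that the remainder be small at the two centres, which crossings
  of the levels \<open>1 / sqrt 2\<close> and \<open>- 1 / sqrt 2\<close> provide. Such crossings
  need not vary smoothly in time, hence the open condition and the gluing; convex combinations are
  harmless since any two admissible pairs for one profile are close to each other. The shifts are
  selected without reference to \<open>f\<close>, so times of infinite norm need no choice of their
  own. The truncation level 2 is safe because leaving [-2, 2] costs the energy
  \<open>2 * sqrt 2\<close>, against about \<open>sqrt 2 / 2\<close> available. Constants such as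
  \<open>10^30\<close> are crude.\<close>

abbreviation (input) tends (infixr "~~>" 55) where "tends f l \<equiv> tendsto f l"
abbreviation (input) intR :: "(real => real) => real" where "intR \<equiv> integral UNIV"
abbreviation (input) "LL \<equiv> (lborel \<Otimes>\<^sub>M lborel :: (real \<times> real) measure)"
abbreviation (input) "LB \<equiv> (lebesgue :: real measure)"
abbreviation (input) BM :: "('a::topological_space => 'b::topological_space) set" where "BM \<equiv> borel_measurable borel"
abbreviation (input) LM :: "(real => real) set" where "LM \<equiv> borel_measurable lebesgue"
abbreviation (input) cont :: "('a::topological_space => 'b::topological_space) => bool" where "cont \<equiv> continuous_on UNIV"
abbreviation (input) hrd (infix "hrd" 50) where "f hrd D \<equiv> (f has_real_derivative D)"
abbreviation (input) abs_int_on :: "(real => real) => real set => bool" (infixr "abs'_int'_on" 46) where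
 "f abs_int_on S \<equiv> f absolutely_integrable_on S"
abbreviation (input) ew :: "real => real" where "ew t \<equiv> exp (60 * \<bar>t\<bar>)"
lemmas cpb = case_prod_beta'
lemmas bmc = borel_measurable_continuous_onI
lemmas set_LINT_eq = set_lebesgue_integral_eq_integral
lemmas HK_add = Henstock_Kurzweil_Integration.integral_add
lemmas HK_diff = Henstock_Kurzweil_Integration.integral_diff
lemmas L_add = Bochner_Integration.integral_add
lemmas L_diff = Bochner_Integration.integral_diff
lemmas L_int_add = Bochner_Integration.integrable_add
lemmas L_int_diff = Bochner_Integration.integrable_diff


section \<open>Smooth functions and test functions\<close>

text \<open>On the real line \<open>Basis\<close> is \<open>{1}\<close> and the directional
  derivative is the ordinary one, so \<open>C_diff\<close> unfolds without any Frechet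
  derivative.\<close>

lemma C_diff_real_Suc:
 "C_diff (Suc k) (f::real => real) \<longleftrightarrow>
  (\<exists>f'. (ALL x. (f hrd f' x) (at x)) & C_diff k f')"
proof -
 have eq: "dir_deriv 1 f = f'" if "ALL x. (f hrd f' x) (at x)" for f'
 proof
  fix x
  have "(f has_derivative (*) (f' x)) (at x)"
   using that by (simp add: has_field_derivative_def)
  thus "dir_deriv 1 f x = f' x"
   by (simp add: dir_deriv_def frechet_derivative_at[symmetric])
 qed
 show ?thesis
 proof
  assume *: "C_diff (Suc k) f"
  hence "f differentiable (at x)" for x
   by (simp add: differentiable_on_eq_differentiable_at)
  hence "EX D. (f hrd D) (at x)" for x
   by (simp add: real_differentiable_def)
  then obtain f' where f': "ALL x. (f hrd f' x) (at x)"
   by metis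
  thus "\<exists>f'. (ALL x. (f hrd f' x) (at x)) & C_diff k f'"
   using * eq[OF f'] by auto
 next
  assume "\<exists>f'. (ALL x. (f hrd f' x) (at x)) & C_diff k f'"
  then obtain f' where f': "ALL x. (f hrd f' x) (at x)" "C_diff k f'"
   by auto
  thus "C_diff (Suc k) f"
   using eq[OF f'(1)]
   by (auto simp: differentiable_on_eq_differentiable_at real_differentiable_def)
 qed
qed

definition smooth :: "(real => real) => bool" where
 "smooth f \<longleftrightarrow> (ALL k. C_diff k f)"

text \<open>A class of functions closed under differentiation consists of smooth functions;
  exhibiting such a class replaces a formula for the k-th derivative.\<close>

lemma smooth_coinduct:
 assumes "P f"
  and step: "!!f. P f ==> \<exists>f'. (ALL x. (f hrd f' x) (at x)) & P f'"
 shows "smooth f"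
proof -
 have "ALL f. P f --> C_diff k f" for k
 proof (induction k)
  case 0
  show ?case
   by (metis C_diff.simps(1) DERIV_isCont continuous_at_imp_continuous_on step)
 next
  case (Suc k)
  thus ?case
   unfolding C_diff_real_Suc using step by meson
 qed
 thus ?thesis
  using assms(1) by (auto simp: smooth_def)
qed

lemma C_diff_real_Suc_imp: "C_diff (Suc k) (f::real => real) ==> C_diff k f"
proof (induction k arbitrary: f)
 case 0
 thus ?case
  by (auto simp: differentiable_imp_continuous_on)
next
 case (Suc k)
 thus ?case
  using C_diff_real_Suc by metis
qed

lemma smooth_deriv:
 assumes "smooth f"
 shows "(f hrd deriv f x) (at x)" "smooth (deriv f)"
proof -
 have ex: "\<exists>f'. (ALL x. (f hrd f' x) (at x)) & C_diff k f'" for k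
  using assms C_diff_real_Suc[of k f] unfolding smooth_def by blast
 have eq: "ALL x. (f hrd f' x) (at x) ==> f' = deriv f" for f'
  by (intro ext) (metis DERIV_imp_deriv)
 show "(f hrd deriv f x) (at x)"
  using ex[of 0] eq by metis
 show "smooth (deriv f)"
  unfolding smooth_def using ex eq by metis
qed

lemma smooth_continuous: "smooth f ==> continuous_on S f"
 by (intro continuous_at_imp_continuous_on ballI DERIV_isCont[OF smooth_deriv(1)])

lemma smooth_mult: 
 assumes "smooth f" "smooth g"
 shows "smooth (%x. f x * g x)"
proof -
 have add: "C_diff k f ==> C_diff k g ==> C_diff k (%x. f x + g x)" for k and f g :: "real => real"
 proof (induction k arbitrary: f g)
  case 0
  thus ?case by (simp add: continuous_on_add)
 next
  case (Suc k)
  then obtain f' g' where "ALL x. (f hrd f' x) (at x)" "C_diff k f'"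
   "ALL x. (g hrd g' x) (at x)" "C_diff k g'"
   unfolding C_diff_real_Suc by blast
  thus ?case
   unfolding C_diff_real_Suc
   by (intro exI[of _ "%x. f' x + g' x"]) (auto intro!: DERIV_add Suc.IH)
 qed
 have "C_diff k f ==> C_diff k g ==> C_diff k (%x. f x * g x)" for k and f g :: "real => real"
 proof (induction k arbitrary: f g)
  case 0
  thus ?case by (simp add: continuous_on_mult)
 next
  case (Suc k)
  then obtain f' g' where *: "ALL x. (f hrd f' x) (at x)" "C_diff k f'"
   "ALL x. (g hrd g' x) (at x)" "C_diff k g'"
   unfolding C_diff_real_Suc by blast
  moreover have "C_diff k f" "C_diff k g"
   using Suc.prems C_diff_real_Suc_imp by blast+
  ultimately show ?case
   unfolding C_diff_real_Suc
   by (intro exI[of _ "%x. f' x * g x + g' x * f x"] conjI allI DERIV_mult add Suc.IH) auto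
 qed
 thus ?thesis
  using assms by (auto simp: smooth_def)
qed

lemma smooth_affine:
 assumes "smooth f"
 shows "smooth (%x. a * f (c * x + d))"
proof (rule smooth_coinduct[where P = "%h. EX a f. smooth f & h = (%x. a * f (c * x + d))"])
 fix h assume "EX a f. smooth f & h = (%x. a * f (c * x + d))"
 then obtain a f where f: "smooth f" and h: "h = (%x. a * f (c * x + d))"
  by blast
 have "(h hrd (a * c) * deriv f (c * x + d)) (at x)" for x
  unfolding h using DERIV_chain'[OF _ smooth_deriv(1)[OF f], of "%x. c * x + d" c x UNIV]
  by (auto intro!: derivative_eq_intros DERIV_chain2[OF smooth_deriv(1)[OF f]])
 thus "\<exists>f'. (ALL x. (h hrd f' x) (at x)) & (EX a f. smooth f & f' = (%x. a * f (c * x + d)))"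
  using smooth_deriv(2)[OF f] by (intro exI[of _ "%x. (a * c) * deriv f (c * x + d)"]) blast
qed (use assms in blast)

lemma smooth_const [simp]: "smooth (%x. a)"
 by (rule smooth_coinduct[where P = "%h. EX a. h = (%x. a)"]) (auto intro!: exI derivative_eq_intros)

definition flat_exp :: "real => real" where
 "flat_exp x = (if x > 0 then exp (- (1 / x)) else 0)"

lemma flat_exp_bounds: "0 <= flat_exp x" "flat_exp x <= 1" "x <= 0 ==> flat_exp x = 0" "x > 0 ==> flat_exp x > 0"
 by (auto simp: flat_exp_def)

lemma poly_times_exp_tendsto_0: "((%y. poly p y * exp (- y)) ~~> (0::real)) at_top"
proof -
 have "((%y. \<Sum>i\<le>degree p. coeff p i * (y ^ i / exp y)) ~~> (\<Sum>i\<le>degree p. coeff p i * 0)) at_top"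
  by (intro tendsto_intros tendsto_power_div_exp_0)
 thus ?thesis
  by (simp add: poly_altdef sum_distrib_right exp_minus divide_inverse mult.assoc)
qed

text \<open>The functions \<open>poly p (1/x) * exp (- (1/x))\<close>, extended by 0 to
  \<open>x <= 0\<close>, are closed under differentiation.\<close>

lemma smooth_flat_exp: "smooth flat_exp"
proof (rule smooth_coinduct[where P = "%h. EX p. h = (%x. if x > 0 then poly p (1/x) * exp (-(1/x)) else 0)"])
 show "EX p. flat_exp = (%x. if x > 0 then poly p (1/x) * exp (-(1/x)) else 0)"
  by (rule exI[of _ 1]) (auto simp: flat_exp_def)
next
 fix h :: "real => real" assume "EX p. h = (%x. if x > 0 then poly p (1/x) * exp (-(1/x)) else 0)"
 then obtain p where h: "h = (%x. if x > 0 then poly p (1/x) * exp (-(1/x)) else 0)" by blast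
 \<comment> \<open>The chain rule brings out \<open>1/x^2\<close> times \<open>p - pderiv p\<close>,
   whence the factor \<open>X^2\<close>.\<close>
 define q where "q = [:0,0,1:] * (p - pderiv p)"
 have "(h hrd (if x > 0 then poly q (1/x) * exp (-(1/x)) else 0)) (at x)" for x
 proof -
  consider "x > 0" | "x < 0" | "x = 0" by linarith
  thus ?thesis
  proof cases
   case 1
   have "((%x. poly p (1/x) * exp (-(1/x))) hrd poly q (1/x) * exp (-(1/x))) (at x)"
   using 1 
   by (auto intro!: derivative_eq_intros DERIV_chain2[OF poly_DERIV] simp: q_def field_simps power2_eq_square)
   moreover have "\<forall>\<^sub>F y in nhds x. h y = poly p (1/y) * exp (-(1/y))"
   using eventually_nhds_in_open[of "{0<..}" x] 1 by (auto simp: h elim!: eventually_mono)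
   ultimately show ?thesis
   using 1 by (subst DERIV_cong_ev[OF refl _ refl]) auto
  next
   case 2
   have "\<forall>\<^sub>F y in nhds x. h y = 0"
   using eventually_nhds_in_open[of "{..<0}" x] 2 by (auto simp: h elim!: eventually_mono)
   thus ?thesis
   using 2 by (subst DERIV_cong_ev[OF refl _ refl]) auto
  next
   case 3
   have "((%y. (h y - h 0) / (y - 0)) ~~> 0) (at_right 0)"
   proof -
   \<comment> \<open>The difference quotient at 0 carries one more factor \<open>1/y\<close>, which
     \<open>pCons 0\<close> absorbs into the polynomial.\<close>
   have "((%y. poly (pCons 0 p) (inverse y) * exp (- inverse y)) ~~> 0) (at_right (0::real))"
   by (rule filterlim_compose[OF poly_times_exp_tendsto_0 filterlim_inverse_at_top_right])
   moreover have "\<forall>\<^sub>F y in at_right (0::real). poly (pCons 0 p) (inverse y) * exp (- inverse y) = (h y - h 0) / (y - 0)"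
   using eventually_at_right_less[of 0]
   by eventually_elim (auto simp: h field_simps)
   ultimately show ?thesis
   by (rule Lim_transform_eventually)
   qed
   moreover have "((%y. (h y - h 0) / (y - 0)) ~~> 0) (at_left 0)"
   proof -
   have "\<forall>\<^sub>F y in at_left (0::real). 0 = (h y - h 0) / (y - 0)"
   by (auto simp: h eventually_at_filter)
   thus ?thesis
   using tendsto_const by (rule Lim_transform_eventually[rotated])
   qed
   ultimately show ?thesis
   using 3 by (simp add: has_field_derivative_iff filterlim_split_at_real)
  qed
 qed
 thus "\<exists>f'. (ALL x. (h hrd f' x) (at x)) &
  (EX p. f' = (%x. if x > 0 then poly p (1/x) * exp (-(1/x)) else 0))"
  by (intro exI[of _ "%x. if x > 0 then poly q (1/x) * exp (-(1/x)) else 0"]) auto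
qed

lemma test_funI:
 assumes "smooth et" "!!x. abs x >= R ==> et x = 0"
 shows "test_fun et"
proof -
 have "{x. et x ~= 0} \<subseteq> {-R..R}"
 proof
  fix x assume "x \<in> {x. et x ~= 0}"
  hence "\<not> R <= abs x" using assms(2) by blast
  thus "x \<in> {-R..R}" by auto
 qed
 thus ?thesis
  using assms(1) bounded_subset[OF bounded_closed_interval] unfolding test_fun_def smooth_def
  by auto
qed

lemma test_fun_support:
 fixes et :: "'a::euclidean_space => real"
 assumes "test_fun et"
 obtains R where "R > 0" "!!x. norm x >= R ==> et x = 0"
proof -
 have "bounded {x. et x ~= 0}"
  using assms bounded_subset[OF compact_imp_bounded closure_subset] by (auto simp: test_fun_def)
 then obtain R where "!!x. et x ~= 0 ==> norm x <= R"
  by (auto simp: bounded_iff)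
 thus ?thesis
  by (intro that[of "max 1 (R + 1)"]) force+
qed

lemma test_fun_smooth: "test_fun et ==> smooth et"
 by (simp add: smooth_def test_fun_def)

lemma deriv_zero_outside:
 assumes "!!x. abs x >= R ==> et x = (0::real)" "abs x > R"
 shows "deriv et x = 0"
proof -
 have "\<forall>\<^sub>F y in nhds x. et y = 0"
  using eventually_nhds_in_open[of "{y. abs y > R}" x] assms
  by (auto simp: open_Collect_less continuous_on_rabs elim!: eventually_mono)
 hence "(et hrd 0) (at x)"
  by (subst DERIV_cong_ev[OF refl _ refl]) auto
 thus ?thesis by (rule DERIV_imp_deriv)
qed

lemma test_fun_deriv:
 assumes "test_fun (et::real => real)"
 shows "test_fun (deriv et)"
proof -
 obtain R where R: "R > 0" "!!x. norm x >= R ==> et x = 0" using test_fun_support[OF assms] by blast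
 show ?thesis
  using deriv_zero_outside[of R et] R smooth_deriv(2)[OF test_fun_smooth[OF assms]]
  by (intro test_funI[of _ "R+1"]) auto
qed

lemma test_fun_affine:
 fixes et :: "real => real"
 assumes "test_fun et" "c ~= 0"
 shows "test_fun (%x. a * et (c * x + d))"
proof -
 obtain R where R: "R > 0" "!!x. norm x >= R ==> et x = 0" using test_fun_support[OF assms(1)] by blast
 show ?thesis
 proof (rule test_funI[of _ "(R + abs d) / abs c"])
  show "smooth (%x. a * et (c * x + d))"
   by (rule smooth_affine[OF test_fun_smooth[OF assms(1)]])
  fix x assume "(R + abs d) / abs c <= abs x"
  hence "R + abs d <= abs (c * x)" using assms(2) by (simp add: pos_divide_le_eq abs_mult mult.commute)
  thus "a * et (c * x + d) = 0" using R(2)[of "c * x + d"] by auto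
 qed
qed

text \<open>The parameter \<open>n\<close> steepens the flanks: as it grows the bumps tend to the
  indicator of the open interval, while the bound 1 and the support stay fixed.\<close>

definition bump :: "real => real => real => real => real" where
 "bump a b n x = flat_exp (n * (x - a)) * flat_exp (n * (b - x))"

lemma bump_props:
 assumes "n > 0"
 shows "0 <= bump a b n x" "bump a b n x <= 1" "x \<notin> {a<..<b} ==> bump a b n x = 0"
  "x \<in> {a<..<b} ==> bump a b n x > 0" "test_fun (bump a b n)"
proof -
 show "0 <= bump a b n x" "bump a b n x <= 1"
  using flat_exp_bounds by (auto simp: bump_def mult_le_one)
 have z: "bump a b n x = 0" if "x \<notin> {a<..<b}" for x
  using assms that by (auto simp: bump_def mult_nonneg_nonpos not_less intro!: flat_exp_bounds(3))
 thus "x \<notin> {a<..<b} ==> bump a b n x = 0" .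
 show "x \<in> {a<..<b} ==> bump a b n x > 0"
  using assms by (auto simp: bump_def intro!: mult_pos_pos flat_exp_bounds(4))
 have "smooth (%x. (1 * flat_exp (n * x + (- n * a))) * (1 * flat_exp ((- n) * x + n * b)))"
  by (intro smooth_mult smooth_affine smooth_flat_exp)
 hence "smooth (bump a b n)"
  by (simp add: bump_def[abs_def] algebra_simps)
 thus "test_fun (bump a b n)"
  using z by (intro test_funI[of _ "abs a + abs b"]) (auto simp: abs_if split: if_splits)
qed

lemma bump_tendsto: "(%n. bump a b (real (Suc n)) x) \<longlonglongrightarrow> indicator {a<..<b} x"
proof (cases "x \<in> {a<..<b}")
 case True
 have *: "(%n. flat_exp (real (Suc n) * y)) \<longlonglongrightarrow> 1" if "y > 0" for y
 proof -
  have "(%n. exp (- (inverse (real (Suc n)) * inverse y))) \<longlonglongrightarrow> exp (- (0 * inverse y))"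
   by (intro tendsto_intros LIMSEQ_inverse_real_of_nat)
  thus ?thesis
   using that by (simp add: flat_exp_def divide_inverse del: of_nat_Suc)
 qed
 have "(%n. bump a b (real (Suc n)) x) \<longlonglongrightarrow> 1 * 1"
  unfolding bump_def using True by (intro tendsto_mult *) auto
 thus ?thesis using True by simp
next
 case False
 thus ?thesis by (simp add: bump_props(3) del: of_nat_Suc)
qed

section \<open>Locally integrable functions\<close>

lemma test_mult_integrable:
 assumes u: "loc_integrable u" and "cont et" and z: "!!x. abs x >= R ==> et x = 0"
 shows "integrable LB (%x. u x * et x)"
  "(LINT x|LB. u x * et x) = integral {-R..R} (%x. u x * et x)"
  "(%x. u x * et x) abs_int_on {-R..R}"
proof -
 have "(%x. et x * u x) abs_int_on {-R..R}"
 proof (rule absolutely_integrable_bounded_measurable_product_real)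
  show "et \<in> borel_measurable (lebesgue_on {-R..R})"
   using assms(2) continuous_on_subset
   by (intro continuous_imp_measurable_on_sets_lebesgue) auto
  show "bounded (et ` {-R..R})"
   using assms(2) by (intro compact_imp_bounded compact_continuous_image) (auto intro: continuous_on_subset)
  show "u abs_int_on {-R..R}" using u by (auto simp: loc_integrable_def)
 qed auto
 thus ab: "(%x. u x * et x) abs_int_on {-R..R}"
  by (simp add: mult.commute)
 have eq: "indicator {-R..R} x *\<^sub>R (u x * et x) = u x * et x" for x
 proof (cases "x \<in> {-R..R}")
  case False
  hence "R <= abs x" by auto
  thus ?thesis using z by simp
 qed simp
 show "integrable LB (%x. u x * et x)"
  using ab unfolding set_integrable_def eq .
 show "(LINT x|LB. u x * et x) = integral {-R..R} (%x. u x * et x)"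
  using set_LINT_eq(2)[OF ab] unfolding set_lebesgue_integral_def eq .
qed

lemma test_fun_integrable:
 assumes u: "loc_integrable u" and "test_fun et"
 shows "integrable LB (%x. u x * et x)"
proof -
 obtain R where "R > 0" "!!x. norm x >= R ==> et x = 0" using test_fun_support[OF assms(2)] by blast
 thus ?thesis
  using test_mult_integrable(1)[OF u smooth_continuous[OF test_fun_smooth[OF assms(2)]], of R] by auto
qed

text \<open>Lebesgue's differentiation theorem: off a null set \<open>u x\<close> is the limit of
  the means of \<open>u\<close> over \<open>{x..x+h}\<close>.\<close>

lemma intervals_zero_imp_AE_zero:
 assumes "loc_integrable u" "!!a b. a <= b ==> integral {a..b} u = 0"
 shows "AE x in LB. u x = 0"
proof -
 have "u integrable_on cbox a b" for a b
  using assms(1) set_LINT_eq(1) by (auto simp: loc_integrable_def)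
 then obtain N where N: "negligible N" "!!x e. [|x \<notin> N; 0 < e|] ==>
   \<exists>d>0. ALL h. 0 < h & h < d --> norm(integral (cbox x (x + h *\<^sub>R One)) u /\<^sub>R h ^ DIM(real) - u x) < e"
  using integrable_ccontinuous_explicit by metis
 have "u x = 0" if "x \<notin> N" for x
 proof (rule ccontr)
  assume "u x ~= 0"
  hence "\<exists>d>0. ALL h. 0 < h & h < d --> norm(integral {x .. x + h} u /\<^sub>R h - u x) < abs (u x)"
   using N(2)[OF that, of "abs (u x)"] by simp
  then obtain d where "d > 0" "ALL h. 0 < h & h < d --> norm(integral {x .. x + h} u /\<^sub>R h - u x) < abs (u x)"
   by blast
  hence "norm(integral {x .. x + d/2} u /\<^sub>R (d/2) - u x) < abs (u x)"
   by (metis half_gt_zero field_sum_of_halves less_add_same_cancel1)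
  thus False
   using assms(2)[of x "x + d/2"] \<open>d > 0\<close> by simp
 qed
 thus ?thesis
  using N(1) by (auto simp: eventually_ae_filter_negligible intro!: exI[of _ N])
qed

text \<open>Steepening bumps carry the hypothesis over to indicators of intervals by dominated
  convergence.\<close>

lemma fundamental_lemma:
 assumes u: "loc_integrable u" and z: "!!et. test_fun et ==> (LINT x|LB. u x * et x) = 0"
 shows "AE x in LB. u x = 0"
proof (rule intervals_zero_imp_AE_zero[OF u])
 fix a b :: real assume "a <= b"
 have ui: "set_integrable LB {a<..<b} u"
  by (rule set_integrable_subset[of LB "{a..b}"])
   (use u in \<open>auto simp: loc_integrable_def greaterThanLessThan_subseteq_atLeastAtMost_iff\<close>)
 have "(%n. LINT x|LB. u x * bump a b (real (Suc n)) x) \<longlonglongrightarrow> (LINT x|LB. u x * indicator {a<..<b} x)"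
 proof (rule integral_dominated_convergence[where w = "%x. norm (indicator {a<..<b} x *\<^sub>R u x)"])
  show "integrable LB (%x. norm (indicator {a<..<b} x *\<^sub>R u x))"
   using ui unfolding set_integrable_def by (rule integrable_norm)
  have "(%x. indicator {a<..<b} x *\<^sub>R u x) \<in> LM"
   using ui unfolding set_integrable_def by auto
  thus "(%x. u x * indicator {a<..<b} x) \<in> LM"
   by (simp add: mult.commute)
  show "(%x. u x * bump a b (real (Suc n)) x) \<in> LM" for n
   using test_fun_integrable[OF u bump_props(5)] by (intro borel_measurable_integrable) auto
  show "AE x in LB. norm (u x * bump a b (real (Suc n)) x) <= norm (indicator {a<..<b} x *\<^sub>R u x)" for n
  proof (intro AE_I2)
   fix x
   have "0 <= bump a b (real (Suc n)) x" "bump a b (real (Suc n)) x <= 1"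
   "x \<notin> {a<..<b} ==> bump a b (real (Suc n)) x = 0"
   using bump_props(1-3)[of "real (Suc n)"] by auto
   thus "norm (u x * bump a b (real (Suc n)) x) <= norm (indicator {a<..<b} x *\<^sub>R u x)"
   by (cases "x \<in> {a<..<b}") (auto simp: abs_mult mult_left_le)
  qed
  show "AE x in LB. (%n. u x * bump a b (real (Suc n)) x) \<longlonglongrightarrow> u x * indicator {a<..<b} x"
   by (intro AE_I2 tendsto_intros bump_tendsto)
 qed
 hence "(LINT x|LB. u x * indicator {a<..<b} x) = 0"
  using z[OF bump_props(5)] LIMSEQ_unique[OF _ tendsto_const] by (simp del: of_nat_Suc)
 hence "integral {a<..<b} u = 0"
  using set_LINT_eq(2)[OF ui] by (simp add: set_lebesgue_integral_def mult.commute)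
 thus "integral {a..b} u = 0"
  by (simp add: integral_open_interval_real)
qed

section \<open>Absolutely continuous functions\<close>

text \<open>Local absolute continuity, written as the fundamental theorem of calculus. The
  derivative is an explicit argument, so that one works with chosen representatives and meets the
  choice inside \<open>weak_deriv\<close> only when norms and energies are translated.\<close>

definition AC :: "(real => real) => (real => real) => bool" where
 "AC u v \<longleftrightarrow> loc_integrable v & (ALL a b. a <= b --> integral {a..b} v = u b - u a)"

lemma li_cont: "cont u ==> loc_integrable u"
 unfolding loc_integrable_def
 using absolutely_integrable_continuous_real continuous_on_subset by blast

lemma li_add: "loc_integrable u ==> loc_integrable v ==> loc_integrable (%x. u x + v x)"
 unfolding loc_integrable_def by (auto intro: set_integral_add)

lemma li_diff: "loc_integrable u ==> loc_integrable v ==> loc_integrable (%x. u x - v x)"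
 unfolding loc_integrable_def by (auto intro: set_integral_diff)

lemma li_cmult: "loc_integrable u ==> loc_integrable (%x. c * u x)"
 unfolding loc_integrable_def by auto

lemma li_imp: "loc_integrable u ==> u integrable_on {a..b}"
 "loc_integrable u ==> u abs_int_on {a..b}"
 unfolding loc_integrable_def using set_LINT_eq(1) by auto

lemma li_cont_mult:
 assumes "cont c" "loc_integrable u"
 shows "loc_integrable (%x. c x * u x)"
 unfolding loc_integrable_def
proof (intro allI absolutely_integrable_bounded_measurable_product_real)
 fix a b :: real
 have c: "continuous_on {a..b} c" using assms(1) continuous_on_subset by blast
 thus "c \<in> borel_measurable (lebesgue_on {a..b})"
  by (intro continuous_imp_measurable_on_sets_lebesgue) auto
 show "bounded (c ` {a..b})"
  using c compact_continuous_image compact_imp_bounded compact_Icc by blast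
 show "u abs_int_on {a..b}" using assms(2) by (auto simp: loc_integrable_def)
qed auto

lemma li_abs: "loc_integrable u ==> loc_integrable (%x. abs (u x))"
 unfolding loc_integrable_def by (auto intro: set_integrable_abs)

lemma li_shift: 
 assumes "loc_integrable u"
 shows "loc_integrable (%x. u (x + c))" "integral {a..b} (%x. u (x + c)) = integral {a + c..b + c} u"
proof -
 have hi: "((%x. u (x + c)) has_integral integral {a + c..b + c} u) {a..b}" if "loc_integrable u" for u and a b :: real
  using integrable_integral[OF li_imp(1)[OF that]] has_integral_shift_real_ivl[of u _ "a+c" "b+c" c]
  by (simp add: add.commute)
 show "integral {a..b} (%x. u (x + c)) = integral {a + c..b + c} u"
  using hi[OF assms] by blast
 show "loc_integrable (%x. u (x + c))"
  unfolding loc_integrable_def absolutely_integrable_on_def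
  using hi[OF assms] hi[OF li_abs[OF assms]] unfolding integrable_on_def real_norm_def by blast
qed

lemma li_reflect: 
 assumes "loc_integrable u"
 shows "loc_integrable (%x. u (- x))"
 unfolding loc_integrable_def
proof (intro allI)
 fix a b
 show "(%x. u (- x)) abs_int_on {a..b}"
  using absolutely_integrable_reflect_real[where f = u and a = "-b" and b = "-a"] assms
  by (simp add: loc_integrable_def del: absolutely_integrable_reflect_real)
qed

lemma AC_D: "AC u v ==> a <= b ==> u b = u a + integral {a..b} v"
 by (simp add: AC_def)

lemma AC_loc: "AC u v ==> loc_integrable v"
 by (simp add: AC_def)

lemma AC_cont: 
 assumes "AC u v"
 shows "continuous_on S u"
proof -
 have "continuous_on {y-1..y+1} u" for y
 proof (rule continuous_on_eq)
  show "continuous_on {y-1..y+1} (%x. u (y-1) + integral {y-1..x} v)"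
   using li_imp(1)[OF AC_loc[OF assms]]
   by (intro continuous_intros indefinite_integral_continuous_1)
  show "u (y-1) + integral {y-1..x} v = u x" if "x \<in> {y-1..y+1}" for x
   using AC_D[OF assms, of "y-1" x] that by simp
 qed
 hence "isCont u x" for x
  using continuous_on_interior[of "{x-1..x+1}" u x]
  by (simp add: interior_atLeastAtMost_real)
 thus ?thesis
  by (simp add: continuous_at_imp_continuous_on)
qed

lemma AC_loc': "AC u v ==> loc_integrable u"
 by (simp add: AC_cont li_cont)

lemma AC_add: "AC u v ==> AC u' v' ==> AC (%x. u x + u' x) (%x. v x + v' x)"
 unfolding AC_def by (auto intro!: li_add simp: HK_add li_imp)

lemma AC_cmult: "AC u v ==> AC (%x. c * u x) (%x. c * v x)"
 unfolding AC_def by (auto intro!: li_cmult simp: right_diff_distrib)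

lemma AC_diff: "AC u v ==> AC u' v' ==> AC (%x. u x - u' x) (%x. v x - v' x)"
 using AC_add[of u v "%x. (-1) * u' x" "%x. (-1) * v' x"] AC_cmult[of u' v' "-1"] by simp

lemma AC_minus: "AC u v ==> AC (%x. - u x) (%x. - v x)"
 using AC_cmult[of u v "-1"] by simp

lemma AC_C1:
 assumes "!!x. (F hrd F' x) (at x)" "cont F'"
 shows "AC F F'"
 unfolding AC_def
proof (intro conjI allI impI)
 fix a b :: real assume "a <= b"
 hence "(F' has_integral (F b - F a)) {a..b}"
  using assms(1) by (intro fundamental_theorem_of_calculus)
   (auto simp: has_real_derivative_iff_has_vector_derivative[symmetric] intro: DERIV_subset)
 thus "integral {a..b} F' = F b - F a" by blast
qed (use assms(2) li_cont in blast)

lemma AC_const: "AC (%x. c) (%x. 0)"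
 by (rule AC_C1) auto

lemma AC_shift: "AC u v ==> AC (%x. u (x + c)) (%x. v (x + c))"
 unfolding AC_def by (simp add: li_shift)

lemma AC_reflect: 
 assumes "AC u v"
 shows "AC (%x. u (- x)) (%x. - v (- x))"
 unfolding AC_def
proof (intro conjI allI impI)
 show "loc_integrable (%x. - v (- x))"
  using li_cmult[OF li_reflect[OF AC_loc[OF assms]], of "-1"] by simp
 fix a b :: real assume "a <= b"
 thus "integral {a..b} (%x. - v (- x)) = u (- b) - u (- a)"
  using Henstock_Kurzweil_Integration.integral_reflect_real[of "-a" "-b" v] AC_D[OF assms, of "-b" "-a"] by simp
qed

text \<open>On a short interval \<open>F (u b) - F (u a)\<close> differs from \<open>F' (u x) * (u b - u a)\<close> by a
 small multiple of the integral of the absolute value of \<open>v\<close>; the Bolzano bisection principle adds these local estimates up.\<close>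

lemma AC_chain:
 assumes uv: "AC u v" and F: "!!y. (F hrd F' y) (at y)" and F': "cont F'"
 shows "AC (%x. F (u x)) (%x. F' (u x) * v x)"
proof -
 have cu: "cont u" using AC_cont[OF uv] .
 have cF: "cont (%x. F' (u x))"
  using continuous_on_compose2[OF F' cu] by auto
 have lv: "loc_integrable v" and la: "loc_integrable (%x. abs (v x))"
  using AC_loc[OF uv] li_abs by auto
 have lF: "loc_integrable (%x. F' (u x) * v x)"
  using li_cont_mult[OF cF lv] .
 define \<Phi> where "\<Phi> a b = F (u b) - F (u a) - integral {a..b} (%x. F' (u x) * v x)" for a b
 have est: "abs (\<Phi> a b) <= e * integral {a..b} (%x. abs (v x))" if "a <= b" "e > 0" for a b e
  using \<open>a <= b\<close>
 proof (induction rule: Bolzano)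
  case (trans a b c)
  have "integral {a..b} (%x. F' (u x) * v x) + integral {b..c} (%x. F' (u x) * v x) = integral {a..c} (%x. F' (u x) * v x)"
   "integral {a..b} (%x. abs (v x)) + integral {b..c} (%x. abs (v x)) = integral {a..c} (%x. abs (v x))"
   using trans li_imp(1)[OF lF] li_imp(1)[OF la] by (auto intro!: Henstock_Kurzweil_Integration.integral_combine)
  moreover from this have "\<Phi> a c = \<Phi> a b + \<Phi> b c" by (simp add: \<Phi>_def)
  ultimately show ?case using trans by (simp add: distrib_left flip: \<open>_ = integral {a..c} (%x. abs (v x))\<close>)
 next
  case (local x)
  have "isCont (%x. F' (u x)) x"
   using cF by (simp add: continuous_on_eq_continuous_at)
  then obtain d where d: "d > 0" "!!y. abs (y - x) < d ==> abs (F' (u y) - F' (u x)) < e / 2"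
   using \<open>e > 0\<close> unfolding continuous_at_eps_delta by (metis dist_real_def half_gt_zero)
  show ?case
  proof (intro exI[of _ d] conjI allI impI \<open>d > 0\<close>)
   fix a b assume ab: "a <= x & x <= b & b - a < d"
   have near: "abs (F' (u y) - F' (u z)) <= e" if "y \<in> {a..b}" "z \<in> {a..b}" for y z
   proof -
   have "abs (y - x) < d" "abs (z - x) < d" using that ab by auto
   from d(2)[OF this(1)] d(2)[OF this(2)] show ?thesis by linarith
   qed
   \<comment> \<open>The mean value theorem for \<open>F\<close> between \<open>u a\<close> and
     \<open>u b\<close>, followed by the intermediate value theorem for \<open>u\<close>, which
     realises the mean value at a point of the interval.\<close>
   obtain \<xi> where \<xi>: "\<xi> \<in> {a..b}" "F (u b) - F (u a) = F' (u \<xi>) * (u b - u a)"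
   proof -
   have ivt: "\<exists>\<xi>\<in>{a..b}. u \<xi> = z" if "min (u a) (u b) <= z" "z <= max (u a) (u b)" for z
   proof (cases "u a <= u b")
   case True
   thus ?thesis
   using IVT'[of u a z b] that ab continuous_on_subset[OF cu] by auto
   next
   case False
   thus ?thesis
   using IVT2'[of u b z a] that ab continuous_on_subset[OF cu] by auto
   qed
   consider "u a = u b" | "u a < u b" | "u b < u a" by linarith
   thus ?thesis
   proof cases
   case 1
   thus ?thesis using ab that[of a] by auto
   next
   case 2
   obtain z where z: "u a < z" "z < u b" "F (u b) - F (u a) = (u b - u a) * F' z"
   using MVT2[OF 2, of F F'] F by blast
   then obtain \<xi> where "\<xi>\<in>{a..b}" "u \<xi> = z" using ivt[of z] by auto
   thus ?thesis using z that[of \<xi>] by (simp add: mult.commute)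
   next
   case 3
   obtain z where z: "u b < z" "z < u a" "F (u a) - F (u b) = (u a - u b) * F' z"
   using MVT2[OF 3, of F F'] F by blast
   then obtain \<xi> where "\<xi>\<in>{a..b}" "u \<xi> = z" using ivt[of z] by auto
   thus ?thesis using z that[of \<xi>] by (simp add: algebra_simps)
   qed
   qed
   have "\<Phi> a b = integral {a..b} (%x. F' (u \<xi>) * v x) - integral {a..b} (%x. F' (u x) * v x)"
   using \<xi>(2) AC_D[OF uv, of a b] ab by (simp add: \<Phi>_def)
   also have "... = integral {a..b} (%x. F' (u \<xi>) * v x - F' (u x) * v x)"
   using li_imp(1)[OF lF] li_imp(1)[OF li_cmult[OF lv]]
   by (simp add: HK_diff)
   finally have "abs (\<Phi> a b) = norm (integral {a..b} (%x. F' (u \<xi>) * v x - F' (u x) * v x))"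
   by simp
   also have "... <= integral {a..b} (%x. e * abs (v x))"
   proof (rule Henstock_Kurzweil_Integration.integral_norm_bound_integral)
   show "(%x. F' (u \<xi>) * v x - F' (u x) * v x) integrable_on {a..b}"
   using li_imp(1)[OF lF] li_imp(1)[OF li_cmult[OF lv]]
   by (intro Henstock_Kurzweil_Integration.integrable_diff)
   show "(%x. e * abs (v x)) integrable_on {a..b}"
   using li_imp(1)[OF li_cmult[OF la]] .
   show "norm (F' (u \<xi>) * v x - F' (u x) * v x) <= e * abs (v x)" if "x \<in> {a..b}" for x
   proof -
   have "abs (F' (u \<xi>) * v x - F' (u x) * v x) = abs (F' (u \<xi>) - F' (u x)) * abs (v x)"
   by (simp add: left_diff_distrib flip: abs_mult)
   thus ?thesis using near[OF \<xi>(1) that] by (simp add: mult_right_mono)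
   qed
   qed
   finally show "abs (\<Phi> a b) <= e * integral {a..b} (%x. abs (v x))" by simp
  qed
 qed
 have "\<Phi> a b = 0" if "a <= b" for a b
 proof -
  have "abs (\<Phi> a b) <= 0"
  proof (rule field_le_epsilon)
   fix e :: real assume "e > 0"
   define I where "I = integral {a..b} (%x. abs (v x))"
   have "I >= 0" unfolding I_def by (intro Henstock_Kurzweil_Integration.integral_nonneg li_imp la) auto
   have "abs (\<Phi> a b) <= e / (I + 1) * I"
   using est[OF that, of "e / (I + 1)"] \<open>e > 0\<close> \<open>I >= 0\<close> by (simp add: I_def)
   also have "... <= e" using \<open>e > 0\<close> \<open>I >= 0\<close> by (simp add: field_simps)
   finally show "abs (\<Phi> a b) <= 0 + e" by simp
  qed
  thus ?thesis by simp
 qed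
 thus ?thesis
  using lF unfolding AC_def by (auto simp: \<Phi>_def algebra_simps)
qed

lemma AC_square: "AC u v ==> AC (%x. (u x)^2) (%x. 2 * u x * v x)"
 by (rule AC_chain[where F = "%y. y^2" and F' = "%y. 2 * y"]) (auto intro!: derivative_eq_intros continuous_intros)

text \<open>Polarisation: the product is a combination of squares, to which the chain rule
  applies.\<close>

lemma AC_mult:
 assumes "AC u u'" "AC v v'"
 shows "AC (%x. u x * v x) (%x. u' x * v x + u x * v' x)"
proof -
 have "AC (%x. 1/2 * ((u x + v x)^2 - (u x)^2 - (v x)^2))
  (%x. 1/2 * (2 * (u x + v x) * (u' x + v' x) - 2 * u x * u' x - 2 * v x * v' x))"
  by (intro AC_cmult AC_diff AC_square AC_add assms)
 thus ?thesis
  by (simp add: power2_sum algebra_simps)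
qed

lemma AC_primitive:
 assumes "loc_integrable v"
 obtains u where "AC u v" "u 0 = 0"
proof -
 define u where "u x = (if x >= 0 then integral {0..x} v else - integral {x..0} v)" for x
 have i: "v integrable_on {a..b}" for a b using li_imp(1)[OF assms] .
 have "integral {a..b} v = u b - u a" if "a <= b" for a b
 proof -
  consider "0 <= a" | "a < 0" "0 <= b" | "b < 0" by linarith
  thus ?thesis
  proof cases
   case 1
   thus ?thesis
   using Henstock_Kurzweil_Integration.integral_combine[of 0 a b v] i that by (simp add: u_def)
  next
   case 2
   thus ?thesis
   using Henstock_Kurzweil_Integration.integral_combine[of a 0 b v] i that by (simp add: u_def)
  next
   case 3
   thus ?thesis
   using Henstock_Kurzweil_Integration.integral_combine[of a b 0 v] i that by (simp add: u_def)
  qed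
 qed
 hence "AC u v" using assms by (simp add: AC_def)
 thus ?thesis using that by (auto simp: u_def)
qed

lemma AC_continuous_deriv:
 assumes "AC u v" "cont v"
 shows "(u hrd v x) (at x)"
proof -
 have "((%y. integral {x-1..y} v) hrd v x) (at x within {x-1..x+1})"
  using assms(2) continuous_on_subset by (intro integral_has_real_derivative) auto
 hence "((%y. u (x-1) + integral {x-1..y} v) hrd v x) (at x within {x-1..x+1})"
  by (auto intro!: derivative_eq_intros)
 hence "((%y. u (x-1) + integral {x-1..y} v) hrd v x) (at x)"
  by (simp add: at_within_Icc_at)
 moreover have "\<forall>\<^sub>F y in nhds x. u (x-1) + integral {x-1..y} v = u y"
 proof (rule eventually_mono[OF eventually_nhds_in_open[of "{x-1<..}" x]])
  fix y assume "y \<in> {x-1<..}"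
  thus "u (x-1) + integral {x-1..y} v = u y"
   using AC_D[OF assms(1), of "x-1" y] by simp
 qed auto
 ultimately show ?thesis
  by (subst (asm) DERIV_cong_ev[OF refl _ refl]) auto
qed

section \<open>Weak derivatives\<close>

lemma AC_imp_weak:
 assumes "AC u v"
 shows "has_weak_deriv u v"
 unfolding has_weak_deriv_def
proof (intro conjI allI impI)
 fix et :: "real => real" assume t: "test_fun et"
 obtain R where R: "R > 0" "!!x. norm x >= R ==> et x = 0" using test_fun_support[OF t] by blast
 have sm: "smooth et" using t test_fun_smooth by blast
 have cd: "cont (deriv et)" "cont et" using smooth_continuous smooth_deriv(2) sm by blast+
 have z: "abs x >= R + 1 ==> et x = 0" "abs x >= R + 1 ==> deriv et x = 0" for x
  using R deriv_zero_outside[of R et x] by auto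
 have "AC et (deriv et)"
  using AC_C1[of et "deriv et"] smooth_deriv(1)[OF sm] cd by blast
 from AC_D[OF AC_mult[OF assms this], of "-(R+1)" "R+1"] R(1)
 have "integral {-(R+1)..R+1} (%x. v x * et x + u x * deriv et x) = 0"
  using z by simp
 moreover have ui: "(LINT x|LB. u x * deriv et x) = integral {-(R+1)..R+1} (%x. u x * deriv et x)"
   "(%x. u x * deriv et x) abs_int_on {-(R+1)..R+1}"
  using test_mult_integrable(2,3)[OF AC_loc'[OF assms] cd(1), of "R+1"] z(2) by blast+
 moreover have vi: "(LINT x|LB. v x * et x) = integral {-(R+1)..R+1} (%x. v x * et x)"
   "(%x. v x * et x) abs_int_on {-(R+1)..R+1}"
  using test_mult_integrable(2,3)[OF AC_loc[OF assms] cd(2), of "R+1"] z(1) by blast+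
 moreover have "integral {-(R+1)..R+1} (%x. v x * et x + u x * deriv et x)
  = (LINT x|LB. v x * et x) + (LINT x|LB. u x * deriv et x)"
  unfolding ui(1) vi(1)
  using set_LINT_eq(1)[OF ui(2)] set_LINT_eq(1)[OF vi(2)]
  by (rule HK_add[rotated])
 ultimately show "(LINT x|LB. u x * deriv et x) = - (LINT x|LB. v x * et x)"
  by linarith
qed (use assms AC_loc AC_loc' in auto)

lemma integral_mult_AE_cong:
 assumes "AE x in LB. u x = (u' x::real)"
 shows "(LINT x|LB. u x * et x) = (LINT x|LB. u' x * et x)"
proof -
 obtain N where N: "N \<in> null_sets LB" "!!x. x \<notin> N ==> u x = u' x"
  using assms by (auto simp: eventually_ae_filter)
 have "integrable LB (%x. u x * et x) \<longleftrightarrow> integrable LB (%x. u' x * et x)"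
 proof -
  have N': "negligible N" using N(1) by (simp add: negligible_iff_null_sets)
  show ?thesis
   using absolutely_integrable_spike_eq[OF N', where T = UNIV and f = "%x. u' x * et x" and g = "%x. u x * et x"] N(2)
   by (simp add: set_integrable_def)
 qed
 thus ?thesis
 proof (cases "integrable LB (%x. u x * et x)")
  case True
  thus ?thesis
   using \<open>_ \<longleftrightarrow> _\<close> assms by (intro integral_cong_AE borel_measurable_integrable) auto
 qed (simp add: not_integrable_integral_eq)
qed

lemma li_cong_AE:
 assumes "AE x in LB. u x = u' x" "loc_integrable u"
 shows "loc_integrable u'"
proof -
 obtain N where N: "N \<in> null_sets LB" "!!x. x \<notin> N ==> u x = u' x"
  using assms(1) by (auto simp: eventually_ae_filter)
 thus ?thesis
  using assms(2) absolutely_integrable_spike[where f = u and S = N and g = u'] unfolding loc_integrable_def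
  by (metis DiffD2 negligible_iff_null_sets)
qed

lemma has_weak_deriv_cong_AE:
 assumes "AE x in LB. u x = u' x" "AE x in LB. v x = v' x" "has_weak_deriv u v"
 shows "has_weak_deriv u' v'"
 using assms(3) li_cong_AE[OF assms(1)] li_cong_AE[OF assms(2)]
  integral_mult_AE_cong[OF assms(1)] integral_mult_AE_cong[OF assms(2)]
 unfolding has_weak_deriv_def by simp

lemma has_weak_deriv_unique:
 assumes "has_weak_deriv u v" "has_weak_deriv u v'"
 shows "AE x in LB. v x = v' x"
proof -
 have "AE x in LB. v x - v' x = 0"
 proof (rule fundamental_lemma)
  show "loc_integrable (%x. v x - v' x)"
   using assms by (auto simp: has_weak_deriv_def intro: li_diff)
  fix et :: "real => real" assume t: "test_fun et"
  hence "(LINT x|LB. v x * et x) = (LINT x|LB. v' x * et x)"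
   using assms by (auto simp: has_weak_deriv_def)
  moreover have "integrable LB (%x. v x * et x)" "integrable LB (%x. v' x * et x)"
   using assms t test_fun_integrable by (auto simp: has_weak_deriv_def)
  ultimately show "(LINT x|LB. (v x - v' x) * et x) = 0"
   by (simp add: left_diff_distrib)
 qed
 thus ?thesis by simp
qed

text \<open>Du Bois-Reymond's argument: subtracting a multiple of one fixed bump gives a test
  function mean zero, so that it becomes the derivative of a test function. The constant is the mean
  of \<open>u\<close> against the normalised bump.\<close>

lemma zero_weak_deriv:
 assumes u: "has_weak_deriv u (%x. 0)"
 shows "EX c. AE x in LB. u x = c"
proof -
 define b where "b = bump 0 1 1"
 have b: "test_fun b" "!!x. b x >= 0" "!!x. x \<notin> {0<..<1} ==> b x = 0" "!!x. x \<in> {0<..<1} ==> b x > 0"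
  unfolding b_def using bump_props[of 1] zero_less_one by blast+
 have lu: "loc_integrable u" using u by (simp add: has_weak_deriv_def)
 have l1: "loc_integrable (%x. 1)" by (rule li_cont) auto
 have int: "integrable LB et" if "test_fun et" for et :: "real => real"
  using test_fun_integrable[OF l1 that] by simp
 define be where "be = (LINT x|LB. b x)"
 have "be ~= 0"
 proof
  assume "be = 0"
  hence "AE x in LB. b x = 0"
   using integral_nonneg_eq_0_iff_AE[OF int[OF b(1)]] b(2) by (simp add: be_def)
  hence "AE x\<in>{0<..<1::real} in LB. False"
  proof eventually_elim
   case (elim x)
   thus ?case using b(4)[of x] by auto
  qed
  hence "AE x in LB. x \<notin> {0<..<1::real}" by auto
  hence "{0<..<1::real} \<in> null_sets LB"
   using AE_iff_null_sets[of "{0<..<1::real}" LB] by auto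
  thus False
   using open_not_negligible[of "{0<..<1::real}"] negligible_iff_null_sets by auto
 qed
 define c where "c = (LINT x|LB. u x * b x) / be"
 have "AE x in LB. u x - c = 0"
 proof (rule fundamental_lemma)
  show "loc_integrable (%x. u x - c)"
   by (rule li_diff[OF lu li_cont]) auto
  fix ze :: "real => real" assume t: "test_fun ze"
  define s where "s = (LINT x|LB. ze x) / be"
  define f where "f x = ze x - s * b x" for x
  obtain R where R: "R > 0" "!!x. norm x >= R ==> ze x = 0" using test_fun_support[OF t] by blast
  define M where "M = R + 1"
  have fz: "f x = 0" if "abs x >= M" for x
  proof -
   have "x \<notin> {0<..<1}" "norm x >= R" using that R(1) by (auto simp: M_def)
   thus ?thesis using R(2)[of x] b(3)[of x] by (simp add: f_def)
  qed
  have cf: "cont f"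
   unfolding f_def using smooth_continuous[OF test_fun_smooth[OF t]] smooth_continuous[OF test_fun_smooth[OF b(1)]]
   by (intro continuous_intros)
  have fi: "(LINT x|LB. f x) = 0"
   using int[OF t] int[OF b(1)] \<open>be ~= 0\<close> by (simp add: f_def s_def be_def)
  obtain F where F: "AC F f" "F 0 = 0"
   using AC_primitive[OF li_cont[OF cf]] by blast
  define et where "et x = F x - F (-M)" for x
  have det: "(et hrd f x) (at x)" for x
   unfolding et_def using AC_continuous_deriv[OF F(1) cf] by (auto intro!: derivative_eq_intros)
  \<comment> \<open>Mean zero makes the primitive vanish again to the right of the support.\<close>
  have "integral {-M..M} f = 0"
   using test_mult_integrable(2)[OF l1 cf fz] fi by simp
  hence FM: "F M = F (-M)" using AC_D[OF F(1), of "-M" M] R(1) by (simp add: M_def)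
  have etz: "et x = 0" if "abs x >= M" for x
  proof (cases "x >= M")
   case True
   hence "integral {M..x} f = integral {M..x} (%x. 0)"
   using fz by (intro Henstock_Kurzweil_Integration.integral_cong) auto
   thus ?thesis using AC_D[OF F(1) True] FM by (simp add: et_def)
  next
   case False
   hence x: "x <= -M" using that by auto
   hence "integral {x..-M} f = integral {x..-M} (%x. 0)"
   using fz by (intro Henstock_Kurzweil_Integration.integral_cong) auto
   thus ?thesis using AC_D[OF F(1) x] by (simp add: et_def)
  qed
  have sf: "smooth f"
  proof -
   have add: "smooth (%x. g x + h x)" if "smooth g" "smooth h" for g h
   proof (rule smooth_coinduct[where P = "%k. EX g h. smooth g & smooth h & k = (%x. g x + h x)"])
   fix k assume "EX g h. smooth g & smooth h & k = (%x. g x + h x)"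
   then obtain g h where gh: "smooth g" "smooth h" "k = (%x. g x + h x)" by blast
   thus "\<exists>f'. (ALL x. (k hrd f' x) (at x)) & (EX g h. smooth g & smooth h & f' = (%x. g x + h x))"
   by (intro exI[of _ "%x. deriv g x + deriv h x"]) (blast intro: DERIV_add smooth_deriv)
   qed (use that in blast)
   have "smooth (%x. ze x + (- s) * b (1 * x + 0))"
   by (intro add smooth_affine test_fun_smooth t b)
   thus ?thesis by (simp add: f_def[abs_def])
  qed
  have set: "smooth et"
   by (rule smooth_coinduct[where P = "%k. k = et \<or> smooth k"]) (use det sf smooth_deriv in blast)+
  have "test_fun et" by (rule test_funI[OF set etz])
  moreover have "deriv et = f" using det by (intro ext DERIV_imp_deriv)
  ultimately have "(LINT x|LB. u x * f x) = 0"
   using u by (auto simp: has_weak_deriv_def)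
  moreover have "(LINT x|LB. u x * f x) = (LINT x|LB. u x * ze x) - s * (LINT x|LB. u x * b x)"
   using test_fun_integrable[OF lu t] test_fun_integrable[OF lu b(1)]
   by (simp add: f_def right_diff_distrib mult.left_commute)
  moreover have "(LINT x|LB. (u x - c) * ze x) = (LINT x|LB. u x * ze x) - c * (LINT x|LB. ze x)"
   using test_fun_integrable[OF lu t] int[OF t] by (simp add: left_diff_distrib)
  ultimately show "(LINT x|LB. (u x - c) * ze x) = 0"
   by (simp add: c_def s_def)
 qed
 thus ?thesis by auto
qed

text \<open>Subtracting a primitive of \<open>v\<close> leaves a function with weak derivative zero,
  which is constant almost everywhere.\<close>

lemma weak_imp_AC:
 assumes "has_weak_deriv u v"
 obtains U where "AC U v" "AE x in LB. u x = U x"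
proof -
 have lu: "loc_integrable u" "loc_integrable v" using assms by (auto simp: has_weak_deriv_def)
 obtain V where V: "AC V v" using AC_primitive[OF lu(2)] by blast
 have wV: "has_weak_deriv V v" by (rule AC_imp_weak[OF V])
 have "has_weak_deriv (%x. u x - V x) (%x. 0)"
  unfolding has_weak_deriv_def
 proof (intro conjI allI impI)
  show "loc_integrable (%x. u x - V x)" using lu AC_loc'[OF V] li_diff by blast
  fix et :: "real => real" assume t: "test_fun et"
  show "(LINT x|LB. (u x - V x) * deriv et x) = - (LINT x|LB. 0 * et x)"
   using test_fun_integrable[OF lu(1) test_fun_deriv[OF t]] test_fun_integrable[OF AC_loc'[OF V] test_fun_deriv[OF t]]
   assms wV t
   by (simp add: left_diff_distrib has_weak_deriv_def)
 qed (auto intro: li_cont)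
 then obtain c where c: "AE x in LB. u x - V x = c" using zero_weak_deriv by blast
 show ?thesis
 proof
  show "AC (%x. V x + c) v" using AC_add[OF V AC_const, of c] by simp
  show "AE x in LB. u x = V x + c" using c by eventually_elim auto
 qed
qed

lemma continuous_AE_eq:
 assumes "AE x in LB. u x = (U x::real)" "cont u" "cont U"
 shows "u = U"
proof
 fix x
 obtain N where N: "N \<in> null_sets LB" "!!x. x \<notin> N ==> u x = U x"
  using assms(1) by (auto simp: eventually_ae_filter)
 have op: "open {x. u x ~= U x}" using assms(2,3) by (rule open_Collect_neq)
 have "{x. u x ~= U x} \<subseteq> N" using N(2) by blast
 hence "{x. u x ~= U x} = {}"
  using N(1) op negligible_iff_null_sets negligible_subset open_not_negligible by blast
 thus "u x = U x" by auto
qed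

section \<open>Square integrable functions and half lines\<close>

definition sqint :: "real set => (real => real) => bool" where
 "sqint S u \<longleftrightarrow> u \<in> LM & (%x. (u x)^2) abs_int_on S"

lemma abs_int_imp: "f abs_int_on S ==> f integrable_on S" for f :: "real => real"
 by (rule set_LINT_eq(1))

lemma abs_int_subset: "f abs_int_on S ==> T \<subseteq> S ==> T \<in> sets LB ==> (f::real=>real) abs_int_on T"
 by (rule set_integrable_subset)

lemma abs_int_minus: "f abs_int_on S ==> (%x. - f x) abs_int_on S" for f :: "real => real"
 unfolding set_integrable_def by simp

lemma abs_int_bound:
 fixes f :: "real => real"
 assumes "f \<in> LM" "S \<in> sets LB" "g integrable_on S" "!!x. x \<in> S ==> abs (f x) <= g x"
 shows "f abs_int_on S"
proof (rule measurable_bounded_by_integrable_imp_absolutely_integrable[OF _ assms(2,3)])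
 show "f \<in> borel_measurable (lebesgue_on S)" using assms(1) by (rule measurable_restrict_space1)
qed (use assms(4) in auto)

lemma sqint_meas: "sqint S u ==> u \<in> LM"
 by (simp add: sqint_def)

lemma sqint_int: "sqint S u ==> (%x. (u x)^2) integrable_on S"
 by (rule abs_int_imp) (simp add: sqint_def)

lemma abs_mult_le_squares: "abs (a * b) <= a^2 + (b::real)^2"
proof -
 have "2 * (abs a * abs b) <= a^2 + b^2" using sum_squares_bound[of "abs a" "abs b"] by simp
 moreover have "0 <= abs a * abs b" by simp
 ultimately show ?thesis unfolding abs_mult by linarith
qed

lemma sqint_mult:
 assumes "sqint S u" "sqint S v" "S \<in> sets LB"
 shows "(%x. u x * v x) abs_int_on S"
proof (rule abs_int_bound[where g = "%x. (u x)^2 + (v x)^2"])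
 show "(%x. u x * v x) \<in> LM" using sqint_meas[OF assms(1)] sqint_meas[OF assms(2)] by simp
 show "(%x. (u x)^2 + (v x)^2) integrable_on S" using sqint_int[OF assms(1)] sqint_int[OF assms(2)] by (rule integrable_add)
qed (auto intro: abs_mult_le_squares assms)

lemma sqint_dom:
 assumes "u \<in> LM" "S \<in> sets LB" "(%x. g x) integrable_on S" "!!x. x \<in> S ==> (u x)^2 <= g x"
 shows "sqint S u"
 unfolding sqint_def by (intro conjI abs_int_bound[where g = g] borel_measurable_power assms) (simp add: assms(4))

lemma sqint_cmult: "sqint S u ==> sqint S (%x. c * u x)"
 unfolding sqint_def by (auto simp: power_mult_distrib)

lemma sqint_minus: "sqint S u ==> sqint S (%x. - u x)"
 using sqint_cmult[of S u "-1"] by simp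

lemma square_add_le: "(a + b)^2 <= 2 * a^2 + 2 * (b::real)^2"
 using zero_le_power2[of "a - b"] by (simp add: power2_sum power2_diff)

lemma square_diff_le: "(a - b)^2 <= 2 * a^2 + 2 * (b::real)^2"
 using square_add_le[of a "-b"] by simp

lemma sqint_add:
 assumes "sqint S u" "sqint S v" "S \<in> sets LB"
 shows "sqint S (%x. u x + v x)"
proof (rule sqint_dom[where g = "%x. 2 * (u x)^2 + 2 * (v x)^2"])
 show "(%x. u x + v x) \<in> LM" using sqint_meas[OF assms(1)] sqint_meas[OF assms(2)] by simp
 show "(%x. 2 * (u x)^2 + 2 * (v x)^2) integrable_on S"
  using sqint_int[OF assms(1)] sqint_int[OF assms(2)] by (intro integrable_add integrable_on_mult_right)
qed (auto intro: square_add_le assms)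

lemma sqint_diff: "sqint S u ==> sqint S v ==> S \<in> sets LB ==> sqint S (%x. u x - v x)"
 using sqint_add[of S u "%x. - v x"] sqint_minus by simp

lemma sqint_subset: "sqint S u ==> T \<subseteq> S ==> T \<in> sets LB ==> sqint T u"
 unfolding sqint_def by (blast intro: abs_int_subset[where S = S and T = T])

lemma sqint_bdd_mult:
 assumes "sqint S u" "c \<in> LM" "S \<in> sets LB" "!!x. x \<in> S ==> abs (c x) <= M"
 shows "sqint S (%x. c x * u x)"
proof (rule sqint_dom[where g = "%x. M^2 * (u x)^2"])
 show "(%x. c x * u x) \<in> LM" using sqint_meas[OF assms(1)] assms(2) by simp
 show "(%x. M^2 * (u x)^2) integrable_on S"
  using sqint_int[OF assms(1)] by (rule integrable_on_mult_right)
 show "(c x * u x)^2 <= M^2 * (u x)^2" if "x \<in> S" for x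
  using assms(4)[OF that] by (auto simp: power_mult_distrib abs_le_square_iff[symmetric] intro!: mult_right_mono)
qed (use assms in auto)

lemma continuous_meas: "cont u ==> (u::real => real) \<in> LM"
 using bmc[of u] by (intro measurable_completion) simp

lemma integral_le:
 fixes f g :: "real => real"
 shows "f integrable_on S ==> g integrable_on S ==> (!!x. x \<in> S ==> f x <= g x) ==> integral S f <= integral S g"
 by (rule Henstock_Kurzweil_Integration.integral_le)

text \<open>The integral of \<open>(s * u + v)^2\<close> is a nonnegative quadratic polynomial in
  \<open>s\<close>. Evaluate it at its minimum or, if the leading coefficient vanishes, far out in
  the direction in which the linear term decreases.\<close>

lemma Cauchy_Schwarz_integral:
 assumes "sqint S u" "sqint S v" "S \<in> sets LB"
 shows "(integral S (%x. u x * v x))^2 <= integral S (%x. (u x)^2) * integral S (%x. (v x)^2)"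
proof -
 define A B C where "A = integral S (%x. (u x)^2)" and "B = integral S (%x. (v x)^2)"
  and "C = integral S (%x. u x * v x)"
 have i: "(%x. (u x)^2) integrable_on S" "(%x. (v x)^2) integrable_on S" "(%x. u x * v x) integrable_on S"
  using sqint_int[OF assms(1)] sqint_int[OF assms(2)] abs_int_imp[OF sqint_mult[OF assms]] by auto
 have q: "0 <= s^2 * A + 2 * s * C + B" for s
 proof -
  have "0 <= integral S (%x. (s * u x + v x)^2)"
   using sqint_int[OF sqint_add[OF sqint_cmult[OF assms(1), of s] assms(2,3)]]
   by (intro Henstock_Kurzweil_Integration.integral_nonneg) auto
  also have "(%x. (s * u x + v x)^2) = (%x. s^2 * (u x)^2 + (2 * s) * (u x * v x) + (v x)^2)"
   by (auto simp: power2_sum power_mult_distrib algebra_simps)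
  also have "integral S ... = s^2 * A + 2 * s * C + B"
   using i by (simp add: HK_add integrable_add integrable_on_mult_right A_def B_def C_def)
  finally show ?thesis .
 qed
 have "A >= 0" unfolding A_def using i by (intro Henstock_Kurzweil_Integration.integral_nonneg) auto
 show ?thesis
 proof (cases "A = 0")
  case True
  have "C = 0"
  proof (rule ccontr)
   assume "C ~= 0"
   thus False using q[of "- (B + 1) / (2 * C)"] True by (simp add: field_simps)
  qed
  thus ?thesis using True by (simp add: A_def C_def)
 next
  case False
  hence "A > 0" using \<open>A >= 0\<close> by simp
  hence "C^2 <= A * B" using q[of "- C / A"] by (simp add: field_simps power2_eq_square)
  thus ?thesis by (simp add: A_def B_def C_def)
 qed
qed

lemma sqint_nonneg: "sqint S u ==> 0 <= integral S (%x. (u x)^2)"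
 by (intro Henstock_Kurzweil_Integration.integral_nonneg sqint_int) auto

section \<open>Half lines: splitting, limits at infinity, reflection\<close>

lemma half_line_sets [simp]: "{t..} \<in> sets LB" "{..t} \<in> sets LB" for t :: real
 by (rule sets_completionI_sets, simp)+

lemma split_half:
 fixes f :: "real => real"
 assumes "f abs_int_on {t..}" "t <= a"
 shows "integral {t..} f = integral {t..a} f + integral {a..} f"
proof -
 have "f abs_int_on {t..a}" "f abs_int_on {a..}"
  using assms(2) by (intro abs_int_subset[OF assms(1)]; simp)+
 moreover have "{t..} = {t..a} \<union> {a..}" "{t..a} \<inter> {a..} = {a}" using assms(2) by auto
 ultimately show ?thesis
  using Henstock_Kurzweil_Integration.integral_Un[OF abs_int_imp abs_int_imp, of "{t..a}" f "{a..}"] by simp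
qed

lemma split_UNIV:
 fixes f :: "real => real"
 assumes "f abs_int_on UNIV"
 shows "intR f = integral {..t} f + integral {t..} f"
proof -
 have "f abs_int_on {..t}" "f abs_int_on {t..}"
  by (auto intro!: abs_int_subset[OF assms])
 moreover have "UNIV = {..t} \<union> {t..}" "{..t} \<inter> {t..} = {t}" by auto
 ultimately show ?thesis
  using Henstock_Kurzweil_Integration.integral_Un[OF abs_int_imp abs_int_imp, of "{..t}" f "{t..}"] by simp
qed

lemma integral_half_tendsto:
 fixes v :: "real => real"
 assumes "v abs_int_on {t..}"
 shows "((%b. integral {t..b} v) ~~> integral {t..} v) at_top"
proof -
 have "((%b. LINT x:{t..b}|LB. v x) ~~> (LINT x:{t..}|LB. v x)) at_top"
  by (rule tendsto_set_lebesgue_integral_at_top) (use assms in auto)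
 moreover have "(LINT x:{t..b}|LB. v x) = integral {t..b} v" for b
  by (rule set_LINT_eq(2)) (auto intro!: abs_int_subset[OF assms])
 moreover have "(LINT x:{t..}|LB. v x) = integral {t..} v"
  by (rule set_LINT_eq(2)[OF assms])
 ultimately show ?thesis by simp
qed

lemma AC_limit:
 assumes "AC u v" "v abs_int_on {t..}"
 shows "(u ~~> u t + integral {t..} v) at_top"
proof -
 have "((%b. u t + integral {t..b} v) ~~> u t + integral {t..} v) at_top"
  by (intro tendsto_intros integral_half_tendsto assms)
 moreover have "\<forall>\<^sub>F b in at_top. u t + integral {t..b} v = u b"
  using eventually_ge_at_top[of t] by eventually_elim (simp add: AC_D[OF assms(1)])
 ultimately show ?thesis by (rule Lim_transform_eventually)
qed

text \<open>A nonzero limit would keep \<open>abs (u x)\<close> above \<open>abs L / 2\<close> on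
  intervals of arbitrary length.\<close>

lemma integrable_limit_zero:
 fixes u :: "real => real"
 assumes "(u ~~> L) at_top" "u abs_int_on {t..}"
 shows "L = 0"
proof (rule ccontr)
 assume "L ~= 0"
 hence "\<forall>\<^sub>F x in at_top. dist (u x) L < abs L / 2"
  using assms(1) by (intro tendstoD) auto
 then obtain s where s: "!!x. x >= s ==> abs (u x) >= abs L / 2"
  unfolding eventually_at_top_linorder dist_real_def by (smt (verit) field_sum_of_halves)
 define r where "r = max s t"
 have ai: "(%x. abs (u x)) abs_int_on {t..}" using assms(2) by (rule set_integrable_abs)
 have "abs L / 2 * real n <= integral {t..} (%x. abs (u x))" for n
 proof -
  have ai': "(%x. abs (u x)) abs_int_on {r..r + real n}"
   using ai by (rule abs_int_subset) (auto simp: r_def)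
  have "abs L / 2 * real n = integral {r..r + real n} (%x. abs L / 2)" by simp
  also have "... <= integral {r..r + real n} (%x. abs (u x))"
   using ai' s by (intro integral_le abs_int_imp) (auto simp: r_def)
  also have "... <= integral {t..} (%x. abs (u x))"
   using ai ai' by (intro integral_subset_le abs_int_imp) (auto simp: r_def)
  finally show ?thesis .
 qed
 moreover obtain n where "integral {t..} (%x. abs (u x)) < real n * (abs L / 2)"
  using reals_Archimedean3[of "abs L / 2"] \<open>L ~= 0\<close> by auto
 ultimately show False by (smt (verit) mult.commute)
qed

text \<open>Integrability of \<open>v\<close> makes \<open>u\<close> converge and integrability of
  \<open>u\<close> makes the limit 0, so integration by parts over a half line leaves only the
  boundary term at \<open>t\<close>.\<close>

lemma AC_half:
 assumes "AC u v" "u abs_int_on {t..}" "v abs_int_on {t..}"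
 shows "integral {t..} v = - u t" "(u ~~> 0) at_top"
proof -
 note l = AC_limit[OF assms(1,3)]
 have "u t + integral {t..} v = 0" using integrable_limit_zero[OF l assms(2)] .
 with l show "integral {t..} v = - u t" "(u ~~> 0) at_top" by auto
qed

lemma integrable_reflect:
 fixes f :: "real => real"
 shows "integrable LB (%x. f (- x)) \<longleftrightarrow> integrable LB f"
  "integral\<^sup>L LB (%x. f (- x)) = integral\<^sup>L LB f"
proof -
 have *: "has_bochner_integral LB (%x. f (- x)) i \<longleftrightarrow> has_bochner_integral LB f i" for i
  using has_bochner_integral_lebesgue_real_affine_iff[of "-1" f i 0] by simp
 thus 1: "integrable LB (%x. f (- x)) \<longleftrightarrow> integrable LB f"
  by (auto simp: integrable.simps)
 show "integral\<^sup>L LB (%x. f (- x)) = integral\<^sup>L LB f"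
  using * 1 by (cases "integrable LB f") (auto simp: has_bochner_integral_iff not_integrable_integral_eq)
qed

lemma reflect_half:
 fixes f :: "real => real"
 shows "(%x. f (- x)) abs_int_on {-t..} \<longleftrightarrow> f abs_int_on {..t}"
  "f abs_int_on {..t} ==> integral {-t..} (%x. f (- x)) = integral {..t} f"
proof -
 have ind: "indicator {-t..} x *\<^sub>R f (- x) = (%x. indicator {..t} x *\<^sub>R f x) (- x)" for x
  by (auto simp: indicator_def)
 show 1: "(%x. f (- x)) abs_int_on {-t..} \<longleftrightarrow> f abs_int_on {..t}"
  unfolding set_integrable_def ind using integrable_reflect(1)[of "%x. indicator {..t} x *\<^sub>R f x"] by simp
 assume a: "f abs_int_on {..t}"
 have "(LINT x:{-t..}|LB. f (-x)) = (LINT x:{..t}|LB. f x)"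
  unfolding set_lebesgue_integral_def ind using integrable_reflect(2)[of "%x. indicator {..t} x *\<^sub>R f x"] by simp
 thus "integral {-t..} (%x. f (- x)) = integral {..t} f"
  using set_LINT_eq(2) a 1 by metis
qed

lemma measurable_reflect: "f \<in> LM ==> (%x::real. f (- x) :: real) \<in> LM"
 using measurable_compose[OF lebesgue_measurable_scaling[of "-1::real"], of f borel] by simp

lemma AC_half_left:
 assumes "AC u v" "u abs_int_on {..t}" "v abs_int_on {..t}"
 shows "integral {..t} v = u t" "(u ~~> 0) at_bot"
proof -
 have "(%x. - v (- x)) abs_int_on {-t..}"
  using reflect_half(1)[where f = "%x. - v x" and t = t] abs_int_minus[OF assms(3)] by blast
 note * = AC_half[OF AC_reflect[OF assms(1)] _ this]
 have "(%x. u (- x)) abs_int_on {-t..}" using assms(2) reflect_half(1) by blast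
 note * = *[OF this]
 show "integral {..t} v = u t"
  using *(1) reflect_half(2)[OF assms(3)] by simp
 show "(u ~~> 0) at_bot" using *(2) by (simp add: filterlim_at_bot_mirror)
qed

lemma AC_whole:
 assumes "AC u v" "u abs_int_on UNIV" "v abs_int_on UNIV"
 shows "intR v = 0"
 using split_UNIV[OF assms(3), of 0] AC_half(1)[OF assms(1), of 0] AC_half_left(1)[OF assms(1), of 0]
  abs_int_subset[OF assms(2), of "{0..}"] abs_int_subset[OF assms(2), of "{..0}"]
  abs_int_subset[OF assms(3), of "{0..}"] abs_int_subset[OF assms(3), of "{..0}"]
 by simp

text \<open>Integrate \<open>(u^2)' = 2 * u * v\<close> from \<open>t\<close> to infinity and use
  \<open>- 2 * u * v <= u^2 + v^2\<close>; this gives the embedding with constant 1.\<close>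

lemma sobolev_half:
 assumes "AC u v" "sqint {t..} u" "sqint {t..} v"
 shows "(u t)^2 <= integral {t..} (%x. (u x)^2) + integral {t..} (%x. (v x)^2)" "(u ~~> 0) at_top"
proof -
 have uv: "(%x. u x * v x) abs_int_on {t..}" using sqint_mult[OF assms(2,3)] by simp
 hence i: "(%x. 2 * u x * v x) abs_int_on {t..}"
  using set_integrable_mult_right[of 2 LB "{t..}" "%x. u x * v x"] by (simp add: mult.assoc)
 have i2: "(%x. (u x)^2) abs_int_on {t..}" using assms(2) by (simp add: sqint_def)
 note h = AC_half[OF AC_square[OF assms(1)] i2 i]
 have "(u t)^2 = integral {t..} (%x. - (2 * u x * v x))" using h(1) by simp
 also have "... <= integral {t..} (%x. (u x)^2 + (v x)^2)"
 proof (rule integral_le)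
  show "(%x. - (2 * u x * v x)) integrable_on {t..}" using abs_int_imp[OF i] by (rule integrable_neg)
  show "(%x. (u x)^2 + (v x)^2) integrable_on {t..}" using sqint_int assms by (intro integrable_add) auto
  show "- (2 * u x * v x) <= (u x)^2 + (v x)^2" for x
   using zero_le_power2[of "u x + v x"] by (simp add: power2_sum)
 qed
 also have "... = integral {t..} (%x. (u x)^2) + integral {t..} (%x. (v x)^2)"
  using sqint_int assms by (intro HK_add) auto
 finally show "(u t)^2 <= integral {t..} (%x. (u x)^2) + integral {t..} (%x. (v x)^2)" .
 show "(u ~~> 0) at_top"
  using tendsto_real_sqrt[OF h(2)] by (simp add: tendsto_rabs_zero_iff)
qed

section \<open>The Sobolev space\<close>

lemma L2_iff: "u \<in> L2 \<longleftrightarrow> sqint UNIV u"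
 by (simp add: L2_def sqint_def set_integrable_def)

lemma LINT_eq_integral:
 fixes f :: "real => real"
 assumes "f abs_int_on UNIV"
 shows "integral\<^sup>L LB f = intR f"
 using set_LINT_eq(2)[OF assms] by (simp add: set_lebesgue_integral_def)

lemma L2_norm_eq: "sqint UNIV u ==> L2_norm u = sqrt (intR (%x. (u x)^2))"
 by (simp add: L2_norm_def LINT_eq_integral sqint_def)

lemma measurable_cong_AE:
 assumes "AE x in LB. u x = (u' x::real)" "u \<in> borel_measurable (LB::real measure)"
 shows "u' \<in> LM"
 using borel_measurable_AE[OF assms(2), of u'] assms(1) by (auto elim: eventually_mono)

lemma sqint_cong_AE:
 assumes "AE x in LB. u x = u' x" "sqint UNIV u"
 shows "sqint UNIV u'" "L2_norm u' = L2_norm u"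
proof -
 have m: "u' \<in> LM" "u \<in> LM"
  using measurable_cong_AE[OF assms(1)] assms(2) by (auto simp: sqint_def)
 have ae: "AE x in LB. (u x)^2 = (u' x)^2" using assms(1) by eventually_elim simp
 have "integrable LB (%x. (u' x)^2)"
  using assms(2) m ae integrable_cong_AE[of "%x. (u x)^2" LB "%x. (u' x)^2"]
  by (auto simp: sqint_def set_integrable_def)
 thus "sqint UNIV u'" using m by (simp add: sqint_def set_integrable_def)
 show "L2_norm u' = L2_norm u"
  unfolding L2_norm_def using integral_cong_AE[of "%x. (u x)^2" LB "%x. (u' x)^2"] m ae by simp
qed

text \<open>An element of the Sobolev space as a continuous representative together with a
  derivative; \<open>H1_obtain\<close> and \<open>H1_norm_eq\<close> translate to and from
  \<open>H1\<close>.\<close>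

definition H1r :: "(real => real) => (real => real) => bool" where
 "H1r U V \<longleftrightarrow> AC U V & sqint UNIV U & sqint UNIV V"

definition H1sq :: "(real => real) => (real => real) => real" where
 "H1sq U V = intR (%x. (U x)^2) + intR (%x. (V x)^2)"

lemma H1_obtain:
 assumes "u \<in> H1"
 obtains U V where "H1r U V" "AE x in LB. u x = U x"
proof -
 obtain v where u: "sqint UNIV u" and v: "sqint UNIV v" "has_weak_deriv u v"
  using assms by (auto simp: H1_def L2_iff)
 then obtain U where U: "AC U v" "AE x in LB. u x = U x" using weak_imp_AC by blast
 thus ?thesis using that[of U v] v(1) sqint_cong_AE(1)[OF U(2) u] by (simp add: H1r_def)
qed

lemma H1r_imp_H1:
 assumes "H1r U V" "AE x in LB. U x = u x"
 shows "u \<in> H1"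
proof -
 have "has_weak_deriv U V" using assms(1) AC_imp_weak by (auto simp: H1r_def)
 hence "has_weak_deriv u V" using has_weak_deriv_cong_AE[OF assms(2), of V V] by auto
 thus ?thesis using assms sqint_cong_AE(1)[OF assms(2)] by (auto simp: H1_def L2_iff H1r_def)
qed

lemma weak_deriv_AE:
 assumes "AC U V" "AE x in LB. U x = u x"
 shows "AE x in LB. V x = weak_deriv u x"
proof -
 have *: "has_weak_deriv u V" using has_weak_deriv_cong_AE[OF assms(2), of V V] AC_imp_weak[OF assms(1)] by auto
 hence "has_weak_deriv u (weak_deriv u)" unfolding weak_deriv_def by (rule someI[of "has_weak_deriv u"])
 thus ?thesis using has_weak_deriv_unique * by blast
qed

lemma H1_norm_eq:
 assumes "H1r U V" "AE x in LB. U x = u x"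
 shows "H1_norm u = sqrt (H1sq U V)"
proof -
 have AE: "AE x in LB. V x = weak_deriv u x" using weak_deriv_AE[OF _ assms(2)] assms(1) by (auto simp: H1r_def)
 have s: "sqint UNIV U" "sqint UNIV V" using assms(1) by (auto simp: H1r_def)
 show ?thesis
  using sqint_cong_AE(2)[OF AE s(2)] sqint_cong_AE(2)[OF assms(2) s(1)] L2_norm_eq[OF s(1)] L2_norm_eq[OF s(2)]
   sqint_nonneg[OF s(1)] sqint_nonneg[OF s(2)]
  by (simp add: H1_norm_def H1sq_def)
qed

lemma H1sq_nonneg: "H1r U V ==> 0 <= H1sq U V"
 by (auto simp: H1r_def H1sq_def intro!: add_nonneg_nonneg sqint_nonneg)

lemma H1r_sobolev:
 assumes "H1r U V"
 shows "(U t)^2 <= H1sq U V"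
proof -
 have s: "sqint UNIV U" "sqint UNIV V" "AC U V" using assms by (auto simp: H1r_def)
 hence h: "sqint {t..} U" "sqint {t..} V" using sqint_subset[of UNIV _ "{t..}"] by auto
 have "(U t)^2 <= integral {t..} (%x. (U x)^2) + integral {t..} (%x. (V x)^2)"
  using sobolev_half(1)[OF s(3) h] .
 also have "... <= H1sq U V"
  unfolding H1sq_def using sqint_int[OF s(1)] sqint_int[OF s(2)] sqint_int[OF h(1)] sqint_int[OF h(2)]
  by (intro add_mono integral_subset_le) auto
 finally show ?thesis .
qed

lemma H1r_add: "H1r U V ==> H1r U' V' ==> H1r (%x. U x + U' x) (%x. V x + V' x)"
 unfolding H1r_def by (auto intro: AC_add sqint_add)

lemma H1r_diff: "H1r U V ==> H1r U' V' ==> H1r (%x. U x - U' x) (%x. V x - V' x)"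
 unfolding H1r_def by (auto intro: AC_diff sqint_diff)

lemma integral_square_add_le:
 assumes "sqint S u" "sqint S v" "S \<in> sets LB"
 shows "integral S (%x. (u x + v x)^2) <= 2 * integral S (%x. (u x)^2) + 2 * integral S (%x. (v x)^2)"
proof -
 have i: "(%x. 2 * (u x)^2) integrable_on S" "(%x. 2 * (v x)^2) integrable_on S"
  using sqint_int assms(1,2) integrable_on_mult_right by blast+
 have "integral S (%x. (u x + v x)^2) <= integral S (%x. 2 * (u x)^2 + 2 * (v x)^2)"
  using sqint_int[OF sqint_add[OF assms]] i by (intro integral_le integrable_add square_add_le) auto
 also have "... = 2 * integral S (%x. (u x)^2) + 2 * integral S (%x. (v x)^2)"
  using i by (simp add: HK_add)
 finally show ?thesis .
qed

lemma H1sq_add_le: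
 assumes "H1r U V" "H1r U' V'"
 shows "H1sq (%x. U x + U' x) (%x. V x + V' x) <= 2 * H1sq U V + 2 * H1sq U' V'"
 using integral_square_add_le[of UNIV U U'] integral_square_add_le[of UNIV V V'] assms
 by (simp add: H1r_def H1sq_def)

section \<open>The kinks\<close>

text \<open>The derivative of the kink, written as the right-hand side of the first-order equation
  that the kink solves, free of exponentials.\<close>

definition dk01 :: "real => real" where
 "dk01 x = sqrt 2 * kink01 x * (1 - (kink01 x)^2)"

definition dk10 :: "real => real" where
 "dk10 x = dk01 (- x)"

lemma sqrt2_bounds: "1.41 < sqrt 2" "sqrt 2 < (1.42::real)" "sqrt 2 * sqrt 2 = (2::real)" "(sqrt 2)^2 = (2::real)"
proof -
 show "1.41 < sqrt (2::real)" by (rule real_less_rsqrt) (simp add: power2_eq_square)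
 show "sqrt 2 < (1.42::real)" by (rule real_less_lsqrt) (simp_all add: power2_eq_square)
qed auto

lemma one_plus_exp_pos [simp]: "0 < 1 + exp (y::real)"
 by (simp add: add_pos_pos)

lemma one_plus_exp_neq_0 [simp]: "1 + exp (y::real) ~= 0"
 using one_plus_exp_pos[of y] by linarith

lemma kink10_eq: "kink10 x = - kink01 (- x)"
 by (simp add: kink10_def kink01_def)

lemma kink01_square: "(kink01 x)^2 = exp (2 * sqrt 2 * x) / (1 + exp (2 * sqrt 2 * x))"
 by (simp add: kink01_def power_divide exp_double[symmetric] add_nonneg_nonneg mult.assoc)

lemma one_minus_kink01_square: "1 - (kink01 x)^2 = 1 / (1 + exp (2 * sqrt 2 * x))"
proof -
 have "1 + exp (2 * sqrt 2 * x) ~= 0" using exp_gt_zero[of "2 * sqrt 2 * x"] by linarith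
 thus ?thesis unfolding kink01_square by (simp add: field_simps)
qed

lemma kink01_pos: "0 < kink01 x"
proof -
 have "0 < 1 + exp (2 * sqrt 2 * x)" by (simp add: add_pos_pos)
 thus ?thesis unfolding kink01_def by (intro divide_pos_pos) (auto intro: real_sqrt_gt_zero)
qed

lemma kink01_square_less_1: "(kink01 x)^2 < 1"
proof -
 have "0 < 1 - (kink01 x)^2" unfolding one_minus_kink01_square by (simp add: add_pos_pos)
 thus ?thesis by simp
qed

lemma kink01_less_1: "kink01 x < 1"
 using kink01_square_less_1[of x] kink01_pos[of x] by (simp add: power_less_one_iff abs_square_less_1)

lemma kink01_le_exp: "kink01 x <= exp (sqrt 2 * x)"
proof -
 have "1 <= sqrt (1 + exp (2 * sqrt 2 * x))" by simp
 hence "exp (sqrt 2 * x) / sqrt (1 + exp (2 * sqrt 2 * x)) <= exp (sqrt 2 * x) / 1"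
  by (intro divide_left_mono) auto
 thus ?thesis unfolding kink01_def by simp
qed

lemma kink01_ge_exp: "x <= 0 ==> exp (sqrt 2 * x) / sqrt 2 <= kink01 x"
proof -
 assume "x <= 0"
 hence "exp (2 * sqrt 2 * x) <= 1" by (simp add: mult_nonneg_nonpos)
 hence "sqrt (1 + exp (2 * sqrt 2 * x)) <= sqrt 2" by simp
 thus ?thesis unfolding kink01_def
  by (intro divide_left_mono) (auto intro!: mult_pos_pos add_pos_pos)
qed

lemma one_minus_kink01_le: "1 - kink01 x <= exp (- (2 * sqrt 2 * x))"
proof -
 have "1 - kink01 x <= 1 - (kink01 x)^2"
  using kink01_pos[of x] kink01_less_1[of x] by (simp add: power2_eq_square mult_left_le_one_le)
 also have "... <= 1 / exp (2 * sqrt 2 * x)"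
  unfolding one_minus_kink01_square by (intro divide_left_mono) (auto intro!: mult_pos_pos add_pos_pos)
 finally show ?thesis by (simp add: exp_minus divide_inverse)
qed

lemma kink01_0: "kink01 0 = 1 / sqrt 2"
 by (simp add: kink01_def)

lemma DERIV_kink01: "(kink01 hrd dk01 x) (at x)"
proof -
 define E where "E = exp (sqrt 2 * x)"
 have E2: "exp (2 * sqrt 2 * x) = E^2" by (simp add: E_def exp_double[symmetric] mult.assoc)
 have s: "sqrt (1 + E^2) > 0" by (simp add: add_pos_nonneg)
 have s2: "sqrt (1 + E^2) * sqrt (1 + E^2) = 1 + E^2" by (simp add: add_nonneg_nonneg)
 have pos: "1 + exp (2 * sqrt 2 * x) > 0" by (simp add: add_pos_pos)
 have d1: "((%x. exp (sqrt 2 * x)) hrd sqrt 2 * E) (at x)"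
  by (auto intro!: derivative_eq_intros simp: E_def)
 have d2: "((%x. 1 + exp (2 * sqrt 2 * x)) hrd 2 * sqrt 2 * E^2) (at x)"
  by (auto intro!: derivative_eq_intros simp: E2)
 have "((%x. exp (sqrt 2 * x) / sqrt (1 + exp (2 * sqrt 2 * x))) hrd
  (sqrt 2 * E * sqrt (1 + exp (2 * sqrt 2 * x)) - exp (sqrt 2 * x) * (inverse (sqrt (1 + exp (2 * sqrt 2 * x))) / 2 * (2 * sqrt 2 * E^2))) /
   (sqrt (1 + exp (2 * sqrt 2 * x)) * sqrt (1 + exp (2 * sqrt 2 * x)))) (at x)"
  using pos by (intro DERIV_divide d1 DERIV_chain2[OF DERIV_real_sqrt[OF pos] d2]) auto
 hence "((%x. exp (sqrt 2 * x) / sqrt (1 + exp (2 * sqrt 2 * x))) hrd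
  (sqrt 2 * E * sqrt (1 + E^2) - E * (2 * sqrt 2 * E^2 * (inverse (sqrt (1 + E^2)) / 2))) /
   (sqrt (1 + E^2) * sqrt (1 + E^2))) (at x)"
  unfolding E2 unfolding E_def[symmetric] by (simp only: mult.commute)
 moreover have "(sqrt 2 * E * sqrt (1 + E^2) - E * (2 * sqrt 2 * E^2 * (inverse (sqrt (1 + E^2)) / 2))) /
   (sqrt (1 + E^2) * sqrt (1 + E^2)) = dk01 x"
 proof -
  define s where "s = sqrt (1 + E^2)"
  have s: "s > 0" "s * s = 1 + E^2" using \<open>sqrt (1 + E^2) > 0\<close> s2 by (auto simp: s_def)
  have "dk01 x = sqrt 2 * (E / s) * (1 / (s * s))"
   unfolding dk01_def one_minus_kink01_square unfolding kink01_def E2 s(2) E_def[symmetric] s_def[symmetric] ..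
  moreover have "sqrt 2 * E * s - E * (2 * sqrt 2 * E^2 * (inverse s / 2)) = sqrt 2 * E * (s * s - E^2) / s"
   using s(1) by (simp add: field_simps)
  ultimately show ?thesis unfolding s_def[symmetric] s(2) using s by (simp add: field_simps)
 qed
 ultimately show ?thesis unfolding kink01_def[abs_def] by simp
qed

lemma DERIV_kink10: "(kink10 hrd dk10 x) (at x)"
proof -
 have "((%x. - kink01 (- x)) hrd - (dk01 (- x) * (- 1))) (at x)"
  by (intro DERIV_minus DERIV_chain2[OF DERIV_kink01]) (auto intro!: derivative_eq_intros)
 thus ?thesis by (simp add: kink10_eq[abs_def] dk10_def)
qed

lemma continuous_kink01 [continuous_intros]: "continuous_on S f ==> continuous_on S (%x. kink01 (f x))"
 by (rule continuous_on_compose2[of UNIV kink01 S f])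
  (auto intro!: continuous_at_imp_continuous_on DERIV_isCont[OF DERIV_kink01])

lemma continuous_kink01_deriv [continuous_intros]: "continuous_on S f ==> continuous_on S (%x. dk01 (f x))"
 unfolding dk01_def by (intro continuous_intros)

lemma continuous_kink10 [continuous_intros]: "continuous_on S f ==> continuous_on S (%x. kink10 (f x))"
 unfolding kink10_eq by (intro continuous_intros)

lemma continuous_kink10_deriv [continuous_intros]: "continuous_on S f ==> continuous_on S (%x. dk10 (f x))"
 unfolding dk10_def by (intro continuous_intros)

lemma AC_kink01: "AC (%x. kink01 (x - a)) (%x. dk01 (x - a))"
 using AC_shift[OF AC_C1[OF DERIV_kink01], of "- a"] by (simp add: continuous_intros)

lemma AC_kink10: "AC (%x. kink10 (x - a)) (%x. dk10 (x - a))"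
 using AC_shift[OF AC_C1[OF DERIV_kink10], of "- a"] by (simp add: continuous_intros)

lemma dk01_nonneg: "0 < dk01 x"
 unfolding dk01_def using kink01_pos[of x] kink01_square_less_1[of x] by simp

text \<open>To the left the kink itself decays like \<open>exp (sqrt 2 * x)\<close>; to the right
  \<open>1 - (kink01 x)^2\<close> decays at twice that rate. The slower rate serves both
  sides.\<close>

lemma dk01_le: "dk01 x <= sqrt 2 * exp (- sqrt 2 * abs x)"
proof (cases "x >= 0")
 case True
 have "kink01 x * (1 - (kink01 x)^2) <= 1 * (1 / (1 + exp (2 * sqrt 2 * x)))"
  unfolding one_minus_kink01_square using kink01_less_1[of x] kink01_pos[of x]
  by (intro mult_mono) (auto simp: add_nonneg_nonneg)
 also have "... <= 1 / exp (2 * sqrt 2 * x)"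
  unfolding mult_1 by (intro divide_left_mono) (auto intro!: mult_pos_pos add_pos_pos)
 also have "... <= 1 / exp (sqrt 2 * x)"
  using True by (intro divide_left_mono) (auto simp: mult_le_cancel_right)
 finally show ?thesis using True by (simp add: dk01_def mult.assoc exp_minus divide_inverse)
next
 case False
 have "kink01 x * (1 - (kink01 x)^2) <= exp (sqrt 2 * x) * 1"
  using kink01_le_exp[of x] kink01_pos[of x] kink01_square_less_1[of x] by (intro mult_mono) auto
 thus ?thesis using False by (simp add: dk01_def mult.assoc)
qed

lemma kink01_strict_mono: "x < y ==> kink01 x < kink01 y"
 by (rule DERIV_pos_imp_increasing[of x y kink01]) (use DERIV_kink01 dk01_nonneg in blast)+

lemma kink01_mono: "x <= y ==> kink01 x <= kink01 y"
 using kink01_strict_mono[of x y] by (cases "x = y") auto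

section \<open>Exponential weights\<close>

lemma exp_int_top:
 fixes c :: real
 assumes "0 < c"
 shows "(%x. exp (- c * x)) abs_int_on {t..}" "integral {t..} (%x. exp (- c * x)) = exp (- c * t) / c"
proof -
 note i = has_integral_exp_minus_to_infinity[OF assms, of t]
 show "(%x. exp (- c * x)) abs_int_on {t..}"
  using i by (intro nonnegative_absolutely_integrable_1) (auto simp: integrable_on_def)
 show "integral {t..} (%x. exp (- c * x)) = exp (- c * t) / c" using i by (rule integral_unique)
qed

lemma exp_int_bot:
 fixes c :: real
 assumes "0 < c"
 shows "(%x. exp (c * x)) abs_int_on {..t}" "integral {..t} (%x. exp (c * x)) = exp (c * t) / c"
proof -
 have r: "(%x. exp (c * (- x))) abs_int_on {-t..}" using exp_int_top(1)[OF assms] by simp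
 show i: "(%x. exp (c * x)) abs_int_on {..t}"
  using r reflect_half(1)[where f = "%x. exp (c * x)"] by blast
 have "integral {-t..} (%x. exp (c * (- x))) = exp (- c * (- t)) / c"
  using exp_int_top(2)[OF assms, of "-t"] by simp
 thus "integral {..t} (%x. exp (c * x)) = exp (c * t) / c"
  using reflect_half(2)[OF i] by simp
qed

lemma exp_abs_int:
 fixes c :: real
 assumes "0 < c"
 shows "(%x. exp (- c * abs (x - a))) abs_int_on UNIV" "intR (%x. exp (- c * abs (x - a))) = 2 / c"
proof -
 have e1: "exp (- c * abs (x - a)) = exp (c * a) * exp (- c * x)" if "x \<in> {a..}" for x
  unfolding mult_exp_exp using that by (simp add: right_diff_distrib)
 have e2: "exp (- c * abs (x - a)) = exp (- c * a) * exp (c * x)" if "x \<in> {..a}" for x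
  unfolding mult_exp_exp using that by (simp add: right_diff_distrib)
 have i1: "((%x. exp (- c * abs (x - a))) has_integral (1 / c)) {a..}"
 proof (rule has_integral_eq[OF e1[symmetric]])
  have "((%x. exp (- c * x)) has_integral exp (- c * a) / c) {a..}"
   using exp_int_top[OF assms, of a] abs_int_imp integrable_integral by metis
  hence "((%x. exp (c * a) * exp (- c * x)) has_integral exp (c * a) * (exp (- c * a) / c)) {a..}"
   by (rule has_integral_mult_right)
  thus "((%x. exp (c * a) * exp (- c * x)) has_integral 1 / c) {a..}" by (simp add: mult_exp_exp)
 qed auto
 have i2: "((%x. exp (- c * abs (x - a))) has_integral (1 / c)) {..a}"
 proof (rule has_integral_eq[OF e2[symmetric]])
  have "((%x. exp (c * x)) has_integral exp (c * a) / c) {..a}"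
   using exp_int_bot[OF assms, of a] abs_int_imp integrable_integral by metis
  hence "((%x. exp (- c * a) * exp (c * x)) has_integral exp (- c * a) * (exp (c * a) / c)) {..a}"
   by (rule has_integral_mult_right)
  thus "((%x. exp (- c * a) * exp (c * x)) has_integral 1 / c) {..a}" by (simp add: mult_exp_exp)
 qed auto
 have U: "{a..} \<union> {..a} = UNIV" "{a..} \<inter> {..a} = {a}" for a :: real by auto
 have "((%x. exp (- c * abs (x - a))) has_integral (1 / c + 1 / c)) ({a..} \<union> {..a})"
  using i1 i2 by (rule has_integral_Un) (simp add: U)
 hence i: "((%x. exp (- c * abs (x - a))) has_integral (2 / c)) UNIV" by (simp add: U)
 thus "(%x. exp (- c * abs (x - a))) abs_int_on UNIV"
  by (intro nonnegative_absolutely_integrable_1) (auto simp: integrable_on_def)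
 show "intR (%x. exp (- c * abs (x - a))) = 2 / c" using i by (rule integral_unique)
qed

lemma exp_weight_sq:
 "sqint UNIV (%x. M * exp (- sqrt 2 * abs (x - a)))"
 "intR (%x. (M * exp (- sqrt 2 * abs (x - a)))^2) <= M^2"
proof -
 have eq: "(M * exp (- sqrt 2 * abs (x - a)))^2 = M^2 * exp (- (2 * sqrt 2) * abs (x - a))" for x
  by (simp add: power_mult_distrib exp_double[symmetric] mult.assoc)
 have p: "0 < 2 * sqrt (2::real)" by simp
 note i = exp_abs_int[OF p, of a]
 show "sqint UNIV (%x. M * exp (- sqrt 2 * abs (x - a)))"
  unfolding sqint_def eq using i(1) by (auto intro!: continuous_meas continuous_intros)
 show "intR (%x. (M * exp (- sqrt 2 * abs (x - a)))^2) <= M^2"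
 proof -
  have "2 / (2 * sqrt (2::real)) <= 1" using sqrt2_bounds(1) by (simp add: divide_le_eq)
  hence "M^2 * (2 / (2 * sqrt 2)) <= M^2 * 1" by (intro mult_left_mono) auto
  thus ?thesis unfolding eq using i(2) by simp
 qed
qed

lemma sqint_exp_dom:
 assumes "f \<in> LM" "!!x. abs (f x) <= M * exp (- sqrt 2 * abs (x - a))"
 shows "sqint UNIV f" "intR (%x. (f x)^2) <= M^2"
proof -
 have sq: "(f x)^2 <= (M * exp (- sqrt 2 * abs (x - a)))^2" for x
  using assms(2)[of x] by (metis abs_ge_zero power2_abs power_mono)
 show s: "sqint UNIV f"
  by (rule sqint_dom[OF assms(1) _ sqint_int[OF exp_weight_sq(1)] sq]) simp
 have "intR (%x. (f x)^2) <= intR (%x. (M * exp (- sqrt 2 * abs (x - a)))^2)"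
  using sqint_int[OF s] sqint_int[OF exp_weight_sq(1)] sq by (intro integral_le) auto
 thus "intR (%x. (f x)^2) <= M^2" using exp_weight_sq(2) order_trans by blast
qed

lemma exp_weight_shift: "exp (- sqrt 2 * abs y) <= exp (sqrt 2 * abs d) * exp (- sqrt 2 * abs x)" if "abs (x - y) <= abs d"
proof -
 have "- abs y <= abs d - abs x" using that by linarith
 hence "sqrt 2 * - abs y <= sqrt 2 * (abs d - abs x)" by (intro mult_left_mono) auto
 thus ?thesis by (simp add: mult_exp_exp algebra_simps)
qed

lemma dk01_DERIV:
 "(dk01 hrd dk01 x * (sqrt 2 * (1 - 3 * (kink01 x)^2))) (at x)"
 unfolding dk01_def[abs_def]
 by (rule derivative_eq_intros DERIV_kink01 refl | simp)+ (simp add: dk01_def algebra_simps power2_eq_square)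

text \<open>The intermediate point of the mean value theorem has distance at most
  \<open>abs (a - b)\<close> from \<open>x - a\<close>; moving the exponential weight back costs the
  factor \<open>exp (sqrt 2 * abs (a - b))\<close>.\<close>

lemma MVT_shift:
 assumes "!!x. (f hrd f' x) (at x)" "!!x. abs (f' x) <= M * exp (- sqrt 2 * abs x)" "0 <= M"
 shows "abs (f (x - a) - f (x - b)) <= (M * abs (a - b) * exp (sqrt 2 * abs (a - b))) * exp (- sqrt 2 * abs (x - a))"
proof -
 have *: "EX z. abs ((x - a) - z) <= abs (a - b) & abs (f (x - a) - f (x - b)) = abs (a - b) * abs (f' z)"
 proof (cases a b rule: linorder_cases)
  case less
  then obtain z where "x - b < z" "z < x - a" "f (x - a) - f (x - b) = (x - a - (x - b)) * f' z"
   using MVT2[of "x - b" "x - a" f f'] assms(1) by auto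
  thus ?thesis by (intro exI[of _ z]) (auto simp: abs_mult)
 next
  case greater
  then obtain z where "x - a < z" "z < x - b" "f (x - b) - f (x - a) = (x - b - (x - a)) * f' z"
   using MVT2[of "x - a" "x - b" f f'] assms(1) by auto
  thus ?thesis by (intro exI[of _ z]) (auto simp: abs_mult abs_minus_commute[of "f (x - a)"])
 qed auto
 then obtain z where z: "abs ((x - a) - z) <= abs (a - b)" "abs (f (x - a) - f (x - b)) = abs (a - b) * abs (f' z)" by blast
 have "abs (f' z) <= M * (exp (sqrt 2 * abs (a - b)) * exp (- sqrt 2 * abs (x - a)))"
  using assms(2)[of z] mult_left_mono[OF exp_weight_shift[OF z(1)] assms(3)] by linarith
 hence "abs (a - b) * abs (f' z) <= abs (a - b) * (M * (exp (sqrt 2 * abs (a - b)) * exp (- sqrt 2 * abs (x - a))))"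
  by (intro mult_left_mono) auto
 thus ?thesis unfolding z(2) by (simp only: ac_simps)
qed

text \<open>Both differences decay exponentially, with constants \<open>sqrt 2\<close> for the kink
  and 4 for its derivative, and \<open>2 + 16 <= 36\<close>.\<close>

lemma kink01_shift_H1:
 shows "H1r (%x. kink01 (x - a) - kink01 (x - b)) (%x. dk01 (x - a) - dk01 (x - b))"
  "H1sq (%x. kink01 (x - a) - kink01 (x - b)) (%x. dk01 (x - a) - dk01 (x - b))
   <= 36 * (abs (a - b) * exp (sqrt 2 * abs (a - b)))^2"
proof -
 let ?e = "abs (a - b) * exp (sqrt 2 * abs (a - b))"
 have b1: "abs (kink01 (x - a) - kink01 (x - b)) <= (sqrt 2 * ?e) * exp (- sqrt 2 * abs (x - a))" for x
  using MVT_shift[OF DERIV_kink01, of "sqrt 2" x a b] dk01_le dk01_nonneg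
  by (simp add: less_imp_le mult.assoc)
 have d: "abs (dk01 x * (sqrt 2 * (1 - 3 * (kink01 x)^2))) <= 4 * exp (- sqrt 2 * abs x)" for x
 proof -
  have "abs (1 - 3 * (kink01 x)^2) <= 2" using kink01_square_less_1[of x] zero_le_power2[of "kink01 x"] by linarith
  hence "abs (sqrt 2 * (1 - 3 * (kink01 x)^2)) <= sqrt 2 * 2" by (simp add: abs_mult)
  hence "abs (dk01 x * (sqrt 2 * (1 - 3 * (kink01 x)^2))) <= (sqrt 2 * exp (- sqrt 2 * abs x)) * (sqrt 2 * 2)"
   using dk01_le[of x] dk01_nonneg[of x] by (subst abs_mult, intro mult_mono) auto
  also have "... = (sqrt 2 * sqrt 2) * 2 * exp (- sqrt 2 * abs x)" by (simp only: ac_simps)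
  finally show ?thesis by simp
 qed
 have b2: "abs (dk01 (x - a) - dk01 (x - b)) <= (4 * ?e) * exp (- sqrt 2 * abs (x - a))" for x
  using MVT_shift[OF dk01_DERIV, of 4 x a b] d by (simp add: mult.assoc)
 have m: "(%x. kink01 (x - a) - kink01 (x - b)) \<in> LM"
  "(%x. dk01 (x - a) - dk01 (x - b)) \<in> LM"
  by (auto intro!: continuous_meas continuous_intros)
 note s1 = sqint_exp_dom[OF m(1) b1] and s2 = sqint_exp_dom[OF m(2) b2]
 show "H1r (%x. kink01 (x - a) - kink01 (x - b)) (%x. dk01 (x - a) - dk01 (x - b))"
  unfolding H1r_def using s1(1) s2(1) AC_diff[OF AC_kink01 AC_kink01] by blast
 have "(sqrt 2 * ?e)^2 = 2 * ?e^2" "(4 * ?e)^2 = 16 * ?e^2" by (simp_all only: power_mult_distrib) auto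
 thus "H1sq (%x. kink01 (x - a) - kink01 (x - b)) (%x. dk01 (x - a) - dk01 (x - b)) <= 36 * ?e^2"
  unfolding H1sq_def using s1(2) s2(2) by (smt (verit) zero_le_power2)
qed

lemma H1r_reflect:
 assumes "H1r U V"
 shows "H1r (%x. U (- x)) (%x. - V (- x))" "H1sq (%x. U (- x)) (%x. - V (- x)) = H1sq U V"
proof -
 have s: "sqint UNIV U" "sqint UNIV V" "AC U V" using assms by (auto simp: H1r_def)
 have r: "sqint UNIV (%x. f (- x))" "intR (%x. (f (- x))^2) = intR (%x. (f x)^2)" if "sqint UNIV f" for f
 proof -
  have i: "integrable LB (%x. (f x)^2)" using that by (simp add: sqint_def set_integrable_def)
  hence i': "integrable LB (%x. (f (- x))^2)" using integrable_reflect(1)[of "%x. (f x)^2"] by simp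
  thus "sqint UNIV (%x. f (- x))" using that measurable_reflect by (auto simp: sqint_def set_integrable_def)
  show "intR (%x. (f (- x))^2) = intR (%x. (f x)^2)"
   using LINT_eq_integral[of "%x. (f x)^2"] LINT_eq_integral[of "%x. (f (-x))^2"] i i' integrable_reflect(2)[of "%x. (f x)^2"]
   by (simp add: set_integrable_def)
 qed
 show "H1r (%x. U (- x)) (%x. - V (- x))"
  unfolding H1r_def using r(1)[OF s(1)] sqint_minus[OF r(1)[OF s(2)]] AC_reflect[OF s(3)] by blast
 show "H1sq (%x. U (- x)) (%x. - V (- x)) = H1sq U V"
  unfolding H1sq_def using r(2)[OF s(1)] r(2)[OF s(2)] by simp
qed

lemma kink10_shift_H1:
 shows "H1r (%x. kink10 (x - a) - kink10 (x - b)) (%x. dk10 (x - a) - dk10 (x - b))"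
  "H1sq (%x. kink10 (x - a) - kink10 (x - b)) (%x. dk10 (x - a) - dk10 (x - b))
   <= 36 * (abs (a - b) * exp (sqrt 2 * abs (a - b)))^2"
proof -
 have eq: "(%x. kink10 (x - a) - kink10 (x - b)) = (%x. kink01 (- x - (- b)) - kink01 (- x - (- a)))"
  "(%x. dk10 (x - a) - dk10 (x - b)) = (%x. - (dk01 (- x - (- b)) - dk01 (- x - (- a))))"
  by (auto simp: kink10_eq dk10_def algebra_simps)
 note k = kink01_shift_H1[of "-b" "-a"]
 have e: "abs (- b - - a) = abs (a - b)" by simp
 show "H1r (%x. kink10 (x - a) - kink10 (x - b)) (%x. dk10 (x - a) - dk10 (x - b))"
  unfolding eq using H1r_reflect(1)[OF k(1)] .
 show "H1sq (%x. kink10 (x - a) - kink10 (x - b)) (%x. dk10 (x - a) - dk10 (x - b))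
   <= 36 * (abs (a - b) * exp (sqrt 2 * abs (a - b)))^2"
  unfolding eq H1r_reflect(2)[OF k(1)] using k(2) unfolding e .
qed

section \<open>Nearly minimal energy forces proximity to two distant kinks\<close>

definition pot :: "real => real" where "pot u = u^2 * (1 - u^2)^2"
definition dpot :: "real => real" where "dpot u = 2 * u - 8 * u ^ 3 + 6 * u ^ 5"

text \<open>\<open>bog\<close> is a primitive of \<open>sqrt 2 * u * (1 - u^2)\<close>, the square root of twice the potential up to sign.\<close>

definition bog :: "real => real" where "bog u = sqrt 2 * (u^2 / 2 - u ^ 4 / 4)"

lemma pot_nonneg: "0 <= pot u" by (simp add: pot_def)

lemma DERIV_pot: "(pot hrd dpot u) (at u)"
proof -
 have "pot = (%u. u ^ 2 - 2 * u ^ 4 + u ^ 6)"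
  by (rule ext) (simp add: pot_def power2_eq_square eval_nat_numeral algebra_simps)
 moreover have "((%u. u ^ 2 - 2 * u ^ 4 + u ^ 6) hrd dpot u) (at u)"
  unfolding dpot_def by (auto intro!: derivative_eq_intros)
 ultimately show ?thesis by simp
qed

lemma DERIV_bog: "(bog hrd sqrt 2 * u * (1 - u^2)) (at u)"
proof -
 have "sqrt 2 * (u - u ^ 3) = sqrt 2 * u * (1 - u^2)" by (simp add: algebra_simps eval_nat_numeral)
 moreover have "(bog hrd sqrt 2 * (u - u ^ 3)) (at u)"
  unfolding bog_def[abs_def] by (auto intro!: derivative_eq_intros)
 ultimately show ?thesis by (simp only:)
qed

lemma continuous_pot [continuous_intros]: "continuous_on S f ==> continuous_on S (%x. pot (f x))"
 unfolding pot_def by (intro continuous_intros)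

lemma continuous_dpot [continuous_intros]: "continuous_on S f ==> continuous_on S (%x. dpot (f x))"
 unfolding dpot_def by (intro continuous_intros)

lemma continuous_bog [continuous_intros]: "continuous_on S f ==> continuous_on S (%x. bog (f x))"
 unfolding bog_def by (intro continuous_intros) auto

lemma weighted_young: "8 * (abs r * abs y) <= y^2 / 3 + 48 * (r::real)^2"
proof -
 have "0 <= (abs y - 12 * abs r)^2" by simp
 thus ?thesis unfolding mult.commute[of "abs r"] by (simp add: power2_diff power_mult_distrib)
qed

lemma integral_lin2:
 fixes f g :: "real => real"
 assumes "f integrable_on S" "g integrable_on S"
 shows "(%x. al * f x + be * g x) integrable_on S"
  "integral S (%x. al * f x + be * g x) = al * integral S f + be * integral S g"
proof -
 have "((%x. al * f x + be * g x) has_integral (al * integral S f + be * integral S g)) S"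
  using assms by (intro has_integral_add has_integral_mult_right integrable_integral)
 thus "(%x. al * f x + be * g x) integrable_on S"
  "integral S (%x. al * f x + be * g x) = al * integral S f + be * integral S g"
  by (auto simp: integrable_on_def integral_unique)
qed

text \<open>To the right of \<open>a\<close> the coefficient \<open>c\<close> is negative; to its left the weight \<open>w\<close> turns the
 equation \<open>y' = c y + r\<close> into one that is dissipative backwards.\<close>

lemma hardy_bound:
 assumes y: "AC y y'" "sqint {t..} y" "sqint {t..} y'" and r: "sqint {t..} r" and ta: "t <= a"
  and eq: "!!x. x >= t ==> y' x = c x * y x + r x"
  and right: "!!x. x >= a ==> c x <= - 1/2"
  and w: "AC w w'" "!!x. x \<in> {t..a} ==> 1 <= w x" "!!x. x \<in> {t..a} ==> w x <= 4"
  and left: "!!x. x \<in> {t..a} ==> 1/3 <= w' x / 2 + w x * c x"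
 shows "integral {t..} (%x. (y x)^2) <= 150 * (integral {t..} (%x. (r x)^2) + (y a)^2)"
proof -
 have sub: "{a..} \<subseteq> {t..}" "{t..a} \<subseteq> {t..}" using ta by auto
 have ya: "sqint {a..} y" "sqint {a..} y'" "sqint {a..} r"
  using y r sub(1) by (auto intro: sqint_subset[where S = "{t..}"])
 have yt: "sqint {t..a} y" "sqint {t..a} r"
  using y r sub(2) by (auto intro: sqint_subset[where S = "{t..}"])
 have R: "integral {t..} (%x. (r x)^2) = integral {t..a} (%x. (r x)^2) + integral {a..} (%x. (r x)^2)"
  and Y: "integral {t..} (%x. (y x)^2) = integral {t..a} (%x. (y x)^2) + integral {a..} (%x. (y x)^2)"
  using y(2) r ta by (auto intro!: split_half simp: sqint_def)
 \<comment> \<open>To the right of \<open>a\<close>, multiply the equation by \<open>2 * y\<close>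
   and integrate to infinity, where \<open>y^2\<close> vanishes: the negative coefficient yields
   control of \<open>y\<close> by \<open>r\<close> and the boundary value.\<close>
 have right_part: "integral {a..} (%x. (y x)^2) <= 2 * (y a)^2 + 4 * integral {a..} (%x. (r x)^2)"
 proof -
  have m: "(%x. 2 * y x * y' x) abs_int_on {a..}"
   using set_integrable_mult_right[of 2, OF sqint_mult[OF ya(1,2)]] by (simp add: mult.assoc)
  have "- ((y a)^2) = integral {a..} (%x. 2 * y x * y' x)"
   using AC_half(1)[OF AC_square[OF y(1)] _ m] ya(1) by (simp add: sqint_def)
  also have "... <= integral {a..} (%x. (- 1/2) * (y x)^2 + 2 * (r x)^2)"
  proof (rule integral_le)
   show "(%x. 2 * y x * y' x) integrable_on {a..}" using abs_int_imp[OF m] .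
   show "(%x. (- 1/2) * (y x)^2 + 2 * (r x)^2) integrable_on {a..}"
   by (rule integral_lin2(1)[OF sqint_int[OF ya(1)] sqint_int[OF ya(3)]])
   fix x assume "x \<in> {a..}"
   hence x: "x >= a" "x >= t" using ta by auto
   have "c x * (y x)^2 <= (- 1/2) * (y x)^2" using right[OF x(1)] by (intro mult_right_mono) auto
   moreover have "2 * y x * r x <= (y x)^2 / 2 + 2 * (r x)^2"
   using zero_le_power2[of "y x - 2 * r x"] by (simp add: power2_diff power_mult_distrib)
   moreover have "2 * y x * y' x = 2 * (c x * (y x)^2) + 2 * y x * r x"
   using eq[OF x(2)] by (simp add: algebra_simps power2_eq_square)
   ultimately show "2 * y x * y' x <= (- 1/2) * (y x)^2 + 2 * (r x)^2" by linarith
  qed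
  also have "... = (- 1/2) * integral {a..} (%x. (y x)^2) + 2 * integral {a..} (%x. (r x)^2)"
   by (rule integral_lin2(2)[OF sqint_int[OF ya(1)] sqint_int[OF ya(3)]])
  finally show ?thesis by simp
 qed
 \<comment> \<open>To the left of \<open>a\<close>, integrate the derivative of
   \<open>w * y^2\<close> instead. Its quadratic part is at least \<open>2/3 * y^2\<close>, and the
   cross term, with \<open>w <= 4\<close>, costs \<open>y^2 / 3 + 48 * r^2\<close>. The boundary
   term at \<open>t\<close> has the favourable sign and is dropped.\<close>
 have left_part: "integral {t..a} (%x. (y x)^2) <= 12 * (y a)^2 + 144 * integral {t..a} (%x. (r x)^2)"
 proof -
  define D where "D x = w' x * (y x)^2 + w x * (2 * y x * y' x)" for x
  have AD: "AC (%x. w x * (y x)^2) D" unfolding D_def by (rule AC_mult[OF w(1) AC_square[OF y(1)]])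
  have "integral {t..a} (%x. (1/3) * (y x)^2 + (- 48) * (r x)^2) <= integral {t..a} D"
  proof (rule integral_le)
   show "D integrable_on {t..a}" using li_imp(1)[OF AC_loc[OF AD]] .
   show "(%x. (1/3) * (y x)^2 + (- 48) * (r x)^2) integrable_on {t..a}"
   by (rule integral_lin2(1)[OF sqint_int[OF yt(1)] sqint_int[OF yt(2)]])
   fix x assume x: "x \<in> {t..a}"
   have "D x = 2 * ((w' x / 2 + w x * c x) * (y x)^2) + 2 * w x * (r x * y x)"
   using eq[of x] x by (simp add: D_def algebra_simps power2_eq_square)
   moreover have "(1/3) * (y x)^2 <= (w' x / 2 + w x * c x) * (y x)^2"
   using left[OF x] by (intro mult_right_mono) auto
   moreover have "- (2 * w x * (r x * y x)) <= 8 * (abs (r x) * abs (y x))"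
   proof -
   have "- (2 * w x * (r x * y x)) <= abs (2 * w x * (r x * y x))" by simp
   also have "... = (2 * w x) * (abs (r x) * abs (y x))" using w(2)[OF x] by (simp add: abs_mult)
   also have "... <= 8 * (abs (r x) * abs (y x))" using w(3)[OF x] by (intro mult_right_mono) auto
   finally show ?thesis .
   qed
   moreover note weighted_young[of "r x" "y x"]
   ultimately show "(1/3) * (y x)^2 + (- 48) * (r x)^2 <= D x" by linarith
  qed
  moreover have "integral {t..a} D = w a * (y a)^2 - w t * (y t)^2" using AC_D[OF AD ta] by simp
  moreover have "w a * (y a)^2 <= 4 * (y a)^2" "0 <= w t * (y t)^2"
  proof -
   have "w a <= 4" "0 <= w t" using w(2)[of t] w(3)[of a] ta by auto
   thus "w a * (y a)^2 <= 4 * (y a)^2" "0 <= w t * (y t)^2" by (auto intro: mult_right_mono)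
  qed
  moreover have "integral {t..a} (%x. (1/3) * (y x)^2 + (- 48) * (r x)^2)
   = (1/3) * integral {t..a} (%x. (y x)^2) + (- 48) * integral {t..a} (%x. (r x)^2)"
   by (rule integral_lin2(2)[OF sqint_int[OF yt(1)] sqint_int[OF yt(2)]])
  ultimately show ?thesis by linarith
 qed
 have "Y1 + Y2 <= 150 * (R1 + R2 + c)"
  if "Y2 <= 2 * c + 4 * R2" "Y1 <= 12 * c + 144 * R1" "0 <= R2" "0 <= R1" "0 <= c" for Y1 Y2 R1 R2 c :: real
  using that by (smt (verit))
 from this[OF right_part left_part sqint_nonneg[OF ya(3)] sqint_nonneg[OF yt(2)] zero_le_power2]
 show ?thesis unfolding R Y .
qed

text \<open>This is \<open>(1 - h x^2)^(-2)\<close> for the kink \<open>h\<close> centred at \<open>a\<close>.\<close>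

definition hweight :: "real => real => real" where
 "hweight a x = (1 + exp (2 * sqrt 2 * (x - a)))^2"

definition hweight' :: "real => real => real" where
 "hweight' a x = 4 * sqrt 2 * (hweight a x) * (kink01 (x - a))^2"

lemma hweight_AC: "AC (hweight a) (hweight' a)"
proof (rule AC_C1)
 have c: "cont (hweight a)" unfolding hweight_def[abs_def] by (intro continuous_intros)
 thus "cont (hweight' a)" unfolding hweight'_def[abs_def] by (intro continuous_intros)
 fix x
 define E where "E = exp (2 * sqrt 2 * (x - a))"
 have E: "E > 0" by (simp add: E_def)
 have "(hweight a hrd 2 * (1 + E) * (2 * sqrt 2 * E)) (at x)"
  unfolding hweight_def[abs_def] E_def by (auto intro!: derivative_eq_intros)
 moreover have "2 * (1 + E) * (2 * sqrt 2 * E) = hweight' a x"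
  unfolding hweight'_def kink01_square hweight_def E_def[symmetric] using E by (simp add: field_simps power2_eq_square)
 ultimately show "(hweight a hrd hweight' a x) (at x)" by simp
qed

lemma hweight_bounds: "x <= a ==> 1 <= hweight a x" "x <= a ==> hweight a x <= 4"
proof -
 assume "x <= a"
 hence E: "exp (2 * sqrt 2 * (x - a)) <= 1" by (simp add: mult_nonneg_nonpos)
 show "1 <= hweight a x" unfolding hweight_def by (simp add: one_le_power)
 have "(1 + exp (2 * sqrt 2 * (x - a)))^2 <= 2^2" using E by (intro power_mono) (auto simp: add_nonneg_nonneg)
 thus "hweight a x <= 4" unfolding hweight_def by simp
qed

text \<open>With \<open>h\<close> the kink centred at \<open>a\<close>, the weight adds
  \<open>2 * sqrt 2 * h^2\<close> to \<open>sqrt 2 * (1 - 3 * h^2)\<close> and leaves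
  \<open>sqrt 2 * (1 - h^2)\<close>, where \<open>h^2 <= 1/2\<close> left of the centre.\<close>

lemma dissipation_linear:
 assumes "x <= a"
 shows "1/3 <= hweight' a x / 2 + hweight a x * (sqrt 2 * (1 - 3 * (kink01 (x - a))^2))"
proof -
 have s: "(kink01 (x - a))^2 <= 1/2"
  using kink01_mono[of "x - a" 0] assms kink01_pos[of "x - a"] power_mono[of "kink01 (x-a)" "1 / sqrt 2" 2]
  by (simp add: kink01_0 power_divide)
 have "hweight' a x / 2 + hweight a x * (sqrt 2 * (1 - 3 * (kink01 (x - a))^2)) = hweight a x * (sqrt 2 * (1 - (kink01 (x - a))^2))"
  by (simp add: hweight'_def algebra_simps)
 also have "... >= 1 * (1.41 * (1/2))"
  using hweight_bounds(1)[OF assms] s sqrt2_bounds(1) by (intro mult_mono) auto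
 finally show ?thesis by simp
qed

text \<open>The coefficient is the divided difference of \<open>sqrt 2 * u * (1 - u^2)\<close>
  between \<open>u\<close> and the kink \<open>h\<close>. The weight gives \<open>h^2\<close> a
  positive sign; then \<open>h^2 - u * h >= - u^2 / 4\<close> reduces the claim to
  \<open>1 - 5/4 * u^2 >= 1/4\<close>, that is, to \<open>u^2 <= 3/5\<close>.\<close>

lemma dissipation_nonlinear:
 assumes "x <= a" "u^2 <= 3/5"
 shows "1/3 <= hweight' a x / 2 + hweight a x * (sqrt 2 * (1 - u^2 - u * kink01 (x - a) - (kink01 (x - a))^2))"
proof -
 let ?h = "kink01 (x - a)"
 have "0 <= (?h - u / 2)^2" by simp
 hence "?h^2 - u * ?h >= - (u^2 / 4)" by (simp add: power2_diff power_divide algebra_simps)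
 hence b: "1/4 <= 1 + ?h^2 - u^2 - u * ?h" using assms(2) by linarith
 have e: "hweight' a x / 2 + hweight a x * (sqrt 2 * (1 - u^2 - u * ?h - ?h^2)) = hweight a x * (sqrt 2 * (1 + ?h^2 - u^2 - u * ?h))"
  by (simp add: hweight'_def algebra_simps)
 have "1.41 * (1/4) <= sqrt 2 * (1 + ?h^2 - u^2 - u * ?h)"
  by (rule mult_mono[OF less_imp_le[OF sqrt2_bounds(1)] b]) simp_all
 hence "1 * (1.41 * (1/4)) <= hweight a x * (sqrt 2 * (1 + ?h^2 - u^2 - u * ?h))"
  by (rule mult_mono[OF hweight_bounds(1)[OF assms(1)]]) (use hweight_bounds(1)[OF assms(1)] in simp_all)
 thus ?thesis unfolding e by simp
qed

lemma bog_values: "bog 0 = 0" "bog 1 = sqrt 2 / 4" "bog (1 / sqrt 2) = 3 * sqrt 2 / 16"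
  "u^2 = 3/5 ==> bog u = sqrt 2 * 0.21" "u^2 = 4 ==> bog u = - 2 * sqrt 2"
proof -
 have f: "u ^ 4 = (u^2)^2" for u :: real by (simp add: power2_eq_square power4_eq_xxxx mult.assoc)
 show "bog 0 = 0" "bog 1 = sqrt 2 / 4" by (auto simp: bog_def)
 show "bog (1 / sqrt 2) = 3 * sqrt 2 / 16" unfolding bog_def f by (simp add: power_divide)
 show "bog u = sqrt 2 * 0.21" if "u^2 = 3/5"
  unfolding bog_def f that by (simp add: power2_eq_square)
 show "bog u = - 2 * sqrt 2" if "u^2 = 4"
  unfolding bog_def f that by (simp add: power2_eq_square)
qed

section \<open>The Bogomolny inequality, and profiles on one half line\<close>

definition edens :: "(real => real) => (real => real) => real => real" where
 "edens u v x = (v x)^2 / 2 + pot (u x)"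

text \<open>The pointwise Bogomolny inequality: the square of \<open>sqrt 2 * u * (1 - u^2)\<close>
  is \<open>2 * pot u\<close>, so \<open>edens\<close> is half a sum of two squares.\<close>

lemma edens_ge: "abs (sqrt 2 * u x * (1 - (u x)^2) * v x) <= edens u v x"
proof -
 define s where "s = sqrt 2 * u x * (1 - (u x)^2)"
 have s2: "s^2 = 2 * pot (u x)" unfolding s_def pot_def by (simp add: power_mult_distrib)
 have "2 * (s * v x) <= s^2 + (v x)^2" using zero_le_power2[of "s - v x"] by (simp add: power2_diff)
 moreover have "- 2 * (s * v x) <= s^2 + (v x)^2" using zero_le_power2[of "s + v x"] by (simp add: power2_sum)
 ultimately have "abs (s * v x) <= edens u v x" unfolding edens_def s2 by (simp add: abs_if)
 thus ?thesis by (simp add: s_def)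
qed

lemma bog_AC: "AC u v ==> AC (%x. bog (u x)) (%x. sqrt 2 * u x * (1 - (u x)^2) * v x)"
 by (rule AC_chain[OF _ DERIV_bog]) (auto intro!: continuous_intros)

lemma bog_interval:
 assumes "AC u v" "edens u v integrable_on {x..y}" "x <= y"
 shows "abs (bog (u y) - bog (u x)) <= integral {x..y} (edens u v)"
proof -
 note A = bog_AC[OF assms(1)]
 have "abs (bog (u y) - bog (u x)) = norm (integral {x..y} (%x. sqrt 2 * u x * (1 - (u x)^2) * v x))"
  using AC_D[OF A assms(3)] by simp
 also have "... <= integral {x..y} (edens u v)"
  using edens_ge by (intro Henstock_Kurzweil_Integration.integral_norm_bound_integral li_imp(1)[OF AC_loc[OF A]] assms(2)) simp
 finally show ?thesis .
qed

text \<open>One half of the profile, from a zero at \<open>m\<close> to the limit 1. The least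
  possible energy is \<open>bog 1 - bog 0 = sqrt 2 / 4\<close> and \<open>de\<close> bounds the
  excess; 0.06 lies just below \<open>0.045 * sqrt 2\<close>, the excess incurred by reaching
  \<open>u^2 = 3/5\<close> before the last crossing of \<open>1 / sqrt 2\<close>.\<close>

context
 fixes u v :: "real => real" and m de :: real
 assumes u: "AC u v" "sqint {m..} v" "sqint {m..} (%x. u x - 1)" and um: "u m = 0"
  and energy: "integral {m..} (edens u v) <= sqrt 2 / 4 + de" and de: "de < 0.06"
begin

lemma u1_AC: "AC (%x. u x - 1) v"
 using AC_diff[OF u(1) AC_const[of 1]] by simp

lemma u_lim: "(u ~~> 1) at_top"
 using sobolev_half(2)[OF u1_AC u(3,2)] by (simp add: LIM_zero_iff)

lemma u_bound:
 obtains B where "B > 0" "!!x. x >= m ==> abs (u x) <= B"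
proof -
 define B where "B = 2 + integral {m..} (%x. (u x - 1)^2) + integral {m..} (%x. (v x)^2)"
 have "abs (u x) <= B" if "x >= m" for x
 proof -
  have s: "sqint {x..} (%x. u x - 1)" "sqint {x..} v"
   using u that by (auto intro: sqint_subset[where S = "{m..}"])
  have "(u x - 1)^2 <= integral {x..} (%x. (u x - 1)^2) + integral {x..} (%x. (v x)^2)"
   using sobolev_half(1)[OF u1_AC s] .
  also have "... <= integral {m..} (%x. (u x - 1)^2) + integral {m..} (%x. (v x)^2)"
   using that s u by (intro add_mono integral_subset_le sqint_int) auto
  finally have "(u x - 1)^2 <= B - 2" by (simp add: B_def)
  moreover have "abs (u x - 1) <= 1 + (u x - 1)^2" using abs_mult_le_squares[of "u x - 1" 1] by simp
  ultimately show ?thesis by linarith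
 qed
 moreover have "B > 0" unfolding B_def using sqint_nonneg[OF u(3)] sqint_nonneg[OF u(2)] by linarith
 ultimately show ?thesis using that by blast
qed

lemma u_meas: "u \<in> LM"
 by (rule continuous_meas[OF AC_cont[OF u(1)]])

lemma edens_int: "edens u v abs_int_on {m..}"
proof -
 obtain B where B: "B > 0" "!!x. x >= m ==> abs (u x) <= B" using u_bound by blast
 have "sqint {m..} (%x. (u x * (1 + u x)) * (u x - 1))"
 proof (rule sqint_bdd_mult[OF u(3)])
  show "abs (u x * (1 + u x)) <= B * (1 + B)" if "x \<in> {m..}" for x
   using B(2)[of x] that B(1) unfolding abs_mult by (intro mult_mono) auto
 qed (use u_meas in auto)
 hence "(%x. ((u x * (1 + u x)) * (u x - 1))^2) abs_int_on {m..}" by (simp add: sqint_def)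
 moreover have "((u x * (1 + u x)) * (u x - 1))^2 = pot (u x)" for x
  unfolding pot_def by (simp add: power2_eq_square algebra_simps)
 ultimately have p: "(%x. pot (u x)) abs_int_on {m..}" by simp
 have "(%x. (v x)^2 / 2) abs_int_on {m..}" using u(2) by (simp add: sqint_def)
 from set_integral_add(1)[OF this p] show ?thesis by (simp add: edens_def[abs_def])
qed

lemma edens_int': "m <= x ==> edens u v integrable_on {x..y}" "m <= x ==> edens u v abs_int_on {x..}"
 using abs_int_subset[OF edens_int, of "{x..y}"] abs_int_subset[OF edens_int, of "{x..}"] abs_int_imp by auto

lemma bog_tail: "m <= x ==> abs (sqrt 2 / 4 - bog (u x)) <= integral {x..} (edens u v)"
proof -
 assume x: "m <= x"
 have "((%y. abs (bog (u y) - bog (u x))) ~~> abs (bog 1 - bog (u x))) at_top"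
  using u_lim by (intro tendsto_intros isCont_tendsto_compose[OF _ u_lim] DERIV_isCont[OF DERIV_bog])
 moreover have "((%y. integral {x..y} (edens u v)) ~~> integral {x..} (edens u v)) at_top"
  using edens_int'(2)[OF x] by (rule integral_half_tendsto)
 moreover have "\<forall>\<^sub>F y in at_top. abs (bog (u y) - bog (u x)) <= integral {x..y} (edens u v)"
  using eventually_ge_at_top[of x] by eventually_elim (rule bog_interval[OF u(1) edens_int'(1)[OF x]])
 ultimately have "abs (bog 1 - bog (u x)) <= integral {x..} (edens u v)"
  by (intro tendsto_le[OF trivial_limit_at_top_linorder])
 thus ?thesis by (simp add: bog_values)
qed

text \<open>The energy bounds the variation of \<open>bog (u x)\<close> over the stations
  \<open>m\<close>, \<open>x\<close>, \<open>y\<close> and infinity, where it starts at 0 and ends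
  at \<open>sqrt 2 / 4\<close>.\<close>

lemma path3:
 assumes "m <= x" "x <= y"
 shows "abs (bog (u x)) + abs (bog (u y) - bog (u x)) + abs (sqrt 2 / 4 - bog (u y)) <= sqrt 2 / 4 + de"
proof -
 have "integral {m..} (edens u v) = integral {m..x} (edens u v) + integral {x..} (edens u v)"
  using split_half[OF edens_int assms(1)] .
 moreover have "integral {x..} (edens u v) = integral {x..y} (edens u v) + integral {y..} (edens u v)"
  using split_half[OF edens_int'(2)[OF assms(1)] assms(2)] .
 moreover have "abs (bog (u x) - bog (u m)) <= integral {m..x} (edens u v)"
  using bog_interval[OF u(1) edens_int'(1) assms(1)] by simp
 moreover have "abs (bog (u y) - bog (u x)) <= integral {x..y} (edens u v)"
  using bog_interval[OF u(1) edens_int'(1)[OF assms(1)] assms(2)] by simp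
 moreover have "abs (sqrt 2 / 4 - bog (u y)) <= integral {y..} (edens u v)" using bog_tail assms by simp
 ultimately show ?thesis using energy um bog_values(1) by simp
qed

lemma square_IVT:
 assumes "m <= x" "s >= 0" "s <= (u x)^2"
 obtains z where "m <= z" "z <= x" "(u z)^2 = s"
proof -
 have "continuous_on {m..x} (%x. (u x)^2)" by (intro continuous_intros AC_cont[OF u(1)])
 hence "\<exists>z\<ge>m. z <= x & (u z)^2 = s"
  using IVT'[of "%x. (u x)^2" m s x] assms um by auto
 thus ?thesis using that by blast
qed

text \<open>Where \<open>u^2 = 4\<close>, \<open>bog\<close> is \<open>- 2 * sqrt 2\<close>, too far
  from 0 for the available energy.\<close>

lemma u_le_2: "m <= x ==> abs (u x) <= 2"
proof (rule ccontr)
 assume x: "m <= x" "\<not> abs (u x) <= 2"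
 hence "2^2 <= abs (u x)^2" by (intro power_mono) auto
 then obtain z where z: "m <= z" "(u z)^2 = 4" using square_IVT[OF x(1), of 4] by auto
 have "abs (bog (u z)) <= sqrt 2 / 4 + de" using path3[OF z(1) order_refl] by linarith
 thus False using bog_values(5)[OF z(2)] sqrt2_bounds de by (simp add: abs_mult)
qed

text \<open>Since \<open>kink01 0 = 1 / sqrt 2\<close>, the last crossing of this level serves as
  centre of the kink; to its right the profile stays above the level, which makes the coefficient in
  the Hardy estimate negative there.\<close>

lemma last_crossing:
 obtains a where "m < a" "u a = 1 / sqrt 2" "!!x. x >= a ==> u x >= 1 / sqrt 2"
proof -
 define S where "S = {x. m <= x & u x <= 1 / sqrt 2}"
 have lt: "1 / sqrt 2 < (1::real)" by simp
 hence "\<forall>\<^sub>F x in at_top. u x > 1 / sqrt 2" using u_lim by (rule order_tendstoD(1)[rotated])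
 then obtain N where N: "!!x. x >= N ==> u x > 1 / sqrt 2" by (auto simp: eventually_at_top_linorder)
 have bdd: "bdd_above S" unfolding S_def using N by (intro bdd_aboveI[of _ N]) (metis (mono_tags, lifting) linorder_le_cases mem_Collect_eq not_less)
 have "S = {m..} \<inter> {x. u x <= 1 / sqrt 2}" by (auto simp: S_def)
 hence cl: "closed S" using AC_cont[OF u(1)] by (auto intro!: closed_Collect_le continuous_intros)
 have "m \<in> S" using um by (simp add: S_def)
 define a where "a = Sup S"
 have aS: "a \<in> S" unfolding a_def using closed_contains_Sup[OF _ bdd cl] \<open>m \<in> S\<close> by blast
 have gt: "u x > 1 / sqrt 2" if "x > a" for x
 proof (rule ccontr)
  assume "\<not> u x > 1 / sqrt 2"
  hence "x \<in> S" using that aS by (auto simp: S_def)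
  thus False using cSup_upper[OF _ bdd, of x] that unfolding a_def by linarith
 qed
 have "u a >= 1 / sqrt 2"
 proof (rule tendsto_lowerbound)
  show "(u ~~> u a) (at_right a)"
   using AC_cont[OF u(1), of UNIV] by (auto simp: continuous_on_def intro: tendsto_within_subset)
  show "\<forall>\<^sub>F x in at_right a. 1 / sqrt 2 <= u x" using gt by (auto simp: eventually_at_filter less_imp_le)
 qed auto
 hence ua: "u a = 1 / sqrt 2" using aS by (simp add: S_def)
 moreover have "m < a" using aS um ua by (cases "a = m") (auto simp: S_def)
 ultimately show ?thesis using that gt by (metis less_eq_real_def)
qed

text \<open>Along the stations 0, \<open>u^2 = 3/5\<close>, \<open>u = 1 / sqrt 2\<close> and 1,
  \<open>bog\<close> takes the values 0, 0.21, 0.1875 and 0.25 times \<open>sqrt 2\<close>; their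
  variation exceeds \<open>sqrt 2 / 4 + 0.06\<close>. As \<open>bog\<close> is even, the sign of
  \<open>u\<close> at the second station is immaterial.\<close>

lemma u_left_bound:
 assumes a: "m < a" "u a = 1 / sqrt 2" and x: "m <= x" "x <= a"
 shows "(u x)^2 <= 3/5"
proof (rule ccontr)
 assume "\<not> (u x)^2 <= 3/5"
 then obtain z where z: "m <= z" "z <= x" "(u z)^2 = 3/5" using square_IVT[OF x(1), of "3/5"] by auto
 have "abs (bog (u z)) + abs (bog (u a) - bog (u z)) + abs (sqrt 2 / 4 - bog (u a)) <= sqrt 2 / 4 + de"
  using path3[of z a] z x by simp
 thus False using bog_values(4)[OF z(3)] bog_values(3) sqrt2_bounds(1) de unfolding a(2) by (simp add: abs_if)
qed

text \<open>Completing the square: with \<open>s\<close> the right-hand side of the first-order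
  equation, the integral of \<open>s * v\<close> is exactly \<open>bog 1 - bog 0\<close>, so half
  the squared residual integrates to the excess energy.\<close>

lemma resid:
 shows "sqint {m..} (%x. v x - sqrt 2 * u x * (1 - (u x)^2))"
  "integral {m..} (%x. (v x - sqrt 2 * u x * (1 - (u x)^2))^2) <= 2 * de"
proof -
 define s where "s x = sqrt 2 * u x * (1 - (u x)^2)" for x
 have ss: "sqint {m..} s"
 proof -
  have "sqint {m..} (%x. (- sqrt 2 * u x * (1 + u x)) * (u x - 1))"
  proof (rule sqint_bdd_mult[OF u(3)])
   show "abs (- sqrt 2 * u x * (1 + u x)) <= sqrt 2 * 2 * 3" if "x \<in> {m..}" for x
   using u_le_2[of x] that unfolding abs_mult by (intro mult_mono) auto
  qed (use u_meas in auto)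
  thus ?thesis unfolding s_def[abs_def] by (simp add: algebra_simps power2_eq_square)
 qed
 show S: "sqint {m..} (%x. v x - sqrt 2 * u x * (1 - (u x)^2))"
  using sqint_diff[OF u(2) ss] by (simp add: s_def)
 have sv: "(%x. s x * v x) abs_int_on {m..}" using sqint_mult[OF ss u(2)] by simp
 have A: "AC (%x. bog (u x)) (%x. s x * v x)" using bog_AC[OF u(1)] by (simp add: s_def)
 have "((%x. bog (u x)) ~~> bog 1) at_top"
  using isCont_tendsto_compose[OF DERIV_isCont[OF DERIV_bog] u_lim] .
 hence "bog (u m) + integral {m..} (%x. s x * v x) = bog 1"
  using AC_limit[OF A sv] tendsto_unique[OF trivial_limit_at_top_linorder] by blast
 hence I: "integral {m..} (%x. s x * v x) = sqrt 2 / 4" using um bog_values by simp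
 have eq: "(v x - s x)^2 = 2 * edens u v x + (- 2) * (s x * v x)" for x
 proof -
  have "(s x)^2 = 2 * pot (u x)" unfolding s_def pot_def by (simp add: power_mult_distrib)
  thus ?thesis by (simp add: edens_def power2_diff)
 qed
 have "integral {m..} (%x. (v x - s x)^2) = 2 * integral {m..} (edens u v) + (- 2) * integral {m..} (%x. s x * v x)"
  unfolding eq by (rule integral_lin2(2)[OF abs_int_imp[OF edens_int] abs_int_imp[OF sv]])
 thus "integral {m..} (%x. (v x - sqrt 2 * u x * (1 - (u x)^2))^2) <= 2 * de"
  using energy I by (simp add: s_def)
qed

lemma kink_tail: "sqint {m..} (%x. kink01 (x - a) - 1)" "sqint UNIV (%x. dk01 (x - a))"
proof -
 have "sqint {m..} (%x. exp (2 * sqrt 2 * a) * exp (- (2 * sqrt 2) * x))"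
 proof (rule sqint_cmult)
  have "0 < 4 * sqrt (2::real)" by simp
  from exp_int_top(1)[OF this, of m] show "sqint {m..} (%x. exp (- (2 * sqrt 2) * x))"
   unfolding sqint_def exp_double[symmetric] by (auto intro!: continuous_meas continuous_intros simp: mult.assoc)
 qed
 note i = sqint_int[OF this]
 show "sqint {m..} (%x. kink01 (x - a) - 1)"
 proof (rule sqint_dom[OF _ _ i])
  show "(%x. kink01 (x - a) - 1) \<in> LM" by (intro continuous_meas continuous_intros)
  fix x
  have "abs (kink01 (x - a) - 1) <= exp (2 * sqrt 2 * a) * exp (- (2 * sqrt 2) * x)"
   unfolding mult_exp_exp using one_minus_kink01_le[of "x - a"] kink01_less_1[of "x - a"] by (simp add: algebra_simps)
  thus "(kink01 (x - a) - 1)^2 <= (exp (2 * sqrt 2 * a) * exp (- (2 * sqrt 2) * x))^2"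
   by (metis abs_ge_zero power2_abs power_mono)
 qed simp
 have "abs (dk01 (x - a)) <= sqrt 2 * exp (- sqrt 2 * abs (x - a))" for x
  using dk01_le[of "x - a"] dk01_nonneg[of "x - a"] by simp
 thus "sqint UNIV (%x. dk01 (x - a))"
  by (rule sqint_exp_dom(1)[rotated]) (intro continuous_meas continuous_intros)
qed

text \<open>Subtracting the first-order equation of the kink gives a linear equation for the
  difference \<open>y\<close>, with a divided difference as coefficient and the residual as source.
  \<open>hardy_bound\<close> applies, with \<open>y a = 0\<close> because both functions equal
  \<open>1 / sqrt 2\<close> at \<open>a\<close>. The last bound is the one for \<open>y\<close> at
  the zero \<open>m\<close>.\<close>

lemma half_closeness:
 obtains a where "m < a" "u a = 1 / sqrt 2"
  "sqint {m..} (%x. u x - kink01 (x - a))" "sqint {m..} (%x. v x - dk01 (x - a))"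
  "integral {m..} (%x. (u x - kink01 (x - a))^2) + integral {m..} (%x. (v x - dk01 (x - a))^2) <= 10^6 * de"
  "(kink01 (m - a))^2 <= 10^6 * de"
proof -
 obtain a where a: "m < a" "u a = 1 / sqrt 2" "!!x. x >= a ==> u x >= 1 / sqrt 2" using last_crossing by blast
 define y where "y x = u x - kink01 (x - a)" for x
 define y' where "y' x = v x - dk01 (x - a)" for x
 define r where "r x = v x - sqrt 2 * u x * (1 - (u x)^2)" for x
 define c where "c x = sqrt 2 * (1 - (u x)^2 - u x * kink01 (x - a) - (kink01 (x - a))^2)" for x
 have Ay: "AC y y'" unfolding y_def[abs_def] y'_def[abs_def] by (rule AC_diff[OF u(1) AC_kink01])
 have sy: "sqint {m..} y"
  using sqint_diff[OF u(3) kink_tail(1)[of a]] by (simp add: y_def[abs_def])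
 have sy': "sqint {m..} y'"
  unfolding y'_def[abs_def] using u(2) sqint_subset[OF kink_tail(2)] by (intro sqint_diff) auto
 have sr: "sqint {m..} r" "integral {m..} (%x. (r x)^2) <= 2 * de" using resid by (auto simp: r_def[abs_def])
 have eq: "y' x = c x * y x + r x" for x
  unfolding y'_def y_def c_def r_def dk01_def by (simp add: algebra_simps power2_eq_square)
 have sq2: "(1 / sqrt 2) * (1 / sqrt 2) = (1/2::real)" by simp
 have "integral {m..} (%x. (y x)^2) <= 150 * (integral {m..} (%x. (r x)^2) + (y a)^2)"
 proof (rule hardy_bound[OF Ay sy sy' sr(1) less_imp_le[OF a(1)] eq _ hweight_AC[of a]])
  fix x assume x: "a <= x"
  have h: "kink01 (x - a) >= 1 / sqrt 2" using kink01_mono[of 0 "x - a"] x by (simp add: kink01_0)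
  have p: "(1 / sqrt 2) * (1 / sqrt 2) <= u x * u x" "(1 / sqrt 2) * (1 / sqrt 2) <= u x * kink01 (x - a)"
   "(1 / sqrt 2) * (1 / sqrt 2) <= kink01 (x - a) * kink01 (x - a)"
   using mult_mono[OF a(3)[OF x] a(3)[OF x]] mult_mono[OF a(3)[OF x] h] mult_mono[OF h h]
   order_trans[OF _ a(3)[OF x], of 0] order_trans[OF _ h, of 0] by simp_all
  hence "1 - (u x)^2 - u x * kink01 (x - a) - (kink01 (x - a))^2 <= - 1/2"
   unfolding sq2 power2_eq_square by linarith
  hence "c x <= sqrt 2 * (- 1/2)" unfolding c_def by (intro mult_left_mono) auto
  also have "... <= - 1/2" using sqrt2_bounds(1) by simp
  finally show "c x <= - 1/2" .
 next
  fix x assume x: "x \<in> {m..a}"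
  thus "1 <= hweight a x" "hweight a x <= 4" using hweight_bounds[of x a] by auto
  show "1/3 <= hweight' a x / 2 + hweight a x * c x"
   unfolding c_def using dissipation_nonlinear[of x a "u x"] u_left_bound[OF a(1,2)] x by auto
 qed
 moreover have "y a = 0" unfolding y_def a(2) by (simp add: kink01_0)
 ultimately have Y: "integral {m..} (%x. (y x)^2) <= 300 * de" using sr(2) by simp
 have cb: "abs (c x) <= 12" if "x >= m" for x
 proof -
  have h: "abs (kink01 (x - a)) <= 1" using kink01_pos[of "x - a"] kink01_less_1[of "x - a"] by simp
  have "abs (u x * u x) <= 2 * 2" "abs (u x * kink01 (x - a)) <= 2 * 1" "abs (kink01 (x - a) * kink01 (x - a)) <= 1 * 1"
   using mult_mono[OF u_le_2[OF that] u_le_2[OF that]] mult_mono[OF u_le_2[OF that] h] mult_mono[OF h h]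
   unfolding abs_mult by linarith+
  hence "abs (1 - (u x)^2 - u x * kink01 (x - a) - (kink01 (x - a))^2) <= 8"
   unfolding power2_eq_square by linarith
  hence "abs (c x) <= 1.5 * 8" unfolding c_def abs_mult using sqrt2_bounds(2) by (intro mult_mono) auto
  thus ?thesis by simp
 qed
 have "integral {m..} (%x. (y' x)^2) <= integral {m..} (%x. 288 * (y x)^2 + 2 * (r x)^2)"
 proof (rule integral_le)
  show "(%x. 288 * (y x)^2 + 2 * (r x)^2) integrable_on {m..}"
   by (rule integral_lin2(1)[OF sqint_int[OF sy] sqint_int[OF sr(1)]])
  fix x assume "x \<in> {m..}"
  hence "(c x * y x)^2 <= 12^2 * (y x)^2"
   using power_mono[OF cb[of x] abs_ge_zero, of 2] unfolding power_mult_distrib by (intro mult_right_mono) auto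
  thus "(y' x)^2 <= 288 * (y x)^2 + 2 * (r x)^2"
   using square_add_le[of "c x * y x" "r x"] unfolding eq[symmetric] by simp
 qed (use sqint_int[OF sy'] in auto)
 also have "... = 288 * integral {m..} (%x. (y x)^2) + 2 * integral {m..} (%x. (r x)^2)"
  by (rule integral_lin2(2)[OF sqint_int[OF sy] sqint_int[OF sr(1)]])
 finally have Y': "integral {m..} (%x. (y' x)^2) <= 90000 * de" using Y sr(2) sqint_nonneg[OF sr(1)] by linarith
 have tot: "integral {m..} (%x. (y x)^2) + integral {m..} (%x. (y' x)^2) <= 10^6 * de"
  using Y Y' sr(2) sqint_nonneg[OF sr(1)] by simp
 have "(y m)^2 <= 10^6 * de" using sobolev_half(1)[OF Ay sy sy'] tot by linarith
 hence "(kink01 (m - a))^2 <= 10^6 * de" by (simp add: y_def um)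
 thus ?thesis using that[OF a(1,2)] sy sy' tot by (simp add: y_def[abs_def] y'_def[abs_def])
qed

end

lemma kink_exp_square:
 assumes "x <= 0" "(kink01 x)^2 <= M"
 shows "exp (2 * sqrt 2 * x) <= 2 * M"
proof -
 have "exp (sqrt 2 * x) / sqrt 2 <= kink01 x" using kink01_ge_exp[OF assms(1)] .
 hence "(exp (sqrt 2 * x) / sqrt 2)^2 <= (kink01 x)^2" by (intro power_mono) auto
 hence "(exp (sqrt 2 * x))^2 / 2 <= M" using assms(2) by (simp add: power_divide)
 thus ?thesis by (simp add: exp_double[symmetric] mult.assoc)
qed

lemma kink10_tail:
 shows "sqint {m..} (%x. kink10 (x - b))" "sqint {m..} (%x. dk10 (x - b))"
  "integral {m..} (%x. (kink10 (x - b))^2) + integral {m..} (%x. (dk10 (x - b))^2) <= 2 * exp (2 * sqrt 2 * (b - m))"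
proof -
 define e where "e x = exp (2 * sqrt 2 * b) * exp (- (2 * sqrt 2) * x)" for x
 have p: "0 < 2 * sqrt (2::real)" by simp
 have i1: "(%x. exp (- (2 * sqrt 2) * x)) integrable_on {m..}" using abs_int_imp[OF exp_int_top(1)[OF p, of m]] .
 have "integral {m..} e = exp (2 * sqrt 2 * b) * (exp (- (2 * sqrt 2) * m) / (2 * sqrt 2))"
  unfolding e_def exp_int_top(2)[OF p, of m, symmetric] by (rule Henstock_Kurzweil_Integration.integral_mult_right)
 also have "... = exp (2 * sqrt 2 * b) * exp (- (2 * sqrt 2) * m) / (2 * sqrt 2)" by simp
 also have "... = exp (2 * sqrt 2 * (b - m)) / (2 * sqrt 2)" unfolding mult_exp_exp by (simp add: right_diff_distrib)
 finally have i: "e integrable_on {m..}" "integral {m..} e = exp (2 * sqrt 2 * (b - m)) / (2 * sqrt 2)"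
  unfolding e_def using integrable_on_mult_right[OF i1] by auto
 have e: "e x = (exp (sqrt 2 * (b - x)))^2" for x
  unfolding e_def mult_exp_exp exp_double[symmetric] by (simp add: right_diff_distrib mult.assoc)
 have b1: "(kink10 (x - b))^2 <= 1 * e x" for x
  unfolding e kink10_eq using kink01_le_exp[of "b - x"] kink01_pos[of "b - x"] by (auto intro: power_mono)
 have b2: "(dk10 (x - b))^2 <= 2 * e x" for x
 proof -
  have "dk01 (b - x) <= sqrt 2 * exp (sqrt 2 * (b - x))"
   unfolding dk01_def using kink01_le_exp[of "b - x"] kink01_pos[of "b - x"] kink01_square_less_1[of "b - x"]
   mult_mono[of "kink01 (b - x)" "exp (sqrt 2 * (b - x))" "1 - (kink01 (b - x))^2" 1]
   by (simp add: mult.assoc)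
  hence "(dk01 (b - x))^2 <= (sqrt 2 * exp (sqrt 2 * (b - x)))^2"
   using dk01_nonneg[of "b - x"] by (intro power_mono) auto
  thus ?thesis unfolding e dk10_def by (simp add: power_mult_distrib)
 qed
 have m: "(%x. kink10 (x - b)) \<in> LM" "(%x. dk10 (x - b)) \<in> LM"
  by (auto intro!: continuous_meas continuous_intros)
 show s1: "sqint {m..} (%x. kink10 (x - b))" and s2: "sqint {m..} (%x. dk10 (x - b))"
  using sqint_dom[OF m(1) _ integrable_on_mult_right[OF i(1)] b1] sqint_dom[OF m(2) _ integrable_on_mult_right[OF i(1)] b2] by auto
 have "integral {m..} (%x. (kink10 (x - b))^2) <= integral {m..} (%x. 1 * e x)"
  by (intro integral_le sqint_int s1 b1 integrable_on_mult_right i)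
 moreover have "integral {m..} (%x. (dk10 (x - b))^2) <= integral {m..} (%x. 2 * e x)"
  by (intro integral_le sqint_int s2 b2 integrable_on_mult_right i)
 moreover have "3 * integral {m..} e <= 2 * exp (2 * sqrt 2 * (b - m))"
  unfolding i(2) using sqrt2_bounds(1) by (simp add: divide_le_eq)
 ultimately show "integral {m..} (%x. (kink10 (x - b))^2) + integral {m..} (%x. (dk10 (x - b))^2) <= 2 * exp (2 * sqrt 2 * (b - m))"
  by (simp add: Henstock_Kurzweil_Integration.integral_mult_right)
qed

text \<open>Right of \<open>m\<close> the second kink contributes only its tail, whose norm is
  controlled by its value at \<open>m\<close>; that value is bounded by the estimate on the other
  half line.\<close>

lemma half_closeness_sum:
 assumes "sqint {m..} (%x. u x - kink01 (x - a))" "sqint {m..} (%x. v x - dk01 (x - a))"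
  "integral {m..} (%x. (u x - kink01 (x - a))^2) + integral {m..} (%x. (v x - dk01 (x - a))^2) <= 10^6 * de"
  "b <= m" "(kink01 (b - m))^2 <= 10^6 * de"
 shows "integral {m..} (%x. (u x - kink01 (x - a) - kink10 (x - b))^2)
  + integral {m..} (%x. (v x - dk01 (x - a) - dk10 (x - b))^2) <= 10^7 * de"
proof -
 have e: "exp (2 * sqrt 2 * (b - m)) <= 2 * (10^6 * de)" using kink_exp_square[OF _ assms(5)] assms(4) by simp
 note t = kink10_tail[of m b]
 have "integral {m..} (%x. (u x - kink01 (x - a) - kink10 (x - b))^2)
  <= 2 * integral {m..} (%x. (u x - kink01 (x - a))^2) + 2 * integral {m..} (%x. (kink10 (x - b))^2)"
  using integral_square_add_le[OF assms(1) sqint_minus[OF t(1)]] by simp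
 moreover have "integral {m..} (%x. (v x - dk01 (x - a) - dk10 (x - b))^2)
  <= 2 * integral {m..} (%x. (v x - dk01 (x - a))^2) + 2 * integral {m..} (%x. (dk10 (x - b))^2)"
  using integral_square_add_le[OF assms(2) sqint_minus[OF t(2)]] by simp
 moreover have "X1 + X2 <= 10^7 * de" if "X1 <= 2 * P + 2 * R" "X2 <= 2 * P' + 2 * R'" "P + P' <= 10^6 * de"
   "R + R' <= 2 * E" "E <= 2 * (10^6 * de)" for X1 X2 P P' R R' E :: real
  using that by (simp add: field_simps)
 ultimately show ?thesis using assms(3) t(3) e by blast
qed

text \<open>The reflection \<open>u \<mapsto> - u (- \<cdot>)\<close> exchanges the two kinks.\<close>

definition bkg :: "real => real" where "bkg x = kink01 x + kink10 x"
definition bkg_deriv :: "real => real" where "bkg_deriv x = dk01 x + dk10 x"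

abbreviation (input) "admis u v \<equiv> H1r (%x. u x - bkg x) (%x. v x - bkg_deriv x)"

lemma bkg_AC: "AC bkg bkg_deriv"
 using AC_add[OF AC_kink01[of 0] AC_kink10[of 0]] by (simp add: bkg_def[abs_def] bkg_deriv_def[abs_def])

lemma continuous_bkg [continuous_intros]: "continuous_on S f ==> continuous_on S (%x. bkg (f x))"
 unfolding bkg_def by (intro continuous_intros)

lemma bkg_odd: "bkg (- x) = - bkg x" "bkg_deriv (- x) = bkg_deriv x"
 by (auto simp: bkg_def bkg_deriv_def kink10_eq dk10_def)

lemma bkg_sq_deriv: "sqint UNIV bkg_deriv"
proof -
 have "abs (bkg_deriv x) <= (2 * sqrt 2) * exp (- sqrt 2 * abs (x - 0))" for x
  unfolding bkg_deriv_def dk10_def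
  using dk01_le[of x] dk01_nonneg[of x] dk01_le[of "-x"] dk01_nonneg[of "-x"] by simp
 thus ?thesis
  by (rule sqint_exp_dom(1)[rotated]) (auto intro!: continuous_meas continuous_intros simp: bkg_deriv_def[abs_def])
qed

lemma bkg_minus_1: "sqint {m..} (%x. bkg x - 1)"
proof -
 have "sqint UNIV (%x. exp (- sqrt 2 * abs x))" using exp_weight_sq(1)[of 1 0] by simp
 have *: "sqint {min m 0..} (%x. (kink01 (x - 0) - 1) + kink10 (x - 0))"
 proof (rule sqint_add)
  have "sqint {min m 0..0} (%x. kink01 x - 1)"
   unfolding sqint_def by (auto intro!: continuous_meas continuous_intros absolutely_integrable_continuous_real)
  show "sqint {min m 0..} (%x. kink10 (x - 0))" by (rule kink10_tail(1))
  show "sqint {min m 0..} (%x. kink01 (x - 0) - 1)"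
  proof -
   have "0 < 4 * sqrt (2::real)" by simp
   from abs_int_imp[OF exp_int_top(1)[OF this, of "min m 0"]]
   have "(%x. (exp (- (2 * sqrt 2 * x)))^2) integrable_on {min m 0..}"
   unfolding exp_double[symmetric] by (simp add: mult.assoc)
   moreover have "(kink01 x - 1)^2 <= (exp (- (2 * sqrt 2 * x)))^2" for x
   proof -
   have "abs (kink01 x - 1) <= exp (- (2 * sqrt 2 * x))" using one_minus_kink01_le[of x] kink01_less_1[of x] by simp
   thus ?thesis by (metis abs_ge_zero power2_abs power_mono)
   qed
   ultimately show ?thesis
   by (intro sqint_dom[where g = "%x. (exp (- (2 * sqrt 2 * x)))^2"]) (auto intro!: continuous_meas continuous_intros)
  qed
 qed simp
 have "sqint {m..} (%x. (kink01 (x - 0) - 1) + kink10 (x - 0))"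
  by (rule sqint_subset[OF *]) auto
 thus ?thesis by (simp add: bkg_def algebra_simps)
qed

section \<open>Profiles of the energy space on the whole line\<close>

context
 fixes u v :: "real => real"
 assumes H: "admis u v"
begin

lemma S_AC: "AC u v"
proof -
 have "AC (%x. u x - bkg x) (%x. v x - bkg_deriv x)" using H by (simp add: H1r_def)
 from AC_add[OF this bkg_AC] show ?thesis by simp
qed

lemma S_v: "sqint UNIV v"
proof -
 have "sqint UNIV (%x. v x - bkg_deriv x)" using H by (simp add: H1r_def)
 from sqint_add[OF this bkg_sq_deriv] show ?thesis by simp
qed

lemma S_right: "sqint {m..} (%x. u x - 1)"
proof -
 have "sqint UNIV (%x. u x - bkg x)" using H by (simp add: H1r_def)
 hence "sqint {m..} (%x. u x - bkg x)" by (rule sqint_subset) auto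
 from sqint_add[OF this bkg_minus_1] show ?thesis by simp
qed

lemma S_reflect: "H1r (%x. - u (- x) - bkg x) (%x. v (- x) - bkg_deriv x)"
proof -
 have "H1r (%x. - (u (- x) - bkg (- x))) (%x. - (- (v (- x) - bkg_deriv (- x))))"
  using H1r_reflect(1)[OF H] AC_minus sqint_minus by (fastforce simp: H1r_def)
 moreover have "(%x. - (u (- x) - bkg (- x))) = (%x. - u (- x) - bkg x)"
  "(%x. - (- (v (- x) - bkg_deriv (- x)))) = (%x. v (- x) - bkg_deriv x)"
  by (auto simp: bkg_odd)
 ultimately show ?thesis by (simp only:)
qed

lemma S_lim: "(u ~~> 1) at_top"
proof -
 have "sqint {0..} v" using S_v by (rule sqint_subset) auto
 moreover have "AC (%x. u x - 1) v" using AC_diff[OF S_AC AC_const[of 1]] by simp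
 ultimately have "((%x. u x - 1) ~~> 0) at_top" using sobolev_half(2) S_right by blast
 thus ?thesis by (simp add: LIM_zero_iff)
qed

end

text \<open>\<open>pot u\<close> is the square of \<open>u * (1 + u) * (u - 1)\<close>; to the right
  \<open>u - 1\<close> is square integrable and the other factors are bounded. The left side follows
  by reflection.\<close>

lemma S_edens_int:
 assumes "admis u v"
 shows "edens u v abs_int_on UNIV"
proof -
 have r: "(%x. pot (u x)) abs_int_on {0..}"
  if H: "admis u v" for u v
 proof -
  have c: "cont u" using AC_cont[OF S_AC[OF H]] .
  obtain N where N: "!!x. x >= N ==> abs (u x) <= 2"
  proof -
   have "\<forall>\<^sub>F x in at_top. dist (u x) 1 < 1" using S_lim[OF H] by (rule tendstoD) simp
   then obtain N where "!!x. x >= N ==> dist (u x) 1 < 1" by (auto simp: eventually_at_top_linorder)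
   thus ?thesis using that[of N] by (force simp: dist_real_def)
  qed
  have "bounded (u ` {0..max N 0})"
   using c by (intro compact_imp_bounded compact_continuous_image) (auto intro: continuous_on_subset)
  then obtain B where "\<forall>x\<in>u ` {0..max N 0}. norm x <= B" unfolding bounded_iff by blast
  hence B: "!!x. x \<in> {0..max N 0} ==> abs (u x) <= B" by simp
  define M where "M = max 2 B"
  have M: "abs (u x) <= M" if "x >= 0" for x
   using N[of x] B[of x] that by (cases "x >= N") (auto simp: M_def)
  have "M >= 2" by (simp add: M_def)
  have "sqint {0..} (%x. (u x * (1 + u x)) * (u x - 1))"
  proof (rule sqint_bdd_mult[OF S_right[OF H]])
   show "abs (u x * (1 + u x)) <= M * (1 + M)" if "x \<in> {0..}" for x
   using M[of x] that \<open>M >= 2\<close> unfolding abs_mult by (intro mult_mono) auto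
  qed (use continuous_meas[OF c] in auto)
  hence "(%x. ((u x * (1 + u x)) * (u x - 1))^2) abs_int_on {0..}" by (simp add: sqint_def)
  moreover have "((u x * (1 + u x)) * (u x - 1))^2 = pot (u x)" for x
   unfolding pot_def by (simp add: power2_eq_square algebra_simps)
  ultimately show ?thesis by simp
 qed
 have "(%x. pot (- u (- x))) abs_int_on {-0..}" using r[OF S_reflect[OF assms]] by simp
 hence "(%x. pot (- u x)) abs_int_on {..0}"
  using reflect_half(1)[where f = "%x. pot (- u x)" and t = 0] by blast
 hence l: "(%x. pot (u x)) abs_int_on {..0}" by (simp add: pot_def)
 have "(%x. pot (u x)) abs_int_on ({..0} \<union> {0..})"
  using l r[OF assms] by (rule set_integrable_Un) auto
 moreover have "{..0} \<union> {0..} = (UNIV :: real set)" by auto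
 ultimately have p: "(%x. pot (u x)) abs_int_on UNIV" by simp
 have "(%x. (v x)^2 / 2) abs_int_on UNIV" using S_v[OF assms] by (simp add: sqint_def)
 from set_integral_add(1)[OF this p] show ?thesis by (simp add: edens_def[abs_def])
qed

text \<open>The remainder after subtracting kinks centred at \<open>a\<close> and \<open>b\<close>;
  the shifts of the final statement are \<open>- a\<close> and \<open>- b\<close>.\<close>

definition gap :: "(real => real) => real => real => real => real" where
 "gap u a b x = u x - kink01 (x - a) - kink10 (x - b)"
definition gap' :: "(real => real) => real => real => real => real" where
 "gap' v a b x = v x - dk01 (x - a) - dk10 (x - b)"

lemma gap_H1:
 assumes "admis u v"
 shows "H1r (gap u a b) (gap' v a b)"
proof -
 from H1r_diff[OF H1r_diff[OF assms kink01_shift_H1(1)[of a 0]] kink10_shift_H1(1)[of b 0]]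
 have "H1r (%x. u x - bkg x - (kink01 (x - a) - kink01 (x - 0)) - (kink10 (x - b) - kink10 (x - 0)))
  (%x. v x - bkg_deriv x - (dk01 (x - a) - dk01 (x - 0)) - (dk10 (x - b) - dk10 (x - 0)))" .
 moreover have "gap u a b = (%x. u x - bkg x - (kink01 (x - a) - kink01 (x - 0)) - (kink10 (x - b) - kink10 (x - 0)))"
  "gap' v a b = (%x. v x - bkg_deriv x - (dk01 (x - a) - dk01 (x - 0)) - (dk10 (x - b) - dk10 (x - 0)))"
  by (auto simp: gap_def gap'_def bkg_def bkg_deriv_def)
 ultimately show ?thesis by (simp only:)
qed

lemma S_zero:
 assumes H: "admis u v"
 obtains m where "u m = 0"
proof -
 have cu: "cont u" by (rule AC_cont[OF S_AC[OF H]])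
 have "\<forall>\<^sub>F x in at_top. u x > 0" using order_tendstoD(1)[OF S_lim[OF H], of 0] by simp
 then obtain x where x: "u x > 0" by (auto simp: eventually_at_top_linorder)
 have "\<forall>\<^sub>F x in at_top. - u (- x) > 0" using order_tendstoD(1)[OF S_lim[OF S_reflect[OF H]], of 0] by simp
 then obtain y where y: "- u (- y) > 0" by (auto simp: eventually_at_top_linorder)
 have "0 \<in> range u"
  using connectedD_interval[OF connected_continuous_image[OF cu connected_UNIV], of "u (- y)" "u x" 0] x y by auto
 thus ?thesis using that by auto
qed

text \<open>Cut at a zero and treat the left half by reflection. Each half needs at least the energy
  \<open>sqrt 2 / 4\<close>, so neither exceeds it by more than \<open>de\<close>.\<close>

lemma closeness:
 assumes H: "admis u v"
  and E: "intR (edens u v) <= sqrt 2 / 2 + de" and de: "de < 0.06"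
 obtains a b where "u a = 1 / sqrt 2" "u b = - (1 / sqrt 2)" "H1sq (gap u a b) (gap' v a b) <= 10^8 * de"
  "exp (- sqrt 2 * (a - b)) <= 10^8 * de"
proof -
 define u' where "u' x = - u (- x)" for x
 define v' where "v' x = v (- x)" for x
 have H': "H1r (%x. u' x - bkg x) (%x. v' x - bkg_deriv x)" using S_reflect[OF H] by (simp add: u'_def v'_def)
 have c: "cont u" using AC_cont[OF S_AC[OF H]] .
 obtain m where m: "u m = 0" using S_zero[OF H] .
 have m': "u' (- m) = 0" using m by (simp add: u'_def)
 have ei: "edens u v abs_int_on UNIV" using S_edens_int[OF H] .
 have eil: "edens u v abs_int_on {..m}" by (rule abs_int_subset[OF ei]) auto
 have er: "edens u' v' x = edens u v (- x)" for x by (simp add: edens_def u'_def v'_def pot_def)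
 define R where "R = integral {m..} (edens u v)"
 define L where "L = integral {-m..} (edens u' v')"
 have L: "L = integral {..m} (edens u v)" unfolding L_def er[abs_def] using reflect_half(2)[OF eil] .
 have tot: "L + R <= sqrt 2 / 2 + de" unfolding L R_def using split_UNIV[OF ei, of m] E by simp
 have sv: "sqint {s..} v" "sqint {s..} v'" for s
  using sqint_subset[OF S_v[OF H]] sqint_subset[OF S_v[OF H']] by auto
 \<comment> \<open>With less energy on the right half, \<open>half_closeness\<close> would apply
   with a negative excess and bound a square by a negative number.\<close>
 have Rge: "sqrt 2 / 4 <= R"
 proof (rule ccontr)
  assume n: "\<not> sqrt 2 / 4 <= R"
  obtain a where "(kink01 (m - a))^2 <= 10^6 * (R - sqrt 2 / 4)"
   by (rule half_closeness[OF S_AC[OF H] sv(1) S_right[OF H] m, of "R - sqrt 2 / 4"]) (use n in \<open>auto simp: R_def\<close>)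
  moreover have "10^6 * (R - sqrt 2 / 4) < 0" by (rule mult_pos_neg) (use n in auto)
  ultimately show False using zero_le_power2[of "kink01 (m - a)"] by linarith
 qed
 have Lge: "sqrt 2 / 4 <= L"
 proof (rule ccontr)
  assume n: "\<not> sqrt 2 / 4 <= L"
  obtain a where "(kink01 (- m - a))^2 <= 10^6 * (L - sqrt 2 / 4)"
   by (rule half_closeness[OF S_AC[OF H'] sv(2) S_right[OF H'] m', of "L - sqrt 2 / 4"]) (use n in \<open>auto simp: L_def\<close>)
  moreover have "10^6 * (L - sqrt 2 / 4) < 0" by (rule mult_pos_neg) (use n in auto)
  ultimately show False using zero_le_power2[of "kink01 (- m - a)"] by linarith
 qed
 obtain a where a: "m < a" "u a = 1 / sqrt 2"
  "sqint {m..} (%x. u x - kink01 (x - a))" "sqint {m..} (%x. v x - dk01 (x - a))"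
  "integral {m..} (%x. (u x - kink01 (x - a))^2) + integral {m..} (%x. (v x - dk01 (x - a))^2) <= 10^6 * de"
  "(kink01 (m - a))^2 <= 10^6 * de"
  by (rule half_closeness[OF S_AC[OF H] sv(1) S_right[OF H] m _ de]) (use tot Lge in \<open>auto simp: R_def\<close>)
 obtain b' where b': "- m < b'" "u' b' = 1 / sqrt 2"
  "sqint {-m..} (%x. u' x - kink01 (x - b'))" "sqint {-m..} (%x. v' x - dk01 (x - b'))"
  "integral {-m..} (%x. (u' x - kink01 (x - b'))^2) + integral {-m..} (%x. (v' x - dk01 (x - b'))^2) <= 10^6 * de"
  "(kink01 (- m - b'))^2 <= 10^6 * de"
  by (rule half_closeness[OF S_AC[OF H'] sv(2) S_right[OF H'] m' _ de]) (use tot Rge in \<open>auto simp: L_def\<close>)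
 define b where "b = - b'"
 have G: "H1r (gap u a b) (gap' v a b)" using gap_H1[OF H] .
 have Gi: "(%x. (gap u a b x)^2) abs_int_on UNIV" "(%x. (gap' v a b x)^2) abs_int_on UNIV"
  using G by (auto simp: H1r_def sqint_def)
 have right: "integral {m..} (%x. (gap u a b x)^2) + integral {m..} (%x. (gap' v a b x)^2) <= 10^7 * de"
 proof -
  have bm: "- m - b' = b - m" by (simp add: b_def)
  show ?thesis unfolding gap_def gap'_def
   using half_closeness_sum[OF a(3,4,5), of b] b'(1,6) unfolding bm by (simp add: b_def)
 qed
 have "integral {-m..} (%x. (u' x - kink01 (x - b') - kink10 (x - (- a)))^2)
  + integral {-m..} (%x. (v' x - dk01 (x - b') - dk10 (x - (- a)))^2) <= 10^7 * de"
  using half_closeness_sum[OF b'(3,4,5), of "- a"] a(1,6) by simp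
 moreover have "(u' x - kink01 (x - b') - kink10 (x - (- a)))^2 = (gap u a b (- x))^2"
  "(v' x - dk01 (x - b') - dk10 (x - (- a)))^2 = (gap' v a b (- x))^2" for x
 proof -
  have cm: "- a - x = - x - a" by simp
  have comm: "kink01 (- a - x) = kink01 (- x - a)" "dk01 (- a - x) = dk01 (- x - a)"
   unfolding cm by (rule refl)+
  have "u' x - kink01 (x - b') - kink10 (x - (- a)) = - gap u a b (- x)"
   by (simp add: u'_def gap_def kink10_eq b_def algebra_simps comm)
  thus "(u' x - kink01 (x - b') - kink10 (x - (- a)))^2 = (gap u a b (- x))^2" by simp
  have "v' x - dk01 (x - b') - dk10 (x - (- a)) = gap' v a b (- x)"
   by (simp add: v'_def gap'_def dk10_def b_def algebra_simps comm)
  thus "(v' x - dk01 (x - b') - dk10 (x - (- a)))^2 = (gap' v a b (- x))^2" by simp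
 qed
 moreover have "integral {-m..} (%x. (gap u a b (- x))^2) = integral {..m} (%x. (gap u a b x)^2)"
  "integral {-m..} (%x. (gap' v a b (- x))^2) = integral {..m} (%x. (gap' v a b x)^2)"
  using reflect_half(2)[where f = "%x. (gap u a b x)^2"] reflect_half(2)[where f = "%x. (gap' v a b x)^2"]
   abs_int_subset[OF Gi(1), of "{..m}"] abs_int_subset[OF Gi(2), of "{..m}"] by auto
 ultimately have left: "integral {..m} (%x. (gap u a b x)^2) + integral {..m} (%x. (gap' v a b x)^2) <= 10^7 * de"
  by simp
 \<comment> \<open>The sign of \<open>de\<close> is not assumed; it follows from the lower bounds on
   the two halves.\<close>
 have d0: "0 <= de" using tot Lge Rge by simp
 have "H1sq (gap u a b) (gap' v a b) <= 2 * 10^7 * de"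
  unfolding H1sq_def split_UNIV[OF Gi(1), of m] split_UNIV[OF Gi(2), of m] using left right by simp
 hence sq: "H1sq (gap u a b) (gap' v a b) <= 10^8 * de" using d0 by simp
 have "exp (2 * sqrt 2 * (m - a)) <= 2 * (10^6 * de)" "exp (2 * sqrt 2 * (b - m)) <= 2 * (10^6 * de)"
 proof -
  have bm: "- m - b' = b - m" by (simp add: b_def)
  show "exp (2 * sqrt 2 * (m - a)) <= 2 * (10^6 * de)" using kink_exp_square[OF _ a(6)] a(1) by simp
  show "exp (2 * sqrt 2 * (b - m)) <= 2 * (10^6 * de)" using kink_exp_square[OF _ b'(6)[unfolded bm]] b'(1) by (simp add: b_def)
 qed
 \<comment> \<open>Each half bounds the distance of one centre from the zero \<open>m\<close>; in
   the product the location of \<open>m\<close> drops out.\<close>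
 hence "exp (2 * sqrt 2 * (m - a)) * exp (2 * sqrt 2 * (b - m)) <= (2 * (10^6 * de)) * (2 * (10^6 * de))"
  using d0 by (intro mult_mono) auto
 moreover have "exp (2 * sqrt 2 * (m - a)) * exp (2 * sqrt 2 * (b - m)) = (exp (- sqrt 2 * (a - b)))^2"
  unfolding mult_exp_exp exp_double[symmetric] by (simp add: algebra_simps)
 ultimately have "(exp (- sqrt 2 * (a - b)))^2 <= (2 * (10^6 * de))^2" by (simp add: power2_eq_square)
 hence "exp (- sqrt 2 * (a - b)) <= 2 * (10^6 * de)" using d0 by (rule_tac power2_le_imp_le) auto
 hence ex: "exp (- sqrt 2 * (a - b)) <= 10^8 * de" using d0 by simp
 have "u b = - (1 / sqrt 2)" using b'(2) by (simp add: u'_def b_def)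
 thus ?thesis using that[of a b] a(2) sq ex by blast
qed

section \<open>Coercivity of the linearised operator\<close>

definition ddpot :: "real => real" where "ddpot u = 2 - 24 * u^2 + 30 * u ^ 4"

definition kk :: "real => real => real => real" where
 "kk a b x = kink01 (x - a) + kink10 (x - b)"

lemma continuous_ddpot [continuous_intros]: "continuous_on S f ==> continuous_on S (%x. ddpot (f x))"
 unfolding ddpot_def by (intro continuous_intros)

lemma continuous_two_kinks [continuous_intros]: "continuous_on S f ==> continuous_on S (%x. kk a b (f x))"
 unfolding kk_def by (intro continuous_intros)

lemma kink_abs_bounds: "abs (kink01 x) <= 1" "abs (kink10 x) <= 1" "abs (kk a b x) <= 1" "abs (kink10 x) <= exp (- sqrt 2 * x)"
 using kink01_pos[of x] kink01_less_1[of x] kink01_pos[of "-x"] kink01_less_1[of "-x"] kink01_le_exp[of "-x"]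
  kink01_pos[of "x - a"] kink01_less_1[of "x - a"] kink01_pos[of "b - x"] kink01_less_1[of "b - x"]
 by (auto simp: kink10_eq kk_def)

lemma ddpot_bound: "abs u <= 1 ==> abs (ddpot u) <= 56"
proof -
 assume "abs u <= 1"
 hence u2: "u^2 <= 1" by (simp add: abs_square_le_1)
 have "u^2 * u^2 <= 1 * 1" by (rule mult_mono[OF u2 u2]) auto
 moreover have "u ^ 4 = u^2 * u^2" by (simp add: power4_eq_xxxx power2_eq_square mult.assoc)
 ultimately have "u ^ 4 <= 1" by linarith
 moreover have "0 <= u ^ 4" "0 <= u^2" by auto
 ultimately show ?thesis unfolding ddpot_def using u2 by linarith
qed

lemma ddpot_lipschitz:
 assumes "abs s <= 1" "abs t <= 1"
 shows "ddpot s - 168 * abs (t - s) <= ddpot t"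
proof -
 have sq: "s^2 <= 1" "t^2 <= 1" using assms by (auto simp: abs_square_le_1)
 have "ddpot t - ddpot s = (t - s) * (t + s) * (30 * (t^2 + s^2) - 24)"
  unfolding ddpot_def by (simp add: algebra_simps power2_eq_square power4_eq_xxxx)
 hence "abs (ddpot t - ddpot s) = abs (t - s) * (abs (t + s) * abs (30 * (t^2 + s^2) - 24))"
  by (simp add: abs_mult mult.assoc)
 also have "... <= abs (t - s) * (2 * 84)"
 proof (intro mult_left_mono mult_mono)
  show "abs (30 * (t^2 + s^2) - 24) <= 84" using sq zero_le_power2[of s] zero_le_power2[of t] by (smt (verit))
 qed (use assms in auto)
 finally show ?thesis by linarith
qed

text \<open>The logarithmic derivative of \<open>dk01\<close>, by \<open>dk01_DERIV\<close>. As
  \<open>dk01\<close> is the zero mode of the linearised operator, \<open>p = riccati\<close> solves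
  \<open>p' = ddpot kink01 - p^2\<close>, and this factorises the operator.\<close>

definition riccati :: "real => real" where "riccati x = sqrt 2 * (1 - 3 * (kink01 x)^2)"

lemma riccati_AC: "AC (%x. riccati (x - a)) (%x. ddpot (kink01 (x - a)) - (riccati (x - a))^2)"
proof (rule AC_C1)
 show "cont (%x. ddpot (kink01 (x - a)) - (riccati (x - a))^2)"
  unfolding riccati_def by (intro continuous_intros)
 fix x
 have "(riccati hrd sqrt 2 * (0 - 3 * (2 * kink01 y * dk01 y))) (at y)" for y
  unfolding riccati_def[abs_def] by (rule derivative_eq_intros DERIV_kink01 refl | simp)+
 moreover have "sqrt 2 * (0 - 3 * (2 * kink01 y * dk01 y)) = ddpot (kink01 y) - (riccati y)^2" for y
 proof -
  have "sqrt 2 * (0 - 3 * (2 * kink01 y * dk01 y)) = - (6 * (sqrt 2 * sqrt 2) * (kink01 y)^2 * (1 - (kink01 y)^2))"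
   unfolding dk01_def by (simp only: power2_eq_square) (simp only: algebra_simps)
  moreover have "(riccati y)^2 = 2 * (1 - 3 * (kink01 y)^2)^2" unfolding riccati_def by (simp add: power_mult_distrib)
  ultimately show ?thesis unfolding ddpot_def by (simp add: power2_eq_square power4_eq_xxxx algebra_simps)
 qed
 ultimately have "(riccati hrd ddpot (kink01 y) - (riccati y)^2) (at y)" for y by metis
 moreover have "((%x. x - a) hrd 1) (at x)" by (auto intro!: derivative_eq_intros)
 ultimately show "((%x. riccati (x - a)) hrd ddpot (kink01 (x - a)) - (riccati (x - a))^2) (at x)"
  using DERIV_chain2[of riccati "ddpot (kink01 (x - a)) - (riccati (x - a))^2" "%x. x - a" x 1 UNIV] by simp
qed

lemma continuous_riccati [continuous_intros]: "continuous_on S f ==> continuous_on S (%x. riccati (f x))"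
 unfolding riccati_def by (intro continuous_intros)

lemma riccati_bound: "riccati x <= 2" "(riccati x)^2 <= 8" "abs (riccati x) <= 3"
proof -
 have s: "0 <= (kink01 x)^2" "(kink01 x)^2 <= 1" using kink01_square_less_1[of x] by auto
 hence "abs (1 - 3 * (kink01 x)^2) <= 2" by linarith
 hence "(1 - 3 * (kink01 x)^2)^2 <= 2^2" using abs_le_square_iff[of "1 - 3 * (kink01 x)^2" 2] by simp
 thus r2: "(riccati x)^2 <= 8" unfolding riccati_def by (simp add: power_mult_distrib)
 hence "(riccati x)^2 <= 3^2" by simp
 thus "abs (riccati x) <= 3" using abs_le_square_iff[of "riccati x" 3] by simp
 have "riccati x <= sqrt 2 * 1" unfolding riccati_def using s by (intro mult_left_mono) auto
 thus "riccati x <= 2" using sqrt2_bounds(2) by simp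
qed

text \<open>Up to a boundary term the one-kink quadratic form is the integral of \<open>ro^2\<close>
  with \<open>ro = g' - p * g\<close>. Solutions of \<open>g' = p * g\<close> are multiples of the
  zero mode, which does not vanish at \<open>a\<close>; so the Hardy estimate recovers
  \<open>g\<close> from \<open>ro\<close> and the single value \<open>g a\<close>. Passing from one
  kink to two costs 168, a Lipschitz constant of \<open>ddpot\<close> on [-1, 1], times the size of
  the other kink.\<close>

lemma coercive_right:
 assumes g: "H1r g g'" and ta: "t <= a" and ze: "!!x. x >= t ==> abs (kink10 (x - b)) <= ze"
 shows "(integral {t..} (%x. (g x)^2) + integral {t..} (%x. (g' x)^2)) / 3000
  - (g a)^2 - 2 * (g t)^2 - 168 * ze * integral {t..} (%x. (g x)^2)
  <= integral {t..} (%x. (g' x)^2 + ddpot (kk a b x) * (g x)^2)"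
proof -
 define p where "p x = riccati (x - a)" for x
 define ro where "ro x = g' x - p x * g x" for x
 have G: "AC g g'" "sqint {t..} g" "sqint {t..} g'"
  using g sqint_subset[of UNIV _ "{t..}"] by (auto simp: H1r_def)
 have pm: "p \<in> LM" unfolding p_def[abs_def] by (intro continuous_meas continuous_intros)
 have spg: "sqint {t..} (%x. p x * g x)"
  by (rule sqint_bdd_mult[OF G(2) pm, of 3]) (auto simp: p_def riccati_bound)
 have sro: "sqint {t..} ro" unfolding ro_def[abs_def] by (rule sqint_diff[OF G(3) spg]) simp
 define X where "X = integral {t..} (%x. (g x)^2)"
 define Y where "Y = integral {t..} (%x. (g' x)^2)"
 define R where "R = integral {t..} (%x. (ro x)^2)"
 have hardy: "X <= 150 * (R + (g a)^2)"
  unfolding X_def R_def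
 proof (rule hardy_bound[OF G sro ta _ _ hweight_AC[of a], where c = p])
  show "g' x = p x * g x + ro x" for x by (simp add: ro_def)
  show "p x <= - 1/2" if "x >= a" for x
  proof -
   have "1 / sqrt 2 <= kink01 (x - a)" using kink01_mono[of 0 "x - a"] that by (simp add: kink01_0)
   hence "(1 / sqrt 2)^2 <= (kink01 (x - a))^2" by (intro power_mono) auto
   hence "1 - 3 * (kink01 (x - a))^2 <= - 1/2" by (simp add: power_divide)
   hence "p x <= sqrt 2 * (- 1/2)" unfolding p_def riccati_def by (intro mult_left_mono) auto
   thus ?thesis using sqrt2_bounds(1) by simp
  qed
  fix x assume x: "x \<in> {t..a}"
  thus "1 <= hweight a x" "hweight a x <= 4" using hweight_bounds by auto
  show "1/3 <= hweight' a x / 2 + hweight a x * p x"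
   using dissipation_linear[of x a] x by (simp add: p_def riccati_def)
 qed
 have Y: "Y <= 2 * R + 16 * X"
 proof -
  have "Y <= integral {t..} (%x. 2 * (ro x)^2 + 16 * (g x)^2)" unfolding Y_def
  proof (rule integral_le[OF sqint_int[OF G(3)] integral_lin2(1)[OF sqint_int[OF sro] sqint_int[OF G(2)]]])
   fix x
   have "(p x * g x)^2 <= 8 * (g x)^2" unfolding power_mult_distrib p_def
   using riccati_bound(2) by (intro mult_right_mono) auto
   thus "(g' x)^2 <= 2 * (ro x)^2 + 16 * (g x)^2"
   using square_add_le[of "ro x" "p x * g x"] by (simp add: ro_def)
  qed
  also have "... = 2 * R + 16 * X" unfolding R_def X_def by (rule integral_lin2(2)[OF sqint_int[OF sro] sqint_int[OF G(2)]])
  finally show ?thesis .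
 qed
 \<comment> \<open>\<open>D\<close> is the derivative of \<open>p * g^2\<close>; added to
   \<open>ro^2\<close> it cancels every term with \<open>p\<close>, by the Riccati equation.\<close>
 define D where "D x = (ddpot (kink01 (x - a)) - (p x)^2) * (g x)^2 + p x * (2 * g x * g' x)" for x
 have AD: "AC (%x. p x * (g x)^2) D"
  unfolding D_def p_def by (rule AC_mult[OF riccati_AC AC_square[OF G(1)]])
 have g2: "(%x. (g x)^2) abs_int_on {t..}" using G(2) by (simp add: sqint_def)
 have bdd: "(%x. c x * (g x)^2) abs_int_on {t..}"
  if "c \<in> LM" "!!x. abs (c x) <= M" for c M
 proof -
  have "sqint {t..} (%x. c x * g x)" by (rule sqint_bdd_mult[OF G(2) that(1)]) (use that(2) in auto)
  from sqint_mult[OF this G(2)] show ?thesis by (simp add: power2_eq_square mult.assoc)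
 qed
 have mT: "(%x. ddpot (kk a b x)) \<in> LM" "(%x. ddpot (kink01 (x - a))) \<in> LM"
  by (auto intro!: continuous_meas continuous_intros)
 have bT: "(%x. ddpot (kk a b x) * (g x)^2) abs_int_on {t..}"
  by (rule bdd[OF mT(1), of 56]) (auto intro!: ddpot_bound kink_abs_bounds)
 have bA: "(%x. ddpot (kink01 (x - a)) * (g x)^2) abs_int_on {t..}"
  by (rule bdd[OF mT(2), of 56]) (auto intro!: ddpot_bound kink_abs_bounds)
 have bp: "(%x. p x * (g x)^2) abs_int_on {t..}"
  by (rule bdd[OF pm, of 3]) (auto simp: p_def riccati_bound)
 have bp2: "(%x. (p x)^2 * (g x)^2) abs_int_on {t..}"
  by (rule bdd[where c = "%x. (p x)^2" and M = 8]) (use borel_measurable_power[OF pm] in \<open>simp_all add: p_def riccati_bound\<close>)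
 have pgg: "(%x. 2 * ((p x * g x) * g' x)) abs_int_on {t..}"
  using sqint_mult[OF spg G(3)] by simp
 have Dint: "D abs_int_on {t..}"
  using set_integral_add(1)[OF set_integral_diff(1)[OF bA bp2] pgg]
  by (simp add: D_def[abs_def] algebra_simps)
 have "integral {t..} D = - (p t * (g t)^2)" using AC_half(1)[OF AD bp Dint] .
 moreover have "p t * (g t)^2 <= 2 * (g t)^2" unfolding p_def using riccati_bound(1) by (intro mult_right_mono) auto
 ultimately have Dlow: "- (2 * (g t)^2) <= integral {t..} D" by linarith
 have "R + integral {t..} D = integral {t..} (%x. (ro x)^2 + D x)"
  unfolding R_def using sqint_int[OF sro] abs_int_imp[OF Dint]
  by (rule HK_add[symmetric])
 also have "... = integral {t..} (%x. (g' x)^2 + ddpot (kink01 (x - a)) * (g x)^2)"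
  unfolding ro_def D_def by (simp add: power2_diff power_mult_distrib algebra_simps)
 also have "... <= integral {t..} (%x. ((g' x)^2 + ddpot (kk a b x) * (g x)^2) + (168 * ze) * (g x)^2)"
 proof (rule integral_le)
  show "(%x. (g' x)^2 + ddpot (kink01 (x - a)) * (g x)^2) integrable_on {t..}"
   by (intro integrable_add sqint_int G abs_int_imp[OF bA])
  show "(%x. ((g' x)^2 + ddpot (kk a b x) * (g x)^2) + (168 * ze) * (g x)^2) integrable_on {t..}"
   by (intro integrable_add sqint_int G abs_int_imp[OF bT] integrable_on_mult_right)
  fix x assume x: "x \<in> {t..}"
  have "ddpot (kink01 (x - a)) - 168 * abs (kk a b x - kink01 (x - a)) <= ddpot (kk a b x)"
   by (rule ddpot_lipschitz) (auto simp: kink_abs_bounds)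
  moreover have "abs (kk a b x - kink01 (x - a)) <= ze" using ze[of x] x by (simp add: kk_def)
  ultimately have "ddpot (kink01 (x - a)) <= ddpot (kk a b x) + 168 * ze" by (smt (verit))
  hence "ddpot (kink01 (x - a)) * (g x)^2 <= (ddpot (kk a b x) + 168 * ze) * (g x)^2"
   by (intro mult_right_mono) auto
  thus "(g' x)^2 + ddpot (kink01 (x - a)) * (g x)^2 <= ((g' x)^2 + ddpot (kk a b x) * (g x)^2) + (168 * ze) * (g x)^2"
   by (simp add: distrib_right)
 qed
 also have "... = integral {t..} (%x. (g' x)^2 + ddpot (kk a b x) * (g x)^2) + 168 * ze * X"
  unfolding X_def
  by (subst HK_add)
   (auto intro!: integrable_add sqint_int G abs_int_imp[OF bT] integrable_on_mult_right Henstock_Kurzweil_Integration.integral_mult_right)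
 finally have main: "R + integral {t..} D <= integral {t..} (%x. (g' x)^2 + ddpot (kk a b x) * (g x)^2) + 168 * ze * X" .
 have "R >= 0" unfolding R_def by (rule sqint_nonneg[OF sro])
 have "(X + Y) / 3000 - (g a)^2 <= R"
 proof -
  have "X + Y <= 3000 * (R + (g a)^2)" using hardy Y \<open>R >= 0\<close> zero_le_power2[of "g a"] by (smt (verit))
  hence "(X + Y) / 3000 <= R + (g a)^2" by (simp only: divide_le_eq) simp
  thus ?thesis by linarith
 qed
 thus ?thesis using main Dlow unfolding X_def[symmetric] Y_def[symmetric] by linarith
qed

lemma kk_reflect: "kk (- b) (- a) (- x) = - kk a b x"
 unfolding kk_def kink10_eq by simp

lemma ddpot_even: "ddpot (- u) = ddpot u"
 by (simp add: ddpot_def)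

text \<open>The minimum over an interval is at most the mean, so a long interval contains a point at
  which cutting the line costs little.\<close>

lemma small_point:
 assumes g: "sqint UNIV g" "cont g" and "c < d"
 obtains t where "c <= t" "t <= d" "(g t)^2 * (d - c) <= intR (%x. (g x)^2)"
proof -
 have "continuous_on {c..d} (%x. (g x)^2)"
  by (intro continuous_intros continuous_on_subset[OF g(2)]) auto
 then obtain t where t: "t \<in> {c..d}" "!!x. x \<in> {c..d} ==> (g t)^2 <= (g x)^2"
  using continuous_attains_inf[of "{c..d}" "%x. (g x)^2"] \<open>c < d\<close> by auto
 have s: "sqint {c..d} g" using g(1) by (rule sqint_subset) auto
 have "(g t)^2 * (d - c) = integral {c..d} (%x. (g t)^2)" using \<open>c < d\<close> by simp
 also have "... <= integral {c..d} (%x. (g x)^2)"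
  by (intro integral_le sqint_int[OF s]) (use t in auto)
 also have "... <= intR (%x. (g x)^2)"
  using sqint_int[OF s] sqint_int[OF g(1)] by (intro integral_subset_le) auto
 finally show ?thesis using that t(1) by auto
qed

text \<open>Cut at a point of the middle third where \<open>g\<close> is small and apply the
  one-kink estimate on both sides. Boundary terms and the influence of the farther kink each cost at
  most 1/12000, so half of the constant 1/3000 survives.\<close>

lemma coercive:
 assumes g: "H1r g g'" and z: "a - b >= 10^7"
 shows "H1sq g g' / 6000 - (g a)^2 - (g b)^2
  <= intR (%x. (g' x)^2 + ddpot (kk a b x) * (g x)^2)"
proof -
 define z where "z = a - b"
 define ze where "ze = exp (- sqrt 2 * (z / 3))"
 have zb: "z >= 10^7" using z by (simp add: z_def)
 have G: "AC g g'" "sqint UNIV g" "sqint UNIV g'" using g by (auto simp: H1r_def)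
 obtain t where t: "b + z / 3 <= t" "t <= a - z / 3" "(g t)^2 * ((a - z / 3) - (b + z / 3)) <= intR (%x. (g x)^2)"
  using small_point[OF G(2) AC_cont[OF G(1)], of "b + z / 3" "a - z / 3"] zb by (auto simp: z_def field_simps)
 define X where "X = intR (%x. (g x)^2)"
 define Y where "Y = intR (%x. (g' x)^2)"
 have XY: "0 <= X" "0 <= Y" using sqint_nonneg G by (auto simp: X_def Y_def)
 have tz: "t <= a" "b <= t" using t zb by auto
 \<comment> \<open>With a distance of \<open>10^7\<close> the crude bound \<open>y <= exp y\<close>
   is enough.\<close>
 have zesmall: "168 * ze <= 1 / 12000"
 proof -
  define y where "y = sqrt 2 * (z / 3)"
  have "y >= 1 * (10^7 / 3)" unfolding y_def using zb sqrt2_bounds(1) by (intro mult_mono) auto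
  hence "3 * 10^6 <= y" by simp
  moreover have "y <= exp y" using exp_ge_add_one_self[of y] by linarith
  ultimately have "3 * 10^6 <= exp y" by (rule order_trans)
  hence "1 / exp y <= 1 / (3 * 10^6)" by (intro divide_left_mono) auto
  moreover have "ze = 1 / exp y" unfolding ze_def y_def mult_minus_left exp_minus by (simp only: inverse_eq_divide)
  ultimately show ?thesis by simp
 qed
 have gt: "4 * (g t)^2 <= X / 12000"
 proof -
  have "(g t)^2 * (z / 3) <= X" using t(3) by (simp add: X_def z_def field_simps)
  moreover have "(g t)^2 * 48000 <= (g t)^2 * (z / 3)" using zb by (intro mult_left_mono) auto
  ultimately show ?thesis by simp
 qed
 have kr: "abs (kink10 (x - b)) <= ze" if "x >= t" for x
 proof -
  have "z / 3 <= x - b" using that t(1) by simp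
  hence "sqrt 2 * (z / 3) <= sqrt 2 * (x - b)" by (intro mult_left_mono) auto
  hence "exp (- sqrt 2 * (x - b)) <= ze" unfolding ze_def by simp
  thus ?thesis using kink_abs_bounds(4)[of "x - b"] by linarith
 qed
 have kl: "abs (kink10 (x - (- a))) <= ze" if "x >= - t" for x
 proof -
  have "z / 3 <= x - (- a)" using that t(2) by simp
  hence "sqrt 2 * (z / 3) <= sqrt 2 * (x - (- a))" by (intro mult_left_mono) auto
  hence "exp (- sqrt 2 * (x - (- a))) <= ze" unfolding ze_def by simp
  thus ?thesis using kink_abs_bounds(4)[of "x - (- a)"] by linarith
 qed
 define q where "q x = (g' x)^2 + ddpot (kk a b x) * (g x)^2" for x
 have gi: "(%x. (g x)^2) abs_int_on UNIV" "(%x. (g' x)^2) abs_int_on UNIV"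
  using G by (auto simp: sqint_def)
 have qi: "q abs_int_on UNIV"
 proof -
  have "sqint UNIV (%x. ddpot (kk a b x) * g x)"
   by (rule sqint_bdd_mult[OF G(2), of _ 56])
   (auto intro!: ddpot_bound kink_abs_bounds continuous_meas continuous_intros)
  from sqint_mult[OF this G(2)] have "(%x. ddpot (kk a b x) * (g x)^2) abs_int_on UNIV"
   by (simp add: power2_eq_square mult.assoc)
  from set_integral_add(1)[OF gi(2) this] show ?thesis by (simp add: q_def[abs_def])
 qed
 define Xr Yr Xl Yl where "Xr = integral {t..} (%x. (g x)^2)" "Yr = integral {t..} (%x. (g' x)^2)"
  "Xl = integral {..t} (%x. (g x)^2)" "Yl = integral {..t} (%x. (g' x)^2)"
 have X: "X = Xl + Xr" and Y: "Y = Yl + Yr"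
  unfolding X_def Y_def Xr_Yr_Xl_Yl_def using split_UNIV gi by auto
 have right: "(Xr + Yr) / 3000 - (g a)^2 - 2 * (g t)^2 - 168 * ze * Xr <= integral {t..} q"
  unfolding Xr_Yr_Xl_Yl_def q_def[abs_def] by (rule coercive_right[OF g tz(1) kr])
 have left: "(Xl + Yl) / 3000 - (g b)^2 - 2 * (g t)^2 - 168 * ze * Xl <= integral {..t} q"
 proof -
  have "- t <= - b" using tz(2) by simp
  from coercive_right[OF H1r_reflect(1)[OF g] this kl]
  have "(integral {-t..} (%x. (g (- x))^2) + integral {-t..} (%x. (g' (- x))^2)) / 3000
   - (g b)^2 - 2 * (g t)^2 - 168 * ze * integral {-t..} (%x. (g (- x))^2)
   <= integral {-t..} (%x. (g' (- x))^2 + ddpot (kk (- b) (- a) x) * (g (- x))^2)" by simp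
  moreover have "integral {-t..} (%x. (g (- x))^2) = Xl" "integral {-t..} (%x. (g' (- x))^2) = Yl"
   unfolding Xr_Yr_Xl_Yl_def
   using reflect_half(2)[where f = "%x. (g x)^2"] reflect_half(2)[where f = "%x. (g' x)^2"]
   abs_int_subset[OF gi(1), of "{..t}"] abs_int_subset[OF gi(2), of "{..t}"] by auto
  moreover have "(%x. (g' (- x))^2 + ddpot (kk (- b) (- a) x) * (g (- x))^2) = (%x. q (- x))"
  proof
   fix x
   have "kk (- b) (- a) x = - kk a b (- x)" using kk_reflect[of b a "- x"] by simp
   thus "(g' (- x))^2 + ddpot (kk (- b) (- a) x) * (g (- x))^2 = q (- x)" by (simp add: q_def ddpot_even)
  qed
  moreover have "integral {-t..} (%x. q (- x)) = integral {..t} q"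
   by (rule reflect_half(2)[OF abs_int_subset[OF qi]]) auto
  ultimately show ?thesis by simp
 qed
 have tot: "intR q = integral {..t} q + integral {t..} q" by (rule split_UNIV[OF qi])
 have "168 * ze * X <= 1 / 12000 * X" using zesmall XY(1) by (rule mult_right_mono)
 moreover have "168 * ze * X = 168 * ze * Xl + 168 * ze * Xr" unfolding X by (rule distrib_left)
 moreover have "H1sq g g' = X + Y" by (simp add: H1sq_def X_def Y_def)
 ultimately have "H1sq g g' / 6000 - (g a)^2 - (g b)^2 <= intR q"
  using left right gt XY X Y unfolding tot by (simp add: field_simps)
 thus ?thesis by (simp add: q_def[abs_def])
qed

section \<open>The stationary estimate\<close>

text \<open>The remainder is an explicit polynomial times \<open>g^2\<close>, and 188 is the sum of
  the absolute values of its coefficients; 250 exceeds \<open>56 + 188\<close>.\<close>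

lemma dpot_taylor:
 assumes "abs T <= 1" "abs g <= 1"
 shows "abs (dpot (T + g) - dpot T - ddpot T * g) <= 188 * g^2" "abs (dpot (T + g) - dpot T) <= 250 * abs g"
proof -
 define r where "r = - 24 * T + 60 * T ^ 3 + g * (- 8 + 60 * T^2) + 30 * T * g^2 + 6 * g ^ 3"
 have e: "dpot (T + g) - dpot T - ddpot T * g = r * g^2"
  unfolding dpot_def ddpot_def r_def by (simp add: eval_nat_numeral algebra_simps)
 have b: "abs (T ^ 3) <= 1" "abs (g ^ 3) <= 1" "abs (T * g^2) <= 1" "abs (g * T^2) <= 1"
  unfolding abs_mult power_abs by (intro mult_le_one power_le_one; use assms in simp)+
 have "r = - 24 * T + 60 * T ^ 3 - 8 * g + 60 * (g * T^2) + 30 * (T * g^2) + 6 * g ^ 3"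
  unfolding r_def by (simp add: algebra_simps)
 hence "r <= 188" "- r <= 188"
  using b[THEN abs_le_D1] b[THEN abs_le_D2] assms[THEN abs_le_D1] assms[THEN abs_le_D2] by linarith+
 hence r: "abs r <= 188" by (rule abs_leI)
 show t: "abs (dpot (T + g) - dpot T - ddpot T * g) <= 188 * g^2"
  unfolding e abs_mult using r by (auto intro: mult_right_mono)
 have "abs g * abs g <= 1 * abs g" by (rule mult_right_mono[OF assms(2)]) simp
 hence "g^2 <= abs g" by (simp add: power2_eq_square)
 moreover have "abs (ddpot T * g) <= 56 * abs g" unfolding abs_mult using ddpot_bound[OF assms(1)] by (rule mult_right_mono) simp
 ultimately show "abs (dpot (T + g) - dpot T) <= 250 * abs g" using t by linarith
qed

lemma interaction_formula:
 "dpot (A + B) - dpot A - dpot B = (A * B) * (A + B) * (30 * (A^2 + A * B + B^2) - 24)"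
 unfolding dpot_def by (simp add: eval_nat_numeral algebra_simps)

text \<open>The defect is \<open>A * B * (A + B)\<close> times a factor bounded by
  \<open>114 = 30 * 3 + 24\<close>, and the product of the kinks is at most \<open>Z\<close>
  everywhere. In \<open>A^2 * B\<close> the decay away from \<open>a\<close> comes from
  \<open>A\<close> to the left of \<open>a\<close> and from \<open>B\<close> to its right;
  symmetrically for \<open>A * B^2\<close>.\<close>

lemma kink_interaction:
 fixes a b x :: real
 defines "A \<equiv> kink01 (x - a)" and "B \<equiv> kink10 (x - b)" and "Z \<equiv> exp (- sqrt 2 * (a - b))"
 shows "abs (dpot (A + B) - dpot A - dpot B) <= 114 * Z * exp (- sqrt 2 * abs (x - a)) + 114 * Z * exp (- sqrt 2 * abs (x - b))"
proof -
 have A: "0 <= A" "A <= 1" "A <= exp (sqrt 2 * (x - a))"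
  unfolding A_def using kink01_pos kink01_less_1 kink01_le_exp by (auto intro: less_imp_le)
 have B: "abs B <= 1" "abs B <= exp (sqrt 2 * (b - x))"
  unfolding B_def using kink_abs_bounds(2) kink_abs_bounds(4)[of "x - b"] by (auto simp: algebra_simps)
 have AB: "A * abs B <= Z"
 proof -
  have "A * abs B <= exp (sqrt 2 * (x - a)) * exp (sqrt 2 * (b - x))" using A B by (intro mult_mono) auto
  also have "... = Z" unfolding Z_def mult_exp_exp by (simp add: algebra_simps)
  finally show ?thesis .
 qed
 have Z: "Z >= 0" by (simp add: Z_def)
 have P1: "A * abs B * A <= Z * exp (- sqrt 2 * abs (x - a))"
 proof (cases "x <= a")
  case True
  hence "A <= exp (- sqrt 2 * abs (x - a))" using A(3) by (simp add: right_diff_distrib)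
  thus ?thesis using AB A Z by (intro mult_mono) auto
 next
  case False
  have "A * abs B * A <= 1 * abs B * 1" using A by (intro mult_mono) auto
  also have "... <= exp (sqrt 2 * (b - x))" using B by simp
  also have "... = Z * exp (- sqrt 2 * abs (x - a))" unfolding Z_def mult_exp_exp using False by (simp add: algebra_simps)
  finally show ?thesis .
 qed
 have P2: "A * abs B * abs B <= Z * exp (- sqrt 2 * abs (x - b))"
 proof (cases "b <= x")
  case True
  hence "abs B <= exp (- sqrt 2 * abs (x - b))" using B(2) by (simp add: algebra_simps)
  thus ?thesis using AB A Z by (intro mult_mono) auto
 next
  case False
  have "A * abs B * abs B <= A * 1 * 1" using A B by (intro mult_mono) auto
  also have "... <= exp (sqrt 2 * (x - a))" using A by simp
  also have "... = Z * exp (- sqrt 2 * abs (x - b))" unfolding Z_def mult_exp_exp using False by (simp add: algebra_simps)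
  finally show ?thesis .
 qed
 have q: "abs (30 * (A^2 + A * B + B^2) - 24) <= 114"
 proof -
  have a1: "abs A <= 1" using A by simp
  have "abs (A * A) <= 1" "abs (A * B) <= 1" "abs (B * B) <= 1"
   using mult_mono[OF a1 a1] mult_mono[OF a1 B(1)] mult_mono[OF B(1) B(1)] unfolding abs_mult by linarith+
  moreover have "30 * (A^2 + A * B + B^2) = 30 * (A * A) + 30 * (A * B) + 30 * (B * B)" by (simp add: power2_eq_square algebra_simps)
  ultimately show ?thesis by linarith
 qed
 have "abs (dpot (A + B) - dpot A - dpot B) = (A * abs B) * abs (A + B) * abs (30 * (A^2 + A * B + B^2) - 24)"
  unfolding interaction_formula using A(1) by (simp add: abs_mult)
 also have "... <= (A * abs B) * (A + abs B) * 114"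
  using A B q by (intro mult_mono) auto
 also have "... = 114 * (A * abs B * A) + 114 * (A * abs B * abs B)" by (simp add: algebra_simps)
 also have "... <= 114 * (Z * exp (- sqrt 2 * abs (x - a))) + 114 * (Z * exp (- sqrt 2 * abs (x - b)))"
  using P1 P2 by linarith
 finally show ?thesis by (simp add: mult.assoc)
qed

lemma dpot_kink_deriv: "AC (%x. dk01 (x - a)) (%x. dpot (kink01 (x - a)))"
  "AC (%x. dk10 (x - b)) (%x. dpot (kink10 (x - b)))"
proof -
 have eq: "dk01 x * (sqrt 2 * (1 - 3 * (kink01 x)^2)) = dpot (kink01 x)" for x
 proof -
  have "dk01 x * (sqrt 2 * (1 - 3 * (kink01 x)^2)) = (sqrt 2 * sqrt 2) * (kink01 x * (1 - (kink01 x)^2) * (1 - 3 * (kink01 x)^2))"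
   unfolding dk01_def by (simp only: ac_simps)
  thus ?thesis unfolding dpot_def by (simp add: eval_nat_numeral algebra_simps)
 qed
 have A: "AC dk01 (%x. dpot (kink01 x))"
  using dk01_DERIV unfolding eq by (rule AC_C1) (intro continuous_intros)
 show "AC (%x. dk01 (x - a)) (%x. dpot (kink01 (x - a)))"
  using AC_shift[OF A, of "- a"] by simp
 have "AC (%x. dk01 (- x)) (%x. - dpot (kink01 (- x)))" by (rule AC_reflect[OF A])
 moreover have "- dpot (kink01 (- x)) = dpot (kink10 x)" for x by (simp add: kink10_eq dpot_def)
 ultimately have "AC dk10 (%x. dpot (kink10 x))" by (simp add: dk10_def[abs_def])
 from AC_shift[OF this, of "- b"] show "AC (%x. dk10 (x - b)) (%x. dpot (kink10 (x - b)))" by simp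
qed

lemma pot_le: "abs g <= 1 ==> pot g <= g^2"
proof -
 assume "abs g <= 1"
 hence g2: "g^2 <= 1" by (simp add: abs_square_le_1)
 hence "(1 - g^2)^2 <= 1" by (intro power_le_one) auto
 hence "g^2 * (1 - g^2)^2 <= g^2 * 1" by (intro mult_left_mono) auto
 thus ?thesis by (simp add: pot_def)
qed

text \<open>Here \<open>f\<close> is \<open>u'' - dpot u\<close>, which for a solution is the second time derivative.\<close>

locale stationary =
 fixes u v f :: "real => real" and a b :: real
 assumes H: "admis u v"
  and E: "intR (edens u v) <= 1"
  and f: "sqint UNIV f" and eq: "AC v (%x. f x + dpot (u x))"
begin

definition "Z = exp (- sqrt 2 * (a - b))"
definition "g = gap u a b"
definition "g' = gap' v a b"
definition "N2 = H1sq g g'"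
definition "F2 = intR (%x. (f x)^2)"
definition "interact x = dpot (kk a b x) - dpot (kink01 (x - a)) - dpot (kink10 (x - b))"
text \<open>The second derivative of \<open>g\<close>, sorted into the source, the change of the
  nonlinearity, and the defect by which the sum of two kinks fails to be stationary.\<close>

definition "G2 x = f x + (dpot (u x) - dpot (kk a b x)) + interact x"

lemma G: "H1r g g'" "AC g g'" "sqint UNIV g" "sqint UNIV g'"
 using gap_H1[OF H, of a b] by (auto simp: g_def g'_def H1r_def)

lemma g_eq: "u x = kk a b x + g x"
 by (simp add: g_def gap_def kk_def)

lemma N2_nonneg: "0 <= N2" unfolding N2_def by (rule H1sq_nonneg[OF G(1)])

lemma F2_nonneg: "0 <= F2" unfolding F2_def by (rule sqint_nonneg[OF f])

lemma g_sup: "(g x)^2 <= N2" unfolding N2_def by (rule H1r_sobolev[OF G(1)])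

lemma interact_sq: "sqint UNIV interact" "intR (%x. (interact x)^2) <= (230 * Z)^2"
proof -
 define e where "e c x = (114 * Z) * exp (- sqrt 2 * abs (x - c))" for c x
 have e: "sqint UNIV (e c)" "intR (%x. (e c x)^2) <= (114 * Z)^2" for c
  unfolding e_def[abs_def] by (rule exp_weight_sq)+
 have b: "abs (interact x) <= e a x + e b x" for x
  using kink_interaction[of x a b] by (simp add: interact_def e_def Z_def kk_def)
 have sq: "(interact x)^2 <= (e a x + e b x)^2" for x
  using power_mono[OF b[of x] abs_ge_zero, of 2] by simp
 have s: "sqint UNIV (%x. e a x + e b x)" by (rule sqint_add[OF e(1) e(1)]) simp
 show i: "sqint UNIV interact"
  by (rule sqint_dom[OF _ _ sqint_int[OF s] sq]) (auto simp: interact_def[abs_def] intro!: continuous_meas continuous_intros)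
 have "intR (%x. (interact x)^2) <= intR (%x. (e a x + e b x)^2)"
  by (rule integral_le[OF sqint_int[OF i] sqint_int[OF s] sq])
 also have "... <= 2 * (114 * Z)^2 + 2 * (114 * Z)^2"
  using integral_square_add_le[OF e(1) e(1), of a b] e(2)[of a] e(2)[of b] by simp
 also have "... <= (230 * Z)^2" by (simp add: power_mult_distrib)
 finally show "intR (%x. (interact x)^2) <= (230 * Z)^2" .
qed

lemma g'_AC: "AC g' G2"
proof -
 have "AC (%x. v x - dk01 (x - a) - dk10 (x - b))
  (%x. (f x + dpot (u x)) - dpot (kink01 (x - a)) - dpot (kink10 (x - b)))"
  by (intro AC_diff eq dpot_kink_deriv)
 moreover have "(%x. (f x + dpot (u x)) - dpot (kink01 (x - a)) - dpot (kink10 (x - b))) = G2"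
  by (auto simp: G2_def interact_def)
 ultimately show ?thesis by (simp add: g'_def gap'_def[abs_def])
qed

lemma v_norm: "intR (%x. (v x)^2) <= 2"
proof -
 note ei = S_edens_int[OF H]
 have "intR (%x. (v x)^2) <= intR (%x. 2 * edens u v x)"
  by (rule integral_le[OF sqint_int[OF S_v[OF H]] integrable_on_mult_right[OF abs_int_imp[OF ei]]])
   (simp add: edens_def pot_nonneg)
 also have "... = 2 * intR (edens u v)" by (rule Henstock_Kurzweil_Integration.integral_mult_right)
 finally show ?thesis using E by simp
qed

context
 assumes N1: "N2 <= 1"
begin

lemma g1: "abs (g x) <= 1"
 using g_sup[of x] N1 by (simp add: abs_square_le_1[symmetric])

lemma rem_sq: "sqint UNIV (%x. dpot (u x) - dpot (kk a b x))"
 "intR (%x. (dpot (u x) - dpot (kk a b x))^2) <= 250^2 * N2"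
proof -
 have cu: "cont u" by (rule AC_cont[OF S_AC[OF H]])
 have b: "(dpot (u x) - dpot (kk a b x))^2 <= 250^2 * (g x)^2" for x
 proof -
  have "abs (dpot (kk a b x + g x) - dpot (kk a b x)) <= 250 * abs (g x)"
   by (rule dpot_taylor(2)[OF kink_abs_bounds(3) g1])
  hence "abs (dpot (u x) - dpot (kk a b x)) <= 250 * abs (g x)" by (simp only: g_eq[symmetric])
  from power_mono[OF this abs_ge_zero, of 2] show ?thesis by (simp add: power_mult_distrib)
 qed
 have i: "(%x. 250^2 * (g x)^2) integrable_on UNIV" by (rule integrable_on_mult_right[OF sqint_int[OF G(3)]])
 show s: "sqint UNIV (%x. dpot (u x) - dpot (kk a b x))"
  by (rule sqint_dom[OF _ _ i b]) (auto intro!: continuous_meas continuous_intros cu)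
 have "intR (%x. (dpot (u x) - dpot (kk a b x))^2) <= intR (%x. 250^2 * (g x)^2)"
  by (rule integral_le[OF sqint_int[OF s] i b])
 also have "... = 250^2 * intR (%x. (g x)^2)" by (rule Henstock_Kurzweil_Integration.integral_mult_right)
 also have "... <= 250^2 * N2" unfolding N2_def H1sq_def using sqint_nonneg[OF G(4)] by simp
 finally show "intR (%x. (dpot (u x) - dpot (kk a b x))^2) <= 250^2 * N2" .
qed

lemma G2_sq: "sqint UNIV G2" "intR (%x. (G2 x)^2) <= 4 * F2 + 4 * (250^2 * N2) + 2 * (230 * Z)^2"
proof -
 have s1: "sqint UNIV (%x. f x + (dpot (u x) - dpot (kk a b x)))" by (rule sqint_add[OF f rem_sq(1)]) simp
 show "sqint UNIV G2" unfolding G2_def[abs_def] by (rule sqint_add[OF s1 interact_sq(1)]) simp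
 have "intR (%x. (f x + (dpot (u x) - dpot (kk a b x)))^2) <= 2 * F2 + 2 * (250^2 * N2)"
  using integral_square_add_le[OF f rem_sq(1)] rem_sq(2) by (simp add: F2_def)
 moreover have "intR (%x. (G2 x)^2) <= 2 * intR (%x. (f x + (dpot (u x) - dpot (kk a b x)))^2) + 2 * intR (%x. (interact x)^2)"
  unfolding G2_def by (rule integral_square_add_le[OF s1 interact_sq(1)]) simp
 ultimately show "intR (%x. (G2 x)^2) <= 4 * F2 + 4 * (250^2 * N2) + 2 * (230 * Z)^2"
  using interact_sq(2) by linarith
qed

text \<open>The weight 1/48000 keeps all terms that are absorbed into \<open>N2\<close> below the
  coercivity constant 1/6000.\<close>

lemma young_pair: "- (intR (%x. g x * k x)) <= N2 / 48000 + 12000 * intR (%x. (k x)^2)"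
 if k: "sqint UNIV k" for k
proof -
 have i: "(%x. g x * k x) abs_int_on UNIV" by (rule sqint_mult[OF G(3) k]) simp
 have "intR (%x. - (g x * k x)) <= intR (%x. (1 / 48000) * (g x)^2 + 12000 * (k x)^2)"
 proof (rule integral_le[OF _ integral_lin2(1)[OF sqint_int[OF G(3)] sqint_int[OF k]]])
  show "(%x. - (g x * k x)) integrable_on UNIV" using abs_int_imp[OF abs_int_minus[OF i]] .
  fix x
  have "0 <= (g x + 24000 * k x)^2" by simp
  thus "- (g x * k x) <= (1 / 48000) * (g x)^2 + 12000 * (k x)^2"
   by (simp add: power2_sum power_mult_distrib)
 qed
 also have "... = (1 / 48000) * intR (%x. (g x)^2) + 12000 * intR (%x. (k x)^2)"
  by (rule integral_lin2(2)[OF sqint_int[OF G(3)] sqint_int[OF k]])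
 also have "... <= N2 / 48000 + 12000 * intR (%x. (k x)^2)"
  unfolding N2_def H1sq_def using sqint_nonneg[OF G(4)] by simp
 finally show ?thesis by simp
qed

text \<open>Test the equation for \<open>g''\<close> with \<open>g\<close> itself. The Taylor
  remainder contributes a cubic term, and \<open>188 / 10^7 <= 1 / 48000\<close> lets the smallness
  of \<open>g\<close> absorb it.\<close>

lemma energy_identity:
 assumes small: "N2 <= (1 / 10^7)^2"
 shows "intR (%x. (g' x)^2 + ddpot (kk a b x) * (g x)^2)
  <= N2 / 24000 + 12000 * F2 + 12000 * (230 * Z)^2 + N2 / 48000"
proof -
 have gs: "abs (g x) <= 1 / 10^7" for x
 proof -
  have "(g x)^2 <= (1 / 10^7)^2" using g_sup[of x] small by linarith
  thus ?thesis by (metis abs_le_square_iff abs_of_nonneg zero_le_divide_1_iff zero_le_numeral zero_le_power)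
 qed
 have gg: "(%x. g x * g' x) abs_int_on UNIV" by (rule sqint_mult[OF G(3,4)]) simp
 have d1: "(%x. g' x * g' x) abs_int_on UNIV" "(%x. g x * G2 x) abs_int_on UNIV"
  by (auto intro!: sqint_mult G G2_sq)
 have zero: "intR (%x. g' x * g' x + g x * G2 x) = 0"
  by (rule AC_whole[OF AC_mult[OF G(2) g'_AC] gg set_integral_add(1)[OF d1]])
 have gf: "(%x. g x * f x) abs_int_on UNIV" by (rule sqint_mult[OF G(3) f]) simp
 have gI: "(%x. g x * interact x) abs_int_on UNIV" by (rule sqint_mult[OF G(3) interact_sq(1)]) simp
 have g2: "(%x. (g x)^2) abs_int_on UNIV" using G(3) by (simp add: sqint_def)
 have qi: "(%x. (g' x)^2 + ddpot (kk a b x) * (g x)^2) abs_int_on UNIV"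
 proof (rule set_integral_add(1))
  show "(%x. (g' x)^2) abs_int_on UNIV" using G(4) by (simp add: sqint_def)
  have "sqint UNIV (%x. ddpot (kk a b x) * g x)"
   by (rule sqint_bdd_mult[OF G(3), of _ 56]) (auto intro!: ddpot_bound kink_abs_bounds continuous_meas continuous_intros)
  from sqint_mult[OF this G(3)] show "(%x. ddpot (kk a b x) * (g x)^2) abs_int_on UNIV"
   by (simp add: power2_eq_square mult.assoc)
 qed
 let ?R = "%x. (g' x * g' x + g x * G2 x) + ((- (g x * f x) + - (g x * interact x)) + (1 / 48000) * (g x)^2)"
 have Ri: "(%x. (- (g x * f x) + - (g x * interact x)) + (1 / 48000) * (g x)^2) abs_int_on UNIV"
  by (intro set_integral_add(1) abs_int_minus gf gI set_integrable_mult_right g2)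
 have "intR (%x. (g' x)^2 + ddpot (kk a b x) * (g x)^2) <= intR ?R"
 proof (rule integral_le[OF abs_int_imp[OF qi] abs_int_imp])
  show "?R abs_int_on UNIV" by (intro set_integral_add(1) d1 Ri)
  fix x
  define t where "t = dpot (u x) - dpot (kk a b x) - ddpot (kk a b x) * g x"
  have "abs (dpot (kk a b x + g x) - dpot (kk a b x) - ddpot (kk a b x) * g x) <= 188 * (g x)^2"
   by (rule dpot_taylor(1)[OF kink_abs_bounds(3) g1])
  hence "abs t <= 188 * (g x)^2" unfolding t_def by (simp only: g_eq[symmetric])
  hence "abs (g x) * abs t <= (1 / 10^7) * (188 * (g x)^2)" using gs[of x] by (intro mult_mono) auto
  also have "... <= (1 / 48000) * (g x)^2" by simp
  finally have "- (g x * t) <= (1 / 48000) * (g x)^2" by (simp add: abs_le_iff flip: abs_mult)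
  moreover have "g x * G2 x = g x * f x + ddpot (kk a b x) * (g x)^2 + g x * t + g x * interact x"
   by (simp add: G2_def t_def algebra_simps power2_eq_square)
  moreover have "g' x * g' x = (g' x)^2" by (simp add: power2_eq_square)
  ultimately show "(g' x)^2 + ddpot (kk a b x) * (g x)^2 <= ?R x" by linarith
 qed
 also have "intR ?R = intR (%x. g' x * g' x + g x * G2 x)
   + intR (%x. (- (g x * f x) + - (g x * interact x)) + (1 / 48000) * (g x)^2)"
  by (intro HK_add abs_int_imp set_integral_add(1) d1 Ri)
 also have "intR (%x. (- (g x * f x) + - (g x * interact x)) + (1 / 48000) * (g x)^2)
  = - intR (%x. g x * f x) - intR (%x. g x * interact x) + (1 / 48000) * intR (%x. (g x)^2)"
 proof -
  have "((%x. (- (g x * f x) + - (g x * interact x)) + (1 / 48000) * (g x)^2) has_integral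
   (- intR (%x. g x * f x) + - intR (%x. g x * interact x)) + (1 / 48000) * intR (%x. (g x)^2)) UNIV"
   by (intro has_integral_add has_integral_neg has_integral_mult_right integrable_integral abs_int_imp gf gI g2)
  thus ?thesis by (simp add: integral_unique)
 qed
 also have "intR (%x. g' x * g' x + g x * G2 x) + (- intR (%x. g x * f x) - intR (%x. g x * interact x) + (1 / 48000) * intR (%x. (g x)^2))
  <= (N2 / 48000 + 12000 * F2) + (N2 / 48000 + 12000 * (230 * Z)^2) + N2 / 48000"
 proof -
  have "intR (%x. (g x)^2) <= N2" unfolding N2_def H1sq_def using sqint_nonneg[OF G(4)] by simp
  thus ?thesis unfolding zero using young_pair[OF f] young_pair[OF interact_sq(1)] interact_sq(2) unfolding F2_def by linarith
 qed
 finally show ?thesis by simp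
qed

end

text \<open>Coercivity from below meets the tested equation from above, and
  \<open>1/6000 - 1/24000 - 1/48000\<close> exceeds \<open>1/10000\<close>. The values at the
  centres are of order \<open>Z\<close>, so only \<open>F2\<close> and \<open>Z^2\<close>
  remain.\<close>

lemma N_bound:
 assumes "a - b >= 10^7" "N2 <= (1 / 10^7)^2" "(g a)^2 <= 4 * Z^2" "(g b)^2 <= 4 * Z^2"
 shows "N2 <= 10^14 * (F2 + Z^2)"
proof -
 have "(1 / 10^7)^2 <= (1::real)" by (rule power_le_one) auto
 hence N1: "N2 <= 1" using assms(2) by linarith
 have "N2 / 6000 - (g a)^2 - (g b)^2 <= N2 / 24000 + 12000 * F2 + 12000 * (230 * Z)^2 + N2 / 48000"
  using coercive[OF G(1) assms(1)] energy_identity[OF N1 assms(2)] by (simp add: N2_def)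
 moreover have "(230 * Z)^2 = 52900 * Z^2" by (simp add: power_mult_distrib)
 ultimately have "N2 / 10000 <= 12000 * F2 + 1000000000 * Z^2"
  using assms(3,4) N2_nonneg zero_le_power2[of Z] by linarith
 hence "N2 <= 120000000 * F2 + 10000000000000 * Z^2" by linarith
 hence "N2 <= 100000000000000 * F2 + 100000000000000 * Z^2" using F2_nonneg zero_le_power2[of Z] by linarith
 thus ?thesis by simp
qed

text \<open>Without source, \<open>v^2 / 2 - pot u\<close> is a first integral that vanishes at
  infinity. With source its value at \<open>m\<close> is minus the integral of \<open>v * f\<close>
  over \<open>{m..}\<close>, bounded by Cauchy-Schwarz and \<open>v_norm\<close>.\<close>

lemma pointwise_identity: "(v m)^2 / 2 <= pot (u m) + 2 * sqrt F2"
proof -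
 have A: "AC (%x. (1/2) * (v x)^2 - pot (u x)) (%x. (1/2) * (2 * v x * (f x + dpot (u x))) - dpot (u x) * v x)"
  by (intro AC_diff AC_cmult AC_square eq AC_chain[OF S_AC[OF H] DERIV_pot] continuous_intros continuous_on_id)
 have sv: "sqint UNIV v" by (rule S_v[OF H])
 have svm: "sqint {m..} v" "sqint {m..} f" using sqint_subset[OF sv] sqint_subset[OF f] by auto
 have vf: "(%x. v x * f x) abs_int_on {m..}" by (rule sqint_mult[OF svm]) simp
 have e: "edens u v abs_int_on {m..}" by (rule abs_int_subset[OF S_edens_int[OF H]]) auto
 have v2: "(%x. (v x)^2) abs_int_on {m..}" using svm(1) by (simp add: sqint_def)
 have i: "(%x. (1/2) * (v x)^2 - pot (u x)) abs_int_on {m..}"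
  using set_integral_diff(1)[OF v2 e] by (simp add: edens_def[abs_def] field_simps)
 have d: "(%x. (1/2) * (2 * v x * (f x + dpot (u x))) - dpot (u x) * v x) = (%x. v x * f x)"
  by (auto simp: algebra_simps)
 have I: "integral {m..} (%x. v x * f x) = - ((1/2) * (v m)^2 - pot (u m))"
  using AC_half(1)[OF A i] vf unfolding d by blast
 have "(integral {m..} (%x. v x * f x))^2 <= integral {m..} (%x. (v x)^2) * integral {m..} (%x. (f x)^2)"
  by (rule Cauchy_Schwarz_integral[OF svm]) simp
 also have "... <= 2 * F2"
 proof (rule mult_mono)
  have "integral {m..} (%x. (v x)^2) <= intR (%x. (v x)^2)"
   using sqint_int[OF svm(1)] sqint_int[OF sv] by (intro integral_subset_le) auto
  thus "integral {m..} (%x. (v x)^2) <= 2" using v_norm by linarith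
  show "integral {m..} (%x. (f x)^2) <= F2" unfolding F2_def
   using sqint_int[OF svm(2)] sqint_int[OF f] by (intro integral_subset_le) auto
 qed (use sqint_nonneg svm in auto)
 also have "... <= (2 * sqrt F2)^2" using F2_nonneg by (simp add: power_mult_distrib)
 finally have "abs (integral {m..} (%x. v x * f x)) <= 2 * sqrt F2"
  using F2_nonneg by (metis abs_le_square_iff abs_of_nonneg mult_nonneg_nonneg real_sqrt_ge_zero zero_le_numeral)
 thus ?thesis using I by linarith
qed

text \<open>At the midpoint the kinks cancel in value, so \<open>u m = g m\<close>, while their
  slopes add up to \<open>2 * k\<close> and \<open>Z <= (2 * k)^2\<close>. Since
  \<open>v m = 2 * k + g' m\<close>, the first integral bounds \<open>Z\<close> by \<open>N2\<close>
  and the first power of \<open>sqrt F2\<close>, up to small terms, and \<open>N2\<close> is itself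
  bounded by \<open>F2 + Z^2\<close>.\<close>

lemma Z_bound:
 assumes "a - b >= 10^7" "Z <= 1 / 10^24" "N2 <= (1 / 10^7)^2" "(g a)^2 <= 4 * Z^2" "(g b)^2 <= 4 * Z^2" "F2 <= 1"
 shows "Z <= 10^22 * sqrt F2"
proof -
 define m where "m = (a + b) / 2"
 define s where "s = (a - b) / 2"
 have "(1 / 10^7)^2 <= (1::real)" by (rule power_le_one) auto
 hence N1: "N2 <= 1" using assms(3) by linarith
 have N: "N2 <= 10^14 * (F2 + Z^2)" by (rule N_bound[OF assms(1,3,4,5)])
 have ms: "m - a = - s" "m - b = s" by (auto simp: m_def s_def field_simps)
 have "kk a b m = 0" unfolding kk_def ms kink10_eq by simp
 hence um: "u m = g m" using g_eq[of m] by linarith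
 have "(g' m)^2 <= integral {m..} (%x. (g' x)^2) + integral {m..} (%x. (G2 x)^2)"
  using sobolev_half(1)[OF g'_AC] sqint_subset[OF G(4), of "{m..}"] sqint_subset[OF G2_sq(1)[OF N1], of "{m..}"] by auto
 also have "... <= intR (%x. (g' x)^2) + intR (%x. (G2 x)^2)"
  using sqint_int G(4) G2_sq(1)[OF N1] sqint_subset[OF G(4), of "{m..}"] sqint_subset[OF G2_sq(1)[OF N1], of "{m..}"]
  by (intro add_mono integral_subset_le) auto
 also have "intR (%x. (g' x)^2) <= N2" unfolding N2_def H1sq_def using sqint_nonneg[OF G(3)] by simp
 finally have "(g' m)^2 <= N2 + intR (%x. (G2 x)^2)" by simp
 note gm = this
 have g'm: "(g' m)^2 <= 300000 * N2 + 4 * F2 + 110000 * Z^2"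
 proof -
  have "intR (%x. (G2 x)^2) <= 4 * F2 + 250000 * N2 + 105800 * Z^2"
   using G2_sq(2)[OF N1] by (simp add: power_mult_distrib)
  with gm show ?thesis using N2_nonneg zero_le_power2[of Z] by linarith
 qed
 have vm: "(v m)^2 <= 2 * N2 + 4 * sqrt F2"
  using pointwise_identity[of m] pot_le[OF g1[OF N1], of m] g_sup[of m] unfolding um by linarith
 define k where "k = dk01 (- s)"
 have vk: "2 * k = v m - g' m"
  unfolding g'_def gap'_def ms dk10_def k_def by simp
 have kl: "exp (- sqrt 2 * s) <= 2 * k"
 proof -
  have s0: "- s <= 0" using assms(1) by (simp add: s_def)
  have h: "exp (sqrt 2 * - s) / sqrt 2 <= kink01 (- s)" by (rule kink01_ge_exp[OF s0])
  have "kink01 (- s) <= 1 / sqrt 2" using kink01_mono[OF s0] by (simp add: kink01_0)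
  hence "(kink01 (- s))^2 <= (1 / sqrt 2)^2" using kink01_pos[of "- s"] by (intro power_mono) auto
  hence "1/2 <= 1 - (kink01 (- s))^2" by (simp add: power_divide)
  hence "(sqrt 2 * (exp (sqrt 2 * - s) / sqrt 2)) * (1/2) <= (sqrt 2 * kink01 (- s)) * (1 - (kink01 (- s))^2)"
   using h by (intro mult_mono) (auto intro!: mult_nonneg_nonneg less_imp_le[OF kink01_pos])
  thus ?thesis by (simp add: k_def dk01_def)
 qed
 have "Z = (exp (- sqrt 2 * s))^2" unfolding Z_def s_def exp_double[symmetric] by simp
 also have "... <= (2 * k)^2" using kl by (intro power_mono) auto
 also have "... <= 2 * (v m)^2 + 2 * (g' m)^2" unfolding vk by (rule square_diff_le)
 finally have Z1: "Z <= 4 * N2 + 8 * sqrt F2 + 600000 * N2 + 8 * F2 + 220000 * Z^2"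
  using g'm vm by linarith
 have Fs: "F2 <= sqrt F2"
 proof -
  have "sqrt F2 <= 1" using assms(6) by simp
  hence "sqrt F2 * sqrt F2 <= sqrt F2 * 1" using F2_nonneg by (intro mult_left_mono) auto
  thus ?thesis using F2_nonneg by simp
 qed
 have Zs: "Z^2 <= Z / 10^24"
 proof -
  have "Z * Z <= Z * (1 / 10^24)" using assms(2) by (intro mult_left_mono) (auto simp: Z_def)
  thus ?thesis by (simp add: power2_eq_square)
 qed
 \<comment> \<open>Smallness of \<open>Z\<close> has turned \<open>Z^2\<close> into
   \<open>Z / 10^24\<close>, whose contributions are absorbed on the left.\<close>
 have "Z <= 10^6 * (10^14 * (sqrt F2 + Z / 10^24)) + 16 * sqrt F2 + 220000 * (Z / 10^24)"
  using Z1 N Fs Zs N2_nonneg by simp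
 moreover have "Z >= 0" by (simp add: Z_def)
 moreover have "sqrt F2 >= 0" using F2_nonneg by simp
 moreover have "X <= 10^22 * S" if "X <= 10^6 * (10^14 * (S + X / 10^24)) + 16 * S + 220000 * (X / 10^24)" "X >= 0" "S >= 0" for X S :: real
  using that by (simp add: field_simps)
 ultimately show ?thesis by blast
qed

theorem stationary_estimate:
 assumes "a - b >= 10^7" "Z <= 1 / 10^24" "N2 <= (1 / 10^7)^2" "abs (g a) <= 2 * Z" "abs (g b) <= 2 * Z"
 shows "Z + sqrt N2 <= 10^30 * sqrt F2"
proof (cases "F2 <= 1")
 case True
 have sq: "(g a)^2 <= 4 * Z^2" "(g b)^2 <= 4 * Z^2"
  using power_mono[OF assms(4) abs_ge_zero, of 2] power_mono[OF assms(5) abs_ge_zero, of 2] by (auto simp: power_mult_distrib)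
 have z: "Z <= 10^22 * sqrt F2" by (rule Z_bound[OF assms(1-3) sq True])
 have Z0: "0 <= Z" by (simp add: Z_def)
 have "Z^2 <= (10^22 * sqrt F2)^2" using z Z0 by (intro power_mono) auto
 hence "Z^2 <= 10^44 * F2" using F2_nonneg by (simp add: power_mult_distrib)
 hence "N2 <= 10^14 * (F2 + 10^44 * F2)" using N_bound[OF assms(1,3) sq] by simp
 also have "... <= (4 * 10^29 * sqrt F2)^2" using F2_nonneg by (simp add: power_mult_distrib)
 finally have "sqrt N2 <= 4 * 10^29 * sqrt F2" using F2_nonneg by (intro real_le_lsqrt) auto
 moreover have "sqrt F2 >= 0" using F2_nonneg by simp
 moreover have "X + Y <= 10^30 * S" if "Y <= 4 * 10^29 * S" "S >= 0" "X <= 10^22 * S" for X Y S :: real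
  using that by simp
 ultimately show ?thesis using z by blast
next
 \<comment> \<open>For large \<open>f\<close> the claim is trivial: the left side is below 1 by the
   smallness assumptions.\<close>
 case False
 have "sqrt N2 <= 1 / 10^7" using assms(3) by (intro real_le_lsqrt) auto
 moreover have "sqrt F2 >= 1" using False by simp
 moreover have "X + Y <= 10^30 * S" if "Y <= 1 / 10^7" "S >= 1" "X <= 1 / 10^24" for X Y S :: real
  using that by simp
 ultimately show ?thesis using assms(2) by blast
qed

end

section \<open>Twice continuously differentiable selections\<close>

lemma C_diff_local:
 fixes f :: "real => real"
 assumes "!!t. EX h. C_diff k h & (\<forall>\<^sub>F s in nhds t. f s = h s)"
 shows "C_diff k f"
 using assms
proof (induction k arbitrary: f)
 case 0
 have "isCont f t" for t
 proof -
  obtain h where "C_diff 0 h" "\<forall>\<^sub>F s in nhds t. f s = h s" using 0 by blast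
  thus ?thesis using isCont_cong by (auto simp: continuous_on_eq_continuous_at)
 qed
 thus ?case by (simp add: continuous_at_imp_continuous_on)
next
 case (Suc k)
 have loc: "\<exists>h h'. C_diff k h' & (ALL s. (h hrd h' s) (at s)) & (\<forall>\<^sub>F s in nhds t. f s = h s)" for t
  using Suc.prems[of t] unfolding C_diff_real_Suc by blast
 have ev: "\<forall>\<^sub>F s in nhds t. (f hrd h' s) (at s)"
  if "ALL s. (h hrd h' s) (at s)" "\<forall>\<^sub>F s in nhds t. f s = h s" for h h' t
  using eventually_eventually[THEN iffD2, OF that(2)]
 proof eventually_elim
  case (elim s)
  show ?case using that(1) DERIV_cong_ev[OF refl elim refl] by blast
 qed
 have D: "(f hrd deriv f t) (at t)" for t
 proof -
  obtain h h' where "ALL s. (h hrd h' s) (at s)" "\<forall>\<^sub>F s in nhds t. f s = h s" using loc by blast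
  from eventually_nhds_x_imp_x[OF ev[OF this]] have *: "(f hrd h' t) (at t)" .
  hence "deriv f t = h' t" by (rule DERIV_imp_deriv)
  with * show ?thesis by simp
 qed
 have "C_diff k (deriv f)"
 proof (rule Suc.IH)
  fix t
  obtain h h' where h: "C_diff k h'" "ALL s. (h hrd h' s) (at s)" "\<forall>\<^sub>F s in nhds t. f s = h s" using loc by blast
  have "\<forall>\<^sub>F s in nhds t. deriv f s = h' s"
   using ev[OF h(2,3)] by eventually_elim (rule DERIV_imp_deriv)
  thus "EX h. C_diff k h & (\<forall>\<^sub>F s in nhds t. deriv f s = h s)" using h(1) by blast
 qed
 thus ?case unfolding C_diff_real_Suc using D by blast
qed

text \<open>The primitive of a bump supported in the unit interval, divided by its total
  mass.\<close>

lemma smooth_step: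
 obtains th where "smooth th" "!!t. t <= 0 ==> th t = 0" "!!t. t >= 1 ==> th t = 1" "!!t. 0 <= th t" "!!t. th t <= 1"
proof -
 define B where "B = bump 0 1 1"
 have B: "smooth B" "!!x. 0 <= B x" "!!x. x \<notin> {0<..<1} ==> B x = 0" "!!x. x \<in> {0<..<1} ==> 0 < B x"
  unfolding B_def using bump_props[of 1] test_fun_smooth zero_less_one by blast+
 have cB: "cont B" by (rule smooth_continuous[OF B(1)])
 obtain U where U: "AC U B" "U 0 = 0" using AC_primitive[OF li_cont[OF cB]] by blast
 have D: "(U hrd B x) (at x)" for x by (rule AC_continuous_deriv[OF U(1) cB])
 have mono: "U x <= U y" if "x <= y" for x y
 proof (rule DERIV_nonneg_imp_nondecreasing[OF that])
  fix z show "EX y. (U hrd y) (at z) & 0 <= y" using D[of z] B(2)[of z] by blast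
 qed
 have const: "U y = U x" if "x <= y" "!!z. z \<in> {x..y} ==> B z = 0" for x y
  using AC_D[OF U(1) that(1)] that(2) Henstock_Kurzweil_Integration.integral_cong[of "{x..y}" B "%_. 0"] by simp
 have "U 0 < U 1"
 proof -
  obtain z where "0 < z" "z < 1" "U 1 - U 0 = (1 - 0) * B z" using MVT2[of 0 1 U B] D by auto
  thus ?thesis using B(4)[of z] by auto
 qed
 hence p: "U 1 > 0" using U(2) by simp
 define th where "th x = U x / U 1" for x
 have "smooth U" by (rule smooth_coinduct[where P = "%k. k = U \<or> smooth k"]) (use D B(1) smooth_deriv in blast)+
 hence "smooth (%x. (1 / U 1) * U (1 * x + 0))" by (rule smooth_affine)
 hence "smooth th" by (simp add: th_def[abs_def])
 moreover have l: "th t = 0" if "t <= 0" for t using const[OF that] B(3) U(2) by (simp add: th_def)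
 moreover have r: "th t = 1" if "t >= 1" for t using const[OF that] B(3) p by (simp add: th_def)
 moreover have "0 <= th t" for t
 proof (cases "t <= 0")
  case False
  hence "0 <= U t" using mono[of 0 t] U(2) by simp
  thus ?thesis unfolding th_def using p by simp
 qed (simp add: l)
 moreover have "th t <= 1" for t
 proof (cases "t >= 1")
  case False
  hence "U t <= U 1" using mono[of t 1] by simp
  thus ?thesis unfolding th_def using p by (simp add: divide_le_eq)
 qed (simp add: r)
 ultimately show ?thesis by (rule that)
qed

definition C2_curve :: "(real => real \<times> real) => bool" where
 "C2_curve f \<longleftrightarrow> C_diff 2 (%t. fst (f t)) & C_diff 2 (%t. snd (f t))"

lemma C2_curve_local:
 assumes "!!t. EX h. C2_curve h & (\<forall>\<^sub>F s in nhds t. f s = h s)"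
 shows "C2_curve f"
 unfolding C2_curve_def
proof (intro conjI C_diff_local)
 fix t
 obtain h where h: "C2_curve h" "\<forall>\<^sub>F s in nhds t. f s = h s" using assms by blast
 show "EX h. C_diff 2 h & (\<forall>\<^sub>F s in nhds t. fst (f s) = h s)"
  using h by (intro exI[of _ "%t. fst (h t)"]) (auto simp: C2_curve_def elim: eventually_mono)
 show "EX h. C_diff 2 h & (\<forall>\<^sub>F s in nhds t. snd (f s) = h s)"
  using h by (intro exI[of _ "%t. snd (h t)"]) (auto simp: C2_curve_def elim: eventually_mono)
qed

lemma C2_curve_const: "C2_curve (%t. c)"
 unfolding C2_curve_def using smooth_const[unfolded smooth_def] by blast

lemma C_diff_2_affine:
 assumes "smooth th"
 shows "C_diff 2 (%t. a + th (c * t + d) * (e::real))"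
proof -
 have "smooth (%t. e * th (c * t + d))" by (rule smooth_affine[OF assms])
 hence s: "smooth (%t. th (c * t + d) * e)" by (simp add: mult.commute)
 define k where "k = (%t. th (c * t + d) * e)"
 have sk: "smooth k" unfolding k_def by (rule s)
 have "ALL x. ((%t. a + k t) hrd deriv k x) (at x)"
  using DERIV_add[OF DERIV_const smooth_deriv(1)[OF sk], of a] by simp
 hence "C_diff (Suc 1) (%t. a + k t)"
  unfolding C_diff_real_Suc using smooth_deriv(2)[OF sk, unfolded smooth_def] by blast
 thus ?thesis by (simp add: k_def numeral_2_eq_2 del: C_diff.simps)
qed

text \<open>Constancy on the outer thirds and beyond allows pieces to be joined without matching
  derivatives.\<close>

lemma transition:
 assumes "a < b"
 obtains f where "C2_curve f" "!!t. t <= a + (b - a) / 3 ==> f t = c" "!!t. t >= b - (b - a) / 3 ==> f t = c'"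
  "!!t. f t \<in> closed_segment c c'"
proof -
 obtain th where th: "smooth th" "!!t. t <= 0 ==> th t = 0" "!!t. t >= 1 ==> th t = 1" "!!t. 0 <= th t" "!!t. th t <= 1"
  using smooth_step by blast
 define k where "k t = 3 / (b - a) * t + (- (3 * a / (b - a)) - 1)" for t
 define f where "f t = (1 - th (k t)) *\<^sub>R c + th (k t) *\<^sub>R c'" for t
 have fst: "fst (f t) = fst c + th (k t) * (fst c' - fst c)" and snd: "snd (f t) = snd c + th (k t) * (snd c' - snd c)" for t
  by (auto simp: f_def algebra_simps)
 have kt: "k t = (3 * (t - a)) / (b - a) - 1" for t by (simp add: k_def diff_divide_distrib right_diff_distrib)
 have "C2_curve f" unfolding C2_curve_def fst snd k_def by (intro conjI C_diff_2_affine th)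
 moreover have "f t = c" if "t <= a + (b - a) / 3" for t
 proof -
  have "k t <= 0" unfolding kt using that assms by (simp add: field_simps)
  thus ?thesis by (simp add: f_def th)
 qed
 moreover have "f t = c'" if "t >= b - (b - a) / 3" for t
 proof -
  have "k t >= 1" unfolding kt using that assms by (simp add: field_simps)
  thus ?thesis by (simp add: f_def th)
 qed
 moreover have "f t \<in> closed_segment c c'" for t
  unfolding f_def closed_segment_def using th(4,5) by blast
 ultimately show ?thesis using that by blast
qed

lemma glue:
 assumes "C2_curve f" "C2_curve g" "r > 0" "!!t. b - r <= t ==> t <= b ==> f t = c" "!!t. b <= t ==> t <= b + r ==> g t = c"
 shows "C2_curve (%t. if t <= b then f t else g t)"
proof (rule C2_curve_local)
 fix t
 consider "t < b" | "t > b" | "t = b" by linarith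
 thus "EX h. C2_curve h & (\<forall>\<^sub>F s in nhds t. (if s <= b then f s else g s) = h s)"
 proof cases
  case 1
  show ?thesis
   by (rule exI[of _ f], rule conjI[OF assms(1)], rule eventually_mono[OF eventually_nhds_in_open[of "{..<b}"]]) (use 1 in auto)
 next
  case 2
  show ?thesis
   by (rule exI[of _ g], rule conjI[OF assms(2)], rule eventually_mono[OF eventually_nhds_in_open[of "{b<..}"]]) (use 2 in auto)
 next
  case 3
  show ?thesis
   by (rule exI[of _ "%_. c"], rule conjI[OF C2_curve_const], rule eventually_mono[OF eventually_nhds_in_open[of "{b-r<..<b+r}"]])
   (use 3 assms(3-5) in auto)
 qed
qed

text \<open>Near each time one constant choice is admissible. Bisection joins these choices on
  compact intervals, and the unit intervals between integers are then put together. A transition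
  between two choices takes place only where both are admissible, so the curve stays in the convex
  hull.\<close>

lemma C2_selection:
 fixes A :: "real => (real \<times> real) set"
 assumes "!!t. EX c. \<forall>\<^sub>F s in nhds t. c \<in> A s"
 obtains f where "C2_curve f" "!!t. f t \<in> convex hull (A t)"
proof -
 obtain c where c: "!!t. \<forall>\<^sub>F s in nhds t. c t \<in> A s" using assms by metis
 have "\<exists>d>0. ALL s. abs (s - t) < d --> c t \<in> A s" for t
  using c[of t] by (auto simp: eventually_nhds_metric dist_real_def)
 then obtain d where d: "!!t. d t > 0" "!!t s. abs (s - t) < d t ==> c t \<in> A s" by metis
 have hull: "x \<in> convex hull (A t)" if "x \<in> closed_segment p q" "p \<in> A t" "q \<in> A t" for x p q t
  using that(1) closed_segment_subset_convex_hull[OF hull_inc[OF that(2), of convex] hull_inc[OF that(3), of convex]] by blast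
 \<comment> \<open>Prescribed constant values near and beyond both ends make the property additive
   over adjacent intervals; \<open>a < b\<close> makes it vacuous for degenerate ones.\<close>
 define P where "P a b \<longleftrightarrow> (a < b --> (EX f r. r > 0 & C2_curve f & (\<forall>t\<le>a + r. f t = c a) & (\<forall>t\<ge>b - r. f t = c b)
  & (\<forall>t\<in>{a..b}. f t \<in> convex hull (A t))))" for a b
 have P: "P a b" if "a <= b" for a b
  using that
 proof (induction rule: Bolzano)
  case (trans a b e)
  show ?case
  proof (cases "a < b & b < e")
   case True
   obtain f1 r1 where 1: "r1 > 0" "C2_curve f1" "\<forall>t\<le>a + r1. f1 t = c a" "\<forall>t\<ge>b - r1. f1 t = c b" "\<forall>t\<in>{a..b}. f1 t \<in> convex hull (A t)"
   using trans(1) True unfolding P_def by blast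
   obtain f2 r2 where 2: "r2 > 0" "C2_curve f2" "\<forall>t\<le>b + r2. f2 t = c b" "\<forall>t\<ge>e - r2. f2 t = c e" "\<forall>t\<in>{b..e}. f2 t \<in> convex hull (A t)"
   using trans(2) True unfolding P_def by blast
   define f where "f t = (if t <= b then f1 t else f2 t)" for t
   define r where "r = min (min r1 r2) (min (b - a) ((e - b) / 2))"
   have "r > 0" using 1 2 True by (simp add: r_def)
   moreover have "C2_curve f" unfolding f_def[abs_def]
   by (rule glue[OF 1(2) 2(2), of "min r1 r2" _ "c b"]) (use 1 2 in auto)
   moreover have "\<forall>t\<le>a + r. f t = c a" using 1(3) by (auto simp: f_def r_def)
   moreover have "\<forall>t\<ge>e - r. f t = c e"
   proof (intro allI impI)
   fix t assume t: "t >= e - r"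
   have "r <= (e - b) / 2" "r <= r2"
   unfolding r_def by (rule min.coboundedI2, rule min.coboundedI2, rule order_refl)
   (rule min.coboundedI1, rule min.coboundedI2, rule order_refl)
   hence "\<not> t <= b" "t >= e - r2" using t True by (auto simp: field_simps)
   thus "f t = c e" using 2(4) by (simp add: f_def)
   qed
   moreover have "\<forall>t\<in>{a..e}. f t \<in> convex hull (A t)" using 1(5) 2(5) by (auto simp: f_def)
   ultimately show ?thesis unfolding P_def by blast
  next
   case False
   hence "a = b \<or> b = e" using trans by linarith
   thus ?thesis using trans by auto
  qed
 next
  \<comment> \<open>On an interval of length below \<open>d x\<close> around \<open>x\<close> the
    value \<open>c x\<close> is admissible throughout. It is left only within \<open>r\<close> of
    the ends, where \<open>c a\<close> and \<open>c b\<close> respectively are admissible as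
    well.\<close>
  case (local x)
  show ?case
  proof (intro exI[of _ "d x"] conjI allI impI d(1))
   fix a b assume ab: "a <= x & x <= b & b - a < d x"
   show "P a b" unfolding P_def
   proof
   assume "a < b"
   define r where "r = min (min (d a) (d b)) ((b - a) / 2)"
   have "r > 0" using d(1) \<open>a < b\<close> by (auto simp: r_def)
   moreover have "r <= (b - a) / 2" unfolding r_def by (rule min.cobounded2)
   moreover have "r <= d a" "r <= d b" unfolding r_def by auto
   ultimately have r: "r > 0" "r <= d a" "r <= d b" "r <= (b - a) / 2" by auto
   have ar: "a < a + r" and br: "b - r < b" using r by auto
   obtain f1 where 1: "C2_curve f1" "!!t. t <= a + (a + r - a) / 3 ==> f1 t = c a" "!!t. t >= a + r - (a + r - a) / 3 ==> f1 t = c x"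
   "!!t. f1 t \<in> closed_segment (c a) (c x)" using transition[OF ar] by blast
   obtain f2 where 2: "C2_curve f2" "!!t. t <= b - r + (b - (b - r)) / 3 ==> f2 t = c x" "!!t. t >= b - (b - (b - r)) / 3 ==> f2 t = c b"
   "!!t. f2 t \<in> closed_segment (c x) (c b)" using transition[OF br] by blast
   define m where "m = (a + b) / 2"
   define f where "f t = (if t <= m then f1 t else f2 t)" for t
   have cx: "c x \<in> A t" if "t \<in> {a..b}" for t using d(2)[of t x] ab that by auto
   have "C2_curve f" unfolding f_def[abs_def]
   by (rule glue[OF 1(1) 2(1), of "r/3" _ "c x"]) (use r 1(3) 2(2) in \<open>auto simp: m_def field_simps\<close>)
   moreover have "\<forall>t\<le>a + r/3. f t = c a"
   proof (intro allI impI)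
   fix t assume t: "t <= a + r/3"
   hence "t <= m" using r by (simp add: m_def field_simps)
   thus "f t = c a" using 1(2)[of t] t by (simp add: f_def)
   qed
   moreover have "\<forall>t\<ge>b - r/3. f t = c b"
   proof (intro allI impI)
   fix t assume t: "t >= b - r/3"
   hence "\<not> t <= m" using r by (simp add: m_def field_simps)
   thus "f t = c b" using 2(3)[of t] t by (simp add: f_def)
   qed
   moreover have "\<forall>t\<in>{a..b}. f t \<in> convex hull (A t)"
   proof
   fix t assume t: "t \<in> {a..b}"
   show "f t \<in> convex hull (A t)"
   proof (cases "t <= m")
   case True
   show ?thesis
   proof (cases "t >= a + r - (a + r - a) / 3")
   case True
   thus ?thesis using 1(3)[OF True] \<open>t <= m\<close> cx[OF t] by (simp add: f_def hull_inc)
   next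
   case False
   hence "abs (t - a) < d a" using t r by auto
   thus ?thesis using hull[OF 1(4)[of t] d(2)[of t a] cx[OF t]] \<open>t <= m\<close> by (simp add: f_def)
   qed
   next
   case False
   show ?thesis
   proof (cases "t <= b - r + (b - (b - r)) / 3")
   case True
   thus ?thesis using 2(2)[OF True] False cx[OF t] by (simp add: f_def hull_inc)
   next
   case F2: False
   hence "abs (t - b) < d b" using t r by auto
   thus ?thesis using hull[OF 2(4)[of t] cx[OF t] d(2)[of t b]] False by (simp add: f_def)
   qed
   qed
   qed
   ultimately show "EX f r. r > 0 & C2_curve f & (\<forall>t\<le>a + r. f t = c a) & (\<forall>t\<ge>b - r. f t = c b)
   & (\<forall>t\<in>{a..b}. f t \<in> convex hull (A t))"
   using r(1) by (intro exI[of _ f] exI[of _ "r/3"]) auto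
   qed
  qed
 qed
 have "EX f r. r > 0 & C2_curve f & (\<forall>t\<le>real_of_int n + r. f t = c n) & (\<forall>t\<ge>real_of_int n + 1 - r. f t = c (real_of_int n + 1))
  & (\<forall>t\<in>{real_of_int n..real_of_int n + 1}. f t \<in> convex hull (A t))" for n
  using P[of "real_of_int n" "real_of_int n + 1"] unfolding P_def by simp
 then obtain F r where F: "!!n. r n > 0" "!!n. C2_curve (F n)" "!!n t. t <= real_of_int n + r n ==> F n t = c n"
  "!!n t. t >= real_of_int n + 1 - r n ==> F n t = c (real_of_int n + 1)"
  "!!n t. t \<in> {real_of_int n..real_of_int n + 1} ==> F n t \<in> convex hull (A t)" by metis
 define f where "f t = F \<lfloor>t\<rfloor> t" for t
 have "f t \<in> convex hull (A t)" for t
  unfolding f_def by (rule F(5)) (auto simp: less_imp_le)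
 moreover have "C2_curve f"
 proof (rule C2_curve_local)
  fix t :: real
  define n where "n = \<lfloor>t\<rfloor>"
  have n: "real_of_int n <= t" "t < real_of_int n + 1" by (auto simp: n_def)
  show "EX h. C2_curve h & (\<forall>\<^sub>F s in nhds t. f s = h s)"
  proof (cases "t = real_of_int n")
   case False
   hence tn: "t \<in> {real_of_int n<..<real_of_int n + 1}" using n by auto
   have "f s = F n s" if "s \<in> {real_of_int n<..<real_of_int n + 1}" for s
   proof -
   have "\<lfloor>s\<rfloor> = n" using that by (intro floor_unique) auto
   thus ?thesis by (simp add: f_def)
   qed
   hence "\<forall>\<^sub>F s in nhds t. f s = F n s"
   by (rule eventually_mono[OF eventually_nhds_in_open[OF open_greaterThanLessThan tn]])
   thus ?thesis using F(2) by blast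
  next
   case True
   define ro where "ro = min (min (r n) (r (n - 1))) 1"
   have ro: "ro > 0" "ro <= r n" "ro <= r (n - 1)" "ro <= 1" using F(1) by (auto simp: ro_def)
   have tn: "t \<in> {real_of_int n - ro<..<real_of_int n + ro}" using True ro by auto
   have "f s = c n" if s: "s \<in> {real_of_int n - ro<..<real_of_int n + ro}" for s
   proof (cases "s >= real_of_int n")
   case True
   hence "\<lfloor>s\<rfloor> = n" using s ro by (intro floor_unique) auto
   thus ?thesis using F(3)[of s n] s ro by (simp add: f_def)
   next
   case False
   hence "\<lfloor>s\<rfloor> = n - 1" using s ro by (intro floor_unique) auto
   thus ?thesis using F(4)[of "n - 1" s] s ro by (simp add: f_def)
   qed
   hence "\<forall>\<^sub>F s in nhds t. f s = c n"
   by (rule eventually_mono[OF eventually_nhds_in_open[OF open_greaterThanLessThan tn]])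
   thus ?thesis using C2_curve_const by blast
  qed
 qed
 ultimately show ?thesis using that by blast
qed

section \<open>Near-optimal pairs of kinks\<close>

lemma gap_reflect: "gap (%x. - u (- x)) (- b) (- a) x = - gap u a b (- x)"
 unfolding gap_def kink10_eq by (simp add: add.commute, rule arg_cong[where f = kink01], simp)

text \<open>On [0, 1] the slope of the kink is at least 1/28, because
  \<open>exp (2 * sqrt 2) <= 3 ^ 3\<close>. A \<open>d\<close> beyond 1 would already produce an
  increment of 1/28, which the hypothesis excludes.\<close>

lemma kink_increment:
 assumes "0 <= d" "kink01 d - kink01 0 < 1/28"
 shows "d <= 28 * (kink01 d - kink01 0)"
proof -
 have lower: "1/28 <= dk01 x" if "0 <= x" "x <= 1" for x
 proof -
  have "2 * sqrt 2 * x <= 3 * 1" using that sqrt2_bounds(2) by (intro mult_mono) auto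
  hence "exp (2 * sqrt 2 * x) <= exp 3" by simp
  also have "exp 3 = (exp 1 ^ 3 :: real)" by (simp flip: exp_of_nat_mult)
  also have "... <= 3 ^ 3" using exp_le by (intro power_mono) auto
  finally have "1 + exp (2 * sqrt 2 * x) <= 28" by simp
  hence "1/28 <= 1 / (1 + exp (2 * sqrt 2 * x))" by (intro divide_left_mono mult_pos_pos) simp_all
  hence q: "1/28 <= 1 - (kink01 x)^2" by (simp add: one_minus_kink01_square)
  have "1 / sqrt 2 <= kink01 x" using kink01_mono[OF that(1)] by (simp add: kink01_0)
  hence "sqrt 2 * (1 / sqrt 2) <= sqrt 2 * kink01 x" by (intro mult_left_mono) auto
  hence "1 * (1/28) <= (sqrt 2 * kink01 x) * (1 - (kink01 x)^2)" using q kink01_pos[of x] by (intro mult_mono) auto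
  thus ?thesis by (simp add: dk01_def)
 qed
 have mvt: "e <= 28 * (kink01 e - kink01 0)" if "0 <= e" "e <= 1" for e
 proof (cases "e = 0")
  case False
  hence "0 < e" using that by simp
  then obtain z where z: "0 < z" "z < e" "kink01 e - kink01 0 = (e - 0) * dk01 z"
   using MVT2[of 0 e kink01 dk01] DERIV_kink01 that by auto
  have "e * (1/28) <= e * dk01 z" using lower[of z] z that by (intro mult_left_mono) auto
  thus ?thesis using z(3) by simp
 qed simp
 show ?thesis
 proof (cases "d <= 1")
  case True thus ?thesis using mvt assms by blast
 next
  case False
  hence "kink01 1 <= kink01 d" by (intro kink01_mono) auto
  thus ?thesis using mvt[of 1] assms by simp
 qed
qed

text \<open>Compare two pairs that fit the same profile at the centre \<open>a'\<close>: there the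
  right kinks differ by the increment over \<open>a' - a\<close>, and four other terms are of size
  \<open>ka\<close>, whence \<open>112 = 4 * 28\<close>.\<close>

lemma pair_close_a:
 assumes "!!x. abs (gap u a b x) <= ka" "!!x. abs (gap u a' b' x) <= ka"
  "exp (- sqrt 2 * (a - b)) <= ka" "exp (- sqrt 2 * (a' - b')) <= ka" "ka < 1/112"
 shows "abs (a - a') <= 112 * ka"
proof -
 have *: "a' - a <= 112 * ka"
  if "!!x. abs (gap u a b x) <= ka" "!!x. abs (gap u a' b' x) <= ka"
   "exp (- sqrt 2 * (a - b)) <= ka" "exp (- sqrt 2 * (a' - b')) <= ka" "a <= a'" for a b a' b'
 proof -
  have "gap u a b a' - gap u a' b' a' = - (kink01 (a' - a) - kink01 0) - kink10 (a' - b) + kink10 (a' - b')"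
   by (simp add: gap_def)
  moreover have "abs (kink10 (a' - b')) <= ka" using kink_abs_bounds(4)[of "a' - b'"] that(4) by linarith
  moreover have "abs (kink10 (a' - b)) <= ka"
  proof -
   have "sqrt 2 * (a - b) <= sqrt 2 * (a' - b)" using that(5) by (intro mult_left_mono) auto
   hence "exp (- sqrt 2 * (a' - b)) <= exp (- sqrt 2 * (a - b))" by simp
   thus ?thesis using kink_abs_bounds(4)[of "a' - b"] that(3) by linarith
  qed
  ultimately have "kink01 (a' - a) - kink01 0 <= 4 * ka" using that(1)[of a'] that(2)[of a'] by linarith
  moreover from this have "kink01 (a' - a) - kink01 0 < 1/28" using assms(5) by linarith
  hence "a' - a <= 28 * (kink01 (a' - a) - kink01 0)" using kink_increment[of "a' - a"] that(5) by simp
  moreover have "x <= 112 * ka" if "D <= 4 * ka" "x <= 28 * D" for x D :: real using that by linarith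
  ultimately show ?thesis by blast
 qed
 show ?thesis
 proof (cases "a <= a'")
  case True thus ?thesis using *[OF assms(1-4) True] by simp
 next
  case False thus ?thesis using *[OF assms(2,1,4,3)] by simp
 qed
qed

lemma pair_close_b:
 assumes "!!x. abs (gap u a b x) <= ka" "!!x. abs (gap u a' b' x) <= ka"
  "exp (- sqrt 2 * (a - b)) <= ka" "exp (- sqrt 2 * (a' - b')) <= ka" "ka < 1/112"
 shows "abs (b - b') <= 112 * ka"
proof -
 have "abs ((- b) - (- b')) <= 112 * ka"
 proof (rule pair_close_a[where u = "%x. - u (- x)" and b = "- a" and b' = "- a'"])
  show "abs (gap (%x. - u (- x)) (- b) (- a) x) <= ka" "abs (gap (%x. - u (- x)) (- b') (- a') x) <= ka" for x
   unfolding gap_reflect using assms(1)[of "-x"] assms(2)[of "-x"] by auto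
 qed (use assms in \<open>auto simp: algebra_simps\<close>)
 thus ?thesis by simp
qed

text \<open>For \<open>ka <= 1/200\<close> a shift of \<open>112 * ka\<close>, times
  \<open>sqrt 2\<close>, stays below 1, so the exponential factor of the shift estimate is at most
  3.\<close>

lemma gap_move:
 assumes H: "admis u v"
  and N: "H1sq (gap u a0 b0) (gap' v a0 b0) <= ka^2" and ka: "0 <= ka" "ka <= 1/200"
  and ab: "abs (a - a0) <= 112 * ka" "abs (b - b0) <= 112 * ka"
 shows "H1sq (gap u a b) (gap' v a b) <= (10^4 * ka)^2"
proof -
 have e: "(abs d * exp (sqrt 2 * abs d))^2 <= (336 * ka)^2" if "abs d <= 112 * ka" for d
 proof -
  have "sqrt 2 * abs d <= 1.42 * (112 * (1/200))" using that ka sqrt2_bounds(2) by (intro mult_mono) auto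
  hence "sqrt 2 * abs d <= 1" by simp
  hence "exp (sqrt 2 * abs d) <= exp 1" by simp
  also have "... <= 3" by (rule exp_le)
  finally have "abs d * exp (sqrt 2 * abs d) <= (112 * ka) * 3" using that by (intro mult_mono) auto
  thus ?thesis by (intro power_mono) auto
 qed
 note k1 = kink01_shift_H1[of a0 a] and k2 = kink10_shift_H1[of b0 b]
 have eq: "gap u a b = (%x. gap u a0 b0 x + ((kink01 (x - a0) - kink01 (x - a)) + (kink10 (x - b0) - kink10 (x - b))))"
  "gap' v a b = (%x. gap' v a0 b0 x + ((dk01 (x - a0) - dk01 (x - a)) + (dk10 (x - b0) - dk10 (x - b))))"
  by (auto simp: gap_def gap'_def)
 have "H1sq (gap u a b) (gap' v a b) <= 2 * H1sq (gap u a0 b0) (gap' v a0 b0)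
  + 2 * (2 * (36 * (abs (a0 - a) * exp (sqrt 2 * abs (a0 - a)))^2) + 2 * (36 * (abs (b0 - b) * exp (sqrt 2 * abs (b0 - b)))^2))"
 proof -
  have "X <= 2 * N + 2 * (2 * (36 * p) + 2 * (36 * q))"
   if "X <= 2 * N + 2 * Y" "Y <= 2 * K1 + 2 * K2" "K1 <= 36 * p" "K2 <= 36 * q" for X N Y K1 K2 p q :: real
   using that by simp
  thus ?thesis
   unfolding eq using H1sq_add_le[OF gap_H1[OF H] H1r_add[OF k1(1) k2(1)], of a0 b0] H1sq_add_le[OF k1(1) k2(1)] k1(2) k2(2)
   by blast
 qed
 also have "... <= 2 * ka^2 + 2 * (2 * (36 * (336 * ka)^2) + 2 * (36 * (336 * ka)^2))"
  using N e[of "a0 - a"] e[of "b0 - b"] ab by (simp add: abs_minus_commute)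
 also have "... <= (10^4 * ka)^2" by (simp add: power_mult_distrib)
 finally show ?thesis .
qed

section \<open>Square norms as nonnegative integrals\<close>

text \<open>Valued in \<open>ennreal\<close>, so that Tonelli, Fatou and limits apply before
  finiteness is known; over \<open>lborel\<close>, because Fubini is used on products of Borel
  measures.\<close>

definition n2 :: "(real => real) => ennreal" where
 "n2 f = (\<integral>\<^sup>+x. ennreal ((f x)^2) \<partial>lborel)"

lemma n2_shift:
 assumes "f \<in> BM"
 shows "n2 (%x. f (x + h)) = n2 f"
 using nn_integral_real_affine[of "%x. ennreal ((f x)^2)" 1 h] assms by (simp add: n2_def add.commute)

lemma n2_mono:
 assumes "!!x. (f x)^2 <= (g x)^2"
 shows "n2 f <= n2 g"
 unfolding n2_def using assms by (intro nn_integral_mono) (auto intro: ennreal_leI)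

lemma n2_cmult:
 assumes "f \<in> BM"
 shows "n2 (%x. c * f x) = ennreal (c^2) * n2 f"
 unfolding n2_def using assms by (subst nn_integral_cmult[symmetric]) (auto simp: power_mult_distrib ennreal_mult)

lemma n2_minus: "n2 (%x. - f x) = n2 f"
 by (simp add: n2_def)

lemma n2_add:
 assumes "f \<in> BM" "g \<in> BM"
 shows "n2 (%x. f x + g x) <= 2 * n2 f + 2 * n2 g"
proof -
 have "n2 (%x. f x + g x) <= (\<integral>\<^sup>+x. 2 * ennreal ((f x)^2) + 2 * ennreal ((g x)^2) \<partial>lborel)"
  unfolding n2_def
 proof (rule nn_integral_mono)
  fix x
  have "ennreal ((f x + g x)^2) <= ennreal (2 * (f x)^2 + 2 * (g x)^2)" by (rule ennreal_leI[OF square_add_le])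
  also have "... = 2 * ennreal ((f x)^2) + 2 * ennreal ((g x)^2)" by (simp add: ennreal_plus ennreal_mult)
  finally show "ennreal ((f x + g x)^2) <= 2 * ennreal ((f x)^2) + 2 * ennreal ((g x)^2)" .
 qed
 also have "... = 2 * n2 f + 2 * n2 g"
  unfolding n2_def using assms by (subst nn_integral_add) (auto simp: nn_integral_cmult)
 finally show ?thesis .
qed

lemma n2_diff:
 assumes "f \<in> BM" "g \<in> BM"
 shows "n2 (%x. f x - g x) <= 2 * n2 f + 2 * n2 g"
 using n2_add[OF assms(1), of "%x. - g x"] assms(2) by (simp add: n2_minus)

lemma borel_imp_lebesgue: "f \<in> BM ==> f \<in> borel_measurable (LB :: real measure)" for f :: "real => real"
 by (rule measurable_completion) simp

lemma n2_sqint: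
 assumes "f \<in> BM"
 shows "sqint UNIV f \<longleftrightarrow> n2 f < \<infinity>" "sqint UNIV f ==> n2 f = ennreal (intR (%x. (f x)^2))"
proof -
 have m: "(%x. (f x)^2) \<in> borel_measurable lborel" using assms by simp
 have "integrable LB (%x. (f x)^2) \<longleftrightarrow> integrable lborel (%x. (f x)^2)" by (rule integrable_completion[OF m])
 also have "... \<longleftrightarrow> n2 f < \<infinity>" using m by (simp add: n2_def integrable_iff_bounded)
 finally show iff: "sqint UNIV f \<longleftrightarrow> n2 f < \<infinity>"
  using borel_imp_lebesgue[OF assms] by (simp add: sqint_def set_integrable_def)
 assume s: "sqint UNIV f"
 hence i: "integrable lborel (%x. (f x)^2)" using iff m by (simp add: n2_def integrable_iff_bounded)
 have "n2 f = ennreal (integral\<^sup>L lborel (%x. (f x)^2))" unfolding n2_def using i by (intro nn_integral_eq_integral) auto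
 also have "integral\<^sup>L lborel (%x. (f x)^2) = integral\<^sup>L LB (%x. (f x)^2)" by (rule integral_completion[OF m, symmetric])
 also have "... = intR (%x. (f x)^2)" using s by (intro LINT_eq_integral) (simp add: sqint_def)
 finally show "n2 f = ennreal (intR (%x. (f x)^2))" .
qed

text \<open>Cauchy--Schwarz with weight \<open>ka\<close> on the time integral of \<open>w\<close>.\<close>

lemma minkowski:
 assumes AC: "!!x. AC (%s. u s x) (%s. w s x)"
  and w: "(%(s, x). w s x) \<in> BM"
  and ka: "cont ka" "!!s. ka s > 0"
  and b: "!!s. s \<in> {p..q} ==> n2 (w s) <= ennreal ((ka s)^2)" and pq: "p <= q"
 shows "n2 (%x. u q x - u p x) <= ennreal ((integral {p..q} ka)^2)"
proof (cases "p = q")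
 case True
 thus ?thesis by (simp add: n2_def)
next
 case False
 hence pq': "p < q" using pq by simp
 define K where "K = integral {p..q} ka"
 have ci: "ka integrable_on {p..q}" using ka(1) continuous_on_subset integrable_continuous_real by blast
 have Kpos: "K > 0"
 proof -
  obtain m where m: "m \<in> {p..q}" "!!s. s \<in> {p..q} ==> ka m <= ka s"
   using continuous_attains_inf[of "{p..q}" ka] continuous_on_subset[OF ka(1)] pq by auto
  have "integral {p..q} (%s. ka m) <= K" unfolding K_def using ci m by (intro integral_le) auto
  moreover have "integral {p..q} (%s. ka m) > 0" using ka(2)[of m] pq' by simp
  ultimately show ?thesis by linarith
 qed
 have mka: "ka \<in> BM" using ka(1) by (rule bmc)
 have mw: "(%p. w (fst p) (snd p)) \<in> borel_measurable LL"
  using w by (simp add: lborel_prod cpb)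
 have mws: "(%s. w s x) \<in> BM" for x
  using measurable_compose[OF _ mw, of "%s. (s, x)" borel] by (simp)
 have mwx: "w s \<in> BM" for s
  using measurable_compose[OF _ mw, of "%x. (s, x)" borel] by (simp)
 \<comment> \<open>At each \<open>x\<close> the squared increment is at most \<open>K * I x\<close>,
   by splitting \<open>w\<close> into \<open>sqrt ka\<close> times \<open>w / sqrt ka\<close>.
   Integrating \<open>I\<close> over \<open>x\<close> and exchanging the integrals returns the
   second factor \<open>K\<close>.\<close>
 define I where "I x = (\<integral>\<^sup>+s. ennreal (indicator {p..q} s * ((w s x)^2 / ka s)) \<partial>lborel)" for x
 have pt: "ennreal ((u q x - u p x)^2) <= ennreal K * I x" for x
 proof (cases "I x = \<infinity>")
  case True
  thus ?thesis using Kpos by (simp add: ennreal_mult_top)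
 next
  case False
  define a where "a s = sqrt (ka s)" for s
  define c where "c s = w s x / sqrt (ka s)" for s
  have c2: "(c s)^2 = (w s x)^2 / ka s" for s unfolding c_def using ka(2)[of s] by (simp add: power_divide)
  have ca: "cont a" unfolding a_def by (intro continuous_intros ka)
  have mc: "c \<in> BM" unfolding c_def[abs_def] using mws mka by simp
  have int: "integrable lborel (%s. indicator {p..q} s *\<^sub>R (c s)^2)"
  proof (rule integrableI_bounded)
   show "(%s. indicator {p..q} s *\<^sub>R (c s)^2) \<in> borel_measurable lborel" using mc by simp
   have "(\<integral>\<^sup>+s. ennreal (norm (indicator {p..q} s *\<^sub>R (c s)^2)) \<partial>lborel) = I x"
   unfolding I_def by (intro nn_integral_cong) (use ka(2) in \<open>simp add: c2 indicator_def less_imp_le\<close>)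
   thus "(\<integral>\<^sup>+s. ennreal (norm (indicator {p..q} s *\<^sub>R (c s)^2)) \<partial>lborel) < \<infinity>"
   using False by (metis infinity_ennreal_def less_top)
  qed
  have ms: "(%s. indicator {p..q} s *\<^sub>R (c s)^2) \<in> borel_measurable lborel" using mc by simp
  have abs: "(%s. (c s)^2) abs_int_on {p..q}"
   unfolding set_integrable_def integrable_completion[OF ms] by (rule int)
  have sc: "sqint {p..q} c" using abs borel_imp_lebesgue[OF mc] by (simp add: sqint_def)
  have sa: "sqint {p..q} a"
   unfolding sqint_def using ca continuous_on_subset
   by (auto intro!: continuous_meas absolutely_integrable_continuous_real continuous_intros intro: continuous_on_subset)
  have I: "ennreal (integral {p..q} (%s. (c s)^2)) = I x"
  proof -
   have "integral {p..q} (%s. (c s)^2) = integral\<^sup>L lborel (%s. indicator {p..q} s *\<^sub>R (c s)^2)"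
   using set_LINT_eq(2)[OF abs] integral_completion[OF ms] by (simp add: set_lebesgue_integral_def)
   also have "ennreal ... = (\<integral>\<^sup>+s. ennreal (indicator {p..q} s *\<^sub>R (c s)^2) \<partial>lborel)"
   using int by (intro nn_integral_eq_integral[symmetric]) auto
   finally show ?thesis by (simp add: I_def c2)
  qed
  have ac: "a s * c s = w s x" for s using ka(2)[of s] by (simp add: a_def c_def)
  have a2: "(a s)^2 = ka s" for s using ka(2)[of s] by (simp add: a_def)
  have "u q x - u p x = integral {p..q} (%s. a s * c s)" unfolding ac using AC_D[OF AC[of x] pq] by simp
  hence "(u q x - u p x)^2 <= K * integral {p..q} (%s. (c s)^2)"
   using Cauchy_Schwarz_integral[OF sa sc] by (simp add: a2 K_def)
  hence "ennreal ((u q x - u p x)^2) <= ennreal (K * integral {p..q} (%s. (c s)^2))" by (rule ennreal_leI)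
  also have "... = ennreal K * I x" unfolding I[symmetric] using Kpos sqint_nonneg[OF sc] by (intro ennreal_mult) auto
  finally show ?thesis .
 qed
 have mI: "(%(x, s). ennreal (indicator {p..q} s * ((w s x)^2 / ka s))) \<in> borel_measurable LL"
 proof -
  have 1: "(%z. w (snd z) (fst z)) \<in> borel_measurable LL"
   using measurable_compose[of "%z. (snd z, fst z)" "LL", OF _ mw] by simp
  have 2: "(%z. ka (snd z)) \<in> borel_measurable LL"
   by (rule measurable_compose[OF _ mka]) simp
  have 3: "(%z. indicator {p..q} (snd z) :: real) \<in> borel_measurable LL"
   by (rule measurable_compose[of snd _ borel]) simp_all
  show ?thesis unfolding cpb
   by (intro measurable_compose[OF _ measurable_ennreal] borel_measurable_times borel_measurable_divide borel_measurable_power 1 2 3)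
 qed
 have "n2 (%x. u q x - u p x) <= (\<integral>\<^sup>+x. ennreal K * I x \<partial>lborel)"
  unfolding n2_def by (intro nn_integral_mono pt)
 also have "... = ennreal K * (\<integral>\<^sup>+x. I x \<partial>lborel)"
  unfolding I_def by (intro nn_integral_cmult sigma_finite_measure.borel_measurable_nn_integral[OF sigma_finite_lborel mI])
 also have "(\<integral>\<^sup>+x. I x \<partial>lborel) = (\<integral>\<^sup>+s. \<integral>\<^sup>+x. ennreal (indicator {p..q} s * ((w s x)^2 / ka s)) \<partial>lborel \<partial>lborel)"
  unfolding I_def by (rule lborel_pair.Fubini'[OF mI, symmetric])
 also have "... <= (\<integral>\<^sup>+s. ennreal (indicator {p..q} s * ka s) \<partial>lborel)"
 proof (rule nn_integral_mono)
  fix s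
  show "(\<integral>\<^sup>+x. ennreal (indicator {p..q} s * ((w s x)^2 / ka s)) \<partial>lborel) <= ennreal (indicator {p..q} s * ka s)"
  proof (cases "s \<in> {p..q}")
   case True
   have "(\<integral>\<^sup>+x. ennreal ((w s x)^2 / ka s) \<partial>lborel) = (\<integral>\<^sup>+x. ennreal (1 / ka s) * ennreal ((w s x)^2) \<partial>lborel)"
   using ka(2)[of s] by (intro nn_integral_cong) (simp flip: ennreal_mult)
   also have "... = ennreal (1 / ka s) * n2 (w s)" unfolding n2_def using mwx by (intro nn_integral_cmult) simp
   also have "... <= ennreal (1 / ka s) * ennreal ((ka s)^2)" using b[OF True] by (rule mult_left_mono) simp
   also have "... = ennreal (ka s)" using ka(2)[of s] by (simp add: power2_eq_square flip: ennreal_mult)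
   finally show ?thesis using True by simp
  qed simp
 qed
 also have "... = ennreal K"
 proof -
  have "(ka has_integral K) {p..q}" unfolding K_def using ci by (rule integrable_integral)
  from nn_integral_has_integral_lebesgue[OF _ this] show ?thesis using ka(2) by (auto simp: less_imp_le nn_integral_completion)
 qed
 finally have "n2 (%x. u q x - u p x) <= ennreal K * ennreal K" by (simp add: mult_left_mono)
 thus ?thesis using Kpos by (simp add: K_def power2_eq_square flip: ennreal_mult)
qed

section \<open>Continuity of translations\<close>

definition cutoff :: "nat => real => real" where "cutoff m x = max 0 (min 1 (real m + 1 - abs x))"
definition clip :: "real => real => real" where "clip r y = max (- r) (min r y)"

lemma cutoff: "0 <= cutoff m x" "cutoff m x <= 1" "abs x >= real m + 1 ==> cutoff m x = 0" "abs x <= real m ==> cutoff m x = 1"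
 "cont (cutoff m)"
 unfolding cutoff_def[abs_def] by (auto intro!: continuous_intros)

lemma clip: "0 <= r ==> abs (clip r y) <= r" "abs y <= r ==> clip r y = y" "0 <= r ==> abs (clip r y) <= abs y"
 "cont (clip r)"
 unfolding clip_def[abs_def] by (auto intro!: continuous_intros)

lemma clip_lipschitz: "abs (clip r y - clip r z) <= abs (y - z)"
 unfolding clip_def by (auto simp: max_def min_def)

lemma n2_approx_bounded:
 assumes f: "f \<in> BM" "n2 f < \<infinity>"
 shows "(%m. n2 (%x. f x - cutoff m x * clip (real m) (f x))) \<longlonglongrightarrow> 0"
proof -
 have mc: "(%x. f x - cutoff m x * clip (real m) (f x)) \<in> BM" for m
  using f(1) bmc[OF cutoff(5), of m] measurable_compose[OF f(1) bmc[OF clip(4), of "real m"]]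
  by simp
 have le: "(f x - cutoff m x * clip (real m) (f x))^2 <= (f x)^2" for x m
 proof -
  have "abs (f x - cutoff m x * clip (real m) (f x)) <= abs (f x)"
  proof (cases "f x >= 0")
   case True
   have "0 <= clip (real m) (f x)" "clip (real m) (f x) <= f x" using True by (auto simp: clip_def)
   hence "cutoff m x * clip (real m) (f x) <= 1 * f x" "0 <= cutoff m x * clip (real m) (f x)"
   using cutoff(1,2)[of m x] mult_mono[of "cutoff m x" 1 "clip (real m) (f x)" "f x"] True by auto
   thus ?thesis by simp
  next
   case False
   have "0 <= - clip (real m) (f x)" "- clip (real m) (f x) <= - f x" using False by (auto simp: clip_def)
   hence "cutoff m x * (- clip (real m) (f x)) <= 1 * (- f x)" "0 <= cutoff m x * (- clip (real m) (f x))"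
   using cutoff(1,2)[of m x] mult_mono[of "cutoff m x" 1 "- clip (real m) (f x)" "- f x"] mult_nonneg_nonneg[of "cutoff m x" "- clip (real m) (f x)"] False by auto
   thus ?thesis by simp
  qed
  thus ?thesis by (simp add: abs_le_square_iff)
 qed
 have "(%m. \<integral>\<^sup>+x. ennreal ((f x - cutoff m x * clip (real m) (f x))^2) \<partial>lborel) \<longlonglongrightarrow> (\<integral>\<^sup>+x. 0 \<partial>(lborel :: real measure))"
 proof (rule nn_integral_dominated_convergence[where w = "%x. ennreal ((f x)^2)"])
  show "(\<integral>\<^sup>+x. ennreal ((f x)^2) \<partial>lborel) < \<infinity>" using f(2) by (simp add: n2_def)
  show "AE x in lborel. ennreal ((f x - cutoff m x * clip (real m) (f x))^2) <= ennreal ((f x)^2)" for m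
   using le by (auto intro: ennreal_leI)
  show "AE x in lborel. (%m. ennreal ((f x - cutoff m x * clip (real m) (f x))^2)) \<longlonglongrightarrow> 0"
  proof (rule AE_I2)
   fix x
   obtain N where N: "max (abs x) (abs (f x)) <= real N" using real_arch_simple by blast
   have "\<forall>\<^sub>F m in sequentially. 0 = ennreal ((f x - cutoff m x * clip (real m) (f x))^2)"
   by (rule eventually_sequentiallyI[of N]) (use N in \<open>auto simp: clip(2) cutoff(4)\<close>)
   thus "(%m. ennreal ((f x - cutoff m x * clip (real m) (f x))^2)) \<longlonglongrightarrow> 0"
   using tendsto_const by (rule Lim_transform_eventually[rotated])
  qed
 qed (use f mc in auto)
 thus ?thesis by (simp add: n2_def)
qed

lemma less_ennrealE:
 assumes "x < ennreal e"
 obtains p where "x = ennreal p" "0 <= p" "p < e"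
 using assms that by (cases x) (auto simp: ennreal_less_iff)

text \<open>Truncation makes \<open>f\<close> bounded with bounded support, so dominated convergence
  applies to continuous functions that converge to \<open>f\<close> almost everywhere and are
  truncated in the same way.\<close>

lemma n2_approx_continuous:
 assumes f: "f \<in> BM" "n2 f < \<infinity>" and "ep > 0"
 obtains g R where "cont g" "!!x. abs x >= R ==> g x = 0" "n2 (%x. f x - g x) < ennreal ep"
proof -
 have "\<forall>\<^sub>F m in sequentially. n2 (%x. f x - cutoff m x * clip (real m) (f x)) < ennreal (ep / 4)"
  using n2_approx_bounded[OF f] \<open>ep > 0\<close> by (intro order_tendstoD(2)) auto
 then obtain m where m: "n2 (%x. f x - cutoff m x * clip (real m) (f x)) < ennreal (ep / 4)"
  by (auto simp: eventually_sequentially)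
 define b where "b x = cutoff m x * clip (real m) (f x)" for x
 have "f measurable_on UNIV" by (rule lebesgue_measurable_imp_measurable_on[OF borel_imp_lebesgue[OF f(1)]]) simp
 then obtain N g where g: "negligible N" "!!n. cont (g n)" "!!x. x \<notin> N ==> (%n. g n x) \<longlonglongrightarrow> f x"
  by (auto simp: measurable_on_def)
 define k where "k n x = cutoff m x * clip (real m) (g n x)" for n x
 have ck: "cont (k n)" for n
  unfolding k_def by (intro continuous_intros cutoff continuous_on_compose2[OF clip(4) g(2)]) auto
 have mk: "k n \<in> BM" for n by (rule bmc[OF ck])
 have mb: "b \<in> BM"
  unfolding b_def using f(1) bmc[OF cutoff(5), of m] measurable_compose[OF f(1) bmc[OF clip(4), of "real m"]]
  by simp
 have bd: "abs (cutoff m x * clip (real m) y) <= real m * indicator {-real m - 1..real m + 1} x" for x y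
 proof (cases "x \<in> {-real m - 1..real m + 1}")
  case True
  have "abs (cutoff m x) * abs (clip (real m) y) <= 1 * real m" using cutoff(1,2)[of m x] clip(1)[of "real m" y] by (intro mult_mono) auto
  thus ?thesis using True by (simp add: abs_mult)
 next
  case False
  hence "abs x >= real m + 1" by auto
  thus ?thesis using cutoff(3)[of m x] by simp
 qed
 have "(%n. \<integral>\<^sup>+x. ennreal ((b x - k n x)^2) \<partial>lborel) \<longlonglongrightarrow> (\<integral>\<^sup>+x. 0 \<partial>(lborel :: real measure))"
 proof (rule nn_integral_dominated_convergence[where w = "%x. ennreal ((2 * real m)^2) * indicator {-real m - 1..real m + 1} x"])
  show "(\<integral>\<^sup>+x. ennreal ((2 * real m)^2) * indicator {-real m - 1..real m + 1} x \<partial>lborel) < \<infinity>"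
   by (simp add: nn_integral_cmult_indicator ennreal_mult_less_top)
  show "AE x in lborel. ennreal ((b x - k n x)^2) <= ennreal ((2 * real m)^2) * indicator {-real m - 1..real m + 1} x" for n
  proof (rule AE_I2)
   fix x
   have "abs (b x - k n x) <= (2 * real m) * indicator {-real m - 1..real m + 1} x"
   using bd[of x "f x"] bd[of x "g n x"] unfolding b_def k_def by linarith
   hence "(b x - k n x)^2 <= ((2 * real m) * indicator {-real m - 1..real m + 1} x)^2"
   by (metis abs_ge_zero power2_abs power_mono)
   hence "(b x - k n x)^2 <= (2 * real m)^2 * indicator {-real m - 1..real m + 1} x"
   by (cases "x \<in> {-real m - 1..real m + 1}") (auto simp: power_mult_distrib)
   thus "ennreal ((b x - k n x)^2) <= ennreal ((2 * real m)^2) * indicator {-real m - 1..real m + 1} x"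
   by (cases "x \<in> {-real m - 1..real m + 1}") (auto intro: ennreal_leI)
  qed
  show "AE x in lborel. (%n. ennreal ((b x - k n x)^2)) \<longlonglongrightarrow> 0"
  proof -
   have "AE x in LB. x \<notin> N" using g(1) by (simp add: negligible_iff_null_sets AE_not_in)
   hence "AE x in lborel. x \<notin> N" by (simp add: AE_completion_iff)
   thus ?thesis
   proof eventually_elim
   case (elim x)
   have "(%n. clip (real m) (g n x)) \<longlonglongrightarrow> clip (real m) (f x)"
   using clip(4)[of "real m"] by (intro isCont_tendsto_compose[OF _ g(3)[OF elim]]) (simp add: continuous_on_eq_continuous_at)
   hence "(%n. (b x - k n x)^2) \<longlonglongrightarrow> (b x - b x)^2" unfolding k_def b_def by (intro tendsto_intros)
   hence "(%n. ennreal ((b x - k n x)^2)) \<longlonglongrightarrow> ennreal 0" by (intro tendsto_ennrealI) simp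
   thus ?case by simp
   qed
  qed
 qed (use mb mk in auto)
 hence "(%n. n2 (%x. b x - k n x)) \<longlonglongrightarrow> 0" by (simp add: n2_def)
 hence "\<forall>\<^sub>F n in sequentially. n2 (%x. b x - k n x) < ennreal (ep / 4)"
  using \<open>ep > 0\<close> by (intro order_tendstoD(2)) auto
 then obtain n where n: "n2 (%x. b x - k n x) < ennreal (ep / 4)" by (auto simp: eventually_sequentially)
 have "n2 (%x. f x - k n x) = n2 (%x. (f x - b x) + (b x - k n x))" by simp
 also have "... <= 2 * n2 (%x. f x - b x) + 2 * n2 (%x. b x - k n x)"
  using f(1) mb mk by (intro n2_add) auto
 also have "... < ennreal ep"
 proof -
  obtain p where p: "n2 (%x. f x - b x) = ennreal p" "0 <= p" "p < ep / 4"
   using m unfolding b_def[symmetric] by (rule less_ennrealE)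
  obtain q where q: "n2 (%x. b x - k n x) = ennreal q" "0 <= q" "q < ep / 4"
   using n by (rule less_ennrealE)
  hence "ennreal (2 * p + 2 * q) < ennreal ep" using p q by (intro ennreal_lessI) auto
  thus ?thesis using p q by (simp add: ennreal_plus ennreal_mult)
 qed
 finally have "n2 (%x. f x - k n x) < ennreal ep" .
 moreover have "k n x = 0" if "abs x >= real m + 1" for x using cutoff(3)[OF that] by (simp add: k_def)
 ultimately show ?thesis using that ck by blast
qed

lemma two_ennreal: "0 <= a ==> 2 * ennreal a = ennreal (2 * a)"
 by (simp add: ennreal_mult)

lemma ennreal_tendsto_zeroI:
 fixes X :: "'a => ennreal"
 assumes "!!ep::real. ep > 0 ==> \<forall>\<^sub>F x in F. X x <= ennreal ep"
 shows "(X ~~> 0) F"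
proof (rule order_tendstoI)
 fix a :: ennreal assume "0 < a"
 then obtain e where e: "0 < e" "ennreal e < a" by (metis dense ennreal_cases ennreal_less_zero_iff not_less_iff_gr_or_eq top.not_eq_extremum)
 show "\<forall>\<^sub>F x in F. X x < a" using assms[OF e(1)] by eventually_elim (use e in auto)
qed simp

text \<open>A continuous function with bounded support is uniformly continuous; the general case
  follows by approximation, since translation preserves the norm.\<close>

lemma n2_translation:
 assumes f: "f \<in> BM" "n2 f < \<infinity>"
 shows "((%h. n2 (%x. f (x + h) - f x)) ~~> 0) (at 0)"
proof (rule ennreal_tendsto_zeroI)
 fix ep :: real assume "ep > 0"
 hence "ep / 16 > 0" by simp
 obtain g R where g: "cont g" "!!x. abs x >= R ==> g x = 0" and fg: "n2 (%x. f x - g x) < ennreal (ep / 16)"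
  using n2_approx_continuous[OF f \<open>ep / 16 > 0\<close>] by blast
 define ro where "ro = abs R + 1"
 have ro: "ro > 0" "!!x. abs x >= ro ==> g x = 0" using g(2) by (auto simp: ro_def)
 define et where "et = sqrt (ep / (16 * (ro + 1)))"
 have et: "et > 0" "et^2 * (2 * (ro + 1)) = ep / 8" using ro(1) \<open>ep > 0\<close> by (auto simp: et_def field_simps)
 have "uniformly_continuous_on {-(ro+2)..ro+2} g" by (intro compact_uniformly_continuous continuous_on_subset[OF g(1)]) auto
 then obtain d where d: "d > 0" "!!x y. x \<in> {-(ro+2)..ro+2} ==> y \<in> {-(ro+2)..ro+2} ==> dist y x < d ==> dist (g y) (g x) < et"
  unfolding uniformly_continuous_on_def using et(1) by metis
 have mg: "g \<in> BM" by (rule bmc[OF g(1)])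
 have main: "n2 (%x. f (x + h) - f x) <= ennreal ep" if h: "abs h < d" "abs h < 1" for h
 proof -
  have pt: "(g (x + h) - g x)^2 <= et^2 * indicator {-(ro+1)..ro+1} x" for x
  proof (cases "x \<in> {-(ro+1)..ro+1}")
   case True
   have "dist (g (x + h)) (g x) < et" by (rule d(2)) (use True h in \<open>auto simp: dist_real_def\<close>)
   hence "abs (g (x + h) - g x) <= et" by (simp add: dist_real_def)
   thus ?thesis using True et(1) by (simp add: abs_le_square_iff[symmetric])
  next
   case False
   hence "abs x >= ro" "abs (x + h) >= ro" using h by auto
   thus ?thesis using ro(2) False by simp
  qed
  have "n2 (%x. g (x + h) - g x) <= (\<integral>\<^sup>+x. ennreal (et^2) * indicator {-(ro+1)..ro+1} x \<partial>lborel)"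
   unfolding n2_def
  proof (rule nn_integral_mono)
   fix x show "ennreal ((g (x + h) - g x)^2) <= ennreal (et^2) * indicator {-(ro+1)..ro+1} x"
   using ennreal_leI[OF pt[of x]] by (cases "x \<in> {-(ro+1)..ro+1}") auto
  qed
  also have "... = ennreal (et^2 * (2 * (ro + 1)))"
   using ro(1) by (subst nn_integral_cmult_indicator) (simp_all add: ennreal_mult algebra_simps)
  finally have 2: "n2 (%x. g (x + h) - g x) <= ennreal (ep / 8)" unfolding et(2) .
  have mfg: "(%x. f x - g x) \<in> BM" using f mg by simp
  have mfh: "(%x. f (x + h) - g (x + h)) \<in> BM" by (rule measurable_compose[OF _ mfg]) simp
  have mgh: "(%x. g (x + h) - g x) \<in> BM" using mg measurable_compose[OF _ mg, of "%x. x + h" borel] by simp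
  have "n2 (%x. (f (x + h) - g (x + h)) - (f x - g x)) <= 2 * n2 (%x. f (x + h) - g (x + h)) + 2 * n2 (%x. f x - g x)"
   by (rule n2_diff[OF mfh mfg])
  also have "n2 (%x. f (x + h) - g (x + h)) = n2 (%x. f x - g x)" using n2_shift[OF mfg, of h] by simp
  also have "2 * n2 (%x. f x - g x) + 2 * n2 (%x. f x - g x) <= 2 * ennreal (ep / 16) + 2 * ennreal (ep / 16)"
   using fg by (intro add_mono mult_left_mono) auto
  finally have 1: "n2 (%x. (f (x + h) - g (x + h)) - (f x - g x)) <= 2 * ennreal (ep / 16) + 2 * ennreal (ep / 16)" .
  have "n2 (%x. f (x + h) - f x) = n2 (%x. ((f (x + h) - g (x + h)) - (f x - g x)) + (g (x + h) - g x))"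
   by (rule arg_cong[of _ _ n2]) auto
  also have "... <= 2 * n2 (%x. (f (x + h) - g (x + h)) - (f x - g x)) + 2 * n2 (%x. g (x + h) - g x)"
   by (rule n2_add) (use mfh mfg mgh in auto)
  also have "... <= 2 * (2 * ennreal (ep / 16) + 2 * ennreal (ep / 16)) + 2 * ennreal (ep / 8)"
   using 1 2 by (intro add_mono mult_left_mono) auto
  also have "... = ennreal (2 * (2 * (ep / 16) + 2 * (ep / 16)) + 2 * (ep / 8))"
   using \<open>ep > 0\<close> by (simp add: two_ennreal flip: ennreal_plus)
  also have "... <= ennreal ep" using \<open>ep > 0\<close> by (intro ennreal_leI) simp
  finally show ?thesis .
 qed
 show "\<forall>\<^sub>F h in at 0. n2 (%x. f (x + h) - f x) <= ennreal ep"
  unfolding eventually_at by (rule exI[of _ "min d 1"]) (use d(1) main in \<open>auto simp: dist_real_def\<close>)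
qed

section \<open>Duhamel integrals along characteristics\<close>

text \<open>The mean over the segment from \<open>a\<close> to \<open>b\<close>, in either order.
  Thus \<open>J h t\<close> is the oriented integral from 0 to \<open>t\<close> for both signs of
  \<open>t\<close>, and its continuity in parameters is that of an integral over a fixed
  interval.\<close>

definition mean :: "(real => real) => real => real => real" where
 "mean h a b = integral {0..1} (%sg. h (a + sg * (b - a)))"

definition J :: "(real => real) => real => real" where
 "J h t = t * mean h 0 t"

lemma mean_same [simp]: "mean h a a = h a"
 by (simp add: mean_def)

lemma cont2: "cont (%(z, s). h z s) ==> continuous_on S a ==> continuous_on S b ==> continuous_on S (%z. h (a z) (b z))"
 by (rule continuous_on_compose2[of UNIV "%(z, s). h z s" S "%z. (a z, b z)", simplified]) (auto intro!: continuous_intros)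

lemma continuous_mean:
 assumes "cont (%(z, s). h z s)" "cont a" "cont b"
 shows "cont (%z. mean (h z) (a z) (b z))"
proof -
 have "continuous_on (UNIV \<times> cbox 0 1) (%z. h (fst z) (a (fst z) + snd z * (b (fst z) - a (fst z))))"
  by (intro cont2[OF assms(1)] continuous_intros continuous_on_compose2[OF assms(2)] continuous_on_compose2[OF assms(3)]) auto
 hence "cont (%z. integral (cbox 0 1) (%sg. h z (a z + sg * (b z - a z))))"
  by (intro integral_continuous_on_param) (simp add: cpb)
 thus ?thesis by (simp add: mean_def[abs_def])
qed

lemma mean_FTC:
 assumes "!!x. (H hrd h x) (at x)"
 shows "H b - H a = (b - a) * mean h a b"
proof -
 have "((%sg. h (a + sg * (b - a)) * (b - a)) has_integral H (a + 1 * (b - a)) - H (a + 0 * (b - a))) {0..1}"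
 proof (rule fundamental_theorem_of_calculus)
  fix sg :: real
  have 1: "((%sg. a + sg * (b - a)) hrd (b - a)) (at sg)" by (auto intro!: derivative_eq_intros)
  have "((%sg. H (a + sg * (b - a))) hrd h (a + sg * (b - a)) * (b - a)) (at sg)"
   by (rule DERIV_chain'[OF 1 assms])
  thus "((%sg. H (a + sg * (b - a))) has_vector_derivative h (a + sg * (b - a)) * (b - a)) (at sg within {0..1})"
   by (simp add: has_real_derivative_iff_has_vector_derivative has_vector_derivative_at_within)
 qed simp
 from integral_unique[OF this] show ?thesis by (simp add: mean_def mult.commute)
qed

lemma antiderivative:
 assumes "cont h"
 obtains H where "!!x. (H hrd h x) (at x)" "H 0 = (0::real)"
proof -
 obtain H where "AC H h" "H 0 = 0" using AC_primitive[OF li_cont[OF assms]] by blast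
 thus ?thesis by (intro that AC_continuous_deriv assms)
qed

lemma J_zero [simp]: "J h 0 = 0" by (simp add: J_def)

lemma J_FTC: "(!!x. (H hrd h x) (at x)) ==> J h t = H t - H 0"
 using mean_FTC[of H h t 0] by (simp add: J_def)

lemma J_DERIV:
 assumes "cont h"
 shows "(J h hrd h t) (at t)"
proof -
 obtain H where H: "!!x. (H hrd h x) (at x)" "H 0 = 0" by (rule antiderivative[OF assms]) blast
 hence "J h = H" using J_FTC[of H h] by auto
 thus ?thesis using H by simp
qed

lemma J_continuous:
 assumes "cont (%(z, s). h z s)" "cont t"
 shows "cont (%z. J (h z) (t z))"
 unfolding J_def by (intro continuous_intros continuous_mean assms)

lemma J_diff:
 assumes "cont h" "cont k"
 shows "J (%s. h s - k s) t = J h t - J k t"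
proof -
 have "J (%s. h s - k s) t = (J h t - J k t) - (J h 0 - J k 0)"
  by (rule J_FTC) (intro derivative_intros J_DERIV assms)
 thus ?thesis by simp
qed

lemma J_cmult: "J (%s. c * h s) t = c * J h t"
 by (simp add: J_def mean_def)

lemma J_add:
 assumes "cont h" "cont k"
 shows "J (%s. h s + k s) t = J h t + J k t"
 using J_diff[of h "%s. (-1) * k s" t] assms J_cmult[of "-1" k t] by (simp add: continuous_on_minus)

lemma J_reflect: "J (%s. h (- s)) (- t) = - J h t"
 by (simp add: J_def mean_def)

text \<open>In the norm weighted by \<open>exp (L * abs t)\<close> every time integration gains a
  factor \<open>1 / L\<close>; a large \<open>L\<close> thus gives contraction for all times at
  once.\<close>

lemma J_exp_bound:
 assumes h: "cont h" "!!s. abs (h s) <= M * exp (L * abs s)" and L: "L > 0"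
 shows "abs (J h t) <= M / L * exp (L * abs t)"
proof -
 have M: "M >= 0" using h(2)[of 0] by auto
 have pos: "abs (J h t) <= M / L * exp (L * t)" if t: "t >= 0" and h: "cont h" "!!s. abs (h s) <= M * exp (L * abs s)" for h t
 proof -
  have 1: "J h t <= M / L * exp (L * t) - M / L" if h: "cont h" "!!s. abs (h s) <= M * exp (L * abs s)" for h
  proof -
   have "J h 0 - M / L * exp (L * 0) >= J h t - M / L * exp (L * t)"
   proof (rule DERIV_nonpos_imp_nonincreasing[OF t])
   fix x :: real assume x: "0 <= x" "x <= t"
   have "((%x. J h x - M / L * exp (L * x)) hrd h x - M * exp (L * x)) (at x)"
   using L by (auto intro!: derivative_eq_intros J_DERIV h)
   moreover have "h x - M * exp (L * x) <= 0" using h(2)[of x] x by auto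
   ultimately show "EX y. ((%x. J h x - M / L * exp (L * x)) hrd y) (at x) & y <= 0" by blast
   qed
   thus ?thesis by simp
  qed
  have "J h t <= M / L * exp (L * t) - M / L" by (rule 1[OF h])
  moreover have "J (%s. (-1) * h s) t <= M / L * exp (L * t) - M / L" by (rule 1) (use h in \<open>auto intro: continuous_intros\<close>)
  moreover have "M / L >= 0" using M L by simp
  ultimately show ?thesis unfolding J_cmult by (intro abs_leI) linarith+
 qed
 show ?thesis
 proof (cases "t >= 0")
  case True
  thus ?thesis using pos[OF _ h] by simp
 next
  case False
  have "abs (J (%s. h (- s)) (- t)) <= M / L * exp (L * (- t))"
   by (rule pos) (use False h(2)[of "- _"] in \<open>auto intro!: continuous_intros continuous_on_compose2[OF h(1)]\<close>)
  thus ?thesis using False by (simp add: J_reflect)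
 qed
qed

text \<open>Caratheodory's criterion: increments are written as means of the derivative times
  \<open>z - r\<close>, and these means are continuous up to \<open>z = r\<close>, so no limit is
  taken under the integral.\<close>

lemma J_param_DERIV:
 assumes G: "cont (%(s, r). G s r)" "cont (%(s, r). G' s r)"
  and D: "!!s r. (G s hrd G' s r) (at r)"
 shows "((%r. J (%s. G s r) t) hrd J (%s. G' s r) t) (at r)"
  "((%r. J (%s. G s r) r) hrd G r r + J (%s. G' s r) r) (at r)"
proof -
 have cG: "cont (%s. G s r)" for r by (intro cont2[OF G(1)] continuous_intros)
 have cm: "cont (%(z, s). mean (G' s) r z)" for r
  unfolding cpb
  by (rule continuous_mean[of "%p. G' (snd p)"]) (auto intro!: continuous_intros cont2[OF G(2)] simp: cpb)
 have 1: "J (%s. G s z) t - J (%s. G s r) t = J (%s. mean (G' s) r z) t * (z - r)" for z t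
 proof -
  have "J (%s. G s z) t - J (%s. G s r) t = J (%s. G s z - G s r) t" by (simp add: J_diff cG)
  also have "... = J (%s. (z - r) * mean (G' s) r z) t" by (simp add: mean_FTC[OF D])
  finally show ?thesis by (simp add: J_cmult)
 qed
 have 2: "isCont (%z. J (%s. mean (G' s) r z) t) r" for t
  using J_continuous[OF cm continuous_on_const, of r t] by (simp add: continuous_on_eq_continuous_at)
 show "((%r. J (%s. G s r) t) hrd J (%s. G' s r) t) (at r)"
  unfolding CARAT_DERIV using 1 2 by (intro exI[of _ "%z. J (%s. mean (G' s) r z) t"]) simp
 have 3: "J (%s. G s z) z - J (%s. G s z) r = mean (%s. G s z) r z * (z - r)" for z
  using mean_FTC[OF J_DERIV[OF cG[of z]], of z r] by simp
 have "cont (%z. mean (%s. G s z) r z)"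
  by (rule continuous_mean[of "%z s. G s z"]) (auto intro!: continuous_intros cont2[OF G(1)] simp: cpb)
 hence 4: "isCont (%z. mean (%s. G s z) r z) r" by (simp add: continuous_on_eq_continuous_at)
 show "((%r. J (%s. G s r) r) hrd G r r + J (%s. G' s r) r) (at r)"
  unfolding CARAT_DERIV
 proof (intro exI[of _ "%z. mean (%s. G s z) r z + J (%s. mean (G' s) r z) r"] conjI allI)
  fix z
  show "J (%s. G s z) z - J (%s. G s r) r = (mean (%s. G s z) r z + J (%s. mean (G' s) r z) r) * (z - r)"
   unfolding distrib_right 1[symmetric] 3[symmetric] by simp
 qed (use 2 4 in \<open>auto intro!: continuous_intros\<close>)
qed

lemma avg_bound: "abs a <= X ==> abs b <= X ==> abs ((a + b) / 2) <= (X::real)"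
 by (simp add: abs_le_iff field_simps)

text \<open>\<open>Jp\<close> and \<open>Jm\<close> integrate the source along the two
  characteristics through \<open>(t, x)\<close>. \<open>Dh\<close> is d'Alembert's formula, half the
  integral over the triangle between these characteristics and time 0.\<close>

definition Jp :: "(real => real => real) => real => real => real" where
 "Jp f t x = J (%s. f s (x + t - s)) t"
definition Jm :: "(real => real => real) => real => real => real" where
 "Jm f t x = J (%s. f s (x - t + s)) t"
definition Dh :: "(real => real => real) => real => real => real" where
 "Dh f t x = J (%s. J (f s) (x + t - s) - J (f s) (x - t + s)) t / 2"

context
 fixes f :: "real => real => real"
 assumes f: "cont (%(s, x). f s x)"
begin

lemma JF_continuous: "cont (%(s, x). J (f s) x)"
 unfolding cpb
 by (rule J_continuous[of "%p. f (fst p)"]) (auto intro!: continuous_intros cont2[OF f] simp: cpb)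

lemma Jpm_continuous: "cont (%(t, x). Jp f t x)" "cont (%(t, x). Jm f t x)"
 unfolding cpb Jp_def Jm_def
 apply (rule J_continuous[of "%p s. f s (snd p + fst p - s)"])
  apply (auto intro!: continuous_intros cont2[OF f] simp: cpb)[2]
 apply (rule J_continuous[of "%p s. f s (snd p - fst p + s)"])
 apply (auto intro!: continuous_intros cont2[OF f] simp: cpb)
 done

lemma Dh_continuous: "cont (%(t, x). Dh f t x)"
 unfolding cpb Dh_def
 by (intro continuous_intros J_continuous[of "%p s. J (f s) (snd p + fst p - s) - J (f s) (snd p - fst p + s)"])
  (auto intro!: continuous_intros cont2[OF JF_continuous] simp: cpb)

lemma slice: "continuous_on S (f s)"
 using cont2[OF f continuous_on_const continuous_on_id] by simp

lemma Dh_DERIV_t: "((%t. Dh f t x) hrd (Jp f t x + Jm f t x) / 2) (at t)"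
proof -
 have c1: "cont (%s. f s (x + t - s))" and c2: "cont (%s. f s (x - t + s))"
  by (intro cont2[OF f] continuous_intros)+
 have D: "((%t. J (%s. J (f s) (x + t - s) - J (f s) (x - t + s)) t) hrd
  (J (f t) (x + t - t) - J (f t) (x - t + t)) + J (%s. f s (x + t - s) + f s (x - t + s)) t) (at t)"
 proof (rule J_param_DERIV(2))
  show "((%t. J (f s) (x + t - s) - J (f s) (x - t + s)) hrd f s (x + r - s) + f s (x - r + s)) (at r)" for s r
   by (auto intro!: derivative_eq_intros DERIV_chain'[OF _ J_DERIV[OF slice]])
 qed (auto intro!: continuous_intros cont2[OF f] cont2[OF JF_continuous] simp: cpb)
 have "(J (f t) (x + t - t) - J (f t) (x - t + t)) + J (%s. f s (x + t - s) + f s (x - t + s)) t = Jp f t x + Jm f t x"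
  by (simp add: Jp_def Jm_def J_add[OF c1 c2])
 thus ?thesis unfolding Dh_def using DERIV_cdivide[OF D, of 2] by simp
qed

lemma Dh_DERIV_x: "((%x. Dh f t x) hrd (Jp f t x - Jm f t x) / 2) (at x)"
proof -
 have c1: "cont (%s. f s (x + t - s))" and c2: "cont (%s. f s (x - t + s))"
  by (intro cont2[OF f] continuous_intros)+
 have D: "((%x. J (%s. J (f s) (x + t - s) - J (f s) (x - t + s)) t) hrd
  J (%s. f s (x + t - s) - f s (x - t + s)) t) (at x)"
 proof (rule J_param_DERIV(1))
  show "((%x. J (f s) (x + t - s) - J (f s) (x - t + s)) hrd f s (r + t - s) - f s (r - t + s)) (at r)" for s r
   by (auto intro!: derivative_eq_intros DERIV_chain'[OF _ J_DERIV[OF slice]])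
 qed (auto intro!: continuous_intros cont2[OF f] cont2[OF JF_continuous] simp: cpb)
 show ?thesis unfolding Dh_def Jp_def Jm_def J_diff[OF c1 c2, symmetric] using DERIV_cdivide[OF D, of 2] by simp
qed

lemma Jpm_slice: "cont (%s. (Jp f s x + Jm f s x) / 2)"
 by (intro continuous_intros cont2[OF Jpm_continuous(1)] cont2[OF Jpm_continuous(2)]) auto

text \<open>Writing \<open>Dh\<close> as a time integral of the mean of \<open>Jp\<close> and
  \<open>Jm\<close> exhibits two successive time integrations, which gain \<open>1 / L^2\<close> in
  the weighted norms.\<close>

lemma Dh_eq: "Dh f t x = J (%s. (Jp f s x + Jm f s x) / 2) t"
proof -
 have "J (%s. (Jp f s x + Jm f s x) / 2) t = Dh f t x - Dh f 0 x" by (rule J_FTC[OF Dh_DERIV_t])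
 thus ?thesis by (simp add: Dh_def)
qed

lemma Duhamel_bound:
 assumes b: "!!s x. abs (f s x) <= M * exp (L * abs s)" and L: "L > 0"
 shows "abs (Dh f t x) <= M / L^2 * exp (L * abs t)"
proof -
 have 1: "abs (Jp f s x) <= M / L * exp (L * abs s)" for s x
  unfolding Jp_def by (intro J_exp_bound L b cont2[OF f] continuous_intros)
 have 2: "abs (Jm f s x) <= M / L * exp (L * abs s)" for s x
  unfolding Jm_def by (intro J_exp_bound L b cont2[OF f] continuous_intros)
 have 3: "abs ((Jp f s x + Jm f s x) / 2) <= M / L * exp (L * abs s)" for s x
  by (rule avg_bound[OF 1 2])
 have "abs (Dh f t x) <= M / L / L * exp (L * abs t)"
  unfolding Dh_eq by (intro J_exp_bound L 3 Jpm_slice)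
 thus ?thesis by (simp add: power2_eq_square)
qed

end

lemma Dh_diff:
 assumes "cont (%(s, x). f s x)" "cont (%(s, x). g s x)"
 shows "Dh (%s x. f s x - g s x) t x = Dh f t x - Dh g t x"
proof -
 note c = continuous_intros cont2[OF JF_continuous[OF assms(1)]] cont2[OF JF_continuous[OF assms(2)]]
 have "Dh (%s x. f s x - g s x) t x = J (%s. (J (f s) (x + t - s) - J (f s) (x - t + s)) - (J (g s) (x + t - s) - J (g s) (x - t + s))) t / 2"
  unfolding Dh_def J_diff[OF slice[OF assms(1)] slice[OF assms(2)]] by (simp add: algebra_simps)
 thus ?thesis unfolding Dh_def by (subst (asm) J_diff) (auto intro!: c simp: diff_divide_distrib)
qed

lemma n2_J:
 assumes h: "cont (%(s, x). h s x)" and b: "!!s. n2 (h s) <= ennreal ((B * exp (L * abs s))^2)" and L: "L > 0" and B: "B > 0"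
 shows "n2 (%x. J (%s. h s x) t) <= ennreal ((B / L * exp (L * abs t))^2)"
proof -
 have pos: "n2 (%x. J (%s. h s x) t) <= ennreal ((B / L * exp (L * t))^2)" if t: "t >= 0"
  and h: "cont (%(s, x). h s x)" and b: "!!s. n2 (h s) <= ennreal ((B * exp (L * abs s))^2)" for h t
 proof -
  have c: "cont (%s. h s x)" for x by (intro cont2[OF h] continuous_intros)
  have "n2 (%x. J (%s. h s x) t - J (%s. h s x) 0) <= ennreal ((integral {0..t} (%s. B * exp (L * s)))^2)"
  proof (rule minkowski[OF _ _ _ _ _ t])
   show "AC (%t. J (%s. h s x) t) (%s. h s x)" for x by (intro AC_C1 J_DERIV c)
   show "(%(s, x). h s x) \<in> BM" by (rule bmc[OF h])
   show "cont (%s. B * exp (L * s))" by (intro continuous_intros)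
   show "n2 (h s) <= ennreal ((B * exp (L * s))^2)" if "s \<in> {0..t}" for s using b[of s] that by simp
  qed (use B in auto)
  also have "integral {0..t} (%s. B * exp (L * s)) = B / L * exp (L * t) - B / L * exp (L * 0)"
  proof (intro integral_unique fundamental_theorem_of_calculus t)
   fix s
   have "((%s. B / L * exp (L * s)) hrd B * exp (L * s)) (at s)" using L by (auto intro!: derivative_eq_intros)
   thus "((%s. B / L * exp (L * s)) has_vector_derivative B * exp (L * s)) (at s within {0..t})"
   by (simp add: has_real_derivative_iff_has_vector_derivative has_vector_derivative_at_within)
  qed
  also have "ennreal ((B / L * exp (L * t) - B / L * exp (L * 0))^2) <= ennreal ((B / L * exp (L * t))^2)"
  proof (intro ennreal_leI power_mono)
   have "exp (L * t) >= 1" using L t by simp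
   hence "B / L * 1 <= B / L * exp (L * t)" using B L by (intro mult_left_mono) auto
   thus "0 <= B / L * exp (L * t) - B / L * exp (L * 0)" by simp
  qed (use B L in auto)
  finally show ?thesis by simp
 qed
 show ?thesis
 proof (cases "t >= 0")
  case True
  thus ?thesis using pos[OF True h b] by simp
 next
  case False
  have "n2 (%x. J (%s. h (- s) x) (- t)) <= ennreal ((B / L * exp (L * (- t)))^2)"
   by (rule pos[of "- t" "%s. h (- s)"]) (use False b[of "- _"] in \<open>auto intro!: continuous_intros cont2[OF h] simp: cpb\<close>)
  thus ?thesis using False by (simp add: J_reflect[of "%s. h s _"] n2_minus)
 qed
qed

lemma n2_avg:
 assumes m: "f \<in> BM" "g \<in> BM" and b: "n2 f <= ennreal K" "n2 g <= ennreal K" and K: "K >= 0"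
 shows "n2 (%x. (f x + g x) / 2) <= ennreal K"
proof -
 have "n2 (%x. (f x + g x) / 2) = n2 (%x. (1/2) * (f x + g x))" by simp
 also have "... = ennreal ((1/2)^2) * n2 (%x. f x + g x)" by (rule n2_cmult) (use m in simp)
 also have "... <= ennreal ((1/2)^2) * (2 * n2 f + 2 * n2 g)" by (intro mult_left_mono n2_add m) simp
 also have "... <= ennreal ((1/2)^2) * (2 * ennreal K + 2 * ennreal K)" by (intro mult_left_mono add_mono b) auto
 also have "... = ennreal K" using K by (simp add: two_ennreal power2_eq_square flip: ennreal_plus ennreal_mult)
 finally show ?thesis .
qed

lemma n2_Duhamel:
 assumes f: "cont (%(s, x). f s x)" and b: "!!s. n2 (f s) <= ennreal ((B * exp (L * abs s))^2)" and L: "L > 0" and B: "B > 0"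
 shows "n2 (Jp f t) <= ennreal ((B / L * exp (L * abs t))^2)" "n2 (Jm f t) <= ennreal ((B / L * exp (L * abs t))^2)"
  "n2 (Dh f t) <= ennreal ((B / L^2 * exp (L * abs t))^2)"
proof -
 have m: "f s \<in> BM" for s by (rule bmc[OF slice[OF f]])
 show p: "n2 (Jp f t) <= ennreal ((B / L * exp (L * abs t))^2)" for t
  unfolding Jp_def[abs_def]
 proof (rule n2_J[OF _ _ L B])
  show "cont (%(s, x). f s (x + t - s))" unfolding cpb by (intro cont2[OF f] continuous_intros)
  show "n2 (%x. f s (x + t - s)) <= ennreal ((B * exp (L * abs s))^2)" for s
   using n2_shift[OF m[of s], of "t - s"] b[of s] by (simp add: add_diff_eq)
 qed
 show q: "n2 (Jm f t) <= ennreal ((B / L * exp (L * abs t))^2)" for t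
  unfolding Jm_def[abs_def]
 proof (rule n2_J[OF _ _ L B])
  show "cont (%(s, x). f s (x - t + s))" unfolding cpb by (intro cont2[OF f] continuous_intros)
  show "n2 (%x. f s (x - t + s)) <= ennreal ((B * exp (L * abs s))^2)" for s
   using n2_shift[OF m[of s], of "s - t"] b[of s] by (simp add: algebra_simps)
 qed
 have mp: "Jp f t \<in> BM" "Jm f t \<in> BM" for t
  by (intro bmc slice[OF Jpm_continuous(1)[OF f]] slice[OF Jpm_continuous(2)[OF f]])+
 have "n2 (Dh f t) <= ennreal ((B / L / L * exp (L * abs t))^2)"
  unfolding Dh_eq[OF f, abs_def]
 proof (rule n2_J[OF _ _ L])
  show "cont (%(s, x). (Jp f s x + Jm f s x) / 2)"
   unfolding cpb by (intro continuous_intros cont2[OF Jpm_continuous(1)[OF f]] cont2[OF Jpm_continuous(2)[OF f]]) auto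
  fix s
  show "n2 (%x. (Jp f s x + Jm f s x) / 2) <= ennreal ((B / L * exp (L * abs s))^2)" by (intro n2_avg mp p q) simp
 qed (use B L in auto)
 thus "n2 (Dh f t) <= ennreal ((B / L^2 * exp (L * abs t))^2)" by (simp add: power2_eq_square)
qed

section \<open>The wave equation with truncated nonlinearity\<close>

text \<open>Clipping the argument at 2 makes the nonlinearity globally Lipschitz; on [-2, 2] the
  derivative of \<open>dpot\<close> is at most \<open>2 + 24 * 4 + 30 * 16 = 578\<close> in absolute
  value.\<close>

definition tr :: "real => real" where "tr u = dpot (clip 2 u)"

lemma DERIV_dpot: "(dpot hrd 2 - 24 * u^2 + 30 * u ^ 4) (at u)"
 unfolding dpot_def[abs_def] by (auto intro!: derivative_eq_intros)

lemma dpot_lipschitz: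
 assumes "abs u <= M" "abs v <= M"
 shows "abs (dpot u - dpot v) <= (2 + 24 * M^2 + 30 * M ^ 4) * abs (u - v)"
proof -
 have "norm (dpot u - dpot v) <= (2 + 24 * M^2 + 30 * M ^ 4) * norm (u - v)"
 proof (rule field_differentiable_bound[where S = "{-M..M}"])
  fix z :: real assume z: "z \<in> {-M..M}"
  show "(dpot hrd 2 - 24 * z^2 + 30 * z ^ 4) (at z within {-M..M})"
   by (rule DERIV_subset[OF DERIV_dpot]) simp
  have "abs z <= abs M" using z by auto
  hence q1: "z^2 <= M^2" unfolding abs_le_square_iff .
  note q = q1 zero_le_power2[of z]
  have "(z^2)^2 <= (M^2)^2" by (intro power_mono q)
  hence "0 <= z ^ 4" "z ^ 4 <= M ^ 4" by (simp_all flip: power_mult)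
  thus "norm (2 - 24 * z^2 + 30 * z ^ 4) <= 2 + 24 * M^2 + 30 * M ^ 4" using q unfolding real_norm_def by (intro abs_leI) linarith+
 qed (use assms in auto)
 thus ?thesis by simp
qed

lemma tr_lipschitz: "abs (tr u - tr v) <= 600 * abs (u - v)"
proof -
 have "abs (dpot (clip 2 u) - dpot (clip 2 v)) <= 578 * abs (clip 2 u - clip 2 v)"
  using dpot_lipschitz[OF clip(1)[of 2 u] clip(1)[of 2 v]] by simp
 also have "... <= 600 * abs (u - v)"
  using clip_lipschitz[of 2 u v] by (intro mult_mono) auto
 finally show ?thesis by (simp only: tr_def)
qed

lemma tr_0: "tr 0 = 0" and tr_le: "abs (tr u) <= 600 * abs u" and tr_eq: "abs u <= 2 ==> tr u = dpot u"
proof -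
 show 0: "tr 0 = 0" by (simp add: tr_def clip_def dpot_def)
 show "abs (tr u) <= 600 * abs u" using tr_lipschitz[of u 0] 0 by simp
 show "abs u <= 2 ==> tr u = dpot u" by (simp add: tr_def clip)
qed

lemma continuous_tr [continuous_intros]: "continuous_on S f ==> continuous_on S (%x. tr (f x))"
proof -
 have "cont tr" unfolding tr_def[abs_def] by (intro continuous_intros clip)
 thus "continuous_on S f ==> continuous_on S (%x. tr (f x))" by (rule continuous_on_compose2) auto
qed

lemma bkg_le: "abs (bkg x) <= 1"
 using kink01_pos[of x] kink01_less_1[of x] kink01_pos[of "-x"] kink01_less_1[of "-x"] by (auto simp: bkg_def kink10_eq)

text \<open>\<open>dpot\<close> vanishes at the zeros of \<open>pot\<close> inside [-1, 1], with
  \<open>(dpot u)^2 <= 16 * pot u\<close> there, so the energy density of the background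
  dominates.\<close>

lemma tr_bkg: "sqint UNIV (%x. tr (bkg x))"
proof (rule sqint_dom[where g = "%x. 16 * edens bkg bkg_deriv x"])
 show "(%x. tr (bkg x)) \<in> LM" by (intro continuous_meas continuous_intros)
 have "edens bkg bkg_deriv abs_int_on UNIV" by (rule S_edens_int) (auto simp: H1r_def AC_const sqint_def)
 from abs_int_imp[OF this] show "(%x. 16 * edens bkg bkg_deriv x) integrable_on UNIV" by (rule integrable_on_mult_right)
 fix x
 have q: "0 <= (bkg x)^2" "(bkg x)^2 <= 1" using bkg_le[of x] by (auto simp: abs_square_le_1)
 have "dpot (bkg x) = 2 * bkg x * (1 - (bkg x)^2) * (1 - 3 * (bkg x)^2)"
  by (simp add: dpot_def power2_eq_square power3_eq_cube field_simps eval_nat_numeral)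
 hence "(dpot (bkg x))^2 = 4 * pot (bkg x) * (1 - 3 * (bkg x)^2)^2"
  by (simp add: power_mult_distrib pot_def)
 also have "... <= 4 * pot (bkg x) * 4"
 proof (intro mult_left_mono)
  have "abs (1 - 3 * (bkg x)^2) <= abs 2" using q unfolding abs_numeral by (intro abs_leI) linarith+
  thus "(1 - 3 * (bkg x)^2)^2 <= 4" unfolding abs_le_square_iff by simp
 qed (simp add: pot_nonneg)
 also have "... <= 16 * edens bkg bkg_deriv x" by (simp add: edens_def)
 finally show "(tr (bkg x))^2 <= 16 * edens bkg bkg_deriv x" using bkg_le[of x] by (simp add: tr_eq)
qed simp

lemma AC_holder:
 assumes "AC U V" "sqint UNIV V"
 shows "(U y - U x)^2 <= abs (y - x) * intR (%x. (V x)^2)"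
proof -
 have main: "(U y - U x)^2 <= (y - x) * intR (%x. (V x)^2)" if "x <= y" for x y
 proof -
  have s: "sqint {x..y} V" "sqint {x..y} (%_. 1)"
   using sqint_subset[OF assms(2), of "{x..y}"] by (auto simp: sqint_def intro!: absolutely_integrable_continuous_real)
  have "(U y - U x)^2 = (integral {x..y} (%z. 1 * V z))^2" using AC_D[OF assms(1) that] by simp
  also have "... <= integral {x..y} (%z. 1^2) * integral {x..y} (%z. (V z)^2)"
   by (rule Cauchy_Schwarz_integral) (use s in auto)
  also have "... <= (y - x) * intR (%x. (V x)^2)"
   using that sqint_int[OF assms(2)] sqint_int[OF s(1)] by (auto intro!: mult_left_mono integral_subset_le)
  finally show ?thesis .
 qed
 show ?thesis using main[of x y] main[of y x] by (cases "x <= y") (auto simp: power2_commute)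
qed

text \<open>The travelling profiles of d'Alembert's solution. Only their sum is close to the
  background; each contains a primitive of the initial velocity and may be unbounded, hence the
  separate conditions on the derivatives.\<close>

locale wave_data =
 fixes al be al' be' :: "real => real"
 assumes ACal: "AC al al'" and ACbe: "AC be be'"
  and Bal: "al' \<in> BM" and Bbe: "be' \<in> BM"
  and sal: "sqint UNIV al'" and sbe: "sqint UNIV be'"
  and H: "H1r (%x. al x + be x - bkg x) (%x. al' x + be' x - bkg_deriv x)"
begin

definition fw :: "real => real => real" where "fw t x = al (x + t) + be (x - t)"

lemma cal: "continuous_on S f ==> continuous_on S (%x. al (f x))" and cbe: "continuous_on S f ==> continuous_on S (%x. be (f x))"
 for f :: "'a::topological_space => real"
 using continuous_on_compose2[OF AC_cont[OF ACal, of UNIV]] continuous_on_compose2[OF AC_cont[OF ACbe, of UNIV]] by auto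

lemma fw_continuous: "cont (%(t, x). fw t x)"
 unfolding fw_def cpb by (intro continuous_intros cal cbe)

lemma fw_slice: "cont (fw t)"
 using cont2[OF fw_continuous continuous_on_const continuous_on_id, of UNIV t] by simp

text \<open>Hoelder continuity of exponent 1/2 lets each profile move by at most a multiple of
  \<open>sqrt (abs t)\<close> from its value at time 0, well below the exponential weight.\<close>

lemma fw_bound: obtains M where "M > 0" "!!t x. abs (fw t x) <= M * ew t"
proof -
 define S where "S = sqrt (H1sq (%x. al x + be x - bkg x) (%x. al' x + be' x - bkg_deriv x))"
 define A where "A = sqrt (intR (%x. (al' x)^2))"
 define B where "B = sqrt (intR (%x. (be' x)^2))"
 have pos: "S >= 0" "A >= 0" "B >= 0" using H1sq_nonneg[OF H] sqint_nonneg[OF sal] sqint_nonneg[OF sbe] by (auto simp: S_def A_def B_def)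
 have 0: "abs (al x + be x) <= S + 1" for x
  using real_sqrt_le_mono[OF H1r_sobolev[OF H, of x]] bkg_le[of x] by (auto simp: S_def)
 have e: "sqrt (abs t) <= ew t" for t :: real
 proof -
  have "sqrt (abs t) <= 1 + 60 * abs t" by (rule real_le_lsqrt) (auto simp: power2_eq_square algebra_simps)
  thus ?thesis using exp_ge_add_one_self[of "60 * abs t"] by linarith
 qed
 have 1: "abs (al (x + t) - al x) <= A * ew t" for t x
 proof -
  have "abs (al (x + t) - al x) <= sqrt (abs t) * A"
   using real_sqrt_le_mono[OF AC_holder[OF ACal sal, of "x + t" x]] by (simp add: A_def real_sqrt_mult)
  also have "... <= ew t * A" using pos e by (intro mult_right_mono)
  finally show ?thesis by (simp add: mult.commute)
 qed
 have 2: "abs (be (x - t) - be x) <= B * ew t" for t x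
 proof -
  have "abs (be (x - t) - be x) <= sqrt (abs t) * B"
   using real_sqrt_le_mono[OF AC_holder[OF ACbe sbe, of "x - t" x]] by (simp add: B_def real_sqrt_mult)
  also have "... <= ew t * B" using pos e by (intro mult_right_mono)
  finally show ?thesis by (simp add: mult.commute)
 qed
 show ?thesis
 proof (rule that[of "S + 1 + A + B"])
  fix t x
  have "S + 1 <= (S + 1) * ew t" using mult_left_mono[of 1 "ew t" "S + 1"] pos by simp
  hence 3: "abs (al x + be x) <= (S + 1) * ew t" by (rule order_trans[OF 0])
  have gen: "abs (a' + b') <= X + Y + Z" if "abs (a + b) <= X" "abs (a' - a) <= Y" "abs (b' - b) <= Z" for a b a' b' X Y Z :: real
   using that by linarith
  have "(S + 1 + A + B) * ew t = (S + 1) * ew t + A * ew t + B * ew t"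
   by (simp add: algebra_simps)
  thus "abs (fw t x) <= (S + 1 + A + B) * ew t"
   using gen[OF 3 1[of x t] 2[of x t]] unfolding fw_def by simp
 qed (use pos in simp)
qed

lemma fw_t: "AC (%t. fw t x) (%t. al' (x + t) - be' (x - t))"
proof -
 have "AC (%t. be (- t)) (%t. - be' (- t))" using AC_reflect[OF ACbe] by simp
 from AC_shift[OF this, of "- x"] have "AC (%t. be (x - t)) (%t. - be' (x - t))" by (simp add: add.commute)
 from AC_add[OF AC_shift[OF ACal, of x] this] show ?thesis by (simp add: fw_def add.commute)
qed

lemma B_shift: "f \<in> BM ==> (%x. f (x + h)) \<in> BM" for f :: "real => real"
 by (rule measurable_compose[where g = f]) auto

lemma m_char: "(%(t, x). al' (x + t)) \<in> BM" "(%(t, x). be' (x - t)) \<in> BM"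
proof -
 have "(%p::real\<times>real. al' (snd p + fst p)) \<in> BM" "(%p::real\<times>real. be' (snd p - fst p)) \<in> BM"
  by (rule measurable_compose[OF bmc Bal] measurable_compose[OF bmc Bbe]; intro continuous_intros)+
 thus "(%(t, x). al' (x + t)) \<in> BM" "(%(t, x). be' (x - t)) \<in> BM"
  by (simp_all add: cpb)
qed

lemma fw_n2: obtains A where "A > 0" "!!t. n2 (%x. fw t x - bkg x) <= ennreal ((A * ew t)^2)"
proof -
 obtain a b where a: "n2 al' = ennreal a" "a >= 0" and b: "n2 be' = ennreal b" "b >= 0"
  using n2_sqint(2)[OF Bal sal] n2_sqint(2)[OF Bbe sbe] sqint_nonneg[OF sal] sqint_nonneg[OF sbe] by blast
 have U: "cont (%x. al x + be x - bkg x)" by (intro continuous_intros cal cbe)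
 obtain c where c: "n2 (%x. al x + be x - bkg x) = ennreal c" "c >= 0"
  using n2_sqint(2)[OF bmc[OF U]] sqint_nonneg H unfolding H1r_def by blast
 define ka where "ka = sqrt (2 * a + 2 * b + 1)"
 have ka: "ka > 0" "ka^2 = 2 * a + 2 * b + 1" using a b by (auto simp: ka_def)
 have w: "n2 (%x. al' (x + s) - be' (x - s)) <= ennreal (ka^2)" for s
 proof -
  have "n2 (%x. al' (x + s) - be' (x + (- s))) <= 2 * n2 al' + 2 * n2 be'"
   using n2_diff[OF B_shift[OF Bal, of s] B_shift[OF Bbe, of "- s"]] by (simp only: n2_shift Bal Bbe)
  also have "... = ennreal (2 * a + 2 * b)" using a b by (simp add: two_ennreal flip: ennreal_plus)
  also have "... <= ennreal (ka^2)" by (rule ennreal_leI) (simp add: ka(2))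
  finally show ?thesis by simp
 qed
 have mw: "(%(s, x). al' (x + s) - be' (x - s)) \<in> BM"
  using m_char by (simp add: cpb)
 have mink: "n2 (%x. fw q x - fw p x) <= ennreal ((ka * (q - p))^2)" if "p <= q" for p q
  using minkowski[OF fw_t mw, of "%_. ka" p q] w ka(1) that by (simp add: mult.commute)
 have inc: "n2 (%x. fw t x - fw 0 x) <= ennreal ((ka * abs t)^2)" for t
 proof (cases "t >= 0")
  case False
  have "n2 (%x. fw t x - fw 0 x) = n2 (%x. - (fw 0 x - fw t x))" by simp
  also have "... <= ennreal ((ka * abs t)^2)" using mink[of t 0] False by (simp only: n2_minus) simp
  finally show ?thesis .
 qed (use mink[of 0 t] in simp)
 show ?thesis
 proof (rule that[of "2 * ka + 2 * sqrt c + 1"])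
  fix t
  have m: "(%x. fw t x - fw 0 x) \<in> BM" "(%x. al x + be x - bkg x) \<in> BM"
   by (rule bmc, intro continuous_intros fw_slice cal cbe)+
  have "n2 (%x. fw t x - bkg x) = n2 (%x. (fw t x - fw 0 x) + (al x + be x - bkg x))" by (simp add: fw_def algebra_simps)
  also have "... <= 2 * n2 (%x. fw t x - fw 0 x) + 2 * n2 (%x. al x + be x - bkg x)" by (rule n2_add[OF m])
  also have "... <= 2 * ennreal ((ka * abs t)^2) + 2 * ennreal c" using inc[of t] c by (intro add_mono mult_left_mono) auto
  also have "... = ennreal (2 * (ka * abs t)^2 + 2 * (sqrt c)^2)" using c by (simp add: two_ennreal flip: ennreal_plus)
  also have "... <= ennreal (((2 * ka + 2 * sqrt c + 1) * ew t)^2)"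
  proof (rule ennreal_leI)
   have "2 * (ka * abs t)^2 + 2 * (sqrt c)^2 <= (2 * (ka * abs t) + 2 * sqrt c)^2"
   proof -
   have *: "2 * a^2 + 2 * b^2 <= (2 * a + 2 * b)^2" if "a >= 0" "b >= 0" for a b :: real
   using mult_nonneg_nonneg[OF that] by (simp add: power2_sum power_mult_distrib)
   show ?thesis by (rule *) (use ka(1) c(2) in auto)
   qed
   also have "... <= ((2 * ka + 2 * sqrt c + 1) * ew t)^2"
   proof (rule power_mono)
   have e: "abs t <= ew t" "1 <= ew t" using exp_ge_add_one_self[of "60 * abs t"] by linarith+
   have "ka * abs t <= ka * ew t" "sqrt c * 1 <= sqrt c * ew t"
   using mult_left_mono[OF e(1), of ka] mult_left_mono[OF e(2), of "sqrt c"] ka(1) c(2) by auto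
   moreover have "2 * p + 2 * q <= (2 * k + 2 * s + 1) * E" if "p <= k * E" "q * 1 <= s * E" "E >= 0" for p q k s E :: real
   using that by (simp add: algebra_simps)
   ultimately show "2 * (ka * abs t) + 2 * sqrt c <= (2 * ka + 2 * sqrt c + 1) * ew t"
   by simp
   qed (use ka(1) c(2) in auto)
   finally show "2 * (ka * abs t)^2 + 2 * (sqrt c)^2 <= ((2 * ka + 2 * sqrt c + 1) * ew t)^2" .
  qed
  finally show "n2 (%x. fw t x - bkg x) <= ennreal (((2 * ka + 2 * sqrt c + 1) * ew t)^2)" .
 qed (use ka(1) c(2) in \<open>simp add: add_nonneg_pos\<close>)
qed

lemma n2_tr:
 assumes ph: "cont ph" and b: "n2 (%x. ph x - bkg x) <= ennreal (B^2)" and t: "intR (%x. (tr (bkg x))^2) <= B^2"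
 shows "n2 (%x. tr (ph x)) <= ennreal ((1000 * B)^2)"
proof -
 have m: "(%x. tr (ph x) - tr (bkg x)) \<in> BM" "(%x. tr (bkg x)) \<in> BM" "(%x. ph x - bkg x) \<in> BM"
  by (rule bmc, intro continuous_intros ph)+
 have "n2 (%x. tr (ph x) - tr (bkg x)) <= n2 (%x. 600 * (ph x - bkg x))"
  using tr_lipschitz by (intro n2_mono) (simp only: abs_le_square_iff[symmetric] abs_mult abs_numeral)
 also have "... = ennreal (600^2) * n2 (%x. ph x - bkg x)" by (rule n2_cmult[OF m(3)])
 also have "... <= ennreal (600^2) * ennreal (B^2)" by (rule mult_left_mono[OF b]) simp
 finally have 1: "n2 (%x. tr (ph x) - tr (bkg x)) <= ennreal (360000 * B^2)" by (simp add: ennreal_mult)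
 have "n2 (%x. tr (ph x)) = n2 (%x. (tr (ph x) - tr (bkg x)) + tr (bkg x))" by simp
 also have "... <= 2 * n2 (%x. tr (ph x) - tr (bkg x)) + 2 * n2 (%x. tr (bkg x))" by (rule n2_add[OF m(1,2)])
 also have "... <= 2 * ennreal (360000 * B^2) + 2 * ennreal (B^2)"
  using 1 t n2_sqint(2)[OF m(2) tr_bkg] by (intro add_mono mult_left_mono) (auto intro: ennreal_leI)
 also have "... = ennreal (720002 * B^2)" by (simp add: two_ennreal flip: ennreal_plus)
 also have "... <= ennreal ((1000 * B)^2)" by (rule ennreal_leI) (simp add: power_mult_distrib)
 finally show ?thesis .
qed

text \<open>Contraction in the sup norm weighted by \<open>exp (- 60 * abs t)\<close>, with factor
  \<open>600 / 60^2 = 1/6\<close>. Square integrability of the distance to the background is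
  invisible in that norm, so the iteration is confined to the closed set \<open>X\<close> on which
  it holds with a weighted bound.\<close>

theorem fixed_point:
 obtains ph A where "cont (%(t, x). ph t x)"
  "!!t x. ph t x = fw t x - Dh (%s y. tr (ph s y)) t x"
  "A > 0" "!!t. n2 (%x. ph t x - bkg x) <= ennreal ((A * ew t)^2)"
  "!!t. n2 (%x. tr (ph t x)) <= ennreal ((A * ew t)^2)"
proof -
 obtain M where M: "M > 0" "!!t x. abs (fw t x) <= M * ew t" using fw_bound by blast
 obtain A0 where A0: "A0 > 0" "!!t. n2 (%x. fw t x - bkg x) <= ennreal ((A0 * ew t)^2)" using fw_n2 by blast
 define T0 where "T0 = intR (%x. (tr (bkg x))^2)"
 have T0: "T0 >= 0" unfolding T0_def by (rule sqint_nonneg[OF tr_bkg])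
 \<comment> \<open>Twice \<open>A0\<close>, so that the free wave uses only half of the invariant
   bound; \<open>sqrt T0\<close> accommodates the nonlinearity at the background.\<close>
 define A where "A = 2 * A0 + sqrt T0"
 have A: "A > 0" "A0 <= A / 2" "T0 <= A^2" using A0 T0 by (auto simp: A_def power2_sum add_pos_nonneg)
 define wt where "wt w t x = ew t * apply_bcontfun w (t, x)" for w :: "(real \<times> real) \<Rightarrow>\<^sub>C real" and t x :: real
 have cwt: "cont (%(t, x). wt w t x)" for w
  unfolding wt_def cpb by (intro continuous_intros) auto
 have ctr: "cont (%(t, x). tr (wt w t x))" for w
  using cwt[of w] unfolding cpb by (rule continuous_tr)
 have cwts: "cont (wt w t)" for w t by (rule slice[OF cwt])
 have wb: "abs (wt w t x) <= norm w * ew t" for w t x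
  using norm_bounded[of w "(t, x)"] by (simp add: wt_def abs_mult mult.commute)
 define st where "st w = (%(t, x). exp (- 60 * abs t) * (fw t x - Dh (%s y. tr (wt w s y)) t x))" for w
 have e: "ew t * exp (- 60 * abs t) = 1" for t :: real by (simp flip: exp_add)
 have e2: "ew t * (exp (- 60 * abs t) * y) = y" for t y :: real using e[of t] by (metis mult.assoc mult_1)
 have Db: "abs (Dh (%s y. tr (wt w s y)) t x) <= (600 * norm w) / 60^2 * ew t" for w t x
 proof (rule Duhamel_bound[OF ctr])
  show "abs (tr (wt w s x)) <= 600 * norm w * ew s" for s x
   using tr_le[of "wt w s x"] wb[of w s x] by simp
 qed simp
 have stb: "st w \<in> bcontfun" for w
 proof (rule bcontfun_normI)
  show "cont (st w)"
   using fw_continuous Dh_continuous[OF ctr[of w]] unfolding st_def cpb by (intro continuous_intros)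
  fix z :: "real \<times> real"
  obtain t x where z: "z = (t, x)" by (cases z)
  have "abs (fw t x - Dh (%s y. tr (wt w s y)) t x) <= M * ew t + (600 * norm w) / 60^2 * ew t"
   by (rule order_trans[OF abs_triangle_ineq4 add_mono[OF M(2) Db]])
  hence "exp (- 60 * abs t) * abs (fw t x - Dh (%s y. tr (wt w s y)) t x)
   <= exp (- 60 * abs t) * ((M + (600 * norm w) / 60^2) * ew t)"
   by (intro mult_left_mono) (simp_all add: distrib_right)
  also have "... = M + (600 * norm w) / 60^2" using e[of t] by (simp add: mult.commute)
  finally show "norm (st w z) <= M + (600 * norm w) / 60^2" by (simp add: z st_def abs_mult)
 qed
 define T where "T w = Bcontfun (st w)" for w
 have T: "wt (T w) t x = fw t x - Dh (%s y. tr (wt w s y)) t x" for w t x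
  by (subst wt_def, simp only: T_def Bcontfun_inverse[OF stb], simp only: st_def case_prod_conv e2)
 define X where "X = {w. ALL t. n2 (%x. wt w t x - bkg x) <= ennreal ((A * ew t)^2)}"
 have trX: "n2 (%x. tr (wt w t x)) <= ennreal ((1000 * A * ew t)^2)" if "w \<in> X" for w t
 proof -
  have "A * 1 <= A * ew t" using A(1) by (intro mult_left_mono) auto
  hence "A^2 <= (A * ew t)^2" using A(1) by (intro power_mono) auto
  thus ?thesis using n2_tr[OF cwts, of w t "A * ew t"] that A(3) by (simp add: X_def T0_def mult.assoc)
 qed
 have "\<exists>!w. w \<in> X & T w = w"
 proof (rule Banach_fix)
  \<comment> \<open>The bound defining \<open>X\<close> passes to pointwise limits by Fatou's
    lemma.\<close>
  show "complete X" unfolding complete_eq_closed closed_sequential_limits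
  proof (intro allI impI, elim conjE)
   fix w l assume w: "ALL n. w n \<in> X" "w \<longlonglongrightarrow> l"
   have lim: "(%n. wt (w n) t x) \<longlonglongrightarrow> wt l t x" for t x
   proof -
   have "(%n. apply_bcontfun (w n) (t, x)) \<longlonglongrightarrow> apply_bcontfun l (t, x)"
   proof (rule metric_tendsto_imp_tendsto[OF w(2)])
   show "\<forall>\<^sub>F n in sequentially. dist (apply_bcontfun (w n) (t, x)) (apply_bcontfun l (t, x)) <= dist (w n) l"
   by (intro always_eventually allI dist_bounded)
   qed
   thus ?thesis unfolding wt_def by (intro tendsto_intros)
   qed
   show "l \<in> X" unfolding X_def
   proof (intro CollectI allI)
   fix t
   have m: "(%x. ennreal ((wt w t x - bkg x)^2)) \<in> borel_measurable lborel" for w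
   using bmc[OF cwts[of w t]] bmc[of bkg] continuous_bkg[OF continuous_on_id, of UNIV] by simp
   have "n2 (%x. wt l t x - bkg x) = (\<integral>\<^sup>+x. liminf (%n. ennreal ((wt (w n) t x - bkg x)^2)) \<partial>lborel)"
   unfolding n2_def
   proof (intro nn_integral_cong)
   fix x
   have "(%n. ennreal ((wt (w n) t x - bkg x)^2)) \<longlonglongrightarrow> ennreal ((wt l t x - bkg x)^2)"
   by (intro tendsto_ennrealI tendsto_intros lim)
   from lim_imp_Liminf[OF _ this] show "ennreal ((wt l t x - bkg x)^2) = liminf (%n. ennreal ((wt (w n) t x - bkg x)^2))" by simp
   qed
   also have "... <= liminf (%n. n2 (%x. wt (w n) t x - bkg x))"
   unfolding n2_def by (rule nn_integral_liminf[OF m])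
   also have "... <= liminf (%n. ennreal ((A * ew t)^2))"
   using w(1) by (intro Liminf_mono always_eventually) (auto simp: X_def)
   finally show "n2 (%x. wt l t x - bkg x) <= ennreal ((A * ew t)^2)" by (simp add: Liminf_const)
   qed
  qed
  have "bkgE \<in> bcontfun" if "bkgE = (%(t, x). exp (- 60 * abs t) * bkg x)" for bkgE :: "real \<times> real => real"
  proof (rule bcontfun_normI)
   show "cont bkgE" unfolding that cpb by (intro continuous_intros)
   show "norm (bkgE z) <= 1" for z
   proof -
   have "exp (- 60 * abs (fst z)) * abs (bkg (snd z)) <= 1 * 1" using bkg_le by (intro mult_mono) auto
   thus ?thesis by (simp add: that cpb abs_mult)
   qed
  qed
  from this[OF refl] have "wt (Bcontfun (%(t, x). exp (- 60 * abs t) * bkg x)) t x = bkg x" for t x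
   unfolding wt_def by (simp only: Bcontfun_inverse case_prod_conv e2)
  hence "Bcontfun (%(t, x). exp (- 60 * abs t) * bkg x) \<in> X" by (simp only: X_def mem_Collect_eq) (simp add: n2_def)
  thus "X ~= {}" by blast
  show "T ` X \<subseteq> X"
  proof (clarify)
   fix w assume w: "w \<in> X"
   show "T w \<in> X" unfolding X_def
   proof (intro CollectI allI)
   fix t :: real
   let ?E = "ew t"
   have D: "n2 (Dh (%s y. tr (wt w s y)) t) <= ennreal (((1000 * A) / 60^2 * ?E)^2)"
   by (rule n2_Duhamel(3)[OF ctr]) (use trX[OF w] A in auto)
   have m: "(%x. fw t x - bkg x) \<in> BM" "Dh (%s y. tr (wt w s y)) t \<in> BM"
   by (rule bmc, intro continuous_intros fw_slice slice[OF Dh_continuous[OF ctr]])+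
   have "n2 (%x. wt (T w) t x - bkg x) = n2 (%x. (fw t x - bkg x) - Dh (%s y. tr (wt w s y)) t x)"
   by (simp add: T algebra_simps)
   also have "... <= 2 * n2 (%x. fw t x - bkg x) + 2 * n2 (Dh (%s y. tr (wt w s y)) t)" by (rule n2_diff[OF m])
   also have "... <= 2 * ennreal ((A0 * ?E)^2) + 2 * ennreal (((1000 * A) / 60^2 * ?E)^2)"
   by (intro add_mono mult_left_mono A0(2) D) auto
   also have "... = ennreal (2 * (A0 * ?E)^2 + 2 * ((1000 * A) / 60^2 * ?E)^2)" by (simp add: two_ennreal flip: ennreal_plus)
   also have "... <= ennreal ((A * ?E)^2)"
   proof (rule ennreal_leI)
   \<comment> \<open>The total is at most 1/2 from the free wave plus 50/324 from the Duhamel term,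
     times the square of \<open>A * ?E\<close>.\<close>
   have "(A0 * ?E)^2 <= (A / 2 * ?E)^2" using A0(1) A(2) by (intro power_mono mult_right_mono) auto
   hence "(A0 * ?E)^2 <= (A * ?E)^2 / 4" by (simp add: power_mult_distrib power_divide)
   moreover have "((1000 * A) / 60^2 * ?E)^2 = 25/324 * (A * ?E)^2" by (simp add: power_mult_distrib power_divide)
   moreover have "0 <= (A * ?E)^2" by (rule zero_le_power2)
   ultimately show "2 * (A0 * ?E)^2 + 2 * ((1000 * A) / 60^2 * ?E)^2 <= (A * ?E)^2" by linarith
   qed
   finally show "n2 (%x. wt (T w) t x - bkg x) <= ennreal ((A * ?E)^2)" .
   qed
  qed
  show "dist (T w) (T v) <= 1/6 * dist w v" for w v
  proof (rule dist_bound)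
   fix z :: "real \<times> real"
   obtain t x where z: "z = (t, x)" by (cases z)
   have "abs (Dh (%s y. tr (wt v s y) - tr (wt w s y)) t x) <= (600 * dist w v) / 60^2 * ew t"
   proof (rule Duhamel_bound)
   show "cont (%(s, y). tr (wt v s y) - tr (wt w s y))"
   using ctr[of v] ctr[of w] unfolding cpb by (rule continuous_on_diff)
   fix s y
   have "abs (wt v s y - wt w s y) = ew s * dist (apply_bcontfun w (s, y)) (apply_bcontfun v (s, y))"
   by (simp add: wt_def dist_real_def abs_mult abs_minus_commute flip: right_diff_distrib)
   also have "... <= ew s * dist w v" by (intro mult_left_mono dist_bounded) simp
   finally have "600 * abs (wt v s y - wt w s y) <= 600 * (ew s * dist w v)" by (intro mult_left_mono) auto
   from order_trans[OF tr_lipschitz this] show "abs (tr (wt v s y) - tr (wt w s y)) <= 600 * dist w v * ew s"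
   by (simp only: mult_ac)
   qed simp
   hence D: "abs (Dh (%s y. tr (wt v s y)) t x - Dh (%s y. tr (wt w s y)) t x) <= 1/6 * dist w v * ew t"
   by (simp add: Dh_diff[OF ctr ctr])
   have "dist (st w z) (st v z) = exp (- 60 * abs t) * abs (Dh (%s y. tr (wt v s y)) t x - Dh (%s y. tr (wt w s y)) t x)"
   unfolding z st_def dist_real_def by (simp add: abs_mult flip: right_diff_distrib)
   also have "... <= exp (- 60 * abs t) * (1/6 * dist w v * ew t)" by (intro mult_left_mono D) simp
   also have "... = 1/6 * dist w v" using e[of t] by (simp add: mult.commute)
   finally show "dist (apply_bcontfun (T w) z) (apply_bcontfun (T v) z) <= 1/6 * dist w v"
   by (simp add: T_def Bcontfun_inverse[OF stb])
  qed
 qed auto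
 then obtain w where w: "w \<in> X" "T w = w" by blast
 have "A <= 1000 * A" using A(1) by simp
 show ?thesis
 proof (rule that[of "wt w" "1000 * A"])
  show "wt w t x = fw t x - Dh (%s y. tr (wt w s y)) t x" for t x using T[of w t x] w(2) by simp
  show "n2 (%x. wt w t x - bkg x) <= ennreal ((1000 * A * ew t)^2)" for t
  proof -
   have "n2 (%x. wt w t x - bkg x) <= ennreal ((A * ew t)^2)" using w(1) by (simp add: X_def)
   also have "... <= ennreal ((1000 * A * ew t)^2)"
   using A(1) by (intro ennreal_leI power_mono mult_right_mono) auto
   finally show ?thesis .
  qed
 qed (use cwt trX[OF w(1)] A(1) in auto)
qed

end

section \<open>Integration by parts in space-time\<close>

lemma unit_Basis: "(1, 0) \<in> (Basis :: (real \<times> real) set)" "(0, 1) \<in> (Basis :: (real \<times> real) set)"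
 by (auto simp: Basis_prod_def)

lemma test2:
 fixes et :: "real \<times> real => real"
 assumes "test_fun et"
 shows "cont et" "test_fun (dir_deriv (1, 0) et)" "test_fun (dir_deriv (0, 1) et)"
  "((%t. et (t, y + c * t)) hrd dir_deriv (1, 0) et (t, y + c * t) + c * dir_deriv (0, 1) et (t, y + c * t)) (at t)"
  "((%x. et (t, x)) hrd dir_deriv (0, 1) et (t, x)) (at x)"
proof -
 have C: "C_diff k et" for k using assms by (simp add: test_fun_def)
 have d: "et differentiable_on UNIV" using C[of "Suc 0"] by simp
 show "cont et" by (rule differentiable_imp_continuous_on[OF d])
 have D: "(et has_derivative frechet_derivative et (at z)) (at z)" for z
  using d unfolding differentiable_on_def frechet_derivative_works by blast
 hence lin: "linear (frechet_derivative et (at z))" for z using has_derivative_linear by blast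
 obtain R where R: "R > 0" "!!z. norm z >= R ==> et z = 0" using test_fun_support[OF assms] by blast
 have T: "test_fun (dir_deriv b et)" if b: "b \<in> Basis" for b
  unfolding test_fun_def
 proof (intro conjI allI)
  show "C_diff k (dir_deriv b et)" for k using C[of "Suc k"] b by simp
  have z: "dir_deriv b et z = 0" if "norm z > R" for z
  proof -
   have o: "open {z :: real \<times> real. norm z > R}" by (intro open_Collect_less continuous_intros)
   have "(et has_derivative (%_. 0)) (at z)"
   by (rule has_derivative_transform_within_open[OF has_derivative_const[of 0] o]) (use R that in auto)
   hence "frechet_derivative et (at z) = (%_. 0)" by (rule frechet_derivative_at[symmetric])
   thus ?thesis by (simp add: dir_deriv_def)
  qed
  have "{z. dir_deriv b et z ~= 0} \<subseteq> cball 0 R" using z by force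
  hence "closure {z. dir_deriv b et z ~= 0} \<subseteq> cball 0 R" by (intro closure_minimal) auto
  thus "compact (closure {z. dir_deriv b et z ~= 0})"
   using bounded_subset[OF bounded_cball] by (simp add: compact_eq_bounded_closed)
 qed
 show "test_fun (dir_deriv (1, 0) et)" "test_fun (dir_deriv (0, 1) et)" using T unit_Basis by auto
 have e: "frechet_derivative et (at z) (h, k) = h * dir_deriv (1, 0) et z + k * dir_deriv (0, 1) et z" for z h k
 proof -
  have "(h, k) = h *\<^sub>R (1, 0) + k *\<^sub>R ((0, 1) :: real \<times> real)" by simp
  thus ?thesis unfolding dir_deriv_def by (simp only: linear_add[OF lin] linear_scale[OF lin] real_scaleR_def)
 qed
 show "((%t. et (t, y + c * t)) hrd dir_deriv (1, 0) et (t, y + c * t) + c * dir_deriv (0, 1) et (t, y + c * t)) (at t)"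
 proof -
  have "((%t. (t, y + c * t)) has_derivative (%h. (h, c * h))) (at t)" by (auto intro!: derivative_eq_intros)
  from has_derivative_compose[OF this D] show ?thesis
   unfolding has_field_derivative_def by (rule has_derivative_eq_rhs) (auto simp: e algebra_simps)
 qed
 show "((%x. et (t, x)) hrd dir_deriv (0, 1) et (t, x)) (at x)"
 proof -
  have "((%x. (t, x)) has_derivative (%h. (0, h))) (at x)" by (auto intro!: derivative_eq_intros)
  from has_derivative_compose[OF this D] show ?thesis
   unfolding has_field_derivative_def by (rule has_derivative_eq_rhs) (auto simp: e algebra_simps)
 qed
qed

text \<open>Local square integrability in space, uniform over bounded times: stable under shearing,
  and enough to integrate against compactly supported functions.\<close>

definition locb :: "(real => real => real) => bool" where
 "locb w \<longleftrightarrow> (ALL R. EX K. ALL t. abs t <= R --> (\<integral>\<^sup>+x. ennreal (indicator {-R..R} x * (w t x)^2) \<partial>lborel) <= ennreal K)"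

lemma borel_slice: "(%(t, x). w t x) \<in> BM ==> w t \<in> BM" for w :: "real => real => real"
 using measurable_compose[of "%x. (t, x)" borel borel "%(t, x). w t x" borel] by simp

lemma borel_shear:
 fixes w :: "real => real => real"
 assumes "(%(t, x). w t x) \<in> BM"
 shows "(%(t, y). w t (y + c * t)) \<in> BM"
proof -
 have "(%z. (fst z, snd z + c * fst z)) \<in> borel_measurable (borel :: (real \<times> real) measure)"
  by (intro bmc continuous_intros)
 from measurable_compose[OF this assms] show ?thesis by (simp add: cpb)
qed

lemma locb_shear:
 assumes w: "(%(t, x). w t x) \<in> BM" and l: "locb w"
 shows "locb (%t y. w t (y + c * t))"
 unfolding locb_def
proof
 fix R
 define R' where "R' = abs R + abs c * abs R"
 obtain K where K: "!!t. abs t <= R' ==> (\<integral>\<^sup>+x. ennreal (indicator {-R'..R'} x * (w t x)^2) \<partial>lborel) <= ennreal K"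
  using l unfolding locb_def by meson
 show "EX K. ALL t. abs t <= R --> (\<integral>\<^sup>+x. ennreal (indicator {-R..R} x * (w t (x + c * t))^2) \<partial>lborel) <= ennreal K"
 proof (intro exI[of _ K] allI impI)
  fix t assume t: "abs t <= R"
  have ct: "abs (c * t) <= abs c * abs R" using t unfolding abs_mult by (intro mult_left_mono) auto
  have t': "abs t <= R'" using t by (auto simp: R'_def intro: order_trans)
  have "(\<integral>\<^sup>+x. ennreal (indicator {-R..R} x * (w t (x + c * t))^2) \<partial>lborel)
   <= (\<integral>\<^sup>+x. ennreal (indicator {-R'..R'} (x + c * t) * (w t (x + c * t))^2) \<partial>lborel)"
  proof (rule nn_integral_mono, rule ennreal_leI, rule mult_right_mono)
   fix x show "indicator {-R..R} x <= (indicator {-R'..R'} (x + c * t) :: real)"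
   using ct t by (auto simp: indicator_def R'_def abs_le_iff)
  qed simp
  also have "... = (\<integral>\<^sup>+x. ennreal (indicator {-R'..R'} x * (w t x)^2) \<partial>lborel)"
   using nn_integral_real_affine[of "%x. ennreal (indicator {-R'..R'} x * (w t x)^2)" 1 "c * t"] borel_slice[OF w, of t]
   by (simp add: add.commute)
  also have "... <= ennreal K" by (rule K[OF t'])
  finally show "(\<integral>\<^sup>+x. ennreal (indicator {-R..R} x * (w t (x + c * t))^2) \<partial>lborel) <= ennreal K" .
 qed
qed

lemma locb_n2:
 assumes "!!t. n2 (w t) <= ennreal ((A * ew t)^2)" "A >= 0"
 shows "locb w"
 unfolding locb_def
proof (intro allI exI impI)
 fix R t :: real assume t: "abs t <= R"
 have "(\<integral>\<^sup>+x. ennreal (indicator {-R..R} x * (w t x)^2) \<partial>lborel) <= n2 (w t)"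
  unfolding n2_def by (intro nn_integral_mono ennreal_leI) (auto simp: indicator_def)
 also have "... <= ennreal ((A * ew t)^2)" by (rule assms)
 also have "... <= ennreal ((A * exp (60 * R))^2)" using t assms(2) by (intro ennreal_leI power_mono mult_left_mono) auto
 finally show "(\<integral>\<^sup>+x. ennreal (indicator {-R..R} x * (w t x)^2) \<partial>lborel) <= ennreal ((A * exp (60 * R))^2)" .
qed

lemma locb_continuous:
 assumes "cont (%(t, x). w t x)"
 shows "locb w"
 unfolding locb_def
proof
 fix R :: real
 have "compact ({-R..R} \<times> {-R..R})" by (intro compact_Times compact_Icc)
 hence "bounded ((%(t, x). w t x) ` ({-R..R} \<times> {-R..R}))"
  using compact_continuous_image[OF continuous_on_subset[OF assms]] compact_imp_bounded by blast
 then obtain M where M: "M > 0" "!!z. z \<in> (%(t, x). w t x) ` ({-R..R} \<times> {-R..R}) ==> norm z <= M" by (meson bounded_pos)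
 show "EX K. ALL t. abs t <= R --> (\<integral>\<^sup>+x. ennreal (indicator {-R..R} x * (w t x)^2) \<partial>lborel) <= ennreal K"
 proof (intro exI allI impI)
  fix t assume t: "abs t <= R"
  have "(\<integral>\<^sup>+x. ennreal (indicator {-R..R} x * (w t x)^2) \<partial>lborel) <= (\<integral>\<^sup>+x. ennreal (M^2) * indicator {-R..R} x \<partial>lborel)"
  proof (rule nn_integral_mono)
   fix x
   show "ennreal (indicator {-R..R} x * (w t x)^2) <= ennreal (M^2) * indicator {-R..R} x"
   proof (cases "x \<in> {-R..R}")
   case True
   hence "abs (w t x) <= M" using M(2)[of "w t x"] t by force
   hence "(w t x)^2 <= M^2" using M(1) by (simp add: abs_le_square_iff[symmetric])
   thus ?thesis using True by (auto intro: ennreal_leI)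
   qed simp
  qed
  also have "... = ennreal (M^2 * (2 * R))"
   using t by (subst nn_integral_cmult_indicator) (auto simp: ennreal_mult)
  finally show "(\<integral>\<^sup>+x. ennreal (indicator {-R..R} x * (w t x)^2) \<partial>lborel) <= ennreal (M^2 * (2 * R))" .
 qed
qed

text \<open>On the support of \<open>c\<close> the bound \<open>abs w <= 1 + w^2\<close> turns the
  local square bound into integrability over space-time.\<close>

lemma box_integrable:
 fixes c :: "real \<times> real => real"
 assumes w: "(%(t, x). w t x) \<in> BM" and l: "locb w"
  and c: "cont c" and R: "R > 0" "!!z. norm z >= R ==> c z = 0"
 shows "integrable LL (%(t, x). w t x * c (t, x))"
proof (rule integrableI_bounded)
 have mw: "(%z. w (fst z) (snd z)) \<in> borel_measurable LL"
  using w by (simp add: lborel_prod cpb)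
 have mc: "c \<in> borel_measurable LL" using bmc[OF c] by (simp add: lborel_prod)
 show m: "(%(t, x). w t x * c (t, x)) \<in> borel_measurable LL"
  using borel_measurable_times[OF mw mc] by (simp add: cpb)
 obtain M where M: "M > 0" "!!z. abs (c z) <= M"
 proof -
  have "bounded (c ` cball 0 R)" by (intro compact_imp_bounded compact_continuous_image continuous_on_subset[OF c]) auto
  then obtain M where M: "M > 0" "!!z. z \<in> c ` cball 0 R ==> norm z <= M" by (meson bounded_pos)
  have "abs (c z) <= M" for z using M R(2)[of z] by (cases "norm z <= R") auto
  thus ?thesis using that M by blast
 qed
 obtain K where K: "!!t. abs t <= R ==> (\<integral>\<^sup>+x. ennreal (indicator {-R..R} x * (w t x)^2) \<partial>lborel) <= ennreal K"
  using l unfolding locb_def by meson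
 define I :: "real => real" where "I x = indicator {-R..R} x" for x
 have mI: "I \<in> BM" unfolding I_def[abs_def] by simp
 have pt: "abs (w t x * c (t, x)) <= I t * (M * (I x + I x * (w t x)^2))" for t x
 proof (cases "abs t <= R & abs x <= R")
  case True
  have "abs (w t x) <= 1 + (w t x)^2" using sum_squares_bound[of "abs (w t x)" 1] by (simp add: power2_eq_square)
  hence "abs (w t x) * abs (c (t, x)) <= (1 + (w t x)^2) * M" using M(2) by (intro mult_mono) auto
  thus ?thesis using True by (simp add: I_def abs_mult abs_le_iff mult.commute)
 next
  case False
  hence "norm (t, x) >= R" using norm_fst_le[of t x] norm_snd_le[of x t] by auto
  thus ?thesis using R(2) M(1) by (simp add: I_def)
 qed
 have ms: "w t \<in> BM" for t by (rule borel_slice[OF w])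
 have "(\<integral>\<^sup>+z. ennreal (norm ((%(t, x). w t x * c (t, x)) z)) \<partial>LL)
   = (\<integral>\<^sup>+t. \<integral>\<^sup>+x. ennreal (norm (w t x * c (t, x))) \<partial>lborel \<partial>lborel)"
  using m by (subst lborel.nn_integral_fst[symmetric]) auto
 also have "... <= (\<integral>\<^sup>+t. ennreal (M * (2 * R + max 0 K)) * indicator {-R..R} t \<partial>lborel)"
 proof (rule nn_integral_mono)
  fix t
  show "(\<integral>\<^sup>+x. ennreal (norm (w t x * c (t, x))) \<partial>lborel) <= ennreal (M * (2 * R + max 0 K)) * indicator {-R..R} t"
  proof (cases "t \<in> {-R..R}")
   case False
   hence "c (t, x) = 0" for x using R(2)[of "(t, x)"] norm_fst_le[of t x] by auto
   thus ?thesis by simp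
  next
   case True
   have mm: "(%x. ennreal (I x)) \<in> borel_measurable lborel" "(%x. ennreal (I x * (w t x)^2)) \<in> borel_measurable lborel"
   using mI ms[of t] by auto
   have "(\<integral>\<^sup>+x. ennreal (norm (w t x * c (t, x))) \<partial>lborel) <= (\<integral>\<^sup>+x. ennreal M * (ennreal (I x) + ennreal (I x * (w t x)^2)) \<partial>lborel)"
   proof (rule nn_integral_mono)
   fix x
   have "abs (w t x * c (t, x)) <= M * (I x + I x * (w t x)^2)" using pt[of t x] True by (simp add: I_def)
   hence "ennreal (norm (w t x * c (t, x))) <= ennreal (M * (I x + I x * (w t x)^2))" by (intro ennreal_leI) simp
   also have "... = ennreal M * (ennreal (I x) + ennreal (I x * (w t x)^2))"
   using M(1) by (simp add: ennreal_mult I_def)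
   finally show "ennreal (norm (w t x * c (t, x))) <= ennreal M * (ennreal (I x) + ennreal (I x * (w t x)^2))" .
   qed
   also have "... = ennreal M * ((\<integral>\<^sup>+x. ennreal (I x) \<partial>lborel) + (\<integral>\<^sup>+x. ennreal (I x * (w t x)^2) \<partial>lborel))"
   using mm by (simp add: nn_integral_cmult nn_integral_add)
   also have "(\<integral>\<^sup>+x. ennreal (I x) \<partial>lborel) = ennreal (2 * R)"
   using R(1) unfolding I_def ennreal_indicator by (subst nn_integral_indicator) auto
   also have "ennreal M * (ennreal (2 * R) + (\<integral>\<^sup>+x. ennreal (I x * (w t x)^2) \<partial>lborel)) <= ennreal M * (ennreal (2 * R) + ennreal (max 0 K))"
   using K[of t] True unfolding I_def by (intro mult_left_mono add_left_mono) (auto simp: abs_le_iff ennreal_max_0)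
   also have "... = ennreal (M * (2 * R + max 0 K))" using M(1) R(1) by (simp add: ennreal_mult)
   finally show ?thesis using True by simp
  qed
 qed
 also have "... < \<infinity>" using R(1) by (subst nn_integral_cmult_indicator) (auto simp: ennreal_mult_less_top)
 finally show "(\<integral>\<^sup>+z. ennreal (norm ((%(t, x). w t x * c (t, x)) z)) \<partial>LL) < \<infinity>" .
qed

lemma iterated_LINT:
 fixes F :: "real => real => real"
 assumes i: "integrable LL (%(t, x). F t x)" and m: "!!t. F t \<in> BM"
 shows "(LINT t|LB. LINT x|LB. F t x) = (LINT t|lborel. LINT x|lborel. F t x)"
  "(LINT t|lborel. LINT x|lborel. F t x) = (LINT z|LL. (%(t, x). F t x) z)"
  "(LINT t|lborel. LINT x|lborel. F t x) = (LINT x|lborel. LINT t|lborel. F t x)"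
proof -
 have 1: "(LINT x|LB. F t x) = (LINT x|lborel. F t x)" for t using m[of t] by (intro integral_completion) simp
 have "integrable lborel (%t. LINT x|lborel. F t x)" using lborel_pair.integrable_fst[OF i] .
 hence "(%t. LINT x|lborel. F t x) \<in> borel_measurable lborel" by simp
 thus "(LINT t|LB. LINT x|LB. F t x) = (LINT t|lborel. LINT x|lborel. F t x)"
  unfolding 1 by (rule integral_completion)
 show "(LINT t|lborel. LINT x|lborel. F t x) = (LINT z|LL. (%(t, x). F t x) z)"
  using lborel_pair.integral_fst[OF i] .
 show "(LINT t|lborel. LINT x|lborel. F t x) = (LINT x|lborel. LINT t|lborel. F t x)"
  by (rule lborel_pair.Fubini_integral[OF i, symmetric])
qed

lemma LINT_shift: "(LINT x|lborel. F (x + h)) = (LINT x|lborel. F x)" for F :: "real => real"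
 using lborel_integral_real_affine[of 1 F h] by (simp add: add.commute)

lemma AC_compact_zero:
 assumes "AC u v" "!!x. abs x >= R ==> u x = 0" "!!x. abs x >= R ==> v x = 0" "R > 0" "v \<in> BM"
 shows "(LINT x|lborel. v x) = 0"
proof -
 have "(LINT x|lborel. v x) = (LINT x|LB. v x)" using assms(5) by (intro integral_completion[symmetric]) simp
 also have "... = (LINT x:{-R..R}|LB. v x)"
  unfolding set_lebesgue_integral_def
 proof (rule Bochner_Integration.integral_cong[OF refl])
  fix x show "v x = indicator {-R..R} x *\<^sub>R v x" using assms(3)[of x] by (cases "abs x >= R") (auto simp: indicator_def)
 qed
 also have "... = integral {-R..R} v"
  using li_imp(2)[OF AC_loc[OF assms(1)]] by (intro set_LINT_eq(2))
 also have "... = 0" using AC_D[OF assms(1), of "-R" R] assms(2)[of R] assms(2)[of "-R"] assms(4) by simp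
 finally show ?thesis .
qed

lemma test2_support:
 fixes et :: "real \<times> real => real"
 assumes "test_fun et"
 obtains R where "R > 0" "!!z. norm z >= R ==> et z = 0 & dir_deriv (1, 0) et z = 0 & dir_deriv (0, 1) et z = 0"
proof -
 obtain R1 where 1: "R1 > 0" "!!z. norm z >= R1 ==> et z = 0" using test_fun_support[OF assms] by blast
 obtain R2 where 2: "!!z. norm z >= R2 ==> dir_deriv (1, 0) et z = 0" using test_fun_support[OF test2(2)[OF assms]] by blast
 obtain R3 where 3: "!!z. norm z >= R3 ==> dir_deriv (0, 1) et z = 0" using test_fun_support[OF test2(3)[OF assms]] by blast
 show ?thesis by (rule that[of "max R1 (max R2 R3)"]) (use 1 2 3 in auto)
qed

abbreviation (input) LINT2 :: "(real => real => real) => real" where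
 "LINT2 F \<equiv> LINT z|LL. (%(t, x). F t x) z"

text \<open>In the coordinate \<open>y = x - c * t\<close> the operator becomes the derivative along
  lines on which \<open>w\<close> is absolutely continuous, so one integrates by parts in
  \<open>t\<close> for each \<open>y\<close>.\<close>

lemma transport:
 fixes et :: "real \<times> real => real"
 assumes et: "test_fun et" and w: "(%(t, x). w t x) \<in> BM" "locb w"
  and g: "(%(t, x). g t x) \<in> BM" "locb g"
  and AC: "!!y. AC (%t. w t (y + c * t)) (%t. g t (y + c * t))"
 shows "LINT2 (%t x. w t x * (dir_deriv (1, 0) et (t, x) + c * dir_deriv (0, 1) et (t, x))) = - LINT2 (%t x. g t x * et (t, x))"
proof -
 obtain R where R: "R > 0" "!!z. norm z >= R ==> et z = 0 & dir_deriv (1, 0) et z = 0 & dir_deriv (0, 1) et z = 0"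
  using test2_support[OF et] by blast
 define h where "h z = dir_deriv (1, 0) et z + c * dir_deriv (0, 1) et z" for z
 have ch: "cont h" and cet: "cont et"
  unfolding h_def by (intro continuous_intros test2(1) test2(2,3)[OF et] et)+
 have shear: "integrable LL (%(t, y). v t (y + c * t) * k (t, y + c * t))
   & LINT2 (%t x. v t x * k (t, x)) = (LINT y|lborel. LINT t|lborel. v t (y + c * t) * k (t, y + c * t))"
  if v: "(%(t, x). v t x) \<in> BM" "locb v" and k: "cont k" "!!z. norm z >= R ==> k z = 0"
  for v and k :: "real \<times> real => real"
 proof -
  have mk: "(%(t, x). k (t, x)) \<in> BM" using bmc[OF k(1)] by simp
  have i1: "integrable LL (%(t, x). v t x * k (t, x))" by (rule box_integrable[OF v k(1) R(1) k(2)])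
  have i2: "integrable LL (%(t, y). v t (y + c * t) * (%(t, y). k (t, y + c * t)) (t, y))"
  proof (rule box_integrable[OF borel_shear[OF v(1)] locb_shear[OF v]])
   show "cont (%(t, y). k (t, y + c * t))" unfolding cpb
   by (rule continuous_on_compose2[OF k(1)]) (auto intro!: continuous_intros)
   \<comment> \<open>If \<open>abs t < R\<close> and \<open>abs (y + c * t) < R\<close>, then
     \<open>abs y < R + abs c * R\<close>; adding the bound for \<open>t\<close> gives this radius
     for the sheared support.\<close>
   show "R + abs c * R + R > 0" using R(1) by (simp add: add_pos_nonneg)
   fix z :: "real \<times> real" assume z: "R + abs c * R + R <= norm z"
   obtain t y where ty: "z = (t, y)" by (cases z)
   have "norm z <= abs t + abs y" using norm_Pair_le[of t y] by (simp add: ty)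
   hence "abs t >= R \<or> abs (y + c * t) >= R"
   proof (cases "abs t >= R")
   case False
   hence "abs (c * t) <= abs c * R" unfolding abs_mult by (intro mult_left_mono) auto
   thus ?thesis using z False \<open>norm z <= abs t + abs y\<close> by linarith
   qed simp
   hence "norm (t, y + c * t) >= R" using norm_fst_le[of t "y + c * t"] norm_snd_le[of "y + c * t" t] by auto
   thus "(%(t, y). k (t, y + c * t)) z = 0" using k(2) by (simp add: ty)
  qed
  have m1: "(%x. v t x * k (t, x)) \<in> BM" for t
   using borel_slice[OF v(1), of t] borel_slice[OF mk, of t] by simp
  have m2: "(%y. v t (y + c * t) * k (t, y + c * t)) \<in> BM" for t
   using measurable_compose[OF _ m1[of t], of "%y. y + c * t" borel] by simp
  have "LINT2 (%t x. v t x * k (t, x)) = (LINT t|lborel. LINT x|lborel. v t x * k (t, x))"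
   by (rule iterated_LINT(2)[OF i1 m1, symmetric])
  also have "... = (LINT t|lborel. LINT y|lborel. v t (y + c * t) * k (t, y + c * t))"
   using LINT_shift[of "%x. v t x * k (t, x)" "c * t" for t] by simp
  also have "... = (LINT y|lborel. LINT t|lborel. v t (y + c * t) * k (t, y + c * t))"
   using i2 m2 by (intro iterated_LINT(3)) auto
  finally show ?thesis using i2 by simp
 qed
 have inner: "(LINT t|lborel. w t (y + c * t) * h (t, y + c * t)) = - (LINT t|lborel. g t (y + c * t) * et (t, y + c * t))" for y
 proof -
  define e where "e t = et (t, y + c * t)" for t
  define e' where "e' t = h (t, y + c * t)" for t
  have ce: "cont e" "cont e'" unfolding e_def e'_def
   by (rule continuous_on_compose2[OF cet] continuous_on_compose2[OF ch]; auto intro!: continuous_intros)+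
  have z: "e t = 0" "e' t = 0" if "abs t >= R" for t
   using R(2)[of "(t, y + c * t)"] norm_fst_le[of t "y + c * t"] that by (auto simp: e_def e'_def h_def)
  have ACe: "AC e e'" by (rule AC_C1) (use test2(4)[OF et] ce in \<open>auto simp: e_def[abs_def] e'_def[abs_def] h_def\<close>)
  have P: "AC (%t. w t (y + c * t) * e t) (%t. g t (y + c * t) * e t + w t (y + c * t) * e' t)" by (rule AC_mult[OF AC ACe])
  have bw: "(%t. w t (y + c * t)) \<in> BM" and bg: "(%t. g t (y + c * t)) \<in> BM"
   using measurable_compose[of "%t. (t, y)", OF _ borel_shear[OF w(1), of c]] measurable_compose[of "%t. (t, y)", OF _ borel_shear[OF g(1), of c]] by auto
  have be: "e \<in> BM" "e' \<in> BM" using ce by (auto intro: bmc)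
  have i: "integrable lborel (%t. u t * k t)" if "loc_integrable u" "u \<in> BM" "cont k" "!!t. abs t >= R ==> k t = 0" for u k
   using test_mult_integrable(1)[OF that(1,3,4)] that(2) bmc[OF that(3)]
   by (subst (asm) integrable_completion) auto
  have "(LINT t|lborel. g t (y + c * t) * e t + w t (y + c * t) * e' t) = 0"
   by (rule AC_compact_zero[OF P, of R]) (use z R(1) bw bg be in auto)
  hence "(LINT t|lborel. g t (y + c * t) * e t) + (LINT t|lborel. w t (y + c * t) * e' t) = 0"
   by (subst (asm) L_add) (auto intro!: i AC_loc[OF AC] AC_loc'[OF AC] bw bg ce z)
  thus ?thesis by (simp add: e_def e'_def)
 qed
 have "LINT2 (%t x. w t x * h (t, x)) = (LINT y|lborel. LINT t|lborel. w t (y + c * t) * h (t, y + c * t))"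
  using shear[OF w ch] R(2) by (auto simp: h_def)
 also have "... = - (LINT y|lborel. LINT t|lborel. g t (y + c * t) * et (t, y + c * t))" by (simp add: inner)
 also have "... = - LINT2 (%t x. g t x * et (t, x))" using shear[OF g cet] R(2) by auto
 finally show ?thesis by (simp add: h_def)
qed

lemma iter2:
 fixes et :: "real \<times> real => real"
 assumes w: "(%(t, x). w t x) \<in> BM" "locb w" and et: "test_fun et"
 shows "integrable LL (%(t, x). w t x * et (t, x))"
  "(LINT t|LB. LINT x|LB. w t x * et (t, x)) = LINT2 (%t x. w t x * et (t, x))"
proof -
 obtain R where R: "R > 0" "!!z. norm z >= R ==> et z = 0" using test_fun_support[OF et] by blast
 show i: "integrable LL (%(t, x). w t x * et (t, x))"
  by (rule box_integrable[OF w test2(1)[OF et] R])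
 have "(%(t, x). et (t, x)) \<in> BM" using bmc[OF test2(1)[OF et]] by simp
 hence "(%x. w t x * et (t, x)) \<in> BM" for t
  using borel_slice[OF w(1), of t] borel_slice[of "%t x. et (t, x)" t] by simp
 with i show "(LINT t|LB. LINT x|LB. w t x * et (t, x)) = LINT2 (%t x. w t x * et (t, x))"
  using iterated_LINT(1,2)[of "%t x. w t x * et (t, x)"] by simp
qed

section \<open>Continuity in time\<close>

lemma L2_norm_n2: "u \<in> BM ==> L2_norm u = sqrt (enn2real (n2 u))"
proof -
 assume u: "u \<in> BM"
 have "(LINT x|LB. (u x)^2) = (LINT x|lborel. (u x)^2)" using u by (intro integral_completion) simp
 also have "... = enn2real (n2 u)" unfolding n2_def using u by (intro integral_eq_nn_integral) auto
 finally show ?thesis by (simp add: L2_norm_def)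
qed

lemma L2_norm_tendsto:
 assumes "!!s. w s \<in> BM" "((%s. n2 (w s)) ~~> 0) F"
 shows "((%s. L2_norm (w s)) ~~> 0) F"
proof -
 have "((%s. enn2real (n2 (w s))) ~~> 0) F"
  by (rule tendsto_enn2real) (use assms(2) in auto)
 from tendsto_real_sqrt[OF this] show ?thesis using assms(1) by (simp add: L2_norm_n2)
qed

lemma n2_two_tendsto:
 assumes m: "!!s. f s \<in> BM" "!!s. g s \<in> BM"
  and l: "((%s. n2 (f s)) ~~> 0) F" "((%s. n2 (g s)) ~~> 0) F"
 shows "((%s. n2 (%x. f s x + g s x)) ~~> 0) F" "((%s. n2 (%x. f s x - g s x)) ~~> 0) F"
proof -
 have 0: "((%s. (n2 (f s) + n2 (f s)) + (n2 (g s) + n2 (g s))) ~~> (0 + 0) + (0 + 0)) F"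
  by (intro tendsto_intros l)
 show "((%s. n2 (%x. f s x + g s x)) ~~> 0) F"
  by (rule tendsto_sandwich[OF _ _ tendsto_const 0[simplified]]) (use n2_add[OF m] in \<open>auto simp: mult_2\<close>)
 show "((%s. n2 (%x. f s x - g s x)) ~~> 0) F"
  by (rule tendsto_sandwich[OF _ _ tendsto_const 0[simplified]]) (use n2_diff[OF m] in \<open>auto simp: mult_2\<close>)
qed

lemma n2_half_tendsto:
 assumes "!!s. f s \<in> BM" "((%s. n2 (f s)) ~~> 0) F"
 shows "((%s. n2 (%x. f s x / 2)) ~~> 0) F"
 by (rule tendsto_sandwich[OF _ _ tendsto_const assms(2)]) (auto intro!: always_eventually n2_mono simp: power_divide)

text \<open>The increment splits into the change of \<open>P\<close> seen in the moving frame and a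
  translation of the fixed function \<open>P t\<close>, which is small by continuity of translations
  although \<open>P t\<close> is merely square integrable.\<close>

lemma shear_tendsto:
 assumes m: "!!t. P t \<in> BM" and n: "n2 (P t) < \<infinity>" and l: "((%s. n2 (%x. P s x - P t x)) ~~> 0) (at t)"
 shows "((%s. n2 (%x. P s (x + c * s) - P t (x + c * t))) ~~> 0) (at t)"
proof -
 have ms: "(%x. P s (x + h)) \<in> BM" for s h by (rule measurable_compose[OF _ m]) simp
 have "isCont (%h. n2 (%x. P t (x + h) - P t x)) 0"
  using n2_translation[OF m n] by (simp add: isCont_def n2_def)
 moreover have "((%s. c * (s - t)) ~~> 0) (at t)" by (auto intro!: tendsto_eq_intros)
 ultimately have L: "((%s. n2 (%x. P t (x + c * (s - t)) - P t x)) ~~> n2 (%x. P t (x + 0) - P t x)) (at t)"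
  by (rule isCont_tendsto_compose)
 have 2: "((%s. n2 (%x. P t (x + c * s) - P t (x + c * t))) ~~> 0) (at t)"
 proof -
  have "n2 (%x. P t (x + c * s) - P t (x + c * t)) = n2 (%x. P t (x + c * (s - t)) - P t x)" for s
   using n2_shift[of "%x. P t (x + c * (s - t)) - P t x" "c * t"] ms m by (simp add: algebra_simps)
  with L show ?thesis by (simp add: n2_def)
 qed
 have 1: "((%s. n2 (%x. P s (x + c * s) - P t (x + c * s))) ~~> 0) (at t)"
  using l n2_shift[of "%x. P s x - P t x" "c * s" for s] m by simp
 show ?thesis
  using n2_two_tendsto(1)[OF _ _ 1 2] ms by simp
qed

text \<open>Minkowski's inequality gives a Lipschitz bound near \<open>t\<close>, with constant the
  size of the time derivative on \<open>{t-1..t+1}\<close>.\<close>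

lemma lipschitz_tendsto:
 assumes AC: "!!x. AC (%s. u s x) (%s. w s x)" and w: "(%(s, x). w s x) \<in> BM"
  and b: "!!s. n2 (w s) <= ennreal ((B * ew s)^2)" and B: "B > 0"
 shows "((%s. n2 (%x. u s x - u t x)) ~~> 0) (at t)"
proof -
 define ka where "ka = B * exp (60 * (abs t + 1))"
 have mink: "n2 (%x. u q x - u p x) <= ennreal ((ka * (q - p))^2)" if "p <= q" "p >= t - 1" "q <= t + 1" for p q
 proof -
  have "n2 (%x. u q x - u p x) <= ennreal ((integral {p..q} (%_. ka))^2)"
  proof (rule minkowski[OF AC w])
   show "n2 (w s) <= ennreal (ka^2)" if "s \<in> {p..q}" for s
   proof (rule order_trans[OF b], intro ennreal_leI power_mono)
   have "abs s <= abs t + 1" using that \<open>p >= t - 1\<close> \<open>q <= t + 1\<close> by auto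
   thus "B * ew s <= ka" unfolding ka_def using B by (intro mult_left_mono) auto
   qed (use B in auto)
  qed (use that B in \<open>auto simp: ka_def\<close>)
  thus ?thesis using that by (simp add: mult.commute)
 qed
 have inc: "n2 (%x. u s x - u t x) <= ennreal ((ka * abs (s - t))^2)" if "abs (s - t) <= 1" for s
 proof (cases "s >= t")
  case False
  have "n2 (%x. u s x - u t x) = n2 (%x. - (u t x - u s x))" by simp
  also have "... <= ennreal ((ka * abs (s - t))^2)" using mink[of s t] False that by (simp only: n2_minus) simp
  finally show ?thesis .
 qed (use mink[of t s] that in simp)
 have "((%s. ennreal ((ka * abs (s - t))^2)) ~~> ennreal ((ka * abs (t - t))^2)) (at t)"
  by (intro tendsto_ennrealI tendsto_intros)
 hence 0: "((%s. ennreal ((ka * abs (s - t))^2)) ~~> 0) (at t)" by simp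
 have "\<forall>\<^sub>F s in at t. abs (s - t) <= 1" unfolding eventually_at by (rule exI[of _ 1]) (auto simp: dist_real_def)
 hence "\<forall>\<^sub>F s in at t. n2 (%x. u s x - u t x) <= ennreal ((ka * abs (s - t))^2)" by eventually_elim (rule inc)
 thus ?thesis by (intro tendsto_sandwich[OF _ _ tendsto_const 0]) auto
qed

section \<open>Regularity of the solution\<close>

locale wave = wave_data +
 fixes ph :: "real => real => real" and A :: real
 assumes cph: "cont (%(t, x). ph t x)"
  and eq: "ph t x = fw t x - Dh (%s y. tr (ph s y)) t x" and A: "A > 0"
  and nph: "n2 (%x. ph t x - bkg x) <= ennreal ((A * ew t)^2)"
  and nf: "n2 (%x. tr (ph t x)) <= ennreal ((A * ew t)^2)"
begin

definition f :: "real => real => real" where "f t x = tr (ph t x)"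
text \<open>\<open>p\<close> and \<open>q\<close> are the Riemann invariants, the time derivative of
  \<open>ph\<close> plus and minus its space derivative. Along \<open>x = y - t\<close> and
  \<open>x = y + t\<close> respectively they change only by the integral of \<open>- f\<close>, so
  no second derivative of \<open>ph\<close> is involved.\<close>

definition p :: "real => real => real" where "p t x = 2 * al' (x + t) - Jp f t x"
definition q :: "real => real => real" where "q t x = - 2 * be' (x - t) - Jm f t x"
definition ps :: "real => real => real" where "ps t x = (p t x + q t x) / 2"
definition phx :: "real => real => real" where "phx t x = (p t x - q t x) / 2"

lemma cf: "cont (%(t, x). f t x)"
 unfolding f_def cpb using cph by (intro continuous_intros) (simp add: cpb)

lemma borel_c: "cont (%(t, x). g t x) ==> (%(t, x). g t x) \<in> BM" for g :: "real => real => real"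
 by (rule bmc)

lemma mp: "(%(t, x). p t x) \<in> BM" and mq: "(%(t, x). q t x) \<in> BM"
proof -
 note c = m_char[unfolded cpb] borel_c[OF Jpm_continuous(1)[OF cf], unfolded cpb] borel_c[OF Jpm_continuous(2)[OF cf], unfolded cpb]
 show "(%(t, x). p t x) \<in> BM" "(%(t, x). q t x) \<in> BM"
  unfolding p_def q_def cpb by (intro borel_measurable_diff borel_measurable_times borel_measurable_const c)+
qed

lemma mps: "(%(t, x). ps t x) \<in> BM" and mphx: "(%(t, x). phx t x) \<in> BM"
 using mp mq unfolding ps_def phx_def cpb by simp_all

lemma ph_AC_x: "AC (ph t) (phx t)"
proof -
 have D: "AC (Dh f t) (%x. (Jp f t x - Jm f t x) / 2)"
  by (intro AC_C1 Dh_DERIV_x cf continuous_intros slice[OF Jpm_continuous(1)[OF cf]] slice[OF Jpm_continuous(2)[OF cf]]) auto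
 have W: "AC (fw t) (%x. al' (x + t) + be' (x - t))"
  using AC_add[OF AC_shift[OF ACal, of t] AC_shift[OF ACbe, of "- t"]] by (simp add: fw_def[abs_def])
 have "ph t = (%x. fw t x - Dh f t x)" unfolding f_def[abs_def] by (rule ext) (rule eq)
 moreover have "phx t = (%x. (al' (x + t) + be' (x - t)) - (Jp f t x - Jm f t x) / 2)"
  by (auto simp: phx_def p_def q_def field_simps)
 ultimately show ?thesis using AC_diff[OF W D] by simp
qed

lemma ph_AC_t: "AC (%t. ph t x) (%t. ps t x)"
proof -
 have D: "AC (%t. Dh f t x) (%t. (Jp f t x + Jm f t x) / 2)"
  by (intro AC_C1 Dh_DERIV_t Jpm_slice cf)
 have "(%t. ph t x) = (%t. fw t x - Dh f t x)" unfolding f_def[abs_def] by (rule ext) (rule eq)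
 moreover have "(%t. ps t x) = (%t. (al' (x + t) - be' (x - t)) - (Jp f t x + Jm f t x) / 2)"
  by (auto simp: ps_def p_def q_def field_simps)
 ultimately show ?thesis using AC_diff[OF fw_t D] by simp
qed

lemma p_char: "p t (y + (-1) * t) = 2 * al' y - J (%s. f s (y - s)) t" and q_char: "q t (y + 1 * t) = - 2 * be' y - J (%s. f s (y + s)) t"
 by (simp_all add: p_def q_def Jp_def Jm_def)

lemma cf_char: "cont (%s. f s (y - s))" "cont (%s. f s (y + s))"
 by (intro cont2[OF cf] continuous_intros)+

lemma p_AC: "AC (%t. p t (y + (-1) * t)) (%t. - f t (y + (-1) * t))"
 using AC_diff[OF AC_const AC_C1[OF J_DERIV[OF cf_char(1)] cf_char(1)], of "2 * al' y" y] unfolding p_char by simp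

lemma q_AC: "AC (%t. q t (y + 1 * t)) (%t. - f t (y + 1 * t))"
 using AC_diff[OF AC_const AC_C1[OF J_DERIV[OF cf_char(2)] cf_char(2)], of "- 2 * be' y" y] unfolding q_char by simp

lemma nf': "n2 (f t) <= ennreal ((A * ew t)^2)"
 using nf by (simp add: f_def[abs_def])

definition B :: real where "B = sqrt (8 * intR (%x. (al' x)^2) + 8 * intR (%x. (be' x)^2) + 2 * A^2)"

lemma B: "B > 0" "B^2 = 8 * intR (%x. (al' x)^2) + 8 * intR (%x. (be' x)^2) + 2 * A^2"
 using A sqint_nonneg[OF sal] sqint_nonneg[OF sbe] by (auto simp: B_def add_nonneg_pos)

lemma n2_pq: "n2 (p t) <= ennreal ((B * ew t)^2)" "n2 (q t) <= ennreal ((B * ew t)^2)"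
proof -
 have gen: "n2 (%x. c * v (x + h) - g x) <= ennreal ((B * ew t)^2)"
  if v: "v \<in> BM" "sqint UNIV v" "8 * intR (%x. (v x)^2) + 2 * A^2 <= B^2"
   and g: "g \<in> BM" "n2 g <= ennreal ((A / 60 * ew t)^2)" and c: "c^2 = 4" for c v h g
 proof -
  define a where "a = intR (%x. (v x)^2)"
  have a: "a >= 0" "n2 v = ennreal a" using sqint_nonneg[OF v(2)] n2_sqint(2)[OF v(1,2)] by (auto simp: a_def)
  have "n2 (%x. c * v (x + h) - g x) <= 2 * n2 (%x. c * v (x + h)) + 2 * n2 g"
   using B_shift[OF v(1)] g(1) by (intro n2_diff) auto
  also have "n2 (%x. c * v (x + h)) = ennreal (4 * a)"
   by (subst n2_cmult) (auto simp: B_shift[OF v(1)] n2_shift[OF v(1)] a c ennreal_mult)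
  also have "2 * ennreal (4 * a) + 2 * n2 g <= 2 * ennreal (4 * a) + 2 * ennreal ((A / 60 * ew t)^2)"
   using g(2) by (intro add_mono mult_left_mono) auto
  also have "... = ennreal (8 * a + 2 * (A / 60 * ew t)^2)" using a by (simp add: two_ennreal flip: ennreal_plus)
  also have "... <= ennreal ((B * ew t)^2)"
  proof (rule ennreal_leI)
   have e: "1 <= (ew t)^2" by (simp add: one_le_power)
   have "8 * a * 1 + 2 * (A / 60 * ew t)^2 <= 8 * a * (ew t)^2 + 2 * (A * ew t)^2"
   using a(1) A e by (intro add_mono mult_left_mono power_mono mult_right_mono) auto
   also have "... = (8 * a + 2 * A^2) * (ew t)^2" by (simp add: power_mult_distrib algebra_simps)
   also have "... <= B^2 * (ew t)^2" using v(3) by (intro mult_right_mono) (auto simp: a_def)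
   finally show "8 * a + 2 * (A / 60 * ew t)^2 <= (B * ew t)^2" by (simp add: power_mult_distrib)
  qed
  finally show ?thesis .
 qed
 note J = bmc[OF slice[OF Jpm_continuous(1)[OF cf], of UNIV t]] bmc[OF slice[OF Jpm_continuous(2)[OF cf], of UNIV t]]
 note nJ = n2_Duhamel(1,2)[OF cf nf' _ A]
 show "n2 (p t) <= ennreal ((B * ew t)^2)"
  using gen[OF Bal sal _ J(1) nJ(1), of 2 t] B(2) sqint_nonneg[OF sbe] by (simp add: p_def[abs_def])
 show "n2 (q t) <= ennreal ((B * ew t)^2)"
  using gen[OF Bbe sbe _ J(2) nJ(2), of "-2" "- t"] B(2) sqint_nonneg[OF sal] by (simp add: q_def[abs_def])
qed

lemma n2_ps: "n2 (ps t) <= ennreal ((B * ew t)^2)" and n2_phx: "n2 (phx t) <= ennreal ((B * ew t)^2)"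
proof -
 have m: "p t \<in> BM" "q t \<in> BM" "(%x. - q t x) \<in> BM"
  using borel_slice[OF mp] borel_slice[OF mq] by auto
 show "n2 (ps t) <= ennreal ((B * ew t)^2)" unfolding ps_def[abs_def] by (intro n2_avg m n2_pq) auto
 have "n2 (%x. (p t x + - q t x) / 2) <= ennreal ((B * ew t)^2)" by (intro n2_avg m) (auto simp: n2_minus n2_pq)
 thus "n2 (phx t) <= ennreal ((B * ew t)^2)" unfolding phx_def[abs_def] by simp
qed

lemma n2_imp_sqint: "w \<in> BM ==> n2 w <= ennreal K ==> sqint UNIV w"
 using n2_sqint(1)[of w] by (auto simp: le_less_trans)

lemma sq: "sqint UNIV (p t)" "sqint UNIV (q t)" "sqint UNIV (ps t)" "sqint UNIV (phx t)" "sqint UNIV (f t)"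
 using n2_imp_sqint borel_slice mp mq mps mphx borel_c[OF cf] n2_pq n2_ps n2_phx nf' by blast+

lemma ph_H: "admis (ph t) (phx t)"
 unfolding H1r_def
proof (intro conjI AC_diff[OF ph_AC_x bkg_AC] sqint_diff[OF sq(4) bkg_sq_deriv])
 show "sqint UNIV (%x. ph t x - bkg x)"
  by (rule n2_imp_sqint[OF _ nph]) (intro bmc continuous_intros slice[OF cph])
qed simp

text \<open>Along its own characteristics each invariant is Lipschitz in time; returning to fixed
  \<open>x\<close> costs a translation of a square integrable function.\<close>

lemma pq_tendsto: "((%s. n2 (%x. p s x - p t x)) ~~> 0) (at t)" "((%s. n2 (%x. q s x - q t x)) ~~> 0) (at t)"
proof -
 have gen: "((%s. n2 (%x. r s x - r t x)) ~~> 0) (at t)"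
  if r: "(%(t, x). r t x) \<in> BM" "!!t. n2 (r t) <= ennreal ((B * ew t)^2)"
   "!!y. AC (%t. r t (y + c * t)) (%t. - f t (y + c * t))" for r c
 proof -
  define P where "P t y = r t (y + c * t)" for t y
  have mr: "r t \<in> BM" for t by (rule borel_slice[OF r(1)])
  have m: "P t \<in> BM" for t unfolding P_def[abs_def] by (rule B_shift[OF mr])
  have n: "n2 (P t) < \<infinity>" unfolding P_def[abs_def] n2_shift[OF mr] using r(2)[of t] by (auto simp: le_less_trans)
  have "((%s. n2 (%x. P s x - P t x)) ~~> 0) (at t)"
  proof (rule lipschitz_tendsto[OF _ _ _ A])
   show "AC (%s. P s x) (%s. - f s (x + c * s))" for x unfolding P_def by (rule r(3))
   show "(%(s, x). - f s (x + c * s)) \<in> BM" using borel_shear[OF borel_c[OF cf]] by (simp add: cpb)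
   show "n2 (%x. - f s (x + c * s)) <= ennreal ((A * ew s)^2)" for s
   using nf'[of s] n2_shift[OF borel_slice[OF borel_c[OF cf]]] by (simp add: n2_minus)
  qed
  from shear_tendsto[OF m n this, of "- c"] show ?thesis by (simp add: P_def)
 qed
 show "((%s. n2 (%x. p s x - p t x)) ~~> 0) (at t)" by (rule gen[OF mp n2_pq(1) p_AC])
 show "((%s. n2 (%x. q s x - q t x)) ~~> 0) (at t)" by (rule gen[OF mq n2_pq(2) q_AC])
qed

lemma ps_tendsto: "((%s. n2 (%x. ps s x - ps t x)) ~~> 0) (at t)" "((%s. n2 (%x. phx s x - phx t x)) ~~> 0) (at t)"
proof -
 have m: "(%x. p s x - p t x) \<in> BM" "(%x. q s x - q t x) \<in> BM" for s
  using borel_slice[OF mp] borel_slice[OF mq] by auto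
 note l = n2_two_tendsto[OF m pq_tendsto]
 have e: "ps s x - ps t x = ((p s x - p t x) + (q s x - q t x)) / 2" "phx s x - phx t x = ((p s x - p t x) - (q s x - q t x)) / 2" for s x
  by (simp_all add: ps_def phx_def field_simps)
 show "((%s. n2 (%x. ps s x - ps t x)) ~~> 0) (at t)" "((%s. n2 (%x. phx s x - phx t x)) ~~> 0) (at t)"
  unfolding e by (intro n2_half_tendsto l; use m in simp)+
qed

lemma ph_tendsto: "((%s. n2 (%x. ph s x - ph t x)) ~~> 0) (at t)"
 by (rule lipschitz_tendsto[OF ph_AC_t mps n2_ps B(1)])

lemma diff_H: "H1r (%x. ph s x - ph t x) (%x. phx s x - phx t x)"
 using H1r_diff[OF ph_H[of s] ph_H[of t]] by simp

lemma H1sq_tendsto: "((%s. H1sq (%x. ph s x - ph t x) (%x. phx s x - phx t x)) ~~> 0) (at t)"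
proof -
 have m: "(%x. ph s x - ph t x) \<in> BM" "(%x. phx s x - phx t x) \<in> BM" for s
  using borel_slice[OF borel_c[OF cph]] borel_slice[OF mphx] by auto
 have "((%s. (L2_norm (%x. ph s x - ph t x))^2 + (L2_norm (%x. phx s x - phx t x))^2) ~~> 0^2 + 0^2) (at t)"
  by (intro tendsto_intros L2_norm_tendsto m ph_tendsto ps_tendsto)
 moreover have "(L2_norm (%x. ph s x - ph t x))^2 + (L2_norm (%x. phx s x - phx t x))^2 = H1sq (%x. ph s x - ph t x) (%x. phx s x - phx t x)" for s
  using diff_H[of s t] by (auto simp: H1r_def H1sq_def L2_norm_eq sqint_nonneg)
 ultimately show ?thesis by simp
qed

lemma energy_class: "energy_class ph ps"
 unfolding energy_class_def
proof (intro conjI allI)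
 fix t
 show "(%x. ph t x - kink01 x - kink10 x) \<in> H1"
  by (rule H1r_imp_H1[OF ph_H[of t]]) (simp add: bkg_def diff_diff_eq)
 show "ps t \<in> L2" using sq by (simp add: L2_iff)
 show "((%s. H1_norm (%x. ph s x - ph t x)) ~~> 0) (at t)"
 proof -
  have "H1_norm (%x. ph s x - ph t x) = sqrt (H1sq (%x. ph s x - ph t x) (%x. phx s x - phx t x))" for s
   by (rule H1_norm_eq[OF diff_H]) simp
  thus ?thesis using tendsto_real_sqrt[OF H1sq_tendsto[of t]] by simp
 qed
 show "((%s. L2_norm (%x. ps s x - ps t x)) ~~> 0) (at t)"
  using borel_slice[OF mps] by (intro L2_norm_tendsto ps_tendsto) auto
qed

lemma lb: "locb p" "locb q" "locb ps" "locb phx" "locb f" "locb ph"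
 using locb_n2[OF n2_pq(1)] locb_n2[OF n2_pq(2)] locb_n2[OF n2_ps] locb_n2[OF n2_phx] locb_n2[OF nf'] locb_continuous[OF cph] A B(1) by auto

lemma time_deriv: 
 assumes "test_fun et"
 shows "LINT2 (%t x. ph t x * dir_deriv (1, 0) et (t, x)) = - LINT2 (%t x. ps t x * et (t, x))"
 using transport[OF assms borel_c[OF cph] lb(6) mps lb(3), of 0] ph_AC_t by simp

lemma space_deriv: 
 assumes et: "test_fun et"
 shows "LINT2 (%t x. ph t x * dir_deriv (0, 1) et (t, x)) = - LINT2 (%t x. phx t x * et (t, x))"
proof -
 obtain R where R: "R > 0" "!!z. norm z >= R ==> et z = 0 & dir_deriv (1, 0) et z = 0 & dir_deriv (0, 1) et z = 0"
  using test2_support[OF et] by blast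
 have c: "cont et" "cont (dir_deriv (0, 1) et)" using test2(1) test2(3) et by blast+
 have inner: "(LINT x|LB. ph t x * dir_deriv (0, 1) et (t, x)) = - (LINT x|LB. phx t x * et (t, x))" for t
 proof -
  have ce: "cont (%x. et (t, x))" "cont (%x. dir_deriv (0, 1) et (t, x))"
   by (rule continuous_on_compose2[OF c(1)] continuous_on_compose2[OF c(2)]; auto intro!: continuous_intros)+
  have z: "et (t, x) = 0" "dir_deriv (0, 1) et (t, x) = 0" if "abs x >= R" for x
   using R(2)[of "(t, x)"] norm_snd_le[of x t] that by auto
  have P: "AC (%x. ph t x * et (t, x)) (%x. phx t x * et (t, x) + ph t x * dir_deriv (0, 1) et (t, x))"
   by (intro AC_mult ph_AC_x AC_C1 test2(5) et ce)
  have i: "integrable LB (%x. phx t x * et (t, x))" "integrable LB (%x. ph t x * dir_deriv (0, 1) et (t, x))"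
   by (intro test_mult_integrable(1)[where R = R] AC_loc[OF ph_AC_x] AC_loc'[OF ph_AC_x] ce z; simp)+
  have m: "(%x. phx t x * et (t, x) + ph t x * dir_deriv (0, 1) et (t, x)) \<in> BM"
   using ce borel_slice[OF mphx] borel_slice[OF borel_c[OF cph]] by (intro borel_measurable_add borel_measurable_times) (auto intro: bmc)
  have "(LINT x|lborel. phx t x * et (t, x) + ph t x * dir_deriv (0, 1) et (t, x)) = 0"
   by (rule AC_compact_zero[OF P, of R]) (use z R(1) m in auto)
  hence "(LINT x|LB. phx t x * et (t, x) + ph t x * dir_deriv (0, 1) et (t, x)) = 0"
   using m by (subst integral_completion) simp_all
  thus ?thesis using L_add[OF i] by simp
 qed
 have "LINT2 (%t x. ph t x * dir_deriv (0, 1) et (t, x)) = (LINT t|LB. LINT x|LB. ph t x * dir_deriv (0, 1) et (t, x))"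
  by (rule iter2(2)[OF borel_c[OF cph] lb(6) test2(3)[OF et], symmetric])
 also have "... = - (LINT t|LB. LINT x|LB. phx t x * et (t, x))" by (simp add: inner)
 also have "... = - LINT2 (%t x. phx t x * et (t, x))" by (simp add: iter2(2)[OF mphx lb(4) et])
 finally show ?thesis .
qed

lemma distr_time_deriv: "distr_time_deriv ph ps"
 unfolding distr_time_deriv_def using time_deriv iter2(2)[OF borel_c[OF cph] lb(6) test2(2)] iter2(2)[OF mps lb(3)] by simp

text \<open>The wave operator splits into two transport equations: \<open>p\<close> is paired with
  the derivative of \<open>et\<close> along one characteristic direction, \<open>q\<close> along the
  other, and half the sum is the equation for \<open>ph\<close>. The bound 2 turns \<open>tr\<close>
  back into \<open>dpot\<close>.\<close>

lemma distr_solution: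
 assumes b: "!!t x. abs (ph t x) <= 2"
 shows "distr_solution ph"
 unfolding distr_solution_def
proof (intro allI impI)
 fix et :: "real \<times> real => real" assume et: "test_fun et"
 let ?t = "dir_deriv (1, 0) et" and ?x = "dir_deriv (0, 1) et"
 let ?tt = "dir_deriv (1, 0) ?t" and ?xx = "dir_deriv (0, 1) ?x"
 have T: "test_fun ?t" "test_fun ?x" "test_fun ?tt" "test_fun ?xx" using test2(2,3) et by blast+
 note cph' = borel_c[OF cph] lb(6)
 have eqn: "(%t x. ph t x * (?tt (t, x) - ?xx (t, x)) + (2 * ph t x - 8 * (ph t x) ^ 3 + 6 * (ph t x) ^ 5) * et (t, x))
   = (%t x. (ph t x * ?tt (t, x) - ph t x * ?xx (t, x)) + f t x * et (t, x))"
  by (intro ext) (simp only: f_def tr_eq[OF b] dpot_def, simp add: algebra_simps)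
 note i = iter2(1)[OF cph' T(3)] iter2(1)[OF cph' T(4)] iter2(1)[OF borel_c[OF cf] lb(5) et]
  iter2(1)[OF mp lb(1) T(1)] iter2(1)[OF mp lb(1) T(2)] iter2(1)[OF mq lb(2) T(1)] iter2(1)[OF mq lb(2) T(2)]
 note i' = i[unfolded cpb]
 have it: "integrable LL (%(t, x). (ph t x * ?tt (t, x) - ph t x * ?xx (t, x)) + f t x * et (t, x))"
  unfolding cpb by (intro L_int_add L_int_diff i')
 have m: "(%x. (ph t x * ?tt (t, x) - ph t x * ?xx (t, x)) + f t x * et (t, x)) \<in> BM" for t
 proof -
  have "(%x. h (t, x)) \<in> BM" if "test_fun h" for h :: "real \<times> real => real"
   using borel_slice[of "%t x. h (t, x)"] bmc[OF test2(1)[OF that]] by simp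
  thus ?thesis using borel_slice[OF cph'(1)] borel_slice[OF borel_c[OF cf]] T et by simp
 qed
 have P: "LINT2 (%t x. p t x * ?t (t, x)) - LINT2 (%t x. p t x * ?x (t, x)) = LINT2 (%t x. f t x * et (t, x))"
 proof -
  have "LINT2 (%t x. p t x * (?t (t, x) + (-1) * ?x (t, x))) = - LINT2 (%t x. - f t x * et (t, x))"
   by (rule transport[OF et mp lb(1) _ _ p_AC]) (use borel_c[OF cf] lb(5) in \<open>auto simp: cpb locb_def\<close>)
  thus ?thesis using i' by (simp add: cpb right_diff_distrib)
 qed
 have Q: "LINT2 (%t x. q t x * ?t (t, x)) + LINT2 (%t x. q t x * ?x (t, x)) = LINT2 (%t x. f t x * et (t, x))"
 proof -
  have "LINT2 (%t x. q t x * (?t (t, x) + 1 * ?x (t, x))) = - LINT2 (%t x. - f t x * et (t, x))"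
   by (rule transport[OF et mq lb(2) _ _ q_AC]) (use borel_c[OF cf] lb(5) in \<open>auto simp: cpb locb_def\<close>)
  thus ?thesis using i' by (simp add: cpb distrib_left)
 qed
 have 1: "LINT2 (%t x. ps t x * ?t (t, x)) = (LINT2 (%t x. p t x * ?t (t, x)) + LINT2 (%t x. q t x * ?t (t, x))) / 2"
  using i' by (simp add: ps_def cpb add_divide_distrib distrib_right)
 have 2: "LINT2 (%t x. phx t x * ?x (t, x)) = (LINT2 (%t x. p t x * ?x (t, x)) - LINT2 (%t x. q t x * ?x (t, x))) / 2"
  using i' by (simp add: phx_def cpb diff_divide_distrib left_diff_distrib)
 have "(LINT t|LB. LINT x|LB. (ph t x * ?tt (t, x) - ph t x * ?xx (t, x)) + f t x * et (t, x))
   = LINT2 (%t x. (ph t x * ?tt (t, x) - ph t x * ?xx (t, x)) + f t x * et (t, x))"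
  using iterated_LINT(1,2)[OF it m] by simp
 also have "... = LINT2 (%t x. ph t x * ?tt (t, x)) - LINT2 (%t x. ph t x * ?xx (t, x)) + LINT2 (%t x. f t x * et (t, x))"
  using i' by (simp add: cpb)
 also have "... = 0"
 proof -
  have "tt - xx + z = 0" if "tt = - s" "xx = - r" "s = (a + b) / 2" "r = (c - d) / 2" "a - c = z" "b + d = z" for tt xx z s r a b c d :: real
   using that by (simp add: field_simps)
  from this[OF time_deriv[OF T(1)] space_deriv[OF T(2)] 1 2 P Q] show ?thesis .
 qed
 finally have 0: "(LINT t|LB. LINT x|LB. (ph t x * ?tt (t, x) - ph t x * ?xx (t, x)) + f t x * et (t, x)) = 0" .
 show "(LINT t|LB. LINT x|LB. ph t x * (?tt (t, x) - ?xx (t, x))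
   + (2 * ph t x - 8 * (ph t x) ^ 3 + 6 * (ph t x) ^ 5) * et (t, x)) = 0"
  using 0 fun_cong[OF fun_cong[OF eqn]] by simp
qed

end

section \<open>Conservation of energy\<close>

text \<open>Where the integrand is clipped it is constant, so its primitive continues linearly
  beyond [-2, 2].\<close>

lemma J_clip:
 assumes h: "cont h" and F: "!!x. (F hrd h x) (at x)" "F 0 = 0"
 shows "abs u <= 2 ==> J (%u. h (clip 2 u)) u = F u"
  "u >= 2 ==> J (%u. h (clip 2 u)) u = F 2 + (u - 2) * h 2"
  "u <= -2 ==> J (%u. h (clip 2 u)) u = F (-2) + (u + 2) * h (-2)"
proof -
 define k where "k u = h (clip 2 u)" for u
 have ck: "cont k" unfolding k_def by (rule continuous_on_compose2[OF h clip(4)]) auto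
 have small: "J k u = F u" if u: "abs u <= 2" for u
 proof -
  have "mean k 0 u = mean h 0 u" unfolding mean_def
  proof (rule integral_cong)
   fix sg :: real assume "sg \<in> {0..1}"
   hence "abs sg * abs u <= 1 * 2" using u by (intro mult_mono) auto
   thus "k (0 + sg * (u - 0)) = h (0 + sg * (u - 0))" by (simp add: k_def clip(2) abs_mult)
  qed
  thus ?thesis using mean_FTC[OF F(1), of u 0] F(2) by (simp add: J_def)
 qed
 have inc: "J k u = J k a + (u - a) * h a" if a: "!!sg. sg \<in> {0..1} ==> clip 2 (a + sg * (u - a)) = a" for u a
 proof -
  have "mean k a u = integral {0..1} (%sg::real. h a)" unfolding mean_def k_def by (rule integral_cong) (simp add: a)
  thus ?thesis using mean_FTC[OF J_DERIV[OF ck], of u a] by (simp add: algebra_simps)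
 qed
 show "abs u <= 2 ==> J (%u. h (clip 2 u)) u = F u" using small unfolding k_def[abs_def] .
 show "J (%u. h (clip 2 u)) u = F 2 + (u - 2) * h 2" if "u >= 2"
 proof -
  have "clip 2 (2 + sg * (u - 2)) = 2" if "sg \<in> {0..1}" for sg
   using mult_nonneg_nonneg[of sg "u - 2"] that \<open>u >= 2\<close> by (simp add: clip_def)
  from inc[of 2, OF this] show ?thesis using small[of 2] unfolding k_def[abs_def] by simp
 qed
 show "J (%u. h (clip 2 u)) u = F (-2) + (u + 2) * h (-2)" if "u <= -2"
 proof -
  have "clip 2 (-2 + sg * (u - (-2))) = -2" if "sg \<in> {0..1}" for sg
   using mult_nonneg_nonneg[of sg "- u - 2"] that \<open>u <= -2\<close> by (simp add: clip_def algebra_simps)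
  from inc[of "-2", OF this] show ?thesis using small[of "-2"] unfolding k_def[abs_def] by simp
 qed
qed

text \<open>The potential of the truncated nonlinearity: \<open>pot\<close> on [-2, 2], continued by
  its tangents at 2 and -2.\<close>

definition potM :: "real => real" where "potM u = J tr u"

lemma DERIV_potM: "(potM hrd tr u) (at u)"
 unfolding potM_def[abs_def] by (rule J_DERIV) (intro continuous_intros)

lemma continuous_potM [continuous_intros]: "continuous_on S g ==> continuous_on S (%x. potM (g x))"
proof -
 have "cont potM" by (intro continuous_at_imp_continuous_on ballI DERIV_isCont[OF DERIV_potM])
 thus "continuous_on S g ==> continuous_on S (%x. potM (g x))" by (rule continuous_on_compose2) auto
qed

text \<open>At distance \<open>s\<close> outside [-2, 2] the tangent is \<open>36 + 132 * s\<close>;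
  it lies above the edge value 36 and below \<open>pot\<close>.\<close>

lemma potM: "abs u <= 2 ==> potM u = pot u" "potM u <= pot u" "pot (clip 2 u) <= potM u" "0 <= potM u"
proof -
 note * = J_clip[of dpot pot, OF _ DERIV_pot, unfolded tr_def[symmetric] potM_def[symmetric]]
 have c: "cont dpot" using continuous_dpot[OF continuous_on_id, of UNIV] by simp
 have e: "abs u <= 2 ==> potM u = pot u" "u >= 2 ==> potM u = 36 + (u - 2) * 132" "u <= -2 ==> potM u = 36 - (u + 2) * 132" for u
  using *[OF c, of u] by (auto simp: pot_def dpot_def)
 show 1: "abs u <= 2 ==> potM u = pot u" using e(1) .
 have big: "36 + s * 132 <= pot (2 + s)" if s: "s >= 0" for s
 proof -
  have "(6 + 11 * s)^2 <= (6 + 11 * s + (6 * s^2 + s ^ 3))^2" using s by (intro power_mono) auto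
  moreover have "36 + s * 132 <= (6 + 11 * s)^2" by (simp add: power2_sum power_mult_distrib)
  moreover have "pot (2 + s) = (6 + 11 * s + (6 * s^2 + s ^ 3))^2"
   by (simp add: pot_def power2_eq_square power3_eq_cube algebra_simps)
  ultimately show ?thesis by linarith
 qed
 have even: "pot (- u) = pot u" by (simp add: pot_def)
 consider "abs u <= 2" | "u >= 2" | "u <= -2" by linarith
 hence "potM u <= pot u & pot (clip 2 u) <= potM u"
 proof cases
  case 1
  thus ?thesis by (simp add: e clip)
 next
  case 2
  thus ?thesis using big[of "u - 2"] e(2)[of u] by (simp add: clip_def pot_def)
 next
  case 3
  thus ?thesis using big[of "- u - 2"] e(3)[of u] even by (simp add: clip_def pot_def)
 qed
 thus "potM u <= pot u" "pot (clip 2 u) <= potM u" by auto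
 thus "0 <= potM u" using pot_nonneg[of "clip 2 u"] by linarith
qed

lemma edM_int:
 assumes H: "admis u v"
 shows "(%x. (v x)^2 / 2 + potM (u x)) abs_int_on UNIV"
proof (rule abs_int_bound[where g = "edens u v"])
 have "cont (%x. potM (u x))" by (intro continuous_intros AC_cont[OF S_AC[OF H]])
 thus "(%x. (v x)^2 / 2 + potM (u x)) \<in> LM"
  using sqint_meas[OF S_v[OF H]] continuous_meas by (intro borel_measurable_add borel_measurable_divide borel_measurable_power) auto
 show "edens u v integrable_on UNIV" using S_edens_int[OF H] by (rule abs_int_imp)
 show "abs ((v x)^2 / 2 + potM (u x)) <= edens u v x" for x using potM(2)[of "u x"] potM(4)[of "u x"] by (simp add: edens_def)
qed simp

text \<open>A profile leaving \<open>[-2, 2]\<close> passes through a zero first, which costs at least the variation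
 \<open>2 * sqrt 2\<close> of (the linear extension of) \<open>bog\<close> in energy.\<close>

lemma energy_bound:
 assumes H: "admis u v"
  and E: "intR (%x. (v x)^2 / 2 + potM (u x)) < 2 * sqrt 2"
 shows "abs (u x) <= 2"
proof -
 define h where "h u = sqrt 2 * u * (1 - u^2)" for u :: real
 define k where "k u = h (clip 2 u)" for u
 have ch: "cont h" unfolding h_def by (intro continuous_intros)
 have ck: "cont k" unfolding k_def by (rule continuous_on_compose2[OF ch clip(4)]) auto
 have J: "u >= 2 ==> J k u = bog 2 + (u - 2) * h 2" "u <= -2 ==> J k u = bog (-2) + (u + 2) * h (-2)" for u
  using J_clip(2,3)[OF ch, of bog u] DERIV_bog bog_values(1) unfolding h_def k_def[abs_def] by auto
 \<comment> \<open>Beyond 2 the extension of \<open>bog\<close> continues downwards along its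
   tangent, so the level \<open>- 2 * sqrt 2\<close> taken at 2 is not left again.\<close>
 have big: "J k y <= - 2 * sqrt 2" if y: "abs y > 2" for y
 proof -
  have b: "bog 2 = - 2 * sqrt 2" "bog (-2) = - 2 * sqrt 2" "h 2 = - 6 * sqrt 2" "h (-2) = 6 * sqrt 2" by (simp_all add: bog_def h_def)
  show ?thesis
  proof (cases "y > 0")
   case True
   hence "(y - 2) * (6 * sqrt 2) >= 0" using y by (intro mult_nonneg_nonneg) auto
   thus ?thesis using J(1)[of y] y True unfolding b by simp
  next
   case False
   hence "(- y - 2) * (6 * sqrt 2) >= 0" using y by (intro mult_nonneg_nonneg) auto
   thus ?thesis using J(2)[of y] y False unfolding b by (simp add: algebra_simps)
  qed
 qed
 have kb: "abs (k a * b) <= b^2 / 2 + potM a" for a b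
  using edens_ge[of "%_. clip 2 a" 0 "%_. b"] potM(3)[of a] by (simp add: k_def h_def edens_def)
 obtain m where m: "u m = 0" using S_zero[OF H] .
 have AC: "AC (%x. J k (u x)) (%x. k (u x) * v x)" by (rule AC_chain[OF S_AC[OF H] J_DERIV[OF ck] ck])
 note I = edM_int[OF H]
 have path: "abs (J k (u b) - J k (u a)) < 2 * sqrt 2" if ab: "a <= b" for a b
 proof -
  have i1: "(%x. k (u x) * v x) abs_int_on {a..b}" by (rule li_imp(2)[OF AC_loc[OF AC]])
  have i2: "(%x. (v x)^2 / 2 + potM (u x)) integrable_on {a..b}" by (intro abs_int_imp abs_int_subset[OF I]) auto
  have "abs (J k (u b) - J k (u a)) = norm (integral {a..b} (%x. k (u x) * v x))" using AC_D[OF AC ab] by simp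
  also have "... <= integral {a..b} (%x. (v x)^2 / 2 + potM (u x))"
   by (rule integral_norm_bound_integral[OF abs_int_imp[OF i1] i2]) (simp add: kb)
  also have "... <= intR (%x. (v x)^2 / 2 + potM (u x))"
   by (rule integral_subset_le[OF _ i2 abs_int_imp[OF I]]) (simp_all add: potM(4))
  finally show ?thesis using E by simp
 qed
 have J0: "J k (u m) = 0" by (simp add: m)
 show ?thesis
 proof (rule ccontr)
  assume "\<not> abs (u x) <= 2"
  hence "J k (u x) <= - 2 * sqrt 2" using big by simp
  moreover have "abs (J k (u x)) < 2 * sqrt 2" using path[of x m] path[of m x] J0 by (cases "x <= m") auto
  ultimately show False by linarith
 qed
qed

text \<open>The fundamental theorem in \<open>t\<close> for each \<open>y\<close>, then Fubini; used
  both at fixed places and in frames sheared along characteristics.\<close>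

lemma balance:
 assumes w: "!!t. w t \<in> BM" "integrable lborel (w a)" "integrable lborel (w b)"
  and AC: "!!y. AC (%t. w t y) (%t. g t y)" and mg: "(%(t, y). g t y) \<in> BM"
  and i: "integrable LL (%(t, y). indicator {a..b} t * g t y)" and ab: "a <= b"
 shows "(LINT y|lborel. w b y) - (LINT y|lborel. w a y) = (LINT t|lborel. indicator {a..b} t * (LINT y|lborel. g t y))"
proof -
 have pt: "w b y - w a y = (LINT t|lborel. indicator {a..b} t * g t y)" for y
 proof -
  have m: "(%t. indicator {a..b} t * g t y) \<in> borel_measurable lborel"
   using measurable_compose[of "%t. (t, y)", OF _ mg] by simp
  have "w b y - w a y = integral {a..b} (%t. g t y)" using AC_D[OF AC ab] by simp
  also have "... = (LINT t:{a..b}|LB. g t y)"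
   using li_imp(2)[OF AC_loc[OF AC]] by (intro set_LINT_eq(2)[symmetric])
  also have "... = (LINT t|lborel. indicator {a..b} t * g t y)"
   unfolding set_lebesgue_integral_def real_scaleR_def by (rule integral_completion[OF m])
  finally show ?thesis .
 qed
 have "(LINT y|lborel. w b y) - (LINT y|lborel. w a y) = (LINT y|lborel. w b y - w a y)" using w by simp
 also have "... = (LINT y|lborel. LINT t|lborel. indicator {a..b} t * g t y)" by (simp add: pt)
 also have "... = (LINT t|lborel. LINT y|lborel. indicator {a..b} t * g t y)"
  by (rule lborel_pair.Fubini_integral[OF i])
 finally show ?thesis by simp
qed

lemma product_integrable:
 assumes u: "(%(t, y). u t y) \<in> BM" "!!t. n2 (u t) <= ennreal ((K * ew t)^2)"
  and v: "(%(t, y). v t y) \<in> BM" "!!t. n2 (v t) <= ennreal ((K * ew t)^2)" and K: "K > 0"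
 shows "integrable LL (%(t, y). indicator {a..b} t * (u t y * v t y))" "integrable lborel (%y. u t y * v t y)"
proof -
 have m1: "(%z. u (fst z) (snd z)) \<in> borel_measurable LL" "(%z. v (fst z) (snd z)) \<in> borel_measurable LL"
  using u(1) v(1) by (simp_all add: lborel_prod cpb)
 have m3: "(%z. indicator {a..b} (fst z) :: real) \<in> borel_measurable LL"
  by (rule measurable_compose[of fst _ borel]) simp_all
 have m: "(%(t, y). indicator {a..b} t * (u t y * v t y)) \<in> borel_measurable LL"
  using borel_measurable_times[OF m3 borel_measurable_times[OF m1]] by (simp add: cpb)
 have ms: "u t \<in> BM" "v t \<in> BM" for t using borel_slice u(1) v(1) by blast+
 have inner: "(\<integral>\<^sup>+y. ennreal (norm (u t y * v t y)) \<partial>lborel) <= ennreal (2 * (K * ew t)^2)" for t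
 proof -
  have "(\<integral>\<^sup>+y. ennreal (norm (u t y * v t y)) \<partial>lborel) <= (\<integral>\<^sup>+y. ennreal ((u t y)^2) + ennreal ((v t y)^2) \<partial>lborel)"
   using abs_mult_le_squares by (intro nn_integral_mono) (auto simp flip: ennreal_plus intro!: ennreal_leI)
  also have "... = n2 (u t) + n2 (v t)" unfolding n2_def using ms by (intro nn_integral_add) auto
  also have "... <= ennreal ((K * ew t)^2) + ennreal ((K * ew t)^2)" by (intro add_mono u v)
  also have "... = ennreal (2 * (K * ew t)^2)" by (simp flip: ennreal_plus)
  finally show ?thesis .
 qed
 show "integrable lborel (%y. u t y * v t y)"
  by (rule integrableI_bounded) (use ms inner[of t] in \<open>auto intro: le_less_trans\<close>)
 show "integrable LL (%(t, y). indicator {a..b} t * (u t y * v t y))"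
 proof (rule integrableI_bounded[OF m])
  have "(\<integral>\<^sup>+z. ennreal (norm ((%(t, y). indicator {a..b} t * (u t y * v t y)) z)) \<partial>LL)
   = (\<integral>\<^sup>+t. \<integral>\<^sup>+y. ennreal (norm (indicator {a..b} t * (u t y * v t y))) \<partial>lborel \<partial>lborel)"
   using m by (subst lborel.nn_integral_fst[symmetric]) auto
  also have "... <= (\<integral>\<^sup>+t. ennreal (2 * (K * exp (60 * (abs a + abs b)))^2) * indicator {a..b} t \<partial>lborel)"
  proof (rule nn_integral_mono)
   fix t
   show "(\<integral>\<^sup>+y. ennreal (norm (indicator {a..b} t * (u t y * v t y))) \<partial>lborel) <= ennreal (2 * (K * exp (60 * (abs a + abs b)))^2) * indicator {a..b} t"
   proof (cases "t \<in> {a..b}")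
   case True
   have "(\<integral>\<^sup>+y. ennreal (norm (u t y * v t y)) \<partial>lborel) <= ennreal (2 * (K * ew t)^2)" by (rule inner)
   also have "... <= ennreal (2 * (K * exp (60 * (abs a + abs b)))^2)"
   proof (intro ennreal_leI mult_left_mono power_mono)
   have "abs t <= abs a + abs b" using True by auto
   thus "ew t <= exp (60 * (abs a + abs b))" by simp
   qed (use K in auto)
   finally show ?thesis using True by simp
   qed simp
  qed
  also have "... < \<infinity>" by (subst nn_integral_cmult_indicator) (auto simp: ennreal_mult_less_top emeasure_lborel_Icc_eq)
  finally show "(\<integral>\<^sup>+z. ennreal (norm ((%(t, y). indicator {a..b} t * (u t y * v t y)) z)) \<partial>LL) < \<infinity>" .
 qed
qed

section \<open>Energy balance of the truncated flow\<close>

context wave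
begin

text \<open>In the Riemann invariants \<open>(phx^2 + ps^2) / 2\<close> is
  \<open>p^2 / 4 + q^2 / 4\<close>. This form admits a proof at the regularity of the energy space:
  each square obeys a transport equation along characteristics, whereas \<open>ps\<close> and
  \<open>phx\<close> need not be differentiable in time.\<close>

definition en :: "real => real" where
 "en t = (LINT x|lborel. (p t x)^2) / 4 + (LINT x|lborel. (q t x)^2) / 4 + (LINT x|lborel. potM (ph t x))"

definition K :: real where "K = A + B"

lemma nK: "n2 (p t) <= ennreal ((K * ew t)^2)" "n2 (q t) <= ennreal ((K * ew t)^2)"
 "n2 (ps t) <= ennreal ((K * ew t)^2)" "n2 (f t) <= ennreal ((K * ew t)^2)" "K > 0"
proof -
 have *: "ennreal ((c * ew t)^2) <= ennreal ((K * ew t)^2)" if "0 <= c" "c <= K" for c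
  using that by (intro ennreal_leI power_mono mult_right_mono) auto
 have AB: "A <= K" "B <= K" "0 <= A" "0 <= B" using A B(1) by (auto simp: K_def)
 show "n2 (p t) <= ennreal ((K * ew t)^2)" "n2 (q t) <= ennreal ((K * ew t)^2)" "n2 (ps t) <= ennreal ((K * ew t)^2)"
  using n2_pq n2_ps *[of B] AB order_trans by blast+
 show "n2 (f t) <= ennreal ((K * ew t)^2)" using nf' *[of A] AB order_trans by blast
 show "K > 0" using A B(1) by (simp add: K_def)
qed

lemma square_integrable: "w \<in> BM ==> sqint UNIV w ==> integrable lborel (%x. (w x)^2)"
 unfolding sqint_def set_integrable_def by (subst (asm) integrable_completion) auto

lemma mf: "(%(t, x). f t x) \<in> BM" by (rule borel_c[OF cf])

lemma potM_int: "integrable lborel (%x. potM (ph t x))" and edM_int_t: "integrable lborel (%x. (phx t x)^2 / 2 + potM (ph t x))"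
proof -
 have c: "cont (%x. potM (ph t x))" by (intro continuous_intros slice[OF cph])
 have m: "(%x. (phx t x)^2 / 2 + potM (ph t x)) \<in> borel_measurable lborel"
  using borel_slice[OF mphx, of t] bmc[OF c] by simp
 show i: "integrable lborel (%x. (phx t x)^2 / 2 + potM (ph t x))"
  using edM_int[OF ph_H[of t]] unfolding set_integrable_def by (subst (asm) integrable_completion) (use m in auto)
 show "integrable lborel (%x. potM (ph t x))"
  by (rule Bochner_Integration.integrable_bound[OF i]) (use bmc[OF c] potM(4) in auto)
qed

text \<open>In the sheared frame the derivative of \<open>r^2\<close> is \<open>- 2 * r * f\<close>,
  and the space integral does not notice the shear.\<close>

lemma char_balance:
 assumes r: "(%(t, x). r t x) \<in> BM" "!!t. n2 (r t) <= ennreal ((K * ew t)^2)"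
  and AC: "!!y. AC (%t. r t (y + c * t)) (%t. - f t (y + c * t))" and s: "!!t. sqint UNIV (r t)" and ab: "a <= b"
 shows "(LINT x|lborel. (r b x)^2) - (LINT x|lborel. (r a x)^2) = (LINT t|lborel. indicator {a..b} t * (-2 * (LINT x|lborel. r t x * f t x)))"
proof -
 define w where "w t y = (r t (y + c * t))^2" for t y
 define g where "g t y = -2 * (r t (y + c * t) * f t (y + c * t))" for t y
 have ms: "r t \<in> BM" for t by (rule borel_slice[OF r(1)])
 have sh: "n2 (%y. r t (y + c * t)) <= ennreal ((K * ew t)^2)" "n2 (%y. f t (y + c * t)) <= ennreal ((K * ew t)^2)" for t
  using r(2) nK(4) n2_shift[OF ms] n2_shift[OF borel_slice[OF mf]] by auto
 have i: "integrable lborel (w t)" for t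
  unfolding w_def[abs_def] using lborel_integrable_real_affine[of "%x. (r t x)^2" 1 "c * t"] square_integrable[OF ms s] by (simp add: add.commute)
 have I: "integrable LL (%(t, y). indicator {a..b} t * (r t (y + c * t) * f t (y + c * t)))"
  by (rule product_integrable(1)[OF borel_shear[OF r(1)] sh(1) borel_shear[OF mf] sh(2) nK(5)])
 have L: "(LINT y|lborel. w b y) - (LINT y|lborel. w a y) = (LINT t|lborel. indicator {a..b} t * (LINT y|lborel. g t y))"
 proof (rule balance[OF _ i i _ _ _ ab])
  show "w t \<in> BM" for t using i[of t] by simp
  show "AC (%t. w t y) (%t. g t y)" for y
   using AC_square[OF AC[of y]] by (simp add: w_def g_def mult.assoc)
  show "(%(t, y). g t y) \<in> BM"
   using borel_shear[OF r(1), of c] borel_shear[OF mf, of c] by (simp add: g_def cpb)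
  show "integrable LL (%(t, y). indicator {a..b} t * g t y)"
  proof -
   have e: "(%(t, y). indicator {a..b} t * g t y) = (%z. -2 * (%(t, y). indicator {a..b} t * (r t (y + c * t) * f t (y + c * t))) z)"
   by (auto simp: g_def fun_eq_iff)
   show ?thesis unfolding e by (rule integrable_mult_right[OF I])
  qed
 qed
 have "(LINT y|lborel. w t y) = (LINT x|lborel. (r t x)^2)" for t unfolding w_def by (rule LINT_shift)
 moreover have "(LINT y|lborel. g t y) = -2 * (LINT x|lborel. r t x * f t x)" for t
  unfolding g_def using LINT_shift[of "%x. r t x * f t x" "c * t"] by simp
 ultimately show ?thesis using L by simp
qed

text \<open>The quarters of the two squares lose the integral of \<open>f * (p + q) / 2\<close>,
  which is \<open>f * ps\<close>, exactly the gain of the potential term.\<close>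

lemma en_const: "a <= b ==> en b = en a"
proof -
 assume ab: "a <= b"
 have Ipf: "integrable lborel (%x. p t x * f t x)" and Iqf: "integrable lborel (%x. q t x * f t x)" for t
  by (rule product_integrable(2)[OF mp nK(1) mf nK(4,5)] product_integrable(2)[OF mq nK(2) mf nK(4,5)])+
 have Jp: "integrable lborel (%t. indicator {a..b} t * (LINT x|lborel. p t x * f t x))"
  and Jq: "integrable lborel (%t. indicator {a..b} t * (LINT x|lborel. q t x * f t x))"
  using lborel_pair.integrable_fst[OF product_integrable(1)[OF mp nK(1) mf nK(4,5), of a b]]
   lborel_pair.integrable_fst[OF product_integrable(1)[OF mq nK(2) mf nK(4,5), of a b]] by simp_all
 have R: "(LINT x|lborel. potM (ph b x)) - (LINT x|lborel. potM (ph a x)) = (LINT t|lborel. indicator {a..b} t * (LINT x|lborel. f t x * ps t x))"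
 proof (rule balance[OF _ potM_int potM_int _ _ _ ab])
  show "(%x. potM (ph t x)) \<in> BM" for t by (intro bmc continuous_intros slice[OF cph])
  show "AC (%t. potM (ph t y)) (%t. f t y * ps t y)" for y
   unfolding f_def by (rule AC_chain[OF ph_AC_t DERIV_potM]) (intro continuous_intros)
  show "(%(t, y). f t y * ps t y) \<in> BM" using mf mps by (simp add: cpb)
  show "integrable LL (%(t, y). indicator {a..b} t * (f t y * ps t y))"
   by (rule product_integrable(1)[OF mf nK(4) mps nK(3,5)])
 qed
 have "(LINT x|lborel. f t x * ps t x) = (LINT x|lborel. (p t x * f t x + q t x * f t x) / 2)" for t
  by (rule arg_cong[of _ _ "integral\<^sup>L lborel"]) (auto simp: ps_def algebra_simps add_divide_distrib)
 hence e: "(LINT x|lborel. f t x * ps t x) = ((LINT x|lborel. p t x * f t x) + (LINT x|lborel. q t x * f t x)) / 2" for t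
  using Ipf[of t] Iqf[of t] by simp
 have "(LINT t|lborel. indicator {a..b} t * (LINT x|lborel. f t x * ps t x))
   = (LINT t|lborel. (indicator {a..b} t * (LINT x|lborel. p t x * f t x) + indicator {a..b} t * (LINT x|lborel. q t x * f t x)) / 2)"
  unfolding e by (simp add: algebra_simps)
 also have "... = ((LINT t|lborel. indicator {a..b} t * (LINT x|lborel. p t x * f t x)) + (LINT t|lborel. indicator {a..b} t * (LINT x|lborel. q t x * f t x))) / 2"
  using Jp Jq by simp
 finally have e2: "(LINT t|lborel. indicator {a..b} t * (LINT x|lborel. f t x * ps t x)) = ..." .
 have two: "(LINT t|lborel. indicator {a..b} t * (-2 * h t)) = -2 * (LINT t|lborel. indicator {a..b} t * h t)" for h :: "real => real"
  by (simp add: mult.left_commute)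
 show ?thesis
  using char_balance[OF mp nK(1) p_AC sq(1) ab] char_balance[OF mq nK(2) q_AC sq(2) ab] R
  unfolding e2 two en_def by (simp add: field_simps)
qed

lemma LINT_lborel_integral: "w \<in> BM ==> integrable lborel w ==> (LINT x|lborel. w x) = intR w" for w :: "real => real"
 using integral_lborel[of w] by simp

text \<open>The truncated energy is conserved, and at time 0 it is below the true one because
  \<open>potM <= pot\<close>.\<close>

lemma energy_le: "intR (%x. (phx t x)^2 / 2 + potM (ph t x)) <= intR (%x. ((phx 0 x)^2 + (ps 0 x)^2) / 2 + pot (ph 0 x))"
proof -
 have en0: "en t = en 0" using en_const[of 0 t] en_const[of t 0] by (cases "0 <= t") auto
 have i: "integrable lborel (%x. (p t x)^2)" "integrable lborel (%x. (q t x)^2)" "integrable lborel (%x. (ps t x)^2)" for t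
  using square_integrable borel_slice mp mq mps sq by blast+
 have "en t = (LINT x|lborel. (p t x)^2 / 4 + (q t x)^2 / 4 + potM (ph t x))" for t
  using i potM_int by (simp add: en_def)
 moreover have "(p t x)^2 / 4 + (q t x)^2 / 4 + potM (ph t x) = ((phx t x)^2 / 2 + potM (ph t x)) + (ps t x)^2 / 2" for t x
  by (simp add: ps_def phx_def power2_eq_square field_simps)
 ultimately have en: "en t = (LINT x|lborel. ((phx t x)^2 / 2 + potM (ph t x)) + (ps t x)^2 / 2)" for t by simp
 have i2: "integrable lborel (%x. ((phx t x)^2 / 2 + potM (ph t x)) + (ps t x)^2 / 2)" for t
  using edM_int_t[of t] i(3)[of t] by simp
 have "intR (%x. (phx t x)^2 / 2 + potM (ph t x)) = (LINT x|lborel. (phx t x)^2 / 2 + potM (ph t x))"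
  using edM_int_t[of t] by (intro LINT_lborel_integral[symmetric]) auto
 also have "... <= en t" unfolding en by (rule integral_mono[OF edM_int_t i2]) simp
 also have "... = en 0" by (rule en0)
 also have "... = intR (%x. ((phx 0 x)^2 / 2 + potM (ph 0 x)) + (ps 0 x)^2 / 2)"
  unfolding en using i2 by (intro LINT_lborel_integral) auto
 also have "... <= intR (%x. ((phx 0 x)^2 + (ps 0 x)^2) / 2 + pot (ph 0 x))"
 proof (rule integral_le)
  show "(%x. ((phx 0 x)^2 / 2 + potM (ph 0 x)) + (ps 0 x)^2 / 2) integrable_on UNIV"
   using i2[of 0] integrable_on_lborel by blast
  have "(%x. edens (ph 0) (phx 0) x + (ps 0 x)^2 / 2) integrable_on UNIV"
   using abs_int_imp[OF S_edens_int[OF ph_H[of 0]]] sqint_int[OF sq(3)[of 0]] by (intro integrable_add integrable_on_divide)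
  thus "(%x. ((phx 0 x)^2 + (ps 0 x)^2) / 2 + pot (ph 0 x)) integrable_on UNIV"
   by (rule back_subst[of "%g. g integrable_on UNIV"]) (auto simp: edens_def add_divide_distrib)
  show "((phx 0 x)^2 / 2 + potM (ph 0 x)) + (ps 0 x)^2 / 2 <= ((phx 0 x)^2 + (ps 0 x)^2) / 2 + pot (ph 0 x)" for x
   using potM(2)[of "ph 0 x"] by (simp add: add_divide_distrib)
 qed
 finally show ?thesis .
qed

text \<open>Below the threshold \<open>2 * sqrt 2\<close> of \<open>energy_bound\<close> the
  solution stays in [-2, 2], where the truncated and the true potential agree.\<close>

lemma small_energy:
 assumes E: "intR (%x. ((phx 0 x)^2 + (ps 0 x)^2) / 2 + pot (ph 0 x)) <= e" and e: "e < 2 * sqrt 2"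
 shows "abs (ph t x) <= 2" "intR (edens (ph t) (phx t)) <= e"
proof -
 have *: "intR (%x. (phx t x)^2 / 2 + potM (ph t x)) <= e" using energy_le[of t] E by linarith
 show b: "abs (ph t x) <= 2" for x using energy_bound[OF ph_H[of t]] * e by simp
 show "intR (edens (ph t) (phx t)) <= e" using * by (simp add: edens_def[abs_def] potM(1)[OF b])
qed

end

section \<open>Test functions moving along characteristics\<close>

lemma dir_deriv_eq: "(h has_derivative D) (at z) ==> dir_deriv b h z = D b"
 by (simp add: dir_deriv_def frechet_derivative_at[symmetric])

lemma C_diff_lin:
 fixes g h :: "'a::euclidean_space => real"
 shows "C_diff k g ==> C_diff k h ==> C_diff k (%z. g z + c * h z)"
proof (induction k arbitrary: g h)
 case 0
 thus ?case by (auto intro!: continuous_intros)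
next
 case (Suc k)
 have D: "(g has_derivative frechet_derivative g (at z)) (at z)" "(h has_derivative frechet_derivative h (at z)) (at z)" for z
  using Suc.prems unfolding C_diff.simps differentiable_on_def frechet_derivative_works by blast+
 have e: "((%z. g z + c * h z) has_derivative (%b. frechet_derivative g (at z) b + c * frechet_derivative h (at z) b)) (at z)" for z
  by (intro derivative_intros D)
 have "dir_deriv b (%z. g z + c * h z) = (%z. dir_deriv b g z + c * dir_deriv b h z)" for b
  using dir_deriv_eq[OF e] by (auto simp: dir_deriv_def)
 moreover have "(%z. g z + c * h z) differentiable_on UNIV"
  unfolding differentiable_on_def differentiable_def using e by blast
 ultimately show ?case using Suc unfolding C_diff.simps by simp
qed

text \<open>Derivatives of such a product in \<open>t\<close> and \<open>x + c * t\<close> are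
  combinations of functions of the same form, which drives the induction for
  \<open>mv_C_diff\<close>.\<close>

definition mv :: "real => (real => real) => (real => real) => real \<times> real => real" where
 "mv c th ze z = th (fst z) * ze (snd z + c * fst z)"

lemma mv_deriv:
 assumes "smooth th" "smooth ze"
 shows "(mv c th ze has_derivative (%(h, k). h * (mv c (deriv th) ze z + c * mv c th (deriv ze) z) + k * mv c th (deriv ze) z)) (at z)"
proof -
 have 1: "((%z. th (fst z)) has_derivative (%y. fst y * deriv th (fst z))) (at z)"
  using has_derivative_compose[OF has_derivative_fst[OF has_derivative_ident] smooth_deriv(1)[OF assms(1), unfolded has_field_derivative_def]]
  by (simp add: mult.commute)
 have 2: "((%z. ze (snd z + c * fst z)) has_derivative (%y. (snd y + c * fst y) * deriv ze (snd z + c * fst z))) (at z)"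
 proof -
  have "((%z. snd z + c * fst z) has_derivative (%y. snd y + c * fst y)) (at z)" by (auto intro!: derivative_eq_intros)
  from has_derivative_compose[OF this smooth_deriv(1)[OF assms(2), unfolded has_field_derivative_def]] show ?thesis by (simp add: mult.commute)
 qed
 show ?thesis unfolding mv_def[abs_def]
  by (rule has_derivative_eq_rhs[OF has_derivative_mult[OF 1 2]]) (auto simp: algebra_simps)
qed

lemma dir_mv:
 assumes "smooth th" "smooth ze"
 shows "dir_deriv (1, 0) (mv c th ze) = (%z. mv c (deriv th) ze z + c * mv c th (deriv ze) z)" "dir_deriv (0, 1) (mv c th ze) = mv c th (deriv ze)"
 using dir_deriv_eq[OF mv_deriv[OF assms]] by auto

lemma mv_C_diff: "smooth th ==> smooth ze ==> C_diff k (mv c th ze)"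
proof (induction k arbitrary: th ze)
 case 0
 have "cont (%z. th (fst z) * ze (snd z + c * fst z))"
  by (intro continuous_intros continuous_on_compose2[OF smooth_continuous[OF 0(1)]] continuous_on_compose2[OF smooth_continuous[OF 0(2)]]) auto
 thus ?case by (simp add: mv_def[abs_def])
next
 case (Suc k)
 have "b = (1, 0) \<or> b = (0, 1)" if "b \<in> Basis" for b :: "real \<times> real" using that by (auto simp: Basis_prod_def)
 moreover have "mv c th ze differentiable_on UNIV"
  using mv_deriv[OF Suc.prems] unfolding differentiable_on_def differentiable_def by auto
 moreover have "C_diff k (dir_deriv (1, 0) (mv c th ze))" "C_diff k (dir_deriv (0, 1) (mv c th ze))"
  unfolding dir_mv[OF Suc.prems] by (intro C_diff_lin Suc.IH smooth_deriv(2) Suc.prems)+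
 ultimately show ?case unfolding C_diff.simps by blast
qed

lemma mv_test:
 assumes "test_fun th" "test_fun ze"
 shows "test_fun (mv c th ze)"
 unfolding test_fun_def
proof (intro conjI allI)
 show "C_diff k (mv c th ze)" for k by (intro mv_C_diff test_fun_smooth assms)
 obtain R where R: "R > 0" "!!x. norm x >= R ==> th x = 0" using test_fun_support[OF assms(1)] by blast
 obtain S where S: "S > 0" "!!x. norm x >= S ==> ze x = 0" using test_fun_support[OF assms(2)] by blast
 have sub: "{z. mv c th ze z ~= 0} \<subseteq> cball 0 (R + (S + abs c * R))"
 proof
  fix z assume "z \<in> {z. mv c th ze z ~= 0}"
  hence z: "abs (fst z) < R" "abs (snd z + c * fst z) < S" using R(2)[of "fst z"] S(2)[of "snd z + c * fst z"] by (auto simp: mv_def not_le[symmetric])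
  have "abs (c * fst z) <= abs c * R" using z(1) unfolding abs_mult by (intro mult_left_mono) auto
  hence "abs (snd z) <= S + abs c * R" using z(2) by linarith
  moreover have "norm z <= abs (fst z) + abs (snd z)" using norm_Pair_le[of "fst z" "snd z"] by simp
  ultimately show "z \<in> cball 0 (R + (S + abs c * R))" using z(1) by simp
 qed
 hence "closure {z. mv c th ze z ~= 0} \<subseteq> cball 0 (R + (S + abs c * R))" by (intro closure_minimal) auto
 thus "compact (closure {z. mv c th ze z ~= 0})" using bounded_subset[OF bounded_cball] by (simp add: compact_eq_bounded_closed)
qed

lemma test_bounds:
 assumes "test_fun (ze::real => real)"
 obtains Z where "Z > 0" "!!x. abs (ze x) <= Z" "!!x y. abs (ze x - ze y) <= Z * abs (x - y)"
proof -
 have bd: "\<exists>Z>0. ALL x. abs (et x) <= Z" if tf: "test_fun et" for et :: "real => real"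
 proof -
  obtain R where R: "R > 0" "!!x. norm x >= R ==> et x = 0" using test_fun_support[OF tf] by blast
  have "bounded (et ` {-R..R})" by (intro compact_imp_bounded compact_continuous_image smooth_continuous[OF test_fun_smooth[OF tf]]) auto
  then obtain M where M: "M > 0" "!!z. z \<in> et ` {-R..R} ==> norm z <= M" by (meson bounded_pos)
  have "abs (et x) <= M" for x using M R(2)[of x] by (cases "x \<in> {-R..R}") auto
  thus ?thesis using M by blast
 qed
 obtain Z1 where 1: "Z1 > 0" "!!x. abs (ze x) <= Z1" using bd[OF assms] by blast
 obtain Z2 where 2: "Z2 > 0" "!!x. abs (deriv ze x) <= Z2" using bd[OF test_fun_deriv[OF assms]] by blast
 have L: "norm (ze x - ze y) <= Z2 * norm (x - y)" for x y
  by (rule field_differentiable_bound[where S = UNIV and f' = "deriv ze"]) (use 2 smooth_deriv(1)[OF test_fun_smooth[OF assms]] in auto)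
 show ?thesis
 proof (rule that[of "max Z1 Z2"])
  show "abs (ze x - ze y) <= max Z1 Z2 * abs (x - y)" for x y
   using L[of x y] mult_right_mono[of Z2 "max Z1 Z2" "abs (x - y)"] by simp
 qed (use 1 in \<open>auto simp: le_max_iff_disj\<close>)
qed

section \<open>Pairings with moving test functions\<close>

definition pr :: "(real => real => real) => (real => real) => real => real => real" where
 "pr v ze c t = (LINT x|LB. v t x * ze (x + c * t))"

text \<open>Continuity in time with values in the locally integrable functions: the property shared
  by \<open>U\<close>, its time derivative and \<open>dpot U\<close> that makes their pairings
  continuous.\<close>

definition lc :: "(real => real => real) => bool" where
 "lc v \<longleftrightarrow> (ALL t. loc_integrable (v t)) &
  (ALL R t. ((%s. integral {-R..R} (%x. abs (v s x - v t x))) ~~> 0) (at t))"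

lemma test_shift: "test_fun ze ==> test_fun (%x. ze (x + h))" for ze :: "real => real"
 using test_fun_affine[of ze 1 1 h] by simp

lemma pr_continuous:
 assumes v: "lc v" and ze: "test_fun ze"
 shows "cont (pr v ze c)"
proof (intro continuous_at_imp_continuous_on ballI)
 fix t :: real
 obtain Z where Z: "Z > 0" "!!x. abs (ze x) <= Z" "!!x y. abs (ze x - ze y) <= Z * abs (x - y)" using test_bounds[OF ze] by blast
 obtain S where S: "S > 0" "!!x. norm x >= S ==> ze x = 0" using test_fun_support[OF ze] by blast
 define R where "R = S + abs c * (abs t + 1)"
 have l: "loc_integrable (v s)" for s using v by (simp add: lc_def)
 have z: "ze (x + c * s) = 0" if "abs (s - t) <= 1" "abs x >= R" for s x
 proof -
  have "abs (c * s) <= abs c * (abs t + 1)" using that(1) unfolding abs_mult by (intro mult_left_mono) auto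
  thus ?thesis using that(2) S(2)[of "x + c * s"] by (auto simp: R_def)
 qed
 define I where "I = integral {-R..R} (%x. abs (v t x))"
 have main: "abs (pr v ze c s - pr v ze c t) <= Z * integral {-R..R} (%x. abs (v s x - v t x)) + Z * abs (c * s - c * t) * I" if s: "abs (s - t) <= 1" for s
 proof -
  have cze: "cont (%x. ze (x + c * r))" for r
   by (intro smooth_continuous test_fun_smooth test_shift ze)
  have pr: "pr v ze c r = integral {-R..R} (%x. v r x * ze (x + c * r))" "(%x. v r x * ze (x + c * r)) integrable_on {-R..R}"
   if "abs (r - t) <= 1" for r
   using test_mult_integrable(2,3)[OF l cze, of R r r] z[OF that] abs_int_imp by (auto simp: pr_def)
  have 0: "abs (t - t) <= 1" by simp
  have i: "(%x. abs (v s x - v t x)) integrable_on {-R..R}" "(%x. abs (v t x)) integrable_on {-R..R}"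
   by (intro li_imp(1) li_abs li_diff l)+
  have "abs (pr v ze c s - pr v ze c t) = norm (integral {-R..R} (%x. v s x * ze (x + c * s) - v t x * ze (x + c * t)))"
   using pr[OF s] pr[OF 0] by (simp add: HK_diff)
  also have "... <= integral {-R..R} (%x. Z * abs (v s x - v t x) + Z * abs (c * s - c * t) * abs (v t x))"
  proof (rule integral_norm_bound_integral)
   show "(%x. v s x * ze (x + c * s) - v t x * ze (x + c * t)) integrable_on {-R..R}" using pr(2)[OF s] pr(2)[OF 0] by (rule integrable_diff)
   show "(%x. Z * abs (v s x - v t x) + Z * abs (c * s - c * t) * abs (v t x)) integrable_on {-R..R}" using i by (intro integrable_add integrable_on_mult_right)
   fix x
   have "v s x * ze (x + c * s) - v t x * ze (x + c * t) = (v s x - v t x) * ze (x + c * s) + v t x * (ze (x + c * s) - ze (x + c * t))"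
   by (simp add: algebra_simps)
   also have "abs ... <= abs (v s x - v t x) * Z + abs (v t x) * (Z * abs ((x + c * s) - (x + c * t)))"
   by (rule order_trans[OF abs_triangle_ineq], unfold abs_mult, intro add_mono mult_left_mono Z) auto
   finally show "norm (v s x * ze (x + c * s) - v t x * ze (x + c * t)) <= Z * abs (v s x - v t x) + Z * abs (c * s - c * t) * abs (v t x)"
   by (simp add: mult_ac)
  qed
  also have "... = Z * integral {-R..R} (%x. abs (v s x - v t x)) + Z * abs (c * s - c * t) * I"
   using i unfolding I_def by (subst HK_add) (auto intro: integrable_on_mult_right)
  finally show ?thesis .
 qed
 have "((%s. Z * integral {-R..R} (%x. abs (v s x - v t x)) + Z * abs (c * s - c * t) * I) ~~> Z * 0 + Z * abs (c * t - c * t) * I) (at t)"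
  using v unfolding lc_def by (intro tendsto_intros) auto
 hence lim: "((%s. Z * integral {-R..R} (%x. abs (v s x - v t x)) + Z * abs (c * s - c * t) * I) ~~> 0) (at t)" by simp
 have "\<forall>\<^sub>F s in at t. abs (s - t) <= 1" unfolding eventually_at by (rule exI[of _ 1]) (auto simp: dist_real_def)
 hence "\<forall>\<^sub>F s in at t. norm (pr v ze c s - pr v ze c t) <= Z * integral {-R..R} (%x. abs (v s x - v t x)) + Z * abs (c * s - c * t) * I"
  by eventually_elim (use main in simp)
 from Lim_null_comparison[OF this lim] have "((%s. pr v ze c s - pr v ze c t) ~~> 0) (at t)" .
 thus "isCont (pr v ze c) t" by (simp add: isCont_def LIM_zero_iff)
qed

section \<open>Uniqueness\<close>

lemma L2_loc: "w \<in> L2 ==> loc_integrable w"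
 unfolding loc_integrable_def
proof (intro allI)
 fix a b :: real assume "w \<in> L2"
 hence s: "sqint {a..b} w" using sqint_subset[of UNIV w "{a..b}"] by (auto simp: L2_iff)
 have "sqint {a..b} (%_. 1)" by (auto simp: sqint_def intro!: absolutely_integrable_continuous_real)
 from sqint_mult[OF s this] show "w abs_int_on {a..b}" by simp
qed

lemma weak_cont_AC: "has_weak_deriv P F ==> cont P ==> AC P F"
 using weak_imp_AC[of P F] continuous_AE_eq[of P] AC_cont by metis

locale esol =
 fixes U ps :: "real => real => real"
 assumes cU: "cont (U t)" and bU: "EX M. ALL x. abs (U t x) <= M"
  and lU: "EX N. (N ~~> 0) (at t) & (ALL s x. abs (U s x - U t x) <= N s)"
  and ps: "ps t \<in> L2" "((%s. L2_norm (%x. ps s x - ps t x)) ~~> 0) (at t)"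
  and td: "distr_time_deriv U ps" and ds: "distr_solution U"
begin

lemma near: "\<exists>d>0. EX M. ALL s x. abs (s - t) < d --> abs (U s x) <= M"
proof -
 obtain M where M: "!!x. abs (U t x) <= M" using bU by blast
 obtain N where N: "(N ~~> 0) (at t)" "!!s x. abs (U s x - U t x) <= N s" using lU by blast
 have "\<forall>\<^sub>F s in at t. N s < 1" using order_tendstoD(2)[OF N(1)] by simp
 then obtain d where d: "d > 0" "!!s. s ~= t ==> abs (s - t) < d ==> N s < 1" unfolding eventually_at by (auto simp: dist_real_def)
 have "abs (U s x) <= M + 1" if "abs (s - t) < d" for s x
  using d(2)[of s] N(2)[of s x] M[of x] that by (cases "s = t") (auto simp: abs_le_iff)
 thus ?thesis using d(1) by blast
qed

lemma bound: "EX M. \<forall>s\<in>{-T..T}. ALL x. abs (U s x) <= M"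
proof (cases "-T <= T")
 case True
 thus ?thesis
 proof (induction rule: Bolzano)
  case (trans a b c)
  then obtain M M' where "\<forall>s\<in>{a..b}. ALL x. abs (U s x) <= M" "\<forall>s\<in>{b..c}. ALL x. abs (U s x) <= M'" by blast
  hence "\<forall>s\<in>{a..c}. ALL x. abs (U s x) <= max M M'" by (metis atLeastAtMost_iff le_max_iff_disj linear)
  thus ?case by blast
 next
  case (local t)
  obtain d M where d: "d > 0" "!!s x. abs (s - t) < d ==> abs (U s x) <= M" using near by blast
  show ?case
  proof (rule exI[of _ d], intro conjI allI impI d(1))
   fix a b assume "a <= t & t <= b & b - a < d"
   thus "EX M. \<forall>s\<in>{a..b}. ALL x. abs (U s x) <= M" by (intro exI[of _ M] ballI allI d(2)) auto
  qed
 qed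
qed auto

lemma lc_sup:
 assumes c: "!!t. cont (v t)" and N: "!!t. EX N. (N ~~> 0) (at t) & (\<forall>\<^sub>F s in at t. ALL x. abs (v s x - v t x) <= N s)"
 shows "lc v"
 unfolding lc_def
proof (intro conjI allI)
 show "loc_integrable (v t)" for t by (rule li_cont[OF c])
 fix R t :: real
 obtain N where N: "(N ~~> 0) (at t)" "\<forall>\<^sub>F s in at t. ALL x. abs (v s x - v t x) <= N s" using N by blast
 have i: "(%x. abs (v s x - v t x)) integrable_on {-R..R}" for s
  by (intro li_imp(1) li_abs li_diff li_cont c)
 have "\<forall>\<^sub>F s in at t. norm (integral {-R..R} (%x. abs (v s x - v t x))) <= (2 * abs R) * N s"
  using N(2)
 proof eventually_elim
  case (elim s)
  have "norm (integral {-R..R} (%x. abs (v s x - v t x))) <= integral {-R..R} (%x. N s)"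
   by (rule integral_norm_bound_integral[OF i]) (use elim in auto)
  also have "... <= (2 * abs R) * N s"
  proof -
   have "0 <= N s" using elim[rule_format, of 0] by (rule order_trans[OF abs_ge_zero])
   thus ?thesis by (cases "R >= 0") (auto simp: mult_nonpos_nonneg)
  qed
  finally show ?case .
 qed
 moreover have "((%s. (2 * abs R) * N s) ~~> 0) (at t)" using tendsto_mult_left[OF N(1), of "2 * abs R"] by simp
 ultimately show "((%s. integral {-R..R} (%x. abs (v s x - v t x))) ~~> 0) (at t)" by (rule Lim_null_comparison)
qed

lemma lc_U: "lc U"
proof (rule lc_sup[OF cU])
 fix t
 obtain N where N: "(N ~~> 0) (at t)" "!!s x. abs (U s x - U t x) <= N s" using lU by blast
 show "EX N. (N ~~> 0) (at t) & (\<forall>\<^sub>F s in at t. ALL x. abs (U s x - U t x) <= N s)"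
  by (rule exI[of _ N]) (use N in \<open>auto intro: always_eventually\<close>)
qed

lemma lc_dpot: "lc (%t x. dpot (U t x))"
proof (rule lc_sup)
 show "cont (%x. dpot (U t x))" for t by (intro continuous_intros cU)
 fix t
 obtain d M where d: "d > 0" "!!s x. abs (s - t) < d ==> abs (U s x) <= M" using near by blast
 obtain N where N: "(N ~~> 0) (at t)" "!!s x. abs (U s x - U t x) <= N s" using lU by blast
 let ?L = "2 + 24 * M^2 + 30 * M ^ 4"
 show "EX N. (N ~~> 0) (at t) & (\<forall>\<^sub>F s in at t. ALL x. abs (dpot (U s x) - dpot (U t x)) <= N s)"
 proof (intro exI[of _ "%s. ?L * N s"] conjI)
  show "((%s. ?L * N s) ~~> 0) (at t)" using tendsto_mult_left[OF N(1), of ?L] by simp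
  have "abs (dpot (U s x) - dpot (U t x)) <= ?L * N s" if "abs (s - t) < d" for s x
   using dpot_lipschitz[OF d(2)[OF that, of x] d(2)[of t x]] d(1) mult_left_mono[OF N(2)[of s x], of ?L] by simp
  thus "\<forall>\<^sub>F s in at t. ALL x. abs (dpot (U s x) - dpot (U t x)) <= ?L * N s"
   unfolding eventually_at by (intro exI[of _ d]) (use d(1) in \<open>auto simp: dist_real_def\<close>)
 qed
qed

lemma lc_ps: "lc ps"
 unfolding lc_def
proof (intro conjI allI)
 show "loc_integrable (ps t)" for t by (rule L2_loc[OF ps(1)])
 fix R t :: real
 have s: "sqint UNIV (%x. ps s x - ps t x)" for s using ps(1) by (auto simp: L2_iff intro: sqint_diff)
 have "norm (integral {-R..R} (%x. abs (ps s x - ps t x))) <= sqrt (2 * abs R) * L2_norm (%x. ps s x - ps t x)" for s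
 proof -
  have s1: "sqint {-R..R} (%_. 1)" by (auto simp: sqint_def intro!: absolutely_integrable_continuous_real)
  have s2: "sqint {-R..R} (%x. abs (ps s x - ps t x))" using sqint_subset[OF s, of "{-R..R}"] borel_measurable_abs[OF sqint_meas[OF s]] by (auto simp: sqint_def)
  have "(integral {-R..R} (%x. 1 * abs (ps s x - ps t x)))^2 <= integral {-R..R} (%x. 1^2) * integral {-R..R} (%x. abs (ps s x - ps t x)^2)"
   by (rule Cauchy_Schwarz_integral[OF s1 s2]) simp
  also have "... <= (2 * abs R) * intR (%x. (ps s x - ps t x)^2)"
   using sqint_int[OF s] sqint_int[OF s2] by (intro mult_mono) (auto intro!: integral_subset_le integral_nonneg)
  finally have "abs (integral {-R..R} (%x. abs (ps s x - ps t x))) <= sqrt ((2 * abs R) * intR (%x. (ps s x - ps t x)^2))"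
   by (simp add: real_le_rsqrt)
  thus ?thesis using L2_norm_eq[OF s] by (simp add: real_sqrt_mult)
 qed
 moreover have "((%s. sqrt (2 * abs R) * L2_norm (%x. ps s x - ps t x)) ~~> 0) (at t)" using tendsto_mult_left[OF ps(2), of "sqrt (2 * abs R)"] by simp
 ultimately show "((%s. integral {-R..R} (%x. abs (ps s x - ps t x))) ~~> 0) (at t)"
  by (rule Lim_null_comparison[OF always_eventually[OF allI]])
qed

lemma pr_mv: "(LINT x|LB. v t x * mv c th ze (t, x)) = th t * pr v ze c t"
proof -
 have "(LINT x|LB. v t x * mv c th ze (t, x)) = (LINT x|LB. th t * (v t x * ze (x + c * t)))" by (simp add: mv_def mult_ac)
 thus ?thesis by (simp add: pr_def)
qed

lemma pr_int: "lc v ==> test_fun ze ==> integrable LB (%x. v t x * mv c th ze (t, x))"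
proof -
 assume "lc v" "test_fun ze"
 hence "integrable LB (%x. v t x * ze (x + c * t))" by (intro test_fun_integrable test_shift) (auto simp: lc_def)
 from integrable_mult_right[OF this, of "th t"] show ?thesis by (simp add: mv_def mult_ac)
qed

lemma t_int: "lc v ==> test_fun ze ==> test_fun th ==> integrable LB (%t. th t * pr v ze c t)"
 using test_fun_integrable[OF li_cont[OF pr_continuous], of v ze th c] by (simp add: mult.commute)

lemma pairing_deriv: assumes ze: "test_fun ze" shows "AC (pr U ze 0) (pr ps ze 0)"
proof (rule weak_cont_AC)
 show "has_weak_deriv (pr U ze 0) (pr ps ze 0)"
  unfolding has_weak_deriv_def
 proof (intro conjI allI impI li_cont pr_continuous lc_U lc_ps ze)
  fix th :: "real => real" assume th: "test_fun th"
  have "(LINT t|LB. LINT x|LB. U t x * mv 0 (deriv th) ze (t, x)) = - (LINT t|LB. LINT x|LB. ps t x * mv 0 th ze (t, x))"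
   using td[unfolded distr_time_deriv_def, rule_format, OF mv_test[OF th ze, of 0]] by (simp add: dir_mv[OF test_fun_smooth[OF th] test_fun_smooth[OF ze]])
  thus "(LINT t|LB. pr U ze 0 t * deriv th t) = - (LINT t|LB. pr ps ze 0 t * th t)"
   unfolding pr_mv by (simp add: mult.commute)
 qed
qed (intro pr_continuous lc_U ze)

text \<open>Testing both distributional identities with \<open>th t * ze (x + c * t)\<close>, \<open>c^2 = 1\<close>, only one time
 derivative survives.\<close>

lemma char_deriv:
 assumes ze: "test_fun ze" and c: "c^2 = 1"
 shows "AC (%t. pr ps ze c t - c * pr U (deriv ze) c t) (%t. - pr (%t x. dpot (U t x)) ze c t)"
proof (rule weak_cont_AC)
 let ?F = "%t x. dpot (U t x)"
 have ze': "test_fun (deriv ze)" by (rule test_fun_deriv[OF ze])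
 show C: "cont (%t. pr ps ze c t - c * pr U (deriv ze) c t)" by (intro continuous_intros pr_continuous lc_U lc_ps ze ze')
 show "has_weak_deriv (%t. pr ps ze c t - c * pr U (deriv ze) c t) (%t. - pr ?F ze c t)"
  unfolding has_weak_deriv_def
 proof (intro conjI allI impI)
  show "loc_integrable (%t. pr ps ze c t - c * pr U (deriv ze) c t)" by (rule li_cont[OF C])
  show "loc_integrable (%t. - pr ?F ze c t)" by (intro li_cont continuous_intros pr_continuous lc_dpot ze)
  fix th :: "real => real" assume th: "test_fun th"
  have th': "test_fun (deriv th)" "test_fun (deriv (deriv th))" using test_fun_deriv th by blast+
  note s = test_fun_smooth[OF th] test_fun_smooth[OF th'(1)] test_fun_smooth[OF ze] test_fun_smooth[OF ze']
  have "(LINT t|LB. LINT x|LB. U t x * (mv c (deriv (deriv th)) ze (t, x) + c * mv c (deriv th) (deriv ze) (t, x)))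
   = - (LINT t|LB. LINT x|LB. ps t x * mv c (deriv th) ze (t, x))"
   using td[unfolded distr_time_deriv_def, rule_format, OF mv_test[OF th'(1) ze, of c]] unfolding dir_mv[OF s(2,3)] .
  moreover have "(LINT x|LB. U t x * (mv c (deriv (deriv th)) ze (t, x) + c * mv c (deriv th) (deriv ze) (t, x)))
   = deriv (deriv th) t * pr U ze c t + c * (deriv th t * pr U (deriv ze) c t)" for t
   using pr_int[OF lc_U ze] pr_int[OF lc_U ze'] by (simp add: distrib_left mult.left_commute[of _ c] pr_mv)
  ultimately have 1: "(LINT t|LB. deriv (deriv th) t * pr U ze c t + c * (deriv th t * pr U (deriv ze) c t)) = - (LINT t|LB. deriv th t * pr ps ze c t)"
   by (simp add: pr_mv)
  \<comment> \<open>The terms with \<open>th\<close> and the second derivative of \<open>ze\<close>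
    carry the factor \<open>1 - c^2\<close> and cancel.\<close>
  have dd: "dir_deriv (1, 0) (dir_deriv (1, 0) (mv c th ze)) z - dir_deriv (0, 1) (dir_deriv (0, 1) (mv c th ze)) z
   = mv c (deriv (deriv th)) ze z + 2 * c * mv c (deriv th) (deriv ze) z" for z
  proof -
   have "((%z. mv c (deriv th) ze z + c * mv c th (deriv ze) z) has_derivative
   (%h. (%(h, k). h * (mv c (deriv (deriv th)) ze z + c * mv c (deriv th) (deriv ze) z) + k * mv c (deriv th) (deriv ze) z) h
   + c * (%(h, k). h * (mv c (deriv th) (deriv ze) z + c * mv c th (deriv (deriv ze)) z) + k * mv c th (deriv (deriv ze)) z) h)) (at z)"
   by (intro has_derivative_add has_derivative_mult_right mv_deriv s)
   from dir_deriv_eq[OF this, of "(1, 0)"] show ?thesis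
   using c by (simp add: dir_mv s power2_eq_square algebra_simps flip: mult.assoc)
  qed
  have "(LINT t|LB. LINT x|LB. U t x * (mv c (deriv (deriv th)) ze (t, x) + 2 * c * mv c (deriv th) (deriv ze) (t, x)) + ?F t x * mv c th ze (t, x)) = 0"
   using ds[unfolded distr_solution_def, rule_format, OF mv_test[OF th ze, of c]] unfolding dd dpot_def .
  moreover have "(LINT x|LB. U t x * (mv c (deriv (deriv th)) ze (t, x) + 2 * c * mv c (deriv th) (deriv ze) (t, x)) + ?F t x * mv c th ze (t, x))
   = deriv (deriv th) t * pr U ze c t + 2 * c * (deriv th t * pr U (deriv ze) c t) + th t * pr ?F ze c t" for t
  proof -
   have "(LINT x|LB. U t x * (mv c (deriv (deriv th)) ze (t, x) + 2 * c * mv c (deriv th) (deriv ze) (t, x)) + ?F t x * mv c th ze (t, x))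
   = (LINT x|LB. U t x * mv c (deriv (deriv th)) ze (t, x) + (2 * c) * (U t x * mv c (deriv th) (deriv ze) (t, x)) + ?F t x * mv c th ze (t, x))"
   by (rule arg_cong[of _ _ "integral\<^sup>L LB"]) (auto simp: algebra_simps)
   also have "... = (LINT x|LB. U t x * mv c (deriv (deriv th)) ze (t, x)) + (2 * c) * (LINT x|LB. U t x * mv c (deriv th) (deriv ze) (t, x)) + (LINT x|LB. ?F t x * mv c th ze (t, x))"
   using pr_int[OF lc_U ze, of t c "deriv (deriv th)"] pr_int[OF lc_U ze', of t c "deriv th"] pr_int[OF lc_dpot ze, of t c th]
   by simp
   finally show ?thesis unfolding pr_mv pr_mv[of ?F] .
  qed
  ultimately have 2: "(LINT t|LB. deriv (deriv th) t * pr U ze c t + 2 * c * (deriv th t * pr U (deriv ze) c t) + th t * pr ?F ze c t) = 0" by simp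
  note i = t_int[OF lc_U ze th'(2), of c] t_int[OF lc_U ze' th'(1), of c] t_int[OF lc_dpot ze th, of c] t_int[OF lc_ps ze th'(1), of c]
  have 3: "(LINT t|LB. deriv (deriv th) t * pr U ze c t) + c * (LINT t|LB. deriv th t * pr U (deriv ze) c t) = - (LINT t|LB. deriv th t * pr ps ze c t)"
   using 1 i(1,2) by simp
  have 4: "(LINT t|LB. deriv (deriv th) t * pr U ze c t) + 2 * c * (LINT t|LB. deriv th t * pr U (deriv ze) c t) + (LINT t|LB. th t * pr ?F ze c t) = 0"
   using 2 i(1,2,3) by simp
  \<comment> \<open>Eliminating the term with the second derivative of \<open>th\<close> between
    \<open>3\<close> and \<open>4\<close> leaves a single weak derivative in time.\<close>
  have "(LINT t|LB. (pr ps ze c t - c * pr U (deriv ze) c t) * deriv th t) = (LINT t|LB. deriv th t * pr ps ze c t - c * (deriv th t * pr U (deriv ze) c t))"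
   by (rule arg_cong[of _ _ "integral\<^sup>L LB"]) (auto simp: algebra_simps)
  also have "... = (LINT t|LB. deriv th t * pr ps ze c t) - c * (LINT t|LB. deriv th t * pr U (deriv ze) c t)" using i by simp
  also have "... = (LINT t|LB. th t * pr ?F ze c t)" using 3 4 by (simp add: algebra_simps)
  finally show "(LINT t|LB. (pr ps ze c t - c * pr U (deriv ze) c t) * deriv th t) = - (LINT t|LB. - pr ?F ze c t * th t)"
   by (simp add: mult.commute)
 qed
qed

end

text \<open>Clipping the integration variable reduces a bound known only for
  \<open>abs s <= T\<close> to the global one.\<close>

lemma J_local_bound:
 assumes h: "cont h" "!!s. abs s <= T ==> abs (h s) <= M * exp (L * abs s)" and L: "L > 0" and t: "abs t <= T"
 shows "abs (J h t) <= M / L * exp (L * abs t)"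
proof -
 have T: "T >= 0" using t by simp
 have M: "M >= 0" using h(2)[of 0] T by auto
 have "mean (%s. h (clip T s)) 0 t = mean h 0 t" unfolding mean_def
 proof (rule integral_cong)
  fix sg :: real assume "sg \<in> {0..1}"
  hence "abs sg * abs t <= 1 * T" using t by (intro mult_mono) auto
  thus "h (clip T (0 + sg * (t - 0))) = h (0 + sg * (t - 0))" by (simp add: clip(2) abs_mult)
 qed
 hence "J h t = J (%s. h (clip T s)) t" by (simp add: J_def)
 also have "abs ... <= M / L * exp (L * abs t)"
 proof (rule J_exp_bound[OF _ _ L])
  show "cont (%s. h (clip T s))" by (rule continuous_on_compose2[OF h(1) clip(4)]) auto
  show "abs (h (clip T s)) <= M * exp (L * abs s)" for s
  proof -
   have "abs (h (clip T s)) <= M * exp (L * abs (clip T s))" by (rule h(2)[OF clip(1)[OF T]])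
   also have "... <= M * exp (L * abs s)" using clip(3)[OF T, of s] L M by (intro mult_left_mono) auto
   finally show ?thesis .
  qed
 qed
 finally show ?thesis .
qed

lemma pr_shift:
 assumes "test_fun ze"
 shows "pr v (%x. ze (x + - (c * t))) c t = pr v ze 0 t" "deriv (%x. ze (x + h)) = (%x. deriv ze (x + h))"
proof -
 show "pr v (%x. ze (x + - (c * t))) c t = pr v ze 0 t" by (simp add: pr_def)
 show "deriv (%x. ze (x + h)) = (%x. deriv ze (x + h))"
 proof
  fix x
  have "((%x. ze (x + h)) hrd deriv ze (x + h)) (at x)"
   using smooth_deriv(1)[OF test_fun_smooth[OF assms], of "x + h"] by (simp add: DERIV_shift)
  thus "deriv (%x. ze (x + h)) x = deriv ze (x + h)" by (rule DERIV_imp_deriv)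
 qed
qed

lemma abs_shift:
 fixes ze :: "real => real"
 assumes "test_fun ze"
 shows "(LINT x|LB. abs (ze (x + h))) = (LINT x|LB. abs (ze x))"
proof -
 have m: "(%x. abs (ze x)) \<in> BM"
  by (intro borel_measurable_abs bmc smooth_continuous[OF test_fun_smooth[OF assms]])
 have "(LINT x|LB. abs (ze (x + h))) = (LINT x|lborel. abs (ze (x + h)))" for h
  by (rule integral_completion) (use measurable_compose[OF _ m, of "%x. x + h" borel] in simp)
 from this[of h] this[of 0] show ?thesis using LINT_shift[of "%x. abs (ze x)" h] by simp
qed

text \<open>A bump around a point where the continuous \<open>w\<close> exceeds \<open>B\<close>;
  this is how sup bounds are read off from pairings.\<close>

lemma positive_pairing:
 fixes w :: "real => real"
 assumes w: "cont w" and x: "w x > B"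
 obtains ze where "test_fun ze" "(LINT x|LB. w x * ze x) > B * (LINT x|LB. abs (ze x))"
proof -
 have "isCont w x" using w by (simp add: continuous_on_eq_continuous_at)
 hence "\<forall>\<^sub>F y in at x. w y > B" using x order_tendstoD(1) by (auto simp: isCont_def)
 then obtain d where d: "d > 0" "!!y. y ~= x ==> abs (y - x) < d ==> w y > B"
  unfolding eventually_at dist_real_def by auto
 define ze where "ze = bump (x - d) (x + d) 1"
 have ze: "test_fun ze" "!!y. ze y >= 0" "!!y. y \<notin> {x - d<..<x + d} ==> ze y = 0" "ze x > 0"
  unfolding ze_def by (rule bump_props; use d(1) in simp)+
 have c: "cont ze" by (rule smooth_continuous[OF test_fun_smooth[OF ze(1)]])
 have i: "integrable LB (%y. w y * ze y)" "integrable LB (%y. 1 * ze y)"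
  by (rule test_fun_integrable[OF li_cont[OF w] ze(1)] test_fun_integrable[OF li_cont[OF continuous_on_const] ze(1)])+
 define k where "k y = w y * ze y - B * ze y" for y
 have k0: "k y >= 0" for y
 proof (cases "y \<in> {x - d<..<x + d}")
  case True
  hence "w y > B" using d(2)[of y] x by (cases "y = x") auto
  thus ?thesis using mult_right_mono[of B "w y" "ze y"] ze(2)[of y] by (simp add: k_def)
 qed (simp add: k_def ze(3))
 have ik: "integrable LB k" unfolding k_def[abs_def] using i by simp
 have "(LINT y|LB. k y) > 0"
 proof (rule ccontr)
  assume "\<not> ?thesis"
  hence "(LINT y|LB. k y) = 0" using integral_nonneg_AE[of k LB] k0 by (simp add: antisym)
  hence "AE y in LB. k y = 0" using integral_nonneg_eq_0_iff_AE[OF ik] k0 by simp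
  hence "k = (%_. 0)"
  proof (rule continuous_AE_eq)
   show "cont k" unfolding k_def[abs_def] by (intro continuous_intros w c)
  qed simp
  hence "k x = 0" by simp
  thus False using x ze(4) by (simp add: k_def)
 qed
 moreover have "(LINT y|LB. k y) = (LINT y|LB. w y * ze y) - B * (LINT y|LB. ze y)"
  unfolding k_def using i by simp
 ultimately show ?thesis using that[OF ze(1)] ze(2) by simp
qed

text \<open>Gronwall as a contraction: a bound \<open>A * exp (L * abs s)\<close> for the difference
  improves to half of it, since two time integrations gain \<open>1 / L^2\<close> and
  \<open>L^2\<close> is twice the Lipschitz constant \<open>l\<close>. Space derivatives fall on the
  test function only.\<close>

theorem esol_unique:
 assumes s1: "esol U ps" and s2: "esol U' ps'" and U0: "U 0 = U' 0" and ps0: "AE x in LB. ps 0 x = ps' 0 x"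
 shows "U t = U' t" "AE x in LB. ps t x = ps' t x"
proof -
 interpret s1: esol U ps by (rule s1)
 interpret s2: esol U' ps' by (rule s2)
 let ?F = "%t x. dpot (U t x)" and ?F' = "%t x. dpot (U' t x)"
 have pr0: "pr ps ze c 0 = pr ps' ze c 0" "pr U ze c 0 = pr U' ze c 0" if ze: "test_fun ze" for ze c
 proof -
  have "integrable LB (%x. ps 0 x * ze (x + c * 0))" "integrable LB (%x. ps' 0 x * ze (x + c * 0))"
   using s1.lc_ps s2.lc_ps by (auto intro!: test_fun_integrable test_shift ze simp: lc_def simp del: mult_zero_right)
  thus "pr ps ze c 0 = pr ps' ze c 0" unfolding pr_def using ps0 by (intro integral_cong_AE) auto
  show "pr U ze c 0 = pr U' ze c 0" by (simp add: pr_def U0)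
 qed
 have W: "AC (%t. pr U ze 0 t - pr U' ze 0 t) (%t. pr ps ze 0 t - pr ps' ze 0 t)"
   "cont (%t. pr ps ze 0 t - pr ps' ze 0 t)" if ze: "test_fun ze" for ze
  by (intro AC_diff s1.pairing_deriv s2.pairing_deriv continuous_intros pr_continuous s1.lc_ps s2.lc_ps ze)+
 have eqU: "U t = U' t" for t
 proof -
  define T where "T = abs t"
  obtain M1 where M1: "!!s x. s \<in> {-T..T} ==> abs (U s x) <= M1" using s1.bound by blast
  obtain M2 where M2: "!!s x. s \<in> {-T..T} ==> abs (U' s x) <= M2" using s2.bound by blast
  define M where "M = max M1 M2"
  have M: "abs (U s x) <= M" "abs (U' s x) <= M" if "abs s <= T" for s x
   using M1[of s x] M2[of s x] that by (auto simp: M_def abs_le_iff)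
  define l where "l = 2 + 24 * M^2 + 30 * M ^ 4"
  define L where "L = sqrt (2 * l)"
  have l: "l > 0" by (simp add: l_def add_pos_nonneg)
  have L: "L > 0" "L * L = 2 * l" using l by (auto simp: L_def)
  have step: "abs (U s x - U' s x) <= A / 2 * exp (L * abs s)"
   if A: "!!s x. abs s <= T ==> abs (U s x - U' s x) <= A * exp (L * abs s)" and s: "abs s <= T" for A s x
  proof -
   have A0: "A >= 0" using order_trans[OF abs_ge_zero A[of 0]] by (simp add: T_def)
   define n1 where "n1 ze = (LINT x|LB. abs (ze x))" for ze :: "real => real"
   have Fb: "abs (pr ?F ze c s - pr ?F' ze c s) <= l * A * n1 ze * exp (L * abs s)" if ze: "test_fun ze" and s: "abs s <= T" for ze c s
   proof -
   have i: "integrable LB (%x. ?F s x * ze (x + c * s))" "integrable LB (%x. ?F' s x * ze (x + c * s))" "integrable LB (%x. 1 * ze (x + c * s))"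
   using test_fun_integrable[OF li_cont[OF continuous_dpot[OF s1.cU]] test_shift[OF ze], of s "c * s"]
   test_fun_integrable[OF li_cont[OF continuous_dpot[OF s2.cU]] test_shift[OF ze], of s "c * s"]
   test_fun_integrable[OF li_cont[OF continuous_on_const] test_shift[OF ze], of 1 "c * s"] by this
   have n1: "n1 ze = (LINT x|LB. abs (ze (x + c * s)))" unfolding n1_def by (rule abs_shift[OF ze, symmetric])
   define X where "X x = ?F s x * ze (x + c * s) - ?F' s x * ze (x + c * s)" for x
   have e: "pr ?F ze c s - pr ?F' ze c s = (LINT x|LB. X x)"
   unfolding pr_def X_def by (rule L_diff[OF i(1,2), symmetric])
   have iX: "integrable LB X" unfolding X_def[abs_def] by (intro L_int_diff i)
   have "abs (LINT x|LB. X x) <= (LINT x|LB. abs (X x))" by (rule integral_abs_bound)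
   also have "... <= (LINT x|LB. (l * (A * exp (L * abs s))) * abs (ze (x + c * s)))"
   proof (rule integral_mono)
   show "integrable LB (%x. abs (X x))" by (rule integrable_abs[OF iX])
   show "integrable LB (%x. (l * (A * exp (L * abs s))) * abs (ze (x + c * s)))" using integrable_abs[OF i(3)] by (intro integrable_mult_right) (simp only: mult_1)
   fix x
   have "abs (?F s x - ?F' s x) <= l * abs (U s x - U' s x)" unfolding l_def by (rule dpot_lipschitz[OF M[OF s]])
   also have "... <= l * (A * exp (L * abs s))" using A[OF s] l by (intro mult_left_mono) auto
   finally show "abs (X x) <= (l * (A * exp (L * abs s))) * abs (ze (x + c * s))"
   unfolding X_def left_diff_distrib[symmetric] abs_mult by (rule mult_right_mono) simp
   qed
   also have "... = l * A * n1 ze * exp (L * abs s)" unfolding n1 by simp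
   finally show ?thesis unfolding e .
   qed
   have Pb: "abs ((pr ps ze c s - c * pr U (deriv ze) c s) - (pr ps' ze c s - c * pr U' (deriv ze) c s)) <= l * A * n1 ze / L * exp (L * abs s)"
   if ze: "test_fun ze" and c: "c^2 = 1" and s: "abs s <= T" for ze c s
   proof -
   define h where "h r = - pr ?F ze c r - - pr ?F' ze c r" for r
   have ch: "cont h" unfolding h_def by (intro continuous_intros pr_continuous s1.lc_dpot s2.lc_dpot ze)
   have "AC (%s. (pr ps ze c s - c * pr U (deriv ze) c s) - (pr ps' ze c s - c * pr U' (deriv ze) c s)) h"
   unfolding h_def by (intro AC_diff s1.char_deriv s2.char_deriv ze c)
   from J_FTC[OF AC_continuous_deriv[OF this ch], of s]
   have e: "(pr ps ze c s - c * pr U (deriv ze) c s) - (pr ps' ze c s - c * pr U' (deriv ze) c s) = J h s"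
   using pr0[OF ze] pr0(2)[OF test_fun_deriv[OF ze]] by simp
   have "abs (J h s) <= l * A * n1 ze / L * exp (L * abs s)"
   proof (rule J_local_bound[OF ch _ L(1) s])
   show "abs (h r) <= l * A * n1 ze * exp (L * abs r)" if "abs r <= T" for r
   using Fb[OF ze that, of c] by (simp add: h_def abs_minus_commute)
   qed
   thus ?thesis unfolding e .
   qed
   \<comment> \<open>Averaging the bounds for \<open>c = 1\<close> and \<open>c = -1\<close>, with
     \<open>ze\<close> shifted so that both refer to the same place at time \<open>s\<close>,
     cancels the terms with \<open>deriv ze\<close>.\<close>
   have zb: "abs (pr ps ze 0 s - pr ps' ze 0 s) <= l * A * n1 ze / L * exp (L * abs s)" if ze: "test_fun ze" and s: "abs s <= T" for ze s
   proof -
   have "abs ((pr ps ze 0 s - c * pr U (deriv ze) 0 s) - (pr ps' ze 0 s - c * pr U' (deriv ze) 0 s)) <= l * A * n1 ze / L * exp (L * abs s)"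
   if c: "c^2 = 1" for c
   proof -
   have "n1 (%x. ze (x + - (c * s))) = n1 ze" unfolding n1_def by (rule abs_shift[OF ze])
   thus ?thesis using Pb[OF test_shift[OF ze] c s, of "- (c * s)"] by (simp only: pr_shift[OF ze] pr_shift(1)[OF test_fun_deriv[OF ze]])
   qed
   note two = this
   have e: "((a - 1 * b - (a' - 1 * b')) + (a - (-1) * b - (a' - (-1) * b'))) / 2 = a - a'" for a b a' b' :: real by (simp add: field_simps)
   have sq: "1^2 = (1::real)" "(-1)^2 = (1::real)" by simp_all
   show ?thesis using avg_bound[OF two[OF sq(1)] two[OF sq(2)]] unfolding e .
   qed
   have wb: "abs (pr U ze 0 s - pr U' ze 0 s) <= A / 2 * n1 ze * exp (L * abs s)" if ze: "test_fun ze" for ze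
   proof -
   have e: "pr U ze 0 s - pr U' ze 0 s = J (%t. pr ps ze 0 t - pr ps' ze 0 t) s"
   using J_FTC[OF AC_continuous_deriv[OF W[OF ze]], of s] pr0[OF ze] by simp
   have "abs (J (%t. pr ps ze 0 t - pr ps' ze 0 t) s) <= l * A * n1 ze / L / L * exp (L * abs s)" by (rule J_local_bound[OF W(2)[OF ze] zb[OF ze] L(1) s])
   also have "l * A * n1 ze / L / L = A / 2 * n1 ze" using L l by (simp add: field_simps)
   finally show ?thesis unfolding e .
   qed
   \<comment> \<open>Duality: if the difference exceeded the bound at one point, a bump there would
     violate the bound for the pairings. The sign \<open>sg\<close> covers both directions.\<close>
   have no: "\<not> sg * (U s x - U' s x) > A / 2 * exp (L * abs s)" if sg: "abs sg = 1" for sg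
   proof
   assume gt: "sg * (U s x - U' s x) > A / 2 * exp (L * abs s)"
   have c: "cont (%x. sg * (U s x - U' s x))" by (intro continuous_intros s1.cU s2.cU)
   obtain ze where ze: "test_fun ze" "(LINT x|LB. sg * (U s x - U' s x) * ze x) > A / 2 * exp (L * abs s) * (LINT x|LB. abs (ze x))"
   by (rule positive_pairing[OF c gt])
   have i: "integrable LB (%x. U s x * ze x)" "integrable LB (%x. U' s x * ze x)"
   by (intro test_fun_integrable ze li_cont s1.cU s2.cU)+
   have "(LINT x|LB. sg * (U s x - U' s x) * ze x) = (LINT x|LB. sg * (U s x * ze x - U' s x * ze x))"
   by (rule arg_cong[of _ _ "integral\<^sup>L LB"]) (auto simp: algebra_simps)
   also have "... = sg * (pr U ze 0 s - pr U' ze 0 s)" using i by (simp add: pr_def)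
   also have "... <= abs (pr U ze 0 s - pr U' ze 0 s)" using sg abs_ge_self[of "sg * (pr U ze 0 s - pr U' ze 0 s)"] by (simp add: abs_mult)
   also have "... <= A / 2 * n1 ze * exp (L * abs s)" by (rule wb[OF ze(1)])
   finally show False using ze(2) by (simp add: n1_def mult_ac)
   qed
   show ?thesis using no[of 1] no[of "-1"] by (intro abs_leI) auto
  qed
  have "abs (U s x - U' s x) <= (2 * M) * (1/2) ^ n * exp (L * abs s)" if "abs s <= T" for n s x
   using that
  proof (induction n arbitrary: s x)
   case 0
   have "abs (U s x - U' s x) <= 2 * M" using M[OF 0, of x] by (simp add: abs_le_iff)
   also have "2 * M * 1 <= 2 * M * exp (L * abs s)" using M(1)[OF 0, of x] L(1) by (intro mult_left_mono) auto
   finally show ?case by simp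
  next
   case (Suc n)
   from step[OF Suc.IH Suc.prems] show ?case by simp
  qed
  hence b: "abs (U t x - U' t x) <= (2 * M) * (1/2) ^ n * exp (L * abs t)" for n x by (simp add: T_def)
  have lim: "(%n. (2 * M) * (1/2) ^ n * exp (L * abs t)) \<longlonglongrightarrow> (2 * M) * 0 * exp (L * abs t)" by (intro tendsto_intros LIMSEQ_realpow_zero) auto
  show ?thesis
  proof
   fix x
   have "EX N. \<forall>n\<ge>N. abs (U t x - U' t x) <= (2 * M) * (1/2) ^ n * exp (L * abs t)" using b by blast
   from LIMSEQ_le_const[OF lim this] show "U t x = U' t x" by simp
  qed
 qed
 thus "U t = U' t" .
 have "AE x in LB. ps t x - ps' t x = 0"
 proof (rule fundamental_lemma)
  show "loc_integrable (%x. ps t x - ps' t x)" by (intro li_diff L2_loc s1.ps(1) s2.ps(1))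
  fix ze :: "real => real" assume ze: "test_fun ze"
  \<comment> \<open>Once the solutions agree, the pairing of the difference of their time
    derivatives is the derivative of the zero function.\<close>
  have "(%t. pr U ze 0 t - pr U' ze 0 t) = (%_. 0)" by (simp add: pr_def eqU)
  hence "((%_. 0) hrd (pr ps ze 0 t - pr ps' ze 0 t)) (at t)" using AC_continuous_deriv[OF W[OF ze], of t] by simp
  hence z: "pr ps ze 0 t - pr ps' ze 0 t = 0" using DERIV_unique DERIV_const by blast
  have i: "integrable LB (%x. ps t x * ze x)" "integrable LB (%x. ps' t x * ze x)"
   by (intro test_fun_integrable ze L2_loc s1.ps(1) s2.ps(1))+
  thus "(LINT x|LB. (ps t x - ps' t x) * ze x) = 0" using z by (simp add: pr_def left_diff_distrib)
 qed
 thus "AE x in LB. ps t x = ps' t x" by eventually_elim simp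
qed

text \<open>Each \<open>ph t\<close> is replaced by its continuous representative; the inner
  integrals are taken at fixed \<open>t\<close>, so they do not change.\<close>

lemma esol_exists:
 assumes e: "energy_class ph ps" and td: "distr_time_deriv ph ps" and ds: "distr_solution ph"
 obtains U where "esol U ps" "!!t. AE x in LB. ph t x = U t x"
proof -
 have "EX W V. H1r W V & (AE x in LB. ph t x - kink01 x - kink10 x = W x)" for t
  using e H1_obtain unfolding energy_class_def by metis
 then obtain W V where W: "!!t. H1r (W t) (V t)" "!!t. AE x in LB. ph t x - kink01 x - kink10 x = W t x" by metis
 define U where "U t x = W t x + bkg x" for t x
 have ae: "AE x in LB. ph t x = U t x" for t using W(2)[of t] by eventually_elim (simp add: U_def bkg_def)
 have cU: "cont (U t)" for t
  unfolding U_def using W(1)[of t] by (intro continuous_intros) (auto simp: H1r_def intro: AC_cont)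
 have mU: "U t \<in> LM" for t by (rule continuous_meas[OF cU])
 have mph: "ph t \<in> LM" for t
  by (rule measurable_cong_AE[OF _ mU[of t]]) (use ae[of t] in eventually_elim, simp)
 have D: "H1r (%x. U s x - U t x) (%x. V s x - V t x)" for s t using H1r_diff[OF W(1)[of s] W(1)[of t]] by (simp add: U_def)
 have mt: "(%x. h (t, x)) \<in> LM" if "test_fun h" for h :: "real \<times> real => real" and t
  by (intro continuous_meas continuous_on_compose2[OF test2(1)[OF that]] continuous_intros) auto
  have 1: "EX M. ALL x. abs (U t x) <= M" for t
  proof (intro exI allI)
   fix x
   have "abs (W t x) <= sqrt (H1sq (W t) (V t))" using real_sqrt_le_mono[OF H1r_sobolev[OF W(1)[of t], of x]] by simp
   thus "abs (U t x) <= sqrt (H1sq (W t) (V t)) + 1" using bkg_le[of x] by (simp add: U_def abs_le_iff)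
  qed
  have 2: "EX N. (N ~~> 0) (at t) & (ALL s x. abs (U s x - U t x) <= N s)" for t
  proof (intro exI[of _ "%s. H1_norm (%x. ph s x - ph t x)"] conjI allI)
   show "((%s. H1_norm (%x. ph s x - ph t x)) ~~> 0) (at t)" using e by (simp add: energy_class_def)
   fix s x
   have "AE x in LB. U s x - U t x = ph s x - ph t x" using ae[of s] ae[of t] by eventually_elim simp
   from H1_norm_eq[OF D this] have "H1_norm (%x. ph s x - ph t x) = sqrt (H1sq (%x. U s x - U t x) (%x. V s x - V t x))" .
   thus "abs (U s x - U t x) <= H1_norm (%x. ph s x - ph t x)" using real_sqrt_le_mono[OF H1r_sobolev[OF D[of s t], of x]] by simp
  qed
  have 3: "ps t \<in> L2" "((%s. L2_norm (%x. ps s x - ps t x)) ~~> 0) (at t)" for t using e by (auto simp: energy_class_def)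
  have 4: "distr_time_deriv U ps" unfolding distr_time_deriv_def
  proof (intro allI impI)
   fix et :: "real \<times> real => real" assume et: "test_fun et"
   have "(LINT x|LB. U t x * dir_deriv (1, 0) et (t, x)) = (LINT x|LB. ph t x * dir_deriv (1, 0) et (t, x))" for t
   using mU mph mt[OF test2(2)[OF et]] by (intro integral_cong_AE borel_measurable_times) (use ae[of t] in auto)
   thus "(LINT t|LB. LINT x|LB. U t x * dir_deriv (1, 0) et (t, x)) = - (LINT t|LB. LINT x|LB. ps t x * et (t, x))"
   using td et by (simp add: distr_time_deriv_def)
  qed
  have 5: "distr_solution U" unfolding distr_solution_def
  proof (intro allI impI)
   fix et :: "real \<times> real => real" assume et: "test_fun et"
   let ?I = "%v t x. v t x * (dir_deriv (1, 0) (dir_deriv (1, 0) et) (t, x) - dir_deriv (0, 1) (dir_deriv (0, 1) et) (t, x)) + (2 * v t x - 8 * (v t x) ^ 3 + 6 * (v t x) ^ 5) * et (t, x)"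
   note T = mt[OF test2(2)[OF test2(2)[OF et]]] mt[OF test2(3)[OF test2(3)[OF et]]] mt[OF et]
   have "(LINT x|LB. ?I U t x) = (LINT x|LB. ?I ph t x)" for t
   proof (rule integral_cong_AE)
   have "?I v t \<in> LM" if "v t \<in> LM" for v
   by (intro borel_measurable_add borel_measurable_times borel_measurable_diff borel_measurable_power borel_measurable_const T that)
   from this[of U] this[of ph] show "?I U t \<in> LM" "?I ph t \<in> LM" using mU mph by auto
   show "AE x in LB. ?I U t x = ?I ph t x" using ae[of t] by eventually_elim simp
   qed
   thus "(LINT t|LB. LINT x|LB. ?I U t x) = 0" using ds et by (simp add: distr_solution_def)
  qed
 have "esol U ps" by (rule esol.intro) (rule cU 1 2 3 4 5)+
 thus ?thesis using that ae by blast
qed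

theorem solution_unique:
 assumes "global_solution ph\<^sub>0 ph\<^sub>1 ph ps" "global_solution ph\<^sub>0 ph\<^sub>1 ph' ps'"
 shows "AE x in LB. ph' t x = ph t x & ps' t x = ps t x"
proof -
 obtain U where U: "esol U ps" "!!t. AE x in LB. ph t x = U t x" using esol_exists assms(1) unfolding global_solution_def by blast
 obtain U' where U': "esol U' ps'" "!!t. AE x in LB. ph' t x = U' t x" using esol_exists assms(2) unfolding global_solution_def by blast
 interpret s1: esol U ps by (rule U)
 interpret s2: esol U' ps' by (rule U')
 have 0: "AE x in LB. ph 0 x = ph\<^sub>0 x" "AE x in LB. ph' 0 x = ph\<^sub>0 x" "AE x in LB. ps 0 x = ph\<^sub>1 x" "AE x in LB. ps' 0 x = ph\<^sub>1 x"
  using assms by (auto simp: global_solution_def)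
 have "AE x in LB. U 0 x = U' 0 x" using U(2)[of 0] U'(2)[of 0] 0(1,2) by eventually_elim simp
 hence U0: "U 0 = U' 0" by (rule continuous_AE_eq[OF _ s1.cU s2.cU])
 have "AE x in LB. ps 0 x = ps' 0 x" using 0(3,4) by eventually_elim simp
 note u = esol_unique[OF U(1) U'(1) U0 this, of t]
 from u(2) U(2)[of t] U'(2)[of t] show ?thesis by eventually_elim (simp add: u(1))
qed

section \<open>Solutions with given data\<close>

lemma AC_cong_AE: "AC u v ==> AE x in LB. v x = v' x ==> AC u v'"
 by (rule weak_cont_AC[OF has_weak_deriv_cong_AE[OF _ _ AC_imp_weak] AC_cont]) auto

text \<open>Shearing and Fubini need Borel functions: for a merely Lebesgue measurable
  \<open>v\<close>, the map taking \<open>(t, x)\<close> to \<open>v (x + t)\<close> need not be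
  measurable for the product of the \<open>lborel\<close> measures.\<close>

lemma borel_representative:
 assumes "sqint UNIV v"
 obtains v' where "v' \<in> BM" "AE x in LB. v x = v' x" "sqint UNIV v'"
proof -
 obtain v' where v': "v' \<in> borel_measurable lborel" "AE x in lborel. v x = v' x"
  using completion_ex_borel_measurable_real[OF sqint_meas[OF assms]] by blast
 have "AE x in LB. v x = v' x" using v'(2) by (rule AE_completion)
 thus ?thesis using that v'(1) sqint_cong_AE(1)[OF _ assms] by simp
qed

lemma LINT_cong_AE_integral:
 fixes f g :: "real => real"
 assumes "g abs_int_on UNIV" "AE x in LB. f x = g x"
 shows "(LINT x|LB. f x) = intR g"
proof -
 have m: "g \<in> LM" using assms(1) by (auto simp: set_integrable_def)
 hence "f \<in> LM" using assms(2) by (intro measurable_cong_AE[OF _ m]) (auto elim: eventually_mono)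
 hence "(LINT x|LB. f x) = (LINT x|LB. g x)" using m assms(2) by (intro integral_cong_AE)
 thus ?thesis by (simp add: LINT_eq_integral[OF assms(1)])
qed

theorem solution_exists:
 assumes ph\<^sub>0: "ph\<^sub>0 \<in> kink_space" and ph\<^sub>1: "ph\<^sub>1 \<in> L2" and E: "E_tot ph\<^sub>0 ph\<^sub>1 <= e" and e: "e < 2 * sqrt 2"
 obtains ph ps phx where "global_solution ph\<^sub>0 ph\<^sub>1 ph ps"
  "!!t. admis (ph t) (phx t)"
  "!!t. ((%s. H1sq (%x. ph s x - ph t x) (%x. phx s x - phx t x)) ~~> 0) (at t)"
  "!!t. intR (edens (ph t) (phx t)) <= e"
proof -
 have "(%x. ph\<^sub>0 x - kink01 x - kink10 x) \<in> H1" using ph\<^sub>0 by (simp add: kink_space_def)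
 then obtain W V where W: "H1r W V" "AE x in LB. ph\<^sub>0 x - kink01 x - kink10 x = W x" by (rule H1_obtain)
 define U where "U x = W x + bkg x" for x
 have HU: "H1r (%x. U x - bkg x) (%x. (V x + bkg_deriv x) - bkg_deriv x)" using W(1) by (simp add: U_def)
 have aeU: "AE x in LB. U x = ph\<^sub>0 x" using W(2) by eventually_elim (simp add: U_def bkg_def)
 obtain v where v: "v \<in> BM" "AE x in LB. V x + bkg_deriv x = v x" "sqint UNIV v"
  using borel_representative[OF S_v[OF HU]] .
 obtain w where w: "w \<in> BM" "AE x in LB. ph\<^sub>1 x = w x" "sqint UNIV w"
  using borel_representative[of ph\<^sub>1] ph\<^sub>1 by (auto simp: L2_iff)
 have ACU: "AC U v" by (rule AC_cong_AE[OF S_AC[OF HU] v(2)])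
 obtain Q where Q: "AC Q w" using AC_primitive[OF L2_loc[of w]] w(3) by (auto simp: L2_iff)
 \<comment> \<open>D'Alembert's splitting of the data: \<open>U\<close> is the initial profile and
   \<open>Q\<close> a primitive of the initial velocity.\<close>
 define al where "al x = (1/2) * (U x + Q x)" for x
 define be where "be x = (1/2) * (U x - Q x)" for x
 define al' where "al' x = (1/2) * (v x + w x)" for x
 define be' where "be' x = (1/2) * (v x - w x)" for x
 have sums: "al x + be x = U x" "al' x + be' x = v x" "al' x - be' x = w x" for x
  by (simp_all add: al_def be_def al'_def be'_def field_simps)
 have "wave_data al be al' be'"
 proof
  show "AC al al'" "AC be be'" unfolding al_def[abs_def] be_def[abs_def] al'_def[abs_def] be'_def[abs_def]
   by (intro AC_cmult AC_add AC_diff ACU Q)+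
  show "al' \<in> BM" "be' \<in> BM" unfolding al'_def[abs_def] be'_def[abs_def] using v w by auto
  show "sqint UNIV al'" "sqint UNIV be'" unfolding al'_def[abs_def] be'_def[abs_def]
   by (intro sqint_cmult sqint_add sqint_diff v w; simp)+
  show "H1r (%x. al x + be x - bkg x) (%x. al' x + be' x - bkg_deriv x)"
   unfolding sums H1r_def using HU by (auto simp: H1r_def intro!: AC_diff ACU bkg_AC sqint_diff v(3) bkg_sq_deriv)
 qed
 then interpret wd: wave_data al be al' be' .
 obtain ph A where ph: "cont (%(t, x). ph t x)" "!!t x. ph t x = wd.fw t x - Dh (%s y. tr (ph s y)) t x"
  "A > 0" "!!t. n2 (%x. ph t x - bkg x) <= ennreal ((A * ew t)^2)"
  "!!t. n2 (%x. tr (ph t x)) <= ennreal ((A * ew t)^2)"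
  using wd.fixed_point by blast
 interpret wv: wave al be al' be' ph A by unfold_locales (rule ph)+
 have 0: "ph 0 = U" "wv.ps 0 = w" "wv.phx 0 = v"
 proof -
  show "ph 0 = U"
  proof
   fix x show "ph 0 x = U x" by (subst ph(2)) (simp add: wd.fw_def sums Dh_def)
  qed
  have pq: "wv.p 0 x = 2 * al' x" "wv.q 0 x = - 2 * be' x" for x by (simp_all add: wv.p_def wv.q_def Jp_def Jm_def)
  show "wv.ps 0 = w" "wv.phx 0 = v" by (auto simp: wv.ps_def wv.phx_def pq fun_eq_iff sums(2,3)[symmetric])
 qed
 have Hv: "admis U v" using wv.ph_H[of 0] by (simp add: 0)
 have pint: "(%x. pot (U x)) abs_int_on UNIV"
 proof (rule abs_int_bound[OF _ _ abs_int_imp[OF S_edens_int[OF Hv]]])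
  show "(%x. pot (U x)) \<in> LM" by (intro continuous_meas continuous_intros AC_cont[OF ACU])
  show "abs (pot (U x)) <= edens U v x" for x by (simp add: edens_def pot_nonneg)
 qed simp
 have vw: "(%x. (v x)^2 + (w x)^2) abs_int_on UNIV" using v(3) w(3) unfolding sqint_def by (auto intro: set_integral_add)
 have "E_tot ph\<^sub>0 ph\<^sub>1 = 1/2 * intR (%x. (v x)^2 + (w x)^2) + intR (%x. pot (U x))"
 proof -
  have "AE x in LB. (weak_deriv ph\<^sub>0 x)^2 + (ph\<^sub>1 x)^2 = (v x)^2 + (w x)^2"
   using weak_deriv_AE[OF ACU aeU] w(2) by eventually_elim simp
  from LINT_cong_AE_integral[OF vw this] have 1: "(LINT x|LB. (weak_deriv ph\<^sub>0 x)^2 + (ph\<^sub>1 x)^2) = intR (%x. (v x)^2 + (w x)^2)" .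
  have "AE x in LB. (ph\<^sub>0 x)^2 * (1 - (ph\<^sub>0 x)^2)^2 = pot (U x)" using aeU by eventually_elim (simp add: pot_def)
  from LINT_cong_AE_integral[OF pint this] show ?thesis unfolding E_tot_def 1 by simp
 qed
 also have "... = intR (%x. ((v x)^2 + (w x)^2) / 2 + pot (U x))"
  using abs_int_imp[OF vw] abs_int_imp[OF pint] by (subst HK_add) (auto intro: integrable_on_divide)
 finally have Ele: "intR (%x. ((wv.phx 0 x)^2 + (wv.ps 0 x)^2) / 2 + pot (ph 0 x)) <= e" using E by (simp add: 0)
 note small = wv.small_energy[OF Ele e]
 show ?thesis
 proof (rule that[of ph wv.ps wv.phx])
  show "global_solution ph\<^sub>0 ph\<^sub>1 ph wv.ps" unfolding global_solution_def
   using wv.energy_class wv.distr_time_deriv wv.distr_solution[OF small(1)] aeU w(2) by (auto simp: 0 elim: eventually_mono)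
 qed (rule wv.ph_H wv.H1sq_tendsto small(2))+
qed

section \<open>Modulation\<close>

lemma dk01_sq: "sqint UNIV dk01"
proof -
 have "abs (dk01 x) <= sqrt 2 * exp (- sqrt 2 * abs (x - 0))" for x
  using dk01_le[of x] dk01_nonneg[of x] by simp
 thus ?thesis by (rule sqint_exp_dom(1)[rotated]) (intro continuous_meas continuous_kink01_deriv continuous_on_id)
qed

text \<open>On the kink the gradient and potential parts of the energy density coincide and add up
  to the derivative of \<open>bog (kink01 x)\<close>, which stays between 0 and
  \<open>sqrt 2 / 4\<close>. This direction turns the energy assumption into the bound
  \<open>sqrt 2 / 2 + ep\<close>.\<close>

lemma E_pot_kink: "E_pot kink01 <= sqrt 2 / 4"
proof -
 have AC0: "AC kink01 dk01" using AC_kink01[of 0] by simp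
 define w where "w x = sqrt 2 * kink01 x * (1 - (kink01 x)^2) * dk01 x" for x
 have w: "w x = (dk01 x)^2" "pot (kink01 x) = w x / 2" for x
  by (simp_all add: w_def dk01_def pot_def power2_eq_square algebra_simps)
 have ACw: "AC (%x. bog (kink01 x)) w" unfolding w_def[abs_def] by (rule bog_AC[OF AC0])
 have iw: "w abs_int_on UNIV" using dk01_sq by (simp add: sqint_def w(1)[abs_def])
 have bog_le: "0 <= bog (kink01 x)" "bog (kink01 x) <= sqrt 2 / 4" for x
 proof -
  have q: "(kink01 x)^2 <= 1" "0 <= (kink01 x)^2" using kink01_square_less_1[of x] by auto
  have "0 <= (kink01 x)^2 * (2 - (kink01 x)^2)" using q by (intro mult_nonneg_nonneg) auto
  hence "0 <= (kink01 x)^2 / 2 - (kink01 x) ^ 4 / 4" by (simp add: power2_eq_square power4_eq_xxxx algebra_simps)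
  thus "0 <= bog (kink01 x)" by (simp add: bog_def)
  have "0 <= (1 - (kink01 x)^2)^2" by simp
  hence "(kink01 x)^2 / 2 - (kink01 x) ^ 4 / 4 <= 1/4" by (simp add: power2_eq_square power4_eq_xxxx algebra_simps)
  hence "sqrt 2 * ((kink01 x)^2 / 2 - (kink01 x) ^ 4 / 4) <= sqrt 2 * (1/4)" by (intro mult_left_mono) auto
  thus "bog (kink01 x) <= sqrt 2 / 4" by (simp add: bog_def)
 qed
 have "bog (kink01 0) + integral {0..} w <= sqrt 2 / 4"
  by (rule tendsto_upperbound[OF AC_limit[OF ACw]]) (use abs_int_subset[OF iw] bog_le in auto)
 moreover have "integral {..0} w <= bog (kink01 0)"
 proof -
  have ACr: "AC (%x. - bog (kink01 (- x))) (%x. w (- x))" using AC_minus[OF AC_reflect[OF ACw]] by simp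
  note i0 = abs_int_subset[OF iw, of "{..0}"]
  from AC_limit[OF ACr, of 0] have "((%x. - bog (kink01 (- x))) ~~> - bog (kink01 0) + integral {0..} (%x. w (- x))) at_top"
   using reflect_half(1)[where f = w and t = 0] i0 by simp
  hence "- bog (kink01 0) + integral {0..} (%x. w (- x)) <= 0" by (rule tendsto_upperbound) (use bog_le in auto)
  thus ?thesis using reflect_half(2)[where f = w and t = 0] i0 by simp
 qed
 ultimately have total: "intR w <= sqrt 2 / 4" using split_UNIV[OF iw, of 0] by linarith
 have "(LINT x|LB. (weak_deriv kink01 x)^2) = intR w"
  by (rule LINT_cong_AE_integral[OF iw]) (use weak_deriv_AE[OF AC0, of kink01] in \<open>auto simp: w(1) elim: eventually_mono\<close>)
 moreover have "(LINT x|LB. (kink01 x)^2 * (1 - (kink01 x)^2)^2) = intR w / 2"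
  using LINT_eq_integral[OF iw] by (simp add: w(2) flip: pot_def)
 ultimately show ?thesis using total by (simp add: E_pot_def)
qed

text \<open>That \<open>f\<close> represents \<open>dtt_distr u\<close> means that
  \<open>f + dpot u\<close> is a weak derivative of \<open>v\<close>; changing \<open>v\<close> on a
  null set yields the absolute continuity required by \<open>stationary\<close>.\<close>

lemma static_bound:
 assumes H: "admis u v" and E: "intR (edens u v) <= 1"
  and f: "f \<in> L2" "represents f (dtt_distr u)"
  and ab: "a - b >= 10^7" "exp (- sqrt 2 * (a - b)) <= 1 / 10^24" "H1sq (gap u a b) (gap' v a b) <= (1 / 10^7)^2"
   "abs (gap u a b a) <= 2 * exp (- sqrt 2 * (a - b))" "abs (gap u a b b) <= 2 * exp (- sqrt 2 * (a - b))"
 shows "exp (- sqrt 2 * (a - b)) + sqrt (H1sq (gap u a b) (gap' v a b)) <= 10^30 * L2_norm f"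
proof -
 have ACu: "AC u v" by (rule S_AC[OF H])
 have cu: "cont u" by (rule AC_cont[OF ACu])
 have sf: "sqint UNIV f" using f(1) by (simp add: L2_iff)
 have lf: "loc_integrable f" "loc_integrable (%x. dpot (u x))"
  by (rule L2_loc[OF f(1)]) (intro li_cont continuous_intros cu)
 have "has_weak_deriv v (%x. f x + dpot (u x))" unfolding has_weak_deriv_def
 proof (intro conjI allI impI)
  show "loc_integrable v" by (rule AC_loc[OF ACu])
  show "loc_integrable (%x. f x + dpot (u x))" by (rule li_add[OF lf])
  fix et :: "real => real" assume et: "test_fun et"
  have et': "test_fun (deriv et)" "test_fun (deriv (deriv et))" using test_fun_deriv et by blast+
  note i = test_fun_integrable[OF lf(1) et] test_fun_integrable[OF lf(2) et] test_fun_integrable[OF li_cont[OF cu] et'(2)]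
  have "(LINT x|LB. f x * et x) = (LINT x|LB. u x * deriv (deriv et) x + (- 2 * u x + 8 * (u x) ^ 3 - 6 * (u x) ^ 5) * et x)"
   using f(2) et unfolding represents_def dtt_distr_def by simp
  also have "... = (LINT x|LB. u x * deriv (deriv et) x - dpot (u x) * et x)"
   by (rule arg_cong[of _ _ "integral\<^sup>L LB"]) (auto simp: dpot_def algebra_simps)
  also have "... = (LINT x|LB. u x * deriv (deriv et) x) - (LINT x|LB. dpot (u x) * et x)"
   by (rule L_diff[OF i(3,2)])
  also have "(LINT x|LB. u x * deriv (deriv et) x) = - (LINT x|LB. v x * deriv et x)"
   using AC_imp_weak[OF ACu] et'(1) unfolding has_weak_deriv_def by blast
  finally have "(LINT x|LB. v x * deriv et x) = - ((LINT x|LB. f x * et x) + (LINT x|LB. dpot (u x) * et x))" by simp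
  also have "(LINT x|LB. f x * et x) + (LINT x|LB. dpot (u x) * et x) = (LINT x|LB. (f x + dpot (u x)) * et x)"
   using i by (simp add: distrib_right)
  finally show "(LINT x|LB. v x * deriv et x) = - (LINT x|LB. (f x + dpot (u x)) * et x)" .
 qed
 then obtain Y where Y: "AC Y (%x. f x + dpot (u x))" "AE x in LB. v x = Y x" by (rule weak_imp_AC)
 have HY: "admis u Y"
  using H sqint_diff[OF sqint_cong_AE(1)[OF Y(2) S_v[OF H]] bkg_sq_deriv]
  by (auto simp: H1r_def intro!: AC_diff bkg_AC AC_cong_AE[OF ACu Y(2)])
 have "intR (edens u Y) = intR (edens u v)"
 proof -
  have "AE x in LB. edens u v x = edens u Y x" using Y(2) by eventually_elim (simp add: edens_def)
  from LINT_cong_AE_integral[OF S_edens_int[OF HY] this] show ?thesis using LINT_eq_integral[OF S_edens_int[OF H]] by simp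
 qed
 hence EY: "intR (edens u Y) <= 1" using E by simp
 interpret st: stationary u Y f a b by unfold_locales (rule HY EY sf Y(1))+
 have N: "H1sq (gap u a b) (gap' Y a b) = H1sq (gap u a b) (gap' v a b)"
  using H1_norm_eq[OF gap_H1[OF H, of a b], of "gap u a b"] H1_norm_eq[OF gap_H1[OF HY, of a b], of "gap u a b"] by simp
 have "exp (- sqrt 2 * (a - b)) + sqrt (H1sq (gap u a b) (gap' Y a b)) <= 10^30 * sqrt (intR (%x. (f x)^2))"
  using st.stationary_estimate ab unfolding st.Z_def st.N2_def st.g_def st.g'_def st.F2_def N by blast
 thus ?thesis unfolding N L2_norm_eq[OF sf] .
qed

text \<open>The first bound enforces the distance \<open>10^7\<close>, as
  \<open>sqrt 2 <= 1.5\<close>; the second implies the smallness conditions of the stationary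
  estimate.\<close>

definition eta :: real where "eta = min (exp (- 15000000)) (1 / 10^40)"

lemma eta: "eta > 0" "eta <= 1 / 10^40" "exp (- sqrt 2 * d) < eta ==> d >= 10^7"
proof -
 show "eta > 0" "eta <= 1 / 10^40" by (auto simp: eta_def)
 assume "exp (- sqrt 2 * d) < eta"
 hence "exp (- sqrt 2 * d) < exp (- 15000000)" by (simp add: eta_def)
 hence lt: "15000000 < sqrt 2 * d" by simp
 show "d >= 10^7"
 proof (rule ccontr)
  assume "\<not> d >= 10^7"
  hence "sqrt 2 * d <= sqrt 2 * 10^7" by (intro mult_left_mono) auto
  also have "... <= 1.5 * 10^7" using sqrt2_bounds(2) by (intro mult_right_mono) auto
  finally show False using lt by simp
 qed
qed

text \<open>The pairs lie in a convex set: closeness to a reference pair is a box, and the bound on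
  the exponential is a half plane. For the norm of the remainder no convexity is at hand; it is
  recovered by moving from the reference pair.\<close>

lemma hull_bound:
 assumes H: "admis u v" and ka: "ka <= 1 / 200"
  and A: "!!a b. (a, b) \<in> A ==> exp (- sqrt 2 * (a - b)) <= ka & H1sq (gap u a b) (gap' v a b) <= ka^2"
  and p: "(a, b) \<in> convex hull A"
 shows "exp (- sqrt 2 * (a - b)) + sqrt (H1sq (gap u a b) (gap' v a b)) <= 10^5 * ka"
proof -
 obtain a0 b0 where 0: "(a0, b0) \<in> A" using p by (metis convex_hull_empty empty_iff equals0I surj_pair)
 have k0: "0 < ka" using A[OF 0] exp_gt_zero[of "- sqrt 2 * (a0 - b0)"] by linarith
 have g: "abs (gap u a b x) <= ka" if "(a, b) \<in> A" for a b x
  using order_trans[OF H1r_sobolev[OF gap_H1[OF H], of a b x]] A[OF that] k0 by (metis abs_le_square_iff abs_of_pos)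
 define l where "l = - ln ka / sqrt 2"
 have l: "exp (- sqrt 2 * d) <= ka \<longleftrightarrow> l <= d" for d
 proof -
  have "exp (- sqrt 2 * d) <= ka \<longleftrightarrow> - sqrt 2 * d <= ln ka" using k0 by (metis exp_le_cancel_iff exp_ln)
  also have "... \<longleftrightarrow> l <= d" by (auto simp: l_def field_simps)
  finally show ?thesis .
 qed
 define S where "S = cbox (a0 - 112 * ka, b0 - 112 * ka) (a0 + 112 * ka, b0 + 112 * ka) \<inter> {z. inner (1, -1) z >= l}"
 have mem: "(a, b) \<in> S \<longleftrightarrow> abs (a - a0) <= 112 * ka & abs (b - b0) <= 112 * ka & exp (- sqrt 2 * (a - b)) <= ka" for a b
  unfolding l by (auto simp: S_def cbox_Pair_eq abs_le_iff)
 have "A \<subseteq> S"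
 proof
  fix z assume z: "z \<in> A"
  obtain a b where ab: "z = (a, b)" by (cases z)
  have k: "ka < 1/112" using ka by simp
  show "z \<in> S" unfolding ab mem
   using pair_close_a[of u a b ka a0 b0] pair_close_b[of u a b ka a0 b0] g[of a b] g[OF 0] A[of a b] A[OF 0] z k by (auto simp: ab)
 qed
 hence "convex hull A \<subseteq> S" by (rule hull_minimal) (auto simp: S_def intro!: convex_Int convex_box convex_halfspace_ge)
 hence ab: "abs (a - a0) <= 112 * ka" "abs (b - b0) <= 112 * ka" "exp (- sqrt 2 * (a - b)) <= ka" using p mem by auto
 have "H1sq (gap u a b) (gap' v a b) <= (10^4 * ka)^2"
  by (rule gap_move[OF H _ _ ka ab(1,2)]) (use A[OF 0] k0 in auto)
 hence "sqrt (H1sq (gap u a b) (gap' v a b)) <= 10^4 * ka" using k0 by (intro real_le_lsqrt) auto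
 thus ?thesis using ab(3) k0 by simp
qed

theorem modulation:
 fixes ph phx :: "real => real => real"
 assumes H: "!!t. admis (ph t) (phx t)"
  and C: "!!t. ((%s. H1sq (%x. ph s x - ph t x) (%x. phx s x - phx t x)) ~~> 0) (at t)"
  and E: "!!t. intR (edens (ph t) (phx t)) <= sqrt 2 / 2 + ep" and ep: "ep < eta^2 / 10^9"
 obtains a b where "C_diff 2 a" "C_diff 2 b"
  "!!t f. f \<in> L2 ==> represents f (dtt_distr (ph t)) ==>
   exp (- sqrt 2 * (a t - b t)) + sqrt (H1sq (gap (ph t) (a t) (b t)) (gap' (phx t) (a t) (b t))) <= 10^40 * L2_norm f"
proof -
 let ?N = "%t a b. H1sq (gap (ph t) a b) (gap' (phx t) a b)" and ?Z = "%a b. exp (- sqrt 2 * (a - b))"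
 have sm: "eta^2 <= eta" using eta(1,2) by (simp add: power2_eq_square mult_left_le_one_le)
 have h: "1000000000 * ep < eta^2" "0 < eta^2" "eta <= 1" using ep eta(1,2) by auto
 hence "400000000 * ep < eta^2" "100000000 * ep < eta" "100 * ep < 6" using sm by linarith+
 hence ep': "10^8 * ep < eta^2 / 4" "10^8 * ep < eta" "ep < 0.06" by auto
 \<comment> \<open>Strict inequalities keep a fixed pair admissible for nearby times. The factor 2
   leaves room: at the crossings the remainder at either centre is the value of the other kink, at
   most \<open>?Z a b\<close> in absolute value.\<close>
 define A where "A t = {(a, b). abs (gap (ph t) a b a) < 2 * ?Z a b & abs (gap (ph t) a b b) < 2 * ?Z a b & ?Z a b < eta & ?N t a b < eta^2}" for t
 have sel: "EX c. \<forall>\<^sub>F s in nhds t. c \<in> A s" for t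
 proof -
  obtain a b where ab: "ph t a = 1 / sqrt 2" "ph t b = - (1 / sqrt 2)" "?N t a b <= 10^8 * ep" "?Z a b <= 10^8 * ep"
   by (rule closeness[OF H[of t] E[of t] ep'(3)])
  have g: "abs (gap (ph t) a b a) < 2 * ?Z a b" "abs (gap (ph t) a b b) < 2 * ?Z a b"
  proof -
   have "gap (ph t) a b a = - kink10 (a - b)" "gap (ph t) a b b = kink10 (a - b)" using ab(1,2) by (simp_all add: gap_def kink01_0 kink10_eq)
   moreover have "abs (kink10 (a - b)) < 2 * ?Z a b"
   using kink_abs_bounds(4)[of "a - b"] exp_gt_zero[of "- sqrt 2 * (a - b)"] by linarith
   ultimately show "abs (gap (ph t) a b a) < 2 * ?Z a b" "abs (gap (ph t) a b b) < 2 * ?Z a b" by simp_all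
  qed
  have lim: "((%s. ph s x) ~~> ph t x) (at t)" for x
  proof -
   have "((%s. ph s x - ph t x) ~~> 0) (at t)"
   proof (rule Lim_null_comparison)
   show "((%s. sqrt (H1sq (%x. ph s x - ph t x) (%x. phx s x - phx t x))) ~~> 0) (at t)" using tendsto_real_sqrt[OF C[of t]] by simp
   have "abs (ph s x - ph t x) <= sqrt (H1sq (%x. ph s x - ph t x) (%x. phx s x - phx t x))" for s
   using real_sqrt_le_mono[OF H1r_sobolev[OF H1r_diff[OF H[of s] H[of t]], of x]] by simp
   thus "\<forall>\<^sub>F s in at t. norm (ph s x - ph t x) <= sqrt (H1sq (%x. ph s x - ph t x) (%x. phx s x - phx t x))" by simp
   qed
   thus ?thesis by (simp add: LIM_zero_iff)
  qed
  have gl: "((%s. abs (gap (ph s) a b x)) ~~> abs (gap (ph t) a b x)) (at t)" for x unfolding gap_def by (intro tendsto_intros lim)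
  \<comment> \<open>The factor 2 is paid for by the quarter in
    \<open>10^8 * ep < eta^2 / 4\<close>.\<close>
  have Nle: "?N s a b <= 2 * H1sq (%x. ph s x - ph t x) (%x. phx s x - phx t x) + 2 * ?N t a b" for s
  proof -
   have "H1r (%x. ph s x - ph t x) (%x. phx s x - phx t x)" using H1r_diff[OF H[of s] H[of t]] by simp
   moreover have "gap (ph s) a b = (%x. (ph s x - ph t x) + gap (ph t) a b x)"
   "gap' (phx s) a b = (%x. (phx s x - phx t x) + gap' (phx t) a b x)" by (auto simp: gap_def gap'_def)
   ultimately show ?thesis using H1sq_add_le[OF _ gap_H1[OF H[of t], of a b]] by simp
  qed
  have "((%s. 2 * H1sq (%x. ph s x - ph t x) (%x. phx s x - phx t x) + 2 * ?N t a b) ~~> 2 * 0 + 2 * ?N t a b) (at t)" by (intro tendsto_intros C)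
  moreover have "2 * 0 + 2 * ?N t a b < eta^2" using ab(3) ep'(1) zero_less_power[OF eta(1), of 2] by linarith
  ultimately have "\<forall>\<^sub>F s in at t. 2 * H1sq (%x. ph s x - ph t x) (%x. phx s x - phx t x) + 2 * ?N t a b < eta^2" by (rule order_tendstoD(2))
  hence "\<forall>\<^sub>F s in at t. (a, b) \<in> A s"
   using order_tendstoD(2)[OF gl g(1)] order_tendstoD(2)[OF gl g(2)]
   by eventually_elim (use ab(4) ep'(2) Nle in \<open>auto simp: A_def intro: le_less_trans\<close>)
  moreover have "(a, b) \<in> A t" using g ab(3,4) ep' zero_less_power[OF eta(1), of 2] by (auto simp: A_def)
  ultimately show ?thesis by (auto simp: eventually_nhds_conv_at)
 qed
 obtain c where c: "C2_curve c" "!!t. c t \<in> convex hull (A t)" using C2_selection[OF sel] by blast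
 show ?thesis
 proof (rule that[of "%t. fst (c t)" "%t. snd (c t)"])
  show "C_diff 2 (%t. fst (c t))" "C_diff 2 (%t. snd (c t))" using c(1) by (simp_all add: C2_curve_def)
  fix t f assume f: "f \<in> L2" "represents f (dtt_distr (ph t))"
  \<comment> \<open>A common bound for all pairs in \<open>A t\<close>, as the stationary estimate
    applies to each of them. The minimum with \<open>eta\<close> keeps it small enough for
    \<open>hull_bound\<close> also when \<open>f\<close> is large.\<close>
  define ka where "ka = min eta (10^30 * L2_norm f)"
  have L: "L2_norm f >= 0" by (simp add: L2_norm_def)
  have E1: "intR (edens (ph t) (phx t)) <= 1" using E[of t] ep'(3) sqrt2_bounds(2) by simp
  have e7: "eta <= 1 / 10^24" "eta^2 <= (1 / 10^7)^2" using eta(1,2) by (auto intro!: power_mono)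
  have "exp (- sqrt 2 * (fst (c t) - snd (c t))) + sqrt (?N t (fst (c t)) (snd (c t))) <= 10^5 * ka"
  proof (rule hull_bound[OF H[of t], of _ "A t"])
   show "ka <= 1 / 200" using eta(2) by (simp add: ka_def)
   show "(fst (c t), snd (c t)) \<in> convex hull (A t)" using c(2)[of t] by simp
   fix a b assume "(a, b) \<in> A t"
   hence ab: "abs (gap (ph t) a b a) < 2 * ?Z a b" "abs (gap (ph t) a b b) < 2 * ?Z a b" "?Z a b < eta" "?N t a b < eta^2" by (auto simp: A_def)
   have sb: "?Z a b + sqrt (?N t a b) <= 10^30 * L2_norm f"
   by (rule static_bound[OF H[of t] E1 f eta(3)[OF ab(3)] _ order_trans[OF less_imp_le[OF ab(4)] e7(2)]]) (use ab e7(1) in auto)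
   have N0: "0 <= ?N t a b" by (rule H1sq_nonneg[OF gap_H1[OF H[of t]]])
   have "sqrt (?N t a b) < eta" using ab(4) eta(1) by (intro real_less_lsqrt) auto
   hence "sqrt (?N t a b) <= ka" using sb exp_gt_zero[of "- sqrt 2 * (a - b)"] unfolding ka_def by linarith
   hence "(sqrt (?N t a b))^2 <= ka^2" using N0 by (intro power_mono) auto
   moreover have "?Z a b <= ka" using sb ab(3) real_sqrt_ge_zero[OF N0] unfolding ka_def by linarith
   ultimately show "?Z a b <= ka & ?N t a b <= ka^2" using N0 by simp
  qed
  also have "... <= 10^5 * (10^30 * L2_norm f)" by (intro mult_left_mono) (auto simp: ka_def)
  also have "... <= 10^40 * L2_norm f" using L by simp
  finally show "exp (- sqrt 2 * (fst (c t) - snd (c t))) + sqrt (?N t (fst (c t)) (snd (c t))) <= 10^40 * L2_norm f" .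
 qed
qed

theorem corollary1p3:
  shows "\<exists>\<delta>\<^sub>0>0. \<exists>C>0. \<forall>\<epsilon><\<delta>\<^sub>0. \<forall>\<phi>\<^sub>0 \<phi>\<^sub>1.
    \<phi>\<^sub>0 \<in> kink_space \<and> \<phi>\<^sub>1 \<in> L2 \<and> E_tot \<phi>\<^sub>0 \<phi>\<^sub>1 = 2 * E_pot kink01 + \<epsilon> \<longrightarrow>
    (\<exists>\<phi> \<psi>. unique_global_solution \<phi>\<^sub>0 \<phi>\<^sub>1 \<phi> \<psi> \<and>
      (\<exists>(x\<^sub>1::real \<Rightarrow> real) (x\<^sub>2::real \<Rightarrow> real) (g::real \<Rightarrow> real \<Rightarrow> real).
        C_diff 2 x\<^sub>1 \<and> C_diff 2 x\<^sub>2 \<and>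
        (\<forall>t. (AE x in lebesgue. \<phi> t x = kink01 (x + x\<^sub>1 t) + kink10 (x + x\<^sub>2 t) + g t x) \<and>
             g t \<in> H1 \<and>
             ennreal (exp (- sqrt 2 * (x\<^sub>2 t - x\<^sub>1 t)) + H1_norm (g t))
               \<le> ennreal C * distr_L2_norm (dtt_distr (\<phi> t)))))"
proof (rule exI[of _ "eta^2 / 10^9"], rule conjI, rule divide_pos_pos[OF zero_less_power[OF eta(1)]], simp, rule exI[of _ "(10::real)^40"], rule conjI, simp, intro allI impI)
 fix ep ph\<^sub>0 ph\<^sub>1
 assume ep: "ep < eta^2 / 10^9" and d: "ph\<^sub>0 \<in> kink_space & ph\<^sub>1 \<in> L2 & E_tot ph\<^sub>0 ph\<^sub>1 = 2 * E_pot kink01 + ep"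
 have Ele: "E_tot ph\<^sub>0 ph\<^sub>1 <= sqrt 2 / 2 + ep" using d E_pot_kink by linarith
 have "eta^2 <= 1" using eta(1,2) by (intro power_le_one) auto
 hence "ep < 1" using ep by simp
 moreover have "1 < sqrt (2::real)" by simp
 ultimately have e: "sqrt 2 / 2 + ep < 2 * sqrt 2" by linarith
 obtain ph ps phx where ph: "global_solution ph\<^sub>0 ph\<^sub>1 ph ps"
  "!!t. admis (ph t) (phx t)"
  "!!t. ((%s. H1sq (%x. ph s x - ph t x) (%x. phx s x - phx t x)) ~~> 0) (at t)"
  "!!t. intR (edens (ph t) (phx t)) <= sqrt 2 / 2 + ep"
  using solution_exists[OF _ _ Ele e] d by blast
 obtain a b where ab: "C_diff 2 a" "C_diff 2 b"
  "!!t f. f \<in> L2 ==> represents f (dtt_distr (ph t)) ==>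
   exp (- sqrt 2 * (a t - b t)) + sqrt (H1sq (gap (ph t) (a t) (b t)) (gap' (phx t) (a t) (b t))) <= 10^40 * L2_norm f"
  using modulation[OF ph(2-4) ep] by blast
 have neg: "C_diff 2 (%t. - h t)" if "C_diff 2 h" for h :: "real => real"
  using C_diff_lin[OF that that, of "-2"] by simp
 show "EX ph ps. unique_global_solution ph\<^sub>0 ph\<^sub>1 ph ps &
   (\<exists>(x\<^sub>1::real => real) (x\<^sub>2::real => real) (g::real => real => real).
   C_diff 2 x\<^sub>1 & C_diff 2 x\<^sub>2 &
   (ALL t. (AE x in LB. ph t x = kink01 (x + x\<^sub>1 t) + kink10 (x + x\<^sub>2 t) + g t x) &
   g t \<in> H1 &
   ennreal (exp (- sqrt 2 * (x\<^sub>2 t - x\<^sub>1 t)) + H1_norm (g t))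
   <= ennreal (10^40) * distr_L2_norm (dtt_distr (ph t))))"
 proof (rule exI[of _ ph], rule exI[of _ ps], rule conjI, goal_cases)
  case 1
  show "unique_global_solution ph\<^sub>0 ph\<^sub>1 ph ps"
   unfolding unique_global_solution_def using ph(1) solution_unique[OF ph(1)] by blast
 next
  case 2
  \<comment> \<open>The centres enter with opposite sign, so that the difference of the two shifts
    in the exponent is \<open>a t - b t\<close>.\<close>
  show ?case
  proof (rule exI[of _ "%t. - a t"], rule exI[of _ "%t. - b t"], rule exI[of _ "%t. gap (ph t) (a t) (b t)"], intro conjI allI neg ab(1,2))
  fix t
  note G = gap_H1[OF ph(2)[of t], of "a t" "b t"]
  show "AE x in LB. ph t x = kink01 (x + - a t) + kink10 (x + - b t) + gap (ph t) (a t) (b t) x" by (simp add: gap_def)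
  show "gap (ph t) (a t) (b t) \<in> H1" by (rule H1r_imp_H1[OF G]) simp
  have N: "H1_norm (gap (ph t) (a t) (b t)) = sqrt (H1sq (gap (ph t) (a t) (b t)) (gap' (phx t) (a t) (b t)))" by (rule H1_norm_eq[OF G]) simp
  show "ennreal (exp (- sqrt 2 * (- b t - - a t)) + H1_norm (gap (ph t) (a t) (b t))) <= ennreal (10^40) * distr_L2_norm (dtt_distr (ph t))"
  proof (cases "\<exists>f\<in>L2. represents f (dtt_distr (ph t))")
   case True
   define f where "f = (SOME f. f \<in> L2 & represents f (dtt_distr (ph t)))"
   have f: "f \<in> L2 & represents f (dtt_distr (ph t))" using someI_ex[of "%f. f \<in> L2 & represents f (dtt_distr (ph t))"] True unfolding f_def by blast
   have "exp (- sqrt 2 * (- b t - - a t)) + H1_norm (gap (ph t) (a t) (b t)) <= 10^40 * L2_norm f" using ab(3)[of f t] f by (simp add: N)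
   hence "ennreal (exp (- sqrt 2 * (- b t - - a t)) + H1_norm (gap (ph t) (a t) (b t))) <= ennreal (10^40 * L2_norm f)" by (rule ennreal_leI)
   also have "... = ennreal (10^40) * ennreal (L2_norm f)" by (rule ennreal_mult) (simp_all add: L2_norm_def)
   also have "ennreal (L2_norm f) = distr_L2_norm (dtt_distr (ph t))" using True by (simp add: distr_L2_norm_def f_def)
   finally show ?thesis .
  next
   \<comment> \<open>Without a square integrable representative the right side is a positive
     multiple of infinity.\<close>
   case False
   hence "distr_L2_norm (dtt_distr (ph t)) = \<infinity>" by (simp add: distr_L2_norm_def)
   thus ?thesis by (simp add: ennreal_mult_top)
  qed
  qed
 qed
qed

end
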